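(* Let $q_1,q_2\in\mathbb{C}$ be nonzero, not roots of unity, multiplicatively independent, with at least one of them not of modulus 1 (labelled so that $|q_1|\neq1$), and let $\sigma_j(f)(x)=f(q_jx)$, $j=1,2$. Fix logarithms $\log(q_1),\log(q_2)$ and let $\alpha:=\log(q_2)/\log(q_1)$. Consider systems of two scalar linear $q$-difference equations $$(\ast)\qquad \sigma_j^{m_j}(f)+b_{j,m_j-1}\sigma_j^{m_j-1}(f)+\dots+b_{j,0}f=0,\quad j=1,2,\qquad b_{j,i}\in\mathbb{C}(x).$$ (1) If $\alpha$ is nonreal and $f$ is a meromorphic function on the Riemann surface $\hat{\mathbb C}$ of the logarithm that solves a system $(\ast)$, then $$f(x)=\sum_{i=1}^I\sum_{j=0}^J\sum_{k=0}^K r_{i,j,k}(x)\log(x)^jx^{\alpha_i}g_{i,k}(t)\zeta(t)^k\rho(\delta_i,t),\qquad t=\log(x)/\log(q_1),$$ where $\alpha_i,\delta_i\in\mathbb{C}$, $r_{i,j,k}\in\mathbb{C}(x)$, the $g_{i,k}$ are elliptic functions, and the elliptic functions and the functions $\zeta$ and $\rho$ are taken with respect to the periods $1$ and $\alpha$. Conversely, any such function satisfies a pair of linear $q$-difference equations $(\ast)$ with rational coefficients. (2) If $f$ is a meromorphic function on $\hat{\mathbb C}$ solving a system $(\ast)$, and $\alpha$ is real or $f$ has only finitely many poles, then $$f(x)=\sum_{i,j=0}^I r_{ij}(x)x^{\alpha_i}\log(x)^j$$ where $\alpha_i\in\mathbb{C}$ and $r_{ij}\in\mathbb{C}(x)$.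 (3) If $f\in\mathbb{C}[[x]][x^{-1}]$ satisfies a system $(\ast)$, then $f$ is rational.
   Context: Multiplicatively independent means that there are no nonzero integers $n_1,n_2$ with $q_2^{n_2}=q_1^{n_1}$. $\hat{\mathbb C}$ is the Riemann surface of the logarithm over $\mathbb{C}\setminus\{0\}$; for $x\in\hat{\mathbb C}$, $q_jx$ is the point with $\log(q_jx)=\log(q_j)+\log(x)$, using the fixed logarithms. For nonreal $\alpha$: elliptic functions are the meromorphic functions on $\mathbb{C}$ that are $1$- and $\alpha$-periodic. $\wp$ is the Weierstrass function for the periods $1,\alpha$: the unique $1$- and $\alpha$-periodic meromorphic function whose only pole in the parallelogram with vertices $\pm\frac12\pm\frac\alpha2$ is a double pole at $0$, with $\wp(t)=t^{-2}+O(t)$ as $t\to0$. $\zeta$ is the odd antiderivative of $\wp$. The Weierstrass sigma function $\sigma_W$ is the entire function, vanishing at the origin, with $\sigma_W'/\sigma_W=-\zeta$ and $\sigma_W'(0)=1$. Finally $\rho(\delta,t)=\sigma_W(t+\delta)/\sigma_W(t)$. *)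

theory Defs
  imports
    "HOL-Complex_Analysis.Complex_Analysis"
    "HOL-Computational_Algebra.Computational_Algebra"
    "HOL-Computational_Algebra.Field_as_Ring"
    "HOL-Library.Landau_Symbols"
begin

typedef log_surface = "{(x :: complex, w :: complex). x \<noteq> 0 \<and> exp w = x}"
proof
  show "(1, 0) \<in> {(x :: complex, w :: complex). x \<noteq> 0 \<and> exp w = x}"
    by simp
qed

definition ls_proj :: "log_surface \<Rightarrow> complex" where
  "ls_proj p = fst (Rep_log_surface p)"

definition ls_log :: "log_surface \<Rightarrow> complex" where
  "ls_log p = snd (Rep_log_surface p)"

definition ls_point :: "complex \<Rightarrow> log_surface" where
  "ls_point w = Abs_log_surface (exp w, w)"

lemma ls_log_point [simp]: "ls_log (ls_point w) = w"
  by (simp add: ls_log_def ls_point_def Abs_log_surface_inverse)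

lemma ls_proj_point [simp]: "ls_proj (ls_point w) = exp w"
  by (simp add: ls_proj_def ls_point_def Abs_log_surface_inverse)

lemma ls_point_log [simp]: "ls_point (ls_log p) = p"
proof -
  have "Rep_log_surface p = (exp (ls_log p), ls_log p)"
    using Rep_log_surface[of p] by (auto simp: ls_log_def)
  thus ?thesis
    by (metis Rep_log_surface_inverse ls_point_def)
qed

definition ls_powr :: "log_surface \<Rightarrow> complex \<Rightarrow> complex" where
  "ls_powr p a = exp (a * ls_log p)"

text \<open>
  The logarithm is a global biholomorphic chart from the surface onto the plane, with
  inverse \<^const>\<open>ls_point\<close>, so the complex-analytic notions below are read in this chart.
  Values at isolated points are immaterial for a meromorphic function; hence two
  meromorphic functions are considered equal if they agree outside of a closed discrete set,
  which is what the quantifier \<open>ls_generic\<close> expresses.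
\<close>

definition ls_meromorphic :: "(log_surface \<Rightarrow> complex) \<Rightarrow> bool" where
  "ls_meromorphic f \<longleftrightarrow> (\<lambda>w. f (ls_point w)) meromorphic_on UNIV"

definition ls_is_pole :: "(log_surface \<Rightarrow> complex) \<Rightarrow> log_surface \<Rightarrow> bool" where
  "ls_is_pole f p \<longleftrightarrow> is_pole (\<lambda>w. f (ls_point w)) (ls_log p)"

definition ls_generic :: "(log_surface \<Rightarrow> bool) \<Rightarrow> bool" where
  "ls_generic P \<longleftrightarrow> (\<forall>\<^sub>\<approx>w\<in>UNIV. P (ls_point w))"

text \<open>
  The field of rational functions is \<^typ>\<open>complex poly fract\<close>. Evaluation uses the
  representation in lowest terms and yields 0 at the poles.
\<close>

definition ratfun_eval :: "complex poly fract \<Rightarrow> complex \<Rightarrow> complex" where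
  "ratfun_eval r x = (case quot_of_fract r of (p, d) \<Rightarrow> poly p x / poly d x)"

definition ratfun_fls :: "complex poly fract \<Rightarrow> complex fls" where
  "ratfun_fls r = (case quot_of_fract r of
     (p, d) \<Rightarrow> fps_to_fls (fps_of_poly p) / fps_to_fls (fps_of_poly d))"

text \<open>Here \<open>l\<close> is the chosen logarithm of \<open>q\<close>.\<close>

definition ls_mult :: "complex \<Rightarrow> log_surface \<Rightarrow> log_surface" where
  "ls_mult l p = ls_point (l + ls_log p)"

definition ls_shift :: "complex \<Rightarrow> (log_surface \<Rightarrow> complex) \<Rightarrow> log_surface \<Rightarrow> complex" where
  "ls_shift l f = (\<lambda>p. f (ls_mult l p))"

definition ls_solves_qdiff :: "complex \<Rightarrow> (log_surface \<Rightarrow> complex) \<Rightarrow> bool" where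
  "ls_solves_qdiff l f \<longleftrightarrow>
     (\<exists>(m::nat) (b :: nat \<Rightarrow> complex poly fract). m \<ge> 1 \<and>
        ls_generic (\<lambda>p. (ls_shift l ^^ m) f p
          + (\<Sum>i<m. ratfun_eval (b i) (ls_proj p) * (ls_shift l ^^ i) f p) = 0))"

definition fls_shift_mult :: "complex \<Rightarrow> complex fls \<Rightarrow> complex fls" where
  "fls_shift_mult q F = fls_compose_fps F (fps_const q * fps_X)"

definition fls_solves_qdiff :: "complex \<Rightarrow> complex fls \<Rightarrow> bool" where
  "fls_solves_qdiff q F \<longleftrightarrow>
     (\<exists>(m::nat) (b :: nat \<Rightarrow> complex poly fract). m \<ge> 1 \<and>
        (fls_shift_mult q ^^ m) F
          + (\<Sum>i<m. ratfun_fls (b i) * (fls_shift_mult q ^^ i) F) = 0)"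

definition mult_independent :: "complex \<Rightarrow> complex \<Rightarrow> bool" where
  "mult_independent q1 q2 \<longleftrightarrow>
     \<not> (\<exists>n1 n2 :: int. n1 \<noteq> 0 \<and> n2 \<noteq> 0 \<and> q2 powi n2 = q1 powi n1)"

definition root_of_unity :: "complex \<Rightarrow> bool" where
  "root_of_unity q \<longleftrightarrow> (\<exists>n::nat. n \<ge> 1 \<and> q ^ n = 1)"

text \<open>
  Nicely meromorphic functions are the canonical representatives of meromorphic functions:
  continuous away from the poles and 0 at the poles. With them, the descriptions below
  determine the functions uniquely (for nonreal \<open>\<alpha>\<close>). The periods are 1 and \<open>\<alpha>\<close>.
\<close>

definition elliptic_fun :: "complex \<Rightarrow> (complex \<Rightarrow> complex) \<Rightarrow> bool" where
  "elliptic_fun \<alpha> g \<longleftrightarrow> g nicely_meromorphic_on UNIV \<and>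
     (\<forall>t. g (t + 1) = g t) \<and> (\<forall>t. g (t + \<alpha>) = g t)"

definition weierstrass_p :: "complex \<Rightarrow> complex \<Rightarrow> complex" where
  "weierstrass_p \<alpha> = (THE g. elliptic_fun \<alpha> g \<and>
     {t \<in> convex hull {1/2 + \<alpha>/2, 1/2 - \<alpha>/2, - 1/2 + \<alpha>/2, - 1/2 - \<alpha>/2}. is_pole g t} = {0} \<and>
     zorder g 0 = -2 \<and>
     (\<lambda>t. g t - 1 / t ^ 2) \<in> O[at 0](\<lambda>t. t))"

definition weierstrass_zeta :: "complex \<Rightarrow> complex \<Rightarrow> complex" where
  "weierstrass_zeta \<alpha> = (THE z. z nicely_meromorphic_on UNIV \<and>
     (\<forall>t. \<not> is_pole (weierstrass_p \<alpha>) t \<longrightarrow> (z has_field_derivative weierstrass_p \<alpha> t) (at t)) \<and>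
     (\<forall>t. z (- t) = - z t))"

text \<open>
  Note the sign: as the antiderivative of \<open>\<wp>\<close>, the function \<open>\<zeta>\<close> behaves like \<open>-1/t\<close> at 0,
  so it is the negative of the classical Weierstrass zeta function.
\<close>

definition weierstrass_sigma :: "complex \<Rightarrow> complex \<Rightarrow> complex" where
  "weierstrass_sigma \<alpha> = (THE s. s holomorphic_on UNIV \<and> s 0 = 0 \<and> deriv s 0 = 1 \<and>
     (\<forall>t. s t \<noteq> 0 \<longrightarrow> deriv s t / s t = - weierstrass_zeta \<alpha> t))"

definition weierstrass_rho :: "complex \<Rightarrow> complex \<Rightarrow> complex \<Rightarrow> complex" where
  "weierstrass_rho \<alpha> \<delta> t = weierstrass_sigma \<alpha> (t + \<delta>) / weierstrass_sigma \<alpha> t"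

text \<open>Here \<open>l\<close> is the chosen logarithm of the first multiplier.\<close>

definition elliptic_form :: "complex \<Rightarrow> complex \<Rightarrow> (log_surface \<Rightarrow> complex) \<Rightarrow> bool" where
  "elliptic_form l \<alpha> f \<longleftrightarrow>
     (\<exists>(I::nat) (J::nat) (K::nat) (a :: nat \<Rightarrow> complex) (\<delta> :: nat \<Rightarrow> complex)
        (r :: nat \<Rightarrow> nat \<Rightarrow> nat \<Rightarrow> complex poly fract) (g :: nat \<Rightarrow> nat \<Rightarrow> complex \<Rightarrow> complex).
        (\<forall>i\<in>{1..I}. \<forall>k\<in>{0..K}. elliptic_fun \<alpha> (g i k)) \<and>
        ls_generic (\<lambda>p. let t = ls_log p / l in
          f p = (\<Sum>i=1..I. \<Sum>j=0..J. \<Sum>k=0..K.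
            ratfun_eval (r i j k) (ls_proj p) * ls_log p ^ j * ls_powr p (a i) *
            g i k t * weierstrass_zeta \<alpha> t ^ k * weierstrass_rho \<alpha> (\<delta> i) t)))"

definition log_power_form :: "(log_surface \<Rightarrow> complex) \<Rightarrow> bool" where
  "log_power_form f \<longleftrightarrow>
     (\<exists>(I::nat) (a :: nat \<Rightarrow> complex) (r :: nat \<Rightarrow> nat \<Rightarrow> complex poly fract).
        ls_generic (\<lambda>p. f p = (\<Sum>i=0..I. \<Sum>j=0..I.
          ratfun_eval (r i j) (ls_proj p) * ls_powr p (a i) * ls_log p ^ j)))"

end

theory Submission
  imports Defs
begin

text \<open>
  Write \<open>T1\<close>, \<open>T2\<close> for the two shifts. A solution \<open>f\<close> spans a finite-dimensional space over
  \<open>\<complex>(x)\<close> that is stable under both. Multiplicative independence forces all slopes of the two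
  equations at \<open>0\<close> and \<open>\<infinity>\<close> to vanish, so that there are lattices at \<open>0\<close> and \<open>\<infinity>\<close> stable under
  both operators. At any other point \<open>y\<close> one transports the obvious lattice from far away on the orbit
  of \<open>y\<close>. The global sections of the resulting vector bundle on the projective line, with suitable
  poles at \<open>0\<close> and \<open>\<infinity>\<close>, form a finite-dimensional complex vector space stable under \<open>T1\<close> and
  \<open>T2\<close>. Hence \<open>h = D f\<close> satisfies two equations with constant coefficients for some polynomial
  \<open>D \<noteq> 0\<close>.

  For a Laurent series this leaves only finitely many coefficients of \<open>h\<close>. For a meromorphic
  function on the surface of the logarithm, \<open>h\<close> splits into joint generalized eigenvectors. If the
  poles are finite in number or \<open>\<alpha>\<close> is real, these are entire, and an entire one is \<open>x\<^sup>s\<close> times a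
  polynomial in \<open>log x\<close>, because some derivative of its unipotent part is entire and invariant
  under both shifts, hence constant. If
  \<open>\<alpha>\<close> is nonreal, Legendre's relation allows one to divide by some \<open>x\<^sup>s \<rho>(\<delta>, t)\<close> to make a generalized
  eigenvector unipotent, and to choose combinations of \<open>log x\<close> and \<open>\<zeta>(t)\<close> on which the two
  difference operators act as independent differentiations; a unipotent function is then a
  polynomial in these with elliptic coefficients. The Weierstrass functions are obtained from a theta
  product. The converse holds because the terms in question span a finite-dimensional space over
  \<open>\<complex>(x)\<close> that is stable under the shifts.
\<close>

subsection \<open>The field of rational functions\<close>

text \<open>One of the multipliers may lie on the unit circle, so solutions cannot in general be
  normalized by contracting towards 0 or infinity. Up to the equations with constant coefficients
  the argument is therefore algebraic: it uses that orbits are infinite and that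
  \<open>q1 powi i * q2 powi j = 1\<close> forces \<open>i = j = 0\<close>. The latter enters twice.
  For the slopes, \<open>T2\<close> would turn one eigenvector of \<open>x^p T1\<close> into
  eigenvectors whose eigenvalues differ by powers of \<open>q2\<close>, too many for a
  finite-dimensional space. For the lattices, the transported lattice can differ from the obvious
  one at \<open>y\<close> only if both orbits of \<open>y\<close> meet the finite set of singular
  points; a pair of singular points determines \<open>y\<close>, so this happens at finitely many
  places and a vector bundle results. Its twist at 0 and infinity is by a monomial because a
  dilation multiplies \<open>x^N\<close> by a constant. That the sections form a finite-dimensional
  space needs no sheaf theory: after clearing a common denominator their coordinates are polynomials
  of bounded degree.\<close>

locale poly_embedding =
  fixes h :: "complex poly \<Rightarrow> 'b :: field"
  assumes add: "h (p + q) = h p + h q"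
    and mult: "h (p * q) = h p * h q"
    and one: "h 1 = 1"
    and nonzero: "p \<noteq> 0 \<Longrightarrow> h p \<noteq> 0"
begin

lemma zero [simp]: "h 0 = 0"
  using add[of 0 0] by (simp only: add_cancel_right_right add_0_right)

lemma uminus: "h (- p) = - h p"
  using add[of p "- p"] by (simp add: eq_neg_iff_add_eq_0 add.commute)

text \<open>The universal property of the fraction field. It serves four embeddings of the
  polynomial ring: the dilation, the Laurent expansions at 0 and at infinity, and the substitution
  of \<open>exp w\<close>. Lowest terms agree with \<open>ratfun_fls\<close> and
  \<open>ratfun_eval\<close>, while \<open>lift_Fract\<close> frees the homomorphism laws from that
  choice.\<close>

definition lift :: "complex poly fract \<Rightarrow> 'b" where
  "lift r = h (fst (quot_of_fract r)) / h (snd (quot_of_fract r))"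

lemma lift_Fract [simp]:
  assumes "b \<noteq> 0"
  shows "lift (Fract a b) = h a / h b"
proof -
  define c d where "c = fst (quot_of_fract (Fract a b))" and "d = snd (quot_of_fract (Fract a b))"
  have d: "d \<noteq> 0" by (simp add: d_def)
  have "Fract c d = Fract a b" unfolding c_def d_def by (rule Fract_quot_of_fract)
  hence "c * b = a * d" using d assms by (simp add: eq_fract)
  hence "h c * h b = h a * h d" by (metis mult)
  thus ?thesis using nonzero[OF d] nonzero[OF assms]
    by (simp add: lift_def flip: c_def d_def) (simp add: field_simps)
qed

lemma lift_add [simp]: "lift (r + s) = lift r + lift s"
proof (cases r; cases s)
  fix a b c d assume "r = Fract a b" "b \<noteq> 0" "s = Fract c d" "d \<noteq> 0"
  thus ?thesis using nonzero[of b] nonzero[of d] by (simp add: add mult field_simps)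
qed

lemma lift_mult [simp]: "lift (r * s) = lift r * lift s"
proof (cases r; cases s)
  fix a b c d assume "r = Fract a b" "b \<noteq> 0" "s = Fract c d" "d \<noteq> 0"
  thus ?thesis using nonzero[of b] nonzero[of d] by (simp add: mult)
qed

lemma lift_0 [simp]: "lift 0 = 0" by (simp add: Zero_fract_def)
lemma lift_1 [simp]: "lift 1 = 1" by (simp add: One_fract_def one)

lemma lift_uminus [simp]: "lift (- r) = - lift r"
  using lift_add[of r "- r"] by (simp add: eq_neg_iff_add_eq_0 add.commute)

lemma lift_diff [simp]: "lift (r - s) = lift r - lift s"
  using lift_add[of r "- s"] by simp

lemma lift_eq_0_iff [simp]: "lift r = 0 \<longleftrightarrow> r = 0"
proof (cases r)
  case (Fract a b)
  thus ?thesis using nonzero[of b] nonzero[of a] by (auto simp: eq_fract Zero_fract_def)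
qed

lemma lift_inverse [simp]: "lift (inverse r) = inverse (lift r)"
proof (cases "r = 0")
  case False
  hence "lift r * lift (inverse r) = 1" by (simp flip: lift_mult)
  thus ?thesis by (metis inverse_unique)
qed simp

lemma lift_divide [simp]: "lift (r / s) = lift r / lift s"
  by (simp add: divide_inverse)

lemma lift_power [simp]: "lift (r ^ n) = lift r ^ n"
  by (induction n) auto

lemma lift_sum [simp]: "lift (\<Sum>i\<in>A. f i) = (\<Sum>i\<in>A. lift (f i))"
  by (induction A rule: infinite_finite_induct) auto

end

text \<open>A map obeying a Horner recursion is a substitution and hence multiplicative. The
  expansion at infinity arises in this form.\<close>

lemma poly_embeddingI:
  fixes h :: "complex poly \<Rightarrow> 'b :: field" and c :: "complex \<Rightarrow> 'b"
  assumes 0: "h 0 = 0" and pC: "\<And>a p. h (pCons a p) = c a + x * h p"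
    and c: "\<And>a b. c (a + b) = c a + c b" "\<And>a b. c (a * b) = c a * c b" "c 1 = 1"
    and nonzero: "\<And>p. p \<noteq> 0 \<Longrightarrow> h p \<noteq> 0"
  shows "poly_embedding h"
proof
  have c0: "c 0 = 0" using c(1)[of 0 0] by (simp only: add_cancel_right_right add_0_right)
  show add: "h (p + q) = h p + h q" for p q
    by (induction p q rule: poly_induct2) (auto simp: 0 pC c algebra_simps)
  have smult: "h (smult a p) = c a * h p" for a p
    by (induction p) (auto simp: 0 pC c algebra_simps)
  show "h (p * q) = h p * h q" for p q
    by (induction p) (auto simp: 0 pC c0 add smult algebra_simps)
  show "h 1 = 1" by (simp add: one_pCons pC 0 c)
qed (use nonzero in auto)

abbreviation pfrac :: "complex poly \<Rightarrow> complex poly fract" where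
  "pfrac p \<equiv> Fract p 1"

lemma pfrac_eq_iff [simp]: "pfrac p = pfrac q \<longleftrightarrow> p = q"
  by (simp add: eq_fract)

lemma pfrac_eq_0_iff [simp]: "pfrac p = 0 \<longleftrightarrow> p = 0"
  by (simp add: Zero_fract_def eq_fract)

lemma pcompose_linear_nonzero: "q \<noteq> 0 \<Longrightarrow> p \<noteq> 0 \<Longrightarrow> pcompose p [:0, q:] \<noteq> (0 :: complex poly)"
  using pcompose_eq_0_iff[of "[:0, q:]" p] by auto

lemma pfrac_const_simps: "pfrac 0 = 0" "pfrac 1 = 1" "pfrac (p + q) = pfrac p + pfrac q"
    "pfrac (p * q) = pfrac p * pfrac q" "pfrac (- p) = - pfrac p"
  by (simp_all add: Zero_fract_def One_fract_def)

lemma poly_embedding_dil: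
  assumes "q \<noteq> 0"
  shows "poly_embedding (\<lambda>p. pfrac (pcompose p [:0, q:]))"
  by standard (use assms in \<open>simp_all only: pcompose_add pcompose_mult pcompose_1 pfrac_const_simps
        pfrac_eq_0_iff pcompose_linear_nonzero not_False_eq_True\<close>)

text \<open>The automorphism \<open>r(x)\<close> to \<open>r(q x)\<close> of the field of rational
  functions, by which the shift operators act on scalars.\<close>

definition dil :: "complex \<Rightarrow> complex poly fract \<Rightarrow> complex poly fract" where
  "dil q = poly_embedding.lift (\<lambda>p. pfrac (pcompose p [:0, q:]))"

context
  fixes q :: complex
  assumes q: "q \<noteq> 0"
begin

interpretation poly_embedding "\<lambda>p. pfrac (pcompose p [:0, q:])"
  rewrites "poly_embedding.lift (\<lambda>p. pfrac (pcompose p [:0, q:])) = dil q"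
  using q by (simp_all add: poly_embedding_dil dil_def)

lemma dil_Fract: "b \<noteq> 0 \<Longrightarrow> dil q (Fract a b) = Fract (pcompose a [:0, q:]) (pcompose b [:0, q:])"
  by (subst lift_Fract) auto

lemmas dil_add = lift_add and dil_mult = lift_mult and dil_0 = lift_0 and dil_1 = lift_1
  and dil_uminus = lift_uminus and dil_diff = lift_diff and dil_eq_0_iff = lift_eq_0_iff
  and dil_divide = lift_divide and dil_power = lift_power and dil_sum = lift_sum
  and dil_inverse = lift_inverse

lemma dil_pfrac: "dil q (pfrac p) = pfrac (pcompose p [:0, q:])"
  by (subst dil_Fract) (auto simp: pcompose_1)

end

lemma dil_dil:
  assumes "q \<noteq> 0" "p \<noteq> 0"
  shows "dil q (dil p r) = dil (q * p) r"
proof (cases r)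
  case (Fract a b)
  have *: "pcompose (pcompose u [:0, p:]) [:0, q:] = pcompose u [:0, q * p:]" for u
    by (simp flip: pcompose_assoc add: pcompose_pCons mult.commute)
  show ?thesis using Fract assms
    by (simp add: dil_Fract pcompose_linear_nonzero *)
qed

lemma dil_id [simp]: "dil 1 r = r"
  by (cases r) (simp add: dil_Fract pcompose_idR)

lemma dil_inv: "q \<noteq> 0 \<Longrightarrow> dil q (dil (1 / q) r) = r" "q \<noteq> 0 \<Longrightarrow> dil (1 / q) (dil q r) = r"
  by (simp_all add: dil_dil)

subsection \<open>Local rings\<close>

text \<open>The local ring of the projective line at \<open>y\<close>. Asking for some
  representation, not the reduced one, makes closure under sums and products immediate.
  Correspondingly, \<open>infty_bounded d\<close> allows a pole of order at most \<open>d\<close> at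
  infinity, and \<open>infty_bounded 0\<close> is the local ring there.\<close>

definition reg_at :: "complex \<Rightarrow> complex poly fract set" where
  "reg_at y = {r. \<exists>a b. poly b y \<noteq> 0 \<and> r = Fract a b}"

definition infty_bounded :: "nat \<Rightarrow> complex poly fract set" where
  "infty_bounded d = {r. \<exists>a b. b \<noteq> 0 \<and> degree a \<le> degree b + d \<and> r = Fract a b}"

lemma reg_atI: "poly b y \<noteq> 0 \<Longrightarrow> Fract a b \<in> reg_at y"
  by (auto simp: reg_at_def)

lemma reg_at_pfrac [simp, intro]: "pfrac p \<in> reg_at y"
  by (rule reg_atI) auto

lemma reg_at_0 [simp, intro]: "0 \<in> reg_at y" and reg_at_1 [simp, intro]: "1 \<in> reg_at y"
  using reg_at_pfrac[of 0 y] reg_at_pfrac[of 1 y] by (simp_all only: pfrac_const_simps)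

lemma reg_at_add: assumes "r \<in> reg_at y" "s \<in> reg_at y" shows "r + s \<in> reg_at y"
proof -
  from assms obtain a b c d where "poly b y \<noteq> 0" "r = Fract a b" "poly d y \<noteq> 0" "s = Fract c d"
    by (auto simp: reg_at_def)
  moreover from this have "b \<noteq> 0" "d \<noteq> 0" by auto
  ultimately show ?thesis by (auto intro!: reg_atI)
qed

lemma reg_at_mult: assumes "r \<in> reg_at y" "s \<in> reg_at y" shows "r * s \<in> reg_at y"
proof -
  from assms obtain a b c d where "poly b y \<noteq> 0" "r = Fract a b" "poly d y \<noteq> 0" "s = Fract c d"
    by (auto simp: reg_at_def)
  thus ?thesis by (auto intro!: reg_atI)
qed

text \<open>The direction matters: \<open>dil q r\<close> behaves at \<open>y\<close> as
  \<open>r\<close> does at \<open>q * y\<close>. An operator over this dilation thus carries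
  lattices at \<open>q * y\<close> to lattices at \<open>y\<close>, which is why orbits below run
  through \<open>y / q ^ k\<close>.\<close>

lemma dil_reg_at_iff:
  assumes q: "q \<noteq> 0"
  shows "dil q r \<in> reg_at y \<longleftrightarrow> r \<in> reg_at (q * y)"
proof -
  have *: "dil p s \<in> reg_at z" if "s \<in> reg_at (p * z)" "p \<noteq> 0" for p s z
  proof -
    from that obtain a b where ab: "poly b (p * z) \<noteq> 0" "s = Fract a b" by (auto simp: reg_at_def)
    hence "b \<noteq> 0" by auto
    thus ?thesis using ab that by (auto simp: dil_Fract poly_pcompose mult.commute intro!: reg_atI)
  qed
  show ?thesis
    using *[of r q y] *[of "dil q r" "1 / q" "q * y"] q by (auto simp: dil_inv)
qed

lemma finite_not_reg_at: "finite {y. r \<notin> reg_at y}"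
proof (cases r)
  case (Fract a b)
  have "{y. r \<notin> reg_at y} \<subseteq> {y. poly b y = 0}" using Fract by (auto intro!: reg_atI)
  thus ?thesis using poly_roots_finite[of b] Fract finite_subset by blast
qed

text \<open>A root of the reduced denominator would, by comparison with a representation regular
  there, be a root of the numerator as well. So the denominator has no root at all and is
  constant.\<close>

lemma reg_at_everywhere:
  assumes "\<And>y. r \<in> reg_at y"
  obtains p where "r = pfrac p"
proof -
  define a b where "a = fst (quot_of_fract r)" and "b = snd (quot_of_fract r)"
  have b0: "b \<noteq> 0" and r: "r = Fract a b" and co: "coprime a b"
    by (auto simp: a_def b_def coprime_quot_of_fract)
  have "poly b y \<noteq> 0" for y
  proof
    assume b_y: "poly b y = 0"
    from assms[of y] obtain c d where cd: "poly d y \<noteq> 0" "r = Fract c d" by (auto simp: reg_at_def)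
    hence "d \<noteq> 0" by auto
    hence "a * d = c * b" using cd r b0 by (auto simp: eq_fract)
    hence "poly a y * poly d y = 0" using b_y by (metis poly_mult mult_zero_right)
    hence "poly a y = 0" using cd by simp
    hence "[:-y, 1:] dvd a" "[:-y, 1:] dvd b" using b_y by (simp_all add: poly_eq_0_iff_dvd)
    hence "is_unit [:-y, 1:]" using co by (meson coprime_common_divisor)
    thus False by (simp add: is_unit_iff_degree)
  qed
  hence "constant (poly b)" using fundamental_theorem_of_algebra by blast
  hence "degree b = 0" by (simp add: constant_degree)
  then obtain c where c: "b = [:c:]" by (rule degree_eq_zeroE)
  with b0 have "c \<noteq> 0" by auto
  hence "r = pfrac (smult (1 / c) a)" using r c b0 by (simp add: eq_fract)
  thus thesis by (rule that)
qed

lemma infty_boundedI: "b \<noteq> 0 \<Longrightarrow> degree a \<le> degree b + d \<Longrightarrow> Fract a b \<in> infty_bounded d"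
  by (auto simp: infty_bounded_def)

lemma infty_bounded_add: assumes "r \<in> infty_bounded d" "s \<in> infty_bounded d" shows "r + s \<in> infty_bounded d"
proof -
  from assms obtain a b c e where *: "b \<noteq> 0" "degree a \<le> degree b + d" "r = Fract a b"
      "e \<noteq> 0" "degree c \<le> degree e + d" "s = Fract c e"
    by (auto simp: infty_bounded_def)
  have "degree (a * e + c * b) \<le> degree (b * e) + d"
  proof (rule degree_add_le)
    show "degree (a * e) \<le> degree (b * e) + d" "degree (c * b) \<le> degree (b * e) + d"
      using * degree_mult_le[of a e] degree_mult_le[of c b] by (auto simp: degree_mult_eq)
  qed
  thus ?thesis using * by (auto intro!: infty_boundedI simp: mult.commute)
qed

lemma infty_bounded_mult: assumes "r \<in> infty_bounded d" "s \<in> infty_bounded d'" shows "r * s \<in> infty_bounded (d + d')"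
proof -
  from assms obtain a b c e where *: "b \<noteq> 0" "degree a \<le> degree b + d" "r = Fract a b"
      "e \<noteq> 0" "degree c \<le> degree e + d'" "s = Fract c e"
    by (auto simp: infty_bounded_def)
  thus ?thesis using degree_mult_le[of a c] by (auto intro!: infty_boundedI simp: degree_mult_eq)
qed

lemma infty_bounded_pfrac: "pfrac p \<in> infty_bounded d \<longleftrightarrow> degree p \<le> d"
proof
  assume "pfrac p \<in> infty_bounded d"
  then obtain a b where *: "b \<noteq> 0" "degree a \<le> degree b + d" "pfrac p = Fract a b"
    by (auto simp: infty_bounded_def)
  hence "p * b = a" by (simp add: eq_fract)
  thus "degree p \<le> d" using * by (cases "p = 0") (auto simp: degree_mult_eq)
qed (auto intro!: infty_boundedI)

lemma infty_bounded_0 [simp, intro]: "0 \<in> infty_bounded d" and infty_bounded_1 [simp, intro]: "1 \<in> infty_bounded d"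
  using infty_bounded_pfrac[of 0 d] infty_bounded_pfrac[of 1 d] by (simp_all only: pfrac_const_simps) auto

lemma degree_pcompose_linear [simp]: "q \<noteq> 0 \<Longrightarrow> degree (pcompose p [:0, q :: complex:]) = degree p"
  by (simp add: degree_pcompose)

lemma dil_infty_bounded:
  assumes q: "q \<noteq> 0"
  shows "dil q r \<in> infty_bounded d \<longleftrightarrow> r \<in> infty_bounded d"
proof -
  have *: "dil p s \<in> infty_bounded d" if "s \<in> infty_bounded d" "p \<noteq> 0" for p s
  proof -
    from that obtain a b where "b \<noteq> 0" "degree a \<le> degree b + d" "s = Fract a b"
      by (auto simp: infty_bounded_def)
    thus ?thesis using that by (auto simp: dil_Fract pcompose_linear_nonzero intro!: infty_boundedI)
  qed
  show ?thesis
    using *[of r q] *[of "dil q r" "1 / q"] q by (auto simp: dil_inv)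
qed

subsection \<open>Linear systems with more unknowns than equations\<close>

text \<open>Gaussian elimination, one equation at a time: an unknown \<open>p\<close> with a nonzero
  coefficient is eliminated from the remaining equations. The field is kept general because Laurent
  series, complex numbers and rational functions all occur as coefficients.\<close>

lemma underdetermined_system:
  fixes M :: "'a \<Rightarrow> 'b \<Rightarrow> 'f :: field"
  assumes "finite B" "finite A" "card B < card A"
  obtains c where "\<exists>a\<in>A. c a \<noteq> 0" "\<And>b. b \<in> B \<Longrightarrow> (\<Sum>a\<in>A. c a * M a b) = 0"
proof -
  have "\<exists>c. (\<exists>a\<in>A. c a \<noteq> 0) \<and> (\<forall>b\<in>B. (\<Sum>a\<in>A. c a * M a b) = 0)"
    using assms
  proof (induction B arbitrary: A M rule: finite_induct)
    case empty
    then obtain a where "a \<in> A" by fastforce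
    thus ?case by (intro exI[of _ "\<lambda>_. 1"]) auto
  next
    case (insert b B)
    show ?case
    proof (cases "\<forall>a\<in>A. M a b = 0")
      case True
      obtain c where "\<exists>a\<in>A. c a \<noteq> 0" "\<forall>b\<in>B. (\<Sum>a\<in>A. c a * M a b) = 0"
        using insert.IH[of A M] insert.prems insert.hyps by auto
      thus ?thesis using True by (intro exI[of _ c]) auto
    next
      case False
      then obtain p where p: "p \<in> A" "M p b \<noteq> 0" by auto
      define A' where "A' = A - {p}"
      have A': "A = insert p A'" "p \<notin> A'" "finite A'" using p insert.prems by (auto simp: A'_def)
      define N where "N a b' = M a b' - M a b / M p b * M p b'" for a b'
      obtain c where c: "\<exists>a\<in>A'. c a \<noteq> 0" "\<forall>b'\<in>B. (\<Sum>a\<in>A'. c a * N a b') = 0"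
        using insert.IH[of A' N] insert.prems insert.hyps A' by auto
      define c' where "c' = c(p := - (\<Sum>a\<in>A'. c a * M a b) / M p b)"
      have eq: "(\<Sum>a\<in>A. c' a * M a b') = c' p * M p b' + (\<Sum>a\<in>A'. c a * M a b')" for b'
        using A' by (auto simp: c'_def intro!: sum.cong)
      have "(\<Sum>a\<in>A. c' a * M a b') = 0" if "b' \<in> insert b B" for b'
      proof (cases "b' = b")
        case True
        thus ?thesis using p by (subst eq) (simp add: c'_def)
      next
        case False
        hence "(\<Sum>a\<in>A'. c a * N a b') = 0" using c that by auto
        hence "(\<Sum>a\<in>A'. c a * M a b') = (\<Sum>a\<in>A'. c a * M a b) / M p b * M p b'"
          by (simp add: N_def algebra_simps sum_subtractf sum_distrib_left sum_divide_distrib)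
        thus ?thesis by (subst eq) (simp add: c'_def)
      qed
      moreover have "\<exists>a\<in>A. c' a \<noteq> 0"
        using c(1) A' by (auto simp: c'_def)
      ultimately show ?thesis by blast
    qed
  qed
  thus thesis using that by blast
qed

subsection \<open>Dilation of formal series\<close>

definition fps_dil :: "complex \<Rightarrow> complex fps \<Rightarrow> complex fps" where
  "fps_dil q f = Abs_fps (\<lambda>n. q ^ n * fps_nth f n)"

lemma fps_nth_dil [simp]: "fps_nth (fps_dil q f) n = q ^ n * fps_nth f n"
  by (simp add: fps_dil_def)

lemma fps_dil_1 [simp]: "fps_dil 1 f = f"
  by (rule fps_ext) simp

lemma fps_dil_dil [simp]: "fps_dil p (fps_dil q f) = fps_dil (p * q) f"
  by (rule fps_ext) (simp add: power_mult_distrib)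

lemma fps_dil_add: "fps_dil q (f + g) = fps_dil q f + fps_dil q g"
  by (rule fps_ext) (simp add: algebra_simps)

lemma fps_dil_0 [simp]: "fps_dil q 0 = 0"
  by (rule fps_ext) simp

lemma fps_dil_sum: "fps_dil q (\<Sum>i\<in>A. f i) = (\<Sum>i\<in>A. fps_dil q (f i))"
  by (induction A rule: infinite_finite_induct) (auto simp: fps_dil_add)

lemma fps_dil_const_mult: "fps_dil q (fps_const c * f) = fps_const c * fps_dil q f"
  by (rule fps_ext) simp

lemma fls_shift_mult_nth:
  assumes "q \<noteq> 0"
  shows "fls_nth (fls_shift_mult q f) n = q powi n * fls_nth f n"
  unfolding fls_shift_mult_def using assms by (simp add: fls_nth_fls_compose_fps_linear)

context
  fixes q :: complex
  assumes q: "q \<noteq> 0"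
begin

lemma fls_shift_mult_simps:
  "fls_shift_mult q 0 = 0" "fls_shift_mult q 1 = 1"
  "fls_shift_mult q (f + g) = fls_shift_mult q f + fls_shift_mult q g"
  "fls_shift_mult q (f * g) = fls_shift_mult q f * fls_shift_mult q g"
  "fls_shift_mult q (- f) = - fls_shift_mult q f"
  "fls_shift_mult q (f / g) = fls_shift_mult q f / fls_shift_mult q g"
  "fls_shift_mult q (fls_const c) = fls_const c"
  "fls_shift_mult q f = 0 \<longleftrightarrow> f = 0"
  using q by (simp_all add: fls_shift_mult_def fls_compose_fps_add fls_compose_fps_mult
      fls_compose_fps_divide fls_compose_fps_eq_0_iff)

lemma fls_shift_mult_sum: "fls_shift_mult q (\<Sum>i\<in>A. f i) = (\<Sum>i\<in>A. fls_shift_mult q (f i))"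
  by (induction A rule: infinite_finite_induct) (auto simp: fls_shift_mult_simps)

lemma fls_shift_mult_X_intpow: "fls_shift_mult q (fls_X_intpow n) = fls_const (q powi n) * fls_X_intpow n"
  by (rule fls_eqI) (use q in \<open>auto simp: fls_shift_mult_nth fls_shift_nth\<close>)

lemma fls_shift_mult_fps: "fls_shift_mult q (fps_to_fls f) = fps_to_fls (fps_dil q f)"
  by (rule fls_eqI) (use q in \<open>auto simp: fls_shift_mult_nth power_int_def\<close>)

text \<open>In \<open>x = z^d\<close>, dilating \<open>z\<close> by \<open>q\<close> dilates
  \<open>x\<close> by \<open>q ^ d\<close>. This is the compatibility needed for the ramified
  substitution in \<open>slope_nonneg\<close>.\<close>

lemma fls_shift_mult_compose_power:
  assumes "d > 0"
  shows "fls_shift_mult q (fls_compose_power f d) = fls_compose_power (fls_shift_mult (q ^ d) f) d"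
proof (rule fls_eqI)
  fix n
  have "q powi n = (q ^ d) powi (n div int d)" if "int d dvd n"
    using that by (metis dvd_mult_div_cancel power_int_mult power_int_of_nat)
  thus "fls_nth (fls_shift_mult q (fls_compose_power f d)) n = fls_nth (fls_compose_power (fls_shift_mult (q ^ d) f) d) n"
    using q assms by (simp add: fls_shift_mult_nth fls_nth_compose_power)
qed

end

lemma not_root_of_unity_powi:
  assumes "\<not> root_of_unity q" "q \<noteq> 0" "q powi n = 1"
  shows "n = 0"
proof (rule ccontr)
  assume n: "n \<noteq> 0"
  have "q ^ nat \<bar>n\<bar> = 1"
    using assms(3) by (auto simp: power_int_def abs_if power_inverse split: if_splits)
  thus False using assms(1) n by (auto simp: root_of_unity_def)
qed

lemma not_root_of_unity_powi_inj:
  assumes "\<not> root_of_unity q" "q \<noteq> 0" "q powi m = q powi n"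
  shows "m = n"
  using not_root_of_unity_powi[of q "m - n"] assms by (simp add: power_int_diff)

subsection \<open>An eigenvector at a slope\<close>

text \<open>Since \<open>q\<close> is not a root of unity, some root of \<open>\<psi>\<close> has no further root in its orbit.\<close>

lemma nonresonant_root:
  fixes \<psi> :: "complex poly"
  assumes "\<not> root_of_unity q" "q \<noteq> 0" "\<psi> \<noteq> 0" "poly \<psi> c0 = 0" "c0 \<noteq> 0"
  obtains c where "c \<noteq> 0" "poly \<psi> c = 0" "\<And>k. k \<ge> 1 \<Longrightarrow> poly \<psi> (c / q ^ k) \<noteq> 0"
proof -
  define S where "S = {k. poly \<psi> (c0 / q ^ k) = 0}"
  have "inj (\<lambda>k::nat. c0 / q ^ k)"
  proof (rule injI)
    fix i j assume "c0 / q ^ i = c0 / q ^ j"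
    hence "q powi int i = q powi int j" using assms by (simp add: field_simps)
    thus "i = j" using not_root_of_unity_powi_inj[OF assms(1,2), of "int i" "int j"] by simp
  qed
  hence "finite S"
    unfolding S_def using finite_vimageI[OF poly_roots_finite[OF assms(3)]] by (simp add: vimage_def)
  moreover have "S \<noteq> {}" using assms by (auto simp: S_def intro!: exI[of _ 0])
  ultimately have M: "Max S \<in> S" "\<And>k. k \<in> S \<Longrightarrow> k \<le> Max S" by auto
  show thesis
  proof (rule that[of "c0 / q ^ Max S"])
    fix k :: nat assume "k \<ge> 1"
    thus "poly \<psi> (c0 / q ^ Max S / q ^ k) \<noteq> 0"
      using M(2)[of "Max S + k"] by (auto simp: S_def power_add)
  qed (use M assms in \<open>auto simp: S_def\<close>)
qed

text \<open>Think of vectors with \<open>T (w i) = w (i + 1)\<close> and \<open>w m\<close> equal to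
  minus the sum of the \<open>\<beta> i * w i\<close>. The equations say that the sum of the
  \<open>a i * w i\<close> is an eigenvector of \<open>T\<close> for \<open>c\<close>. The method is
  that of Frobenius: \<open>c\<close> is a root of the characteristic polynomial at 0, chosen
  without resonance so that all later coefficients can be solved for.\<close>

lemma eigenvector_coefficients:
  fixes \<beta> :: "nat \<Rightarrow> complex fps"
  assumes q: "\<not> root_of_unity q" "q \<noteq> 0"
    and m: "i0 < m" "fps_nth (\<beta> i0) 0 \<noteq> 0"
  obtains c a where "c \<noteq> 0" "a (m - 1) \<noteq> 0"
    "- fps_dil q (a (m - 1)) * \<beta> 0 = fps_const c * a 0"
    "\<And>i. i \<ge> 1 \<Longrightarrow> i < m \<Longrightarrow> fps_dil q (a (i - 1)) - fps_dil q (a (m - 1)) * \<beta> i = fps_const c * a i"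
proof -
  define p where "p = 1 / q"
  have p0: "p \<noteq> 0" and pq: "q * p = 1" using q by (auto simp: p_def)
  \<comment> \<open>The leading coefficient 1 is treated like the others; \<open>\<psi>\<close> is
    then the characteristic polynomial at 0.\<close>
  define \<gamma> where "\<gamma> i = (if i < m then \<beta> i else 1)" for i
  define \<psi> where "\<psi> = (\<Sum>i\<le>m. monom (fps_nth (\<gamma> i) 0) i)"
  have poly_\<psi>: "poly \<psi> x = (\<Sum>i\<le>m. fps_nth (\<gamma> i) 0 * x ^ i)" for x
    by (simp add: \<psi>_def poly_sum poly_monom)
  have coeff_\<psi>: "coeff \<psi> i = (if i \<le> m then fps_nth (\<gamma> i) 0 else 0)" for i
    by (simp add: \<psi>_def coeff_sum if_distrib cong: if_cong)
  have \<psi>0: "\<psi> \<noteq> 0" using coeff_\<psi>[of m] by (auto simp: \<gamma>_def)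
  \<comment> \<open>The coefficients of \<open>\<psi>\<close> with indices \<open>i0\<close> and
    \<open>m\<close> are both nonzero, so \<open>\<psi>\<close> is not a monomial and keeps a root
    after all factors of its variable have been removed.\<close>
  have "\<exists>c0. c0 \<noteq> 0 \<and> poly \<psi> c0 = 0"
  proof -
    obtain r where r: "\<psi> = [:0, 1:] ^ order 0 \<psi> * r" "\<not> [:0, 1:] dvd r"
      using order_decomp[OF \<psi>0, of 0] by auto
    have r0: "poly r 0 \<noteq> 0" using r(2) by (simp add: poly_eq_0_iff_dvd)
    have "degree r \<noteq> 0"
    proof
      assume "degree r = 0"
      then obtain c where "r = [:c:]" by (rule degree_eq_zeroE)
      hence mon: "\<psi> = monom c (order 0 \<psi>)" using r(1) by (simp add: monom_altdef)
      hence "coeff \<psi> i = 0 \<or> coeff \<psi> j = 0" if "i \<noteq> j" for i j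
        using that by (metis coeff_monom)
      from this[of i0 m] show False using m by (auto simp: coeff_\<psi> \<gamma>_def)
    qed
    then obtain x where "poly r x = 0"
      using fundamental_theorem_of_algebra[of r] by (auto simp: constant_degree)
    thus ?thesis using r r0 by (intro exI[of _ x]) (metis mult_zero_right poly_mult)
  qed
  then obtain c where c: "c \<noteq> 0" "poly \<psi> c = 0" "\<And>k. k \<ge> 1 \<Longrightarrow> poly \<psi> (c / q ^ k) \<noteq> 0"
    using nonresonant_root[OF q \<psi>0] by metis
  have chi_k: "(\<Sum>i\<le>m. c ^ i * p ^ (Suc i * k) * fps_nth (\<gamma> i) 0) = p ^ k * poly \<psi> (c / q ^ k)" for k
  proof -
    have "c / q ^ k = c * p ^ k" by (simp add: p_def divide_inverse power_inverse)
    thus ?thesis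
      by (simp add: poly_\<psi> sum_distrib_left power_mult_distrib power_add power_mult mult_ac flip: power_mult)
  qed
  \<comment> \<open>\<open>E g k\<close> collects the contributions of \<open>g l\<close> with
    \<open>l < k\<close> to coefficient \<open>k\<close> of the equation \<open>zero\<close>. The
    unknown \<open>g k\<close> itself enters with the factor computed in \<open>chi_k\<close>, which
    is nonzero for \<open>k \<ge> 1\<close>, so the equation is a recursion started at
    \<open>g 0 = 1\<close>.\<close>
  define E where "E g k = (\<Sum>i\<le>m. c ^ i * p ^ (Suc i * k) * (\<Sum>l<k. fps_nth (\<gamma> i) (k - l) * g l))"
    for g :: "nat \<Rightarrow> complex" and k
  have "\<exists>g. g 0 = 1 \<and> (\<forall>k\<ge>1. g k = - E g k / (p ^ k * poly \<psi> (c / q ^ k)))"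
  proof -
    define F where "F g k = (if k = 0 then 1 else - E g k / (p ^ k * poly \<psi> (c / q ^ k)))" for g k
    define gg where "gg = wfrec less_than F"
    have "gg k = F gg k" for k
    proof -
      have "gg k = F (cut gg less_than k) k"
        unfolding gg_def by (rule wfrec) auto
      also have "\<dots> = F gg k"
        unfolding F_def E_def by (auto simp: cut_def intro!: sum.cong)
      finally show ?thesis .
    qed
    thus ?thesis by (intro exI[of _ gg]) (auto simp: F_def)
  qed
  then obtain g0 where g0: "g0 0 = 1" "\<And>k. k \<ge> 1 \<Longrightarrow> g0 k = - E g0 k / (p ^ k * poly \<psi> (c / q ^ k))"
    by blast
  define g where "g = Abs_fps g0"
  \<comment> \<open>The recursion
    \<open>a (j - 1) = fps_dil p (fps_const c * a j + g * \<gamma> j)\<close>, unrolled downwards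
    from \<open>a m = 0\<close>. It satisfies all equations but the one with index 0, and that one
    is \<open>zero\<close>.\<close>
  define a where "a j = (\<Sum>i\<in>{j<..m}. fps_const (c ^ (i - j - 1)) * fps_dil (p ^ (i - j)) (g * \<gamma> i))" for j
  have zero: "(\<Sum>i\<le>m. fps_const (c ^ i) * fps_dil (p ^ Suc i) (g * \<gamma> i)) = 0"
  proof (rule fps_ext)
    fix k
    have "fps_nth (\<Sum>i\<le>m. fps_const (c ^ i) * fps_dil (p ^ Suc i) (g * \<gamma> i)) k
        = (\<Sum>i\<le>m. c ^ i * p ^ (Suc i * k) * fps_nth (\<gamma> i * g) k)"
      by (simp only: fps_sum_nth fps_mult_left_const_nth fps_nth_dil power_mult mult.assoc mult.commute[of g])
    also have "\<dots> = (\<Sum>i\<le>m. c ^ i * p ^ (Suc i * k) * ((\<Sum>l<k. fps_nth (\<gamma> i) (k - l) * g0 l) + fps_nth (\<gamma> i) 0 * g0 k))"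
    proof (rule sum.cong)
      fix i
      have "fps_nth (\<gamma> i * g) k = (\<Sum>l\<le>k. fps_nth (\<gamma> i) (k - l) * g0 l)"
        by (simp add: mult.commute[of _ g] fps_mult_nth g_def atLeast0AtMost mult.commute)
      also have "\<dots> = (\<Sum>l<k. fps_nth (\<gamma> i) (k - l) * g0 l) + fps_nth (\<gamma> i) 0 * g0 k"
        by (simp flip: lessThan_Suc_atMost)
      finally show "c ^ i * p ^ (Suc i * k) * fps_nth (\<gamma> i * g) k = c ^ i * p ^ (Suc i * k) *
         ((\<Sum>l<k. fps_nth (\<gamma> i) (k - l) * g0 l) + fps_nth (\<gamma> i) 0 * g0 k)" by simp
    qed auto
    also have "\<dots> = E g0 k + (\<Sum>i\<le>m. c ^ i * p ^ (Suc i * k) * fps_nth (\<gamma> i) 0) * g0 k"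
      by (simp add: E_def ring_distribs sum.distrib sum_distrib_right mult.assoc)
    also have "\<dots> = 0"
    proof (cases "k = 0")
      case True
      thus ?thesis using c(2) chi_k[of 0] by (simp add: E_def)
    next
      case False
      thus ?thesis unfolding chi_k using g0(2)[of k] c(3)[of k] p0 by (simp add: field_simps)
    qed
    finally show "fps_nth (\<Sum>i\<le>m. fps_const (c ^ i) * fps_dil (p ^ Suc i) (g * \<gamma> i)) k = fps_nth 0 k"
      by simp
  qed
  have last: "fps_dil q (a (m - 1)) = g"
  proof -
    have "{m - 1<..m} = {m}" using m by auto
    hence "a (m - 1) = fps_dil p g" using m by (simp add: a_def \<gamma>_def)
    thus ?thesis by (simp add: pq)
  qed
  have rec: "fps_dil q (\<Sum>i\<in>{j..m}. fps_const (c ^ (i - j)) * fps_dil (p ^ (i - j + 1)) (g * \<gamma> i))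
      = g * \<beta> j + fps_const c * a j" if "j < m" for j
  proof -
    have qp: "q * p ^ Suc n = p ^ n" for n using pq by (simp add: algebra_simps)
    have "fps_dil q (\<Sum>i\<in>{j..m}. fps_const (c ^ (i - j)) * fps_dil (p ^ (i - j + 1)) (g * \<gamma> i))
       = (\<Sum>i\<in>{j..m}. fps_const (c ^ (i - j)) * fps_dil (p ^ (i - j)) (g * \<gamma> i))"
      by (simp add: fps_dil_sum fps_dil_const_mult qp del: power_Suc flip: power_Suc)
    also have "\<dots> = (\<Sum>i\<in>insert j {j<..m}. fps_const (c ^ (i - j)) * fps_dil (p ^ (i - j)) (g * \<gamma> i))"
      using that by (intro sum.cong) auto
    also have "\<dots> = g * \<beta> j + (\<Sum>i\<in>{j<..m}. fps_const (c ^ (i - j)) * fps_dil (p ^ (i - j)) (g * \<gamma> i))"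
      using that by (simp add: \<gamma>_def)
    also have "(\<Sum>i\<in>{j<..m}. fps_const (c ^ (i - j)) * fps_dil (p ^ (i - j)) (g * \<gamma> i)) = fps_const c * a j"
      unfolding a_def sum_distrib_left
    proof (rule sum.cong)
      fix i assume "i \<in> {j<..m}"
      hence "i - j = Suc (i - j - 1)" by auto
      hence "c ^ (i - j) = c * c ^ (i - j - 1)" by (metis power_Suc)
      thus "fps_const (c ^ (i - j)) * fps_dil (p ^ (i - j)) (g * \<gamma> i)
         = fps_const c * (fps_const (c ^ (i - j - 1)) * fps_dil (p ^ (i - j)) (g * \<gamma> i))"
        by (simp add: mult.assoc flip: fps_const_mult)
    qed auto
    finally show ?thesis .
  qed
  show thesis
  proof (rule that[of c a])
    have "fps_nth g 0 \<noteq> 0" by (simp add: g_def g0)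
    thus "a (m - 1) \<noteq> 0" using last by auto
    have "g * \<beta> 0 + fps_const c * a 0 = 0"
      using rec[of 0] zero m by (simp add: atLeast0AtMost)
    thus "- fps_dil q (a (m - 1)) * \<beta> 0 = fps_const c * a 0"
      unfolding last by (simp add: add_eq_0_iff)
    fix i assume i: "i \<ge> 1" "i < m"
    have "a (i - 1) = (\<Sum>l\<in>{i..m}. fps_const (c ^ (l - i)) * fps_dil (p ^ (l - i + 1)) (g * \<gamma> l))"
      unfolding a_def
    proof (rule sum.cong)
      show "{i - 1<..m} = {i..m}" using i by auto
      fix l assume "l \<in> {i..m}"
      hence "l - (i - 1) - 1 = l - i" "l - (i - 1) = l - i + 1" using i by auto
      thus "fps_const (c ^ (l - (i - 1) - 1)) * fps_dil (p ^ (l - (i - 1))) (g * \<gamma> l) =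
        fps_const (c ^ (l - i)) * fps_dil (p ^ (l - i + 1)) (g * \<gamma> l)" by simp
    qed
    thus "fps_dil q (a (i - 1)) - fps_dil q (a (m - 1)) * \<beta> i = fps_const c * a i"
      unfolding last using rec[of i] i by simp
  qed fact
qed

section \<open>Vector spaces over the rational functions with two commuting semilinear
  operators\<close>

locale qdiff = vector_space scl
  for scl :: "complex poly fract \<Rightarrow> 'v :: ab_group_add \<Rightarrow> 'v" +
  fixes T1 T2 :: "'v \<Rightarrow> 'v" and q1 q2 :: complex
  assumes T1_add: "T1 (u + v) = T1 u + T1 v" and T2_add: "T2 (u + v) = T2 u + T2 v"
    and T1_scl: "T1 (scl r v) = scl (dil q1 r) (T1 v)" and T2_scl: "T2 (scl r v) = scl (dil q2 r) (T2 v)"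
    and T1_inj: "T1 v = 0 \<Longrightarrow> v = 0" and T2_inj: "T2 v = 0 \<Longrightarrow> v = 0"
    and commute: "T1 (T2 v) = T2 (T1 v)"
    and q1: "q1 \<noteq> 0" "\<not> root_of_unity q1" and q2: "q2 \<noteq> 0" "\<not> root_of_unity q2"
    and indep: "mult_independent q1 q2"

lemma mult_independent_commute: "mult_independent p q \<Longrightarrow> mult_independent q p"
  unfolding mult_independent_def by metis

text \<open>The assumptions are symmetric in the two operators, so facts are proved for
  \<open>T1\<close> only and specialized to \<open>T2\<close> through this rule.\<close>

lemma (in qdiff) swap: "qdiff scl T2 T1 q2 q1"
  by unfold_locales
     (auto simp: T1_add T2_add T1_scl T2_scl commute q1 q2 intro: mult_independent_commute indep T1_inj T2_inj)

context qdiff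
begin

lemma T1_0 [simp]: "T1 0 = 0" using T1_add[of 0 0] by simp

lemma T1_uminus: "T1 (- v) = - T1 v"
  using T1_add[of v "- v"] by (simp add: eq_neg_iff_add_eq_0 add.commute)

lemma T1_diff: "T1 (u - v) = T1 u - T1 v"
  using T1_add[of u "- v"] by (simp add: T1_uminus)

lemma T1_sum: "T1 (\<Sum>i\<in>A. f i) = (\<Sum>i\<in>A. T1 (f i))"
  by (induction A rule: infinite_finite_induct) (auto simp: T1_add)

lemma T1_cancel: "T1 u = T1 v \<longleftrightarrow> u = v"
  using T1_inj[of "u - v"] by (auto simp: T1_diff)

lemma T1_pow_T2_pow: "(T1 ^^ i) ((T2 ^^ j) v) = (T2 ^^ j) ((T1 ^^ i) v)"
proof -
  have *: "T1 ((T2 ^^ j) v) = (T2 ^^ j) (T1 v)" for v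
    by (induction j) (auto simp: commute)
  show ?thesis by (induction i) (auto simp: *)
qed

lemma T1_pow_add: "(T1 ^^ i) (u + v) = (T1 ^^ i) u + (T1 ^^ i) v"
  by (induction i) (auto simp: T1_add)

lemma T1_pow_0: "(T1 ^^ i) 0 = 0" by (induction i) auto

lemma T1_pow_inj: "(T1 ^^ i) v = 0 \<Longrightarrow> v = 0"
  by (induction i) (auto dest: T1_inj)

lemma T1_pow_sum: "(T1 ^^ n) (\<Sum>i\<in>A. f i) = (\<Sum>i\<in>A. (T1 ^^ n) (f i))"
  by (induction A rule: infinite_finite_induct) (auto simp: T1_pow_add T1_pow_0)

lemma T1_pow_scl: "(T1 ^^ n) (scl r v) = scl (dil (q1 ^ n) r) ((T1 ^^ n) v)"
  using q1 by (induction n) (auto simp: T1_scl dil_dil)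

text \<open>
  A relation has no slope \<open>p \<noteq> 0\<close>: an eigenvector of \<open>x\<^sup>p T1\<close> in an extension of scalars would
  have eigenvectors with infinitely many independent eigenvalues among its images under \<open>T2\<close>.
\<close>

lemma no_integral_slope:
  fixes \<psi> :: "complex poly fract \<Rightarrow> complex fls" and p :: int
  assumes hom: "\<And>r s. \<psi> (r + s) = \<psi> r + \<psi> s" "\<And>r s. \<psi> (r * s) = \<psi> r * \<psi> s" "\<psi> 1 = 1"
    and dil1: "\<And>r. \<psi> (dil q1 r) = fls_shift_mult r1 (\<psi> r)"
    and dil2: "\<And>r. \<psi> (dil q2 r) = fls_shift_mult r2 (\<psi> r)"
    and r1: "r1 \<noteq> 0" "\<not> root_of_unity r1" and r2: "r2 \<noteq> 0"
    and nonres: "\<And>j e :: int. e \<noteq> 0 \<Longrightarrow> r1 powi j * r2 powi e \<noteq> 1"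
    and p: "p \<noteq> 0"
    and rel: "(T1 ^^ m) f + (\<Sum>i<m. scl (b i) ((T1 ^^ i) f)) = 0"
    and ind: "\<And>c i. (\<Sum>i<m. scl (c i) ((T1 ^^ i) f)) = 0 \<Longrightarrow> i < m \<Longrightarrow> c i = 0"
    and G: "finite G" "f \<in> span G" "\<And>g. g \<in> G \<Longrightarrow> T1 g \<in> span G" "\<And>g. g \<in> G \<Longrightarrow> T2 g \<in> span G"
    and ge: "\<And>i. i < m \<Longrightarrow> fls_subdegree (\<psi> (b i)) + p * (int m - int i) \<ge> 0 \<or> \<psi> (b i) = 0"
    and eq: "i0 < m" "\<psi> (b i0) \<noteq> 0" "fls_subdegree (\<psi> (b i0)) + p * (int m - int i0) = 0"
  shows False
proof -
  define S1 where "S1 = fls_shift_mult r1"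
  define S2 where "S2 = fls_shift_mult r2"
  note S1_simps = fls_shift_mult_simps[OF r1(1), folded S1_def] fls_shift_mult_sum[OF r1(1), folded S1_def]
    fls_shift_mult_X_intpow[OF r1(1), folded S1_def]
  note S2_simps = fls_shift_mult_simps[OF r2, folded S2_def] fls_shift_mult_sum[OF r2, folded S2_def]
    fls_shift_mult_X_intpow[OF r2, folded S2_def]
  have S12: "S1 (S2 x) = S2 (S1 x)" for x
    by (rule fls_eqI) (simp add: S1_def S2_def fls_shift_mult_nth r1 r2)
  have \<psi>0: "\<psi> 0 = 0" using hom(1)[of 0 0] by simp
  have \<psi>_uminus: "\<psi> (- r) = - \<psi> r" for r
    using hom(1)[of r "- r"] \<psi>0 by (simp add: eq_neg_iff_add_eq_0 add.commute)
  have \<psi>_sum: "\<psi> (\<Sum>i\<in>A. g i) = (\<Sum>i\<in>A. \<psi> (g i))" for g :: "'x \<Rightarrow> _" and A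
    by (induction A rule: infinite_finite_induct) (auto simp: hom \<psi>0)
  obtain B where B: "B \<subseteq> G" "independent B" "G \<subseteq> span B"
    using maximal_independent_subset[of G] by auto
  have finB: "finite B" by (rule finite_subset[OF B(1) G(1)])
  have spanB: "span B = span G"
    using B span_mono[of G "span B"] span_mono[of B G] by (auto simp: span_span)
  have T1_span: "T1 v \<in> span B" if "v \<in> span B" for v
    using that unfolding spanB
    by (induction rule: span_induct_alt) (auto simp: span_zero T1_add T1_scl G span_add span_scale)
  have T2_span: "T2 v \<in> span B" if "v \<in> span B" for v
    using that unfolding spanB
    by (induction rule: span_induct_alt) (auto simp: span_zero qdiff.T1_0[OF swap] T2_add T2_scl G span_add span_scale)
  have inB1: "(T1 ^^ i) f \<in> span B" for i
    using T1_span G(2) by (induction i) (auto simp: spanB)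
  have inB: "(T2 ^^ j) ((T1 ^^ i) f) \<in> span B" for i j
    using T2_span inB1 by (induction j) auto
  \<comment> \<open>Extension of scalars along \<open>\<psi>\<close>, in coordinates: a vector over
    the Laurent series is a function on the basis \<open>B\<close>, and \<open>\<epsilon> v\<close>
    is the image of \<open>v\<close>.\<close>
  define \<epsilon> where "\<epsilon> v e = \<psi> (representation B v e)" for v e
  have \<epsilon>_outside: "\<epsilon> v e = 0" if "e \<notin> B" for v e
  proof -
    have "representation B v e = 0" using that representation_ne_zero[of B v e] by blast
    thus ?thesis by (simp add: \<epsilon>_def \<psi>0)
  qed
  have \<epsilon>_basis: "\<epsilon> d e = (if d = e then 1 else 0)" if "d \<in> B" for d e
    using representation_basis[OF B(2) that] that by (auto simp: \<epsilon>_def \<psi>0 hom)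
  have \<epsilon>_add: "\<epsilon> (u + v) e = \<epsilon> u e + \<epsilon> v e" if "u \<in> span B" "v \<in> span B" for u v e
    using that by (simp add: \<epsilon>_def representation_add[OF B(2)] hom)
  have \<epsilon>_scl: "\<epsilon> (scl r v) e = \<psi> r * \<epsilon> v e" if "v \<in> span B" for r v e
    using that by (simp add: \<epsilon>_def representation_scale[OF B(2)] hom)
  have \<epsilon>_0: "\<epsilon> 0 e = 0" for e by (simp add: \<epsilon>_def representation_zero \<psi>0)
  have \<epsilon>_sum: "\<epsilon> (\<Sum>i\<in>A. scl (c i) (v i)) e = (\<Sum>i\<in>A. \<psi> (c i) * \<epsilon> (v i) e)"
    if "\<And>i. i \<in> A \<Longrightarrow> v i \<in> span B" for A c and v :: "'y \<Rightarrow> 'v" and e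
    using that
    by (induction A rule: infinite_finite_induct) (auto simp: \<epsilon>_0 \<epsilon>_add \<epsilon>_scl span_sum span_scale)
  have expand: "v = (\<Sum>d\<in>B. scl (representation B v d) d)" if "v \<in> span B" for v
    using sum_representation_eq[OF B(2) that finB] by simp
  \<comment> \<open>The semilinear extension of \<open>T\<close> to these vectors, with
    \<open>S\<close> acting on the Laurent series. It agrees with \<open>T\<close> on the vectors
    \<open>\<epsilon> v\<close>.\<close>
  define P where "P S T u e = (\<Sum>d\<in>B. S (u d) * \<epsilon> (T d) e)" for S T and u :: "'v \<Rightarrow> complex fls" and e
  define P1 where "P1 = P S1 T1"
  define P2 where "P2 = P S2 T2"
  have P1_comb: "P1 (\<lambda>e. \<Sum>i\<in>I. c i * w i e) = (\<lambda>e. \<Sum>i\<in>I. S1 (c i) * P1 (w i) e)" for I c and w :: "'x \<Rightarrow> _"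
    unfolding P1_def P_def S1_simps sum_distrib_right sum_distrib_left
    by (intro ext, subst sum.swap) (simp add: mult_ac)
  have P2_comb: "P2 (\<lambda>e. \<Sum>i\<in>I. c i * w i e) = (\<lambda>e. \<Sum>i\<in>I. S2 (c i) * P2 (w i) e)" for I c and w :: "'x \<Rightarrow> _"
    unfolding P2_def P_def S2_simps sum_distrib_right sum_distrib_left
    by (intro ext, subst sum.swap) (simp add: mult_ac)
  have P1_scale: "P1 (\<lambda>e. c * w e) = (\<lambda>e. S1 c * P1 w e)" for c w
    using P1_comb[of "\<lambda>_. c" "\<lambda>_. w" "{()}"] by simp
  have P2_scale: "P2 (\<lambda>e. c * w e) = (\<lambda>e. S2 c * P2 w e)" for c w
    using P2_comb[of "\<lambda>_. c" "\<lambda>_. w" "{()}"] by simp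
  have P1_\<epsilon>: "P1 (\<epsilon> v) = \<epsilon> (T1 v)" if "v \<in> span B" for v
  proof
    fix e
    have "T1 v = (\<Sum>d\<in>B. scl (dil q1 (representation B v d)) (T1 d))"
      by (subst expand[OF that]) (simp add: T1_sum T1_scl)
    thus "P1 (\<epsilon> v) e = \<epsilon> (T1 v) e"
      by (simp add: \<epsilon>_sum T1_span span_base dil1 P1_def P_def S1_def) (simp add: \<epsilon>_def)
  qed
  have P2_\<epsilon>: "P2 (\<epsilon> v) = \<epsilon> (T2 v)" if "v \<in> span B" for v
  proof
    fix e
    have "T2 v = (\<Sum>d\<in>B. scl (dil q2 (representation B v d)) (T2 d))"
      by (subst expand[OF that]) (simp add: qdiff.T1_sum[OF swap] T2_scl)
    thus "P2 (\<epsilon> v) e = \<epsilon> (T2 v) e"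
      by (simp add: \<epsilon>_sum T2_span span_base dil2 P2_def P_def S2_def) (simp add: \<epsilon>_def)
  qed
  have supported: "u = (\<lambda>e. \<Sum>d\<in>B. u d * \<epsilon> d e)" if "\<And>e. e \<notin> B \<Longrightarrow> u e = 0" for u
  proof
    fix e show "u e = (\<Sum>d\<in>B. u d * \<epsilon> d e)"
    proof (cases "e \<in> B")
      case True
      have "(\<Sum>d\<in>B. u d * \<epsilon> d e) = (\<Sum>d\<in>B. if d = e then u d else 0)"
        by (rule sum.cong) (auto simp: \<epsilon>_basis)
      thus ?thesis using True finB by simp
    qed (auto simp: \<epsilon>_outside that)
  qed
  have P12: "P1 (P2 u) = P2 (P1 u)" if "\<And>e. e \<notin> B \<Longrightarrow> u e = 0" for u
    by (subst (1 2) supported[OF that])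
       (auto simp: P1_comb P2_comb P1_\<epsilon> P2_\<epsilon> T1_span T2_span span_base S12 commute)
  have P_outside: "P S T u e = 0" if "e \<notin> B" for S T u e
    using that by (simp add: P_def \<epsilon>_outside)
  \<comment> \<open>Linear independence survives the extension of scalars: in a basis that extends
    the given family, the coordinate belonging to \<open>v i\<close> is a functional defined over
    the rational functions, and its extension still extracts \<open>c i\<close>.\<close>
  have indep_ext: "c i = 0" if v: "\<And>i. i < m \<Longrightarrow> v i \<in> span B"
      and ind: "\<And>c i. (\<Sum>i<m. scl (c i) (v i)) = 0 \<Longrightarrow> i < m \<Longrightarrow> c i = 0"
      and c: "\<And>e. (\<Sum>i<m. c i * \<epsilon> (v i) e) = 0" and i: "i < m" for v c i
  proof -
    have inj: "inj_on v {..<m}"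
    proof (rule inj_onI, rule ccontr)
      fix j k assume jk: "j \<in> {..<m}" "k \<in> {..<m}" "v j = v k" "j \<noteq> k"
      define c where "c l = (if l = j then 1 else if l = k then - 1 else 0 :: complex poly fract)" for l
      have "(\<Sum>l<m. scl (c l) (v l)) = (\<Sum>l\<in>{j, k}. scl (c l) (v l))"
        using jk by (intro sum.mono_neutral_right) (auto simp: c_def)
      also have "\<dots> = 0" using jk by (simp add: c_def)
      finally show False using ind[of c j] jk by (simp add: c_def)
    qed
    have "independent (v ` {..<m})"
    proof (rule independent_if_scalars_zero)
      fix g x assume g: "(\<Sum>x\<in>v ` {..<m}. scl (g x) x) = 0" and x: "x \<in> v ` {..<m}"
      have "(\<Sum>i<m. scl (g (v i)) (v i)) = 0" using g by (simp add: sum.reindex[OF inj])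
      thus "g x = 0" using ind[of "\<lambda>i. g (v i)"] x by auto
    qed auto
    then obtain B' where B': "v ` {..<m} \<subseteq> B'" "B' \<subseteq> span B" "independent B'" "span B \<subseteq> span B'"
      using maximal_independent_subset_extend[of "v ` {..<m}" "span B"] v by blast
    define L where "L v' = representation B' v' (v i)" for v'
    have L: "\<psi> (L v') = (\<Sum>d\<in>B. \<epsilon> v' d * \<psi> (L d))" if "v' \<in> span B" for v'
    proof -
      have dB': "d \<in> span B'" if "d \<in> B" for d using B'(4) that span_base by blast
      have "L v' = (\<Sum>d\<in>B. representation B v' d * L d)"
        unfolding L_def
        by (subst expand[OF that], subst representation_sum[OF B'(3)])
           (auto simp: span_scale dB' representation_scale[OF B'(3)])
      thus ?thesis by (simp add: \<psi>_sum hom \<epsilon>_def)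
    qed
    have Lv: "L (v k) = (if k = i then 1 else 0)" if "k < m" for k
      using representation_basis[OF B'(3), of "v k"] B'(1) that i inj
      by (auto simp: L_def inj_on_eq_iff)
    have "0 = (\<Sum>d\<in>B. (\<Sum>k<m. c k * \<epsilon> (v k) d) * \<psi> (L d))" by (simp add: c)
    also have "\<dots> = (\<Sum>k<m. c k * (\<Sum>d\<in>B. \<epsilon> (v k) d * \<psi> (L d)))"
      unfolding sum_distrib_left sum_distrib_right by (subst sum.swap) (simp add: mult_ac)
    also have "\<dots> = (\<Sum>k<m. c k * \<psi> (L (v k)))" using v by (simp add: L)
    also have "\<dots> = (\<Sum>k<m. if k = i then c k else 0)" by (rule sum.cong) (auto simp: Lv hom \<psi>0)
    also have "\<dots> = c i" using i by simp
    finally show ?thesis by simp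
  qed
  define X where "X n = (fls_X_intpow n :: complex fls)" for n :: int
  have X_add: "X (a + b) = X a * X b" for a b by (simp add: X_def fls_X_intpow_times_fls_X_intpow)
  have X_0: "X 0 = 1" by (simp add: X_def)
  have X_nz: "X n \<noteq> 0" for n by (simp add: X_def)
  have S1_X: "S1 (X n) = fls_const (r1 powi n) * X n" and S2_X: "S2 (X n) = fls_const (r2 powi n) * X n" for n
    by (simp_all add: X_def S1_simps S2_simps)
  \<comment> \<open>The factor \<open>X p\<close> moves the slope \<open>p\<close> to 0. Up to a
    nonzero constant, \<open>w i\<close> is \<open>X (p * int i)\<close> times the image of
    \<open>(T1 ^^ i) f\<close>.\<close>
  define T where "T u e = X p * P1 u e" for u e
  define w where "w i = (T ^^ i) (\<epsilon> f)" for i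
  have w_Suc: "w (Suc i) = T (w i)" for i by (simp add: w_def)
  have "\<exists>\<kappa>. \<kappa> \<noteq> 0 \<and> w i = (\<lambda>e. fls_const \<kappa> * X (p * int i) * \<epsilon> ((T1 ^^ i) f) e)" for i
  proof (induction i)
    case 0
    thus ?case by (intro exI[of _ 1]) (simp add: w_def X_0)
  next
    case (Suc i)
    then obtain \<kappa> where \<kappa>: "\<kappa> \<noteq> 0" "w i = (\<lambda>e. fls_const \<kappa> * X (p * int i) * \<epsilon> ((T1 ^^ i) f) e)" by blast
    show ?case
      by (intro exI[of _ "\<kappa> * r1 powi (p * int i)"])
         (use \<kappa> r1 in \<open>auto simp: w_Suc T_def P1_scale S1_simps S1_X P1_\<epsilon> inB1 X_add ring_distribs
              simp flip: fls_const_mult_const\<close>)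
  qed
  then obtain \<kappa> where \<kappa>: "\<And>i. \<kappa> i \<noteq> 0"
      and w: "\<And>i. w i = (\<lambda>e. fls_const (\<kappa> i) * X (p * int i) * \<epsilon> ((T1 ^^ i) f) e)"
    by metis
  \<comment> \<open>The relation for \<open>f\<close>, rewritten for the vectors \<open>w i\<close>.
    By the hypothesis \<open>ge\<close> the new coefficients are power series, and by
    \<open>eq\<close> the one with index \<open>i0\<close> has a nonzero constant term.\<close>
  define \<beta>' where "\<beta>' i = fls_const (\<kappa> m / \<kappa> i) * X (p * (int m - int i)) * \<psi> (b i)" for i
  have \<beta>'_ge: "fls_subdegree (\<beta>' i) \<ge> 0" if "i < m" for i
    using ge[OF that] \<kappa>[of m] \<kappa>[of i] by (cases "\<psi> (b i) = 0") (auto simp: \<beta>'_def X_nz X_def add.commute)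
  define \<beta> where "\<beta> i = fls_regpart (\<beta>' i)" for i
  have \<beta>: "fps_to_fls (\<beta> i) = \<beta>' i" if "i < m" for i
    using \<beta>'_ge[OF that] by (simp add: \<beta>_def)
  have w_m: "w m e = - (\<Sum>i<m. \<beta>' i * w i e)" for e
  proof -
    have eq: "(T1 ^^ m) f = (\<Sum>i<m. scl (- b i) ((T1 ^^ i) f))"
      using rel by (simp add: eq_neg_iff_add_eq_0 sum_negf)
    have "\<epsilon> ((T1 ^^ m) f) e = (\<Sum>i<m. \<psi> (- b i) * \<epsilon> ((T1 ^^ i) f) e)"
      unfolding eq by (rule \<epsilon>_sum) (rule inB1)
    hence "\<epsilon> ((T1 ^^ m) f) e = - (\<Sum>i<m. \<psi> (b i) * \<epsilon> ((T1 ^^ i) f) e)"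
      by (simp add: \<psi>_uminus sum_negf)
    moreover have "\<beta>' i * w i e = fls_const (\<kappa> m) * X (p * int m) * (\<psi> (b i) * \<epsilon> ((T1 ^^ i) f) e)" for i
    proof -
      have "fls_const (\<kappa> m / \<kappa> i) * fls_const (\<kappa> i) = fls_const (\<kappa> m)"
        using \<kappa>[of i] by (simp add: fls_const_mult_const)
      moreover have "X (p * (int m - int i)) * X (p * int i) = X (p * int m)"
        by (simp add: algebra_simps flip: X_add)
      moreover have "\<beta>' i * w i e = (fls_const (\<kappa> m / \<kappa> i) * fls_const (\<kappa> i)) *
          (X (p * (int m - int i)) * X (p * int i)) * (\<psi> (b i) * \<epsilon> ((T1 ^^ i) f) e)"
        by (simp only: \<beta>'_def w mult_ac)
      ultimately show ?thesis by simp
    qed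
    ultimately show ?thesis by (simp add: w[of m] sum_distrib_left sum_negf)
  qed
  have "fps_nth (\<beta> i0) 0 \<noteq> 0"
  proof -
    have "\<beta>' i0 \<noteq> 0" "fls_subdegree (\<beta>' i0) = 0"
      using eq \<kappa>[of m] \<kappa>[of i0] by (auto simp: \<beta>'_def X_nz X_def add.commute)
    hence "fls_nth (\<beta>' i0) 0 \<noteq> 0" by (metis nth_fls_subdegree_nonzero)
    thus ?thesis by (simp add: \<beta>_def)
  qed
  then obtain c a where ca: "c \<noteq> 0" "a (m - 1) \<noteq> 0"
    "- fps_dil r1 (a (m - 1)) * \<beta> 0 = fps_const c * a 0"
    "\<And>i. i \<ge> 1 \<Longrightarrow> i < m \<Longrightarrow> fps_dil r1 (a (i - 1)) - fps_dil r1 (a (m - 1)) * \<beta> i = fps_const c * a i"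
    using eigenvector_coefficients[OF r1(2,1) eq(1), of \<beta>] by metis
  define a' where "a' i = fps_to_fls (a i)" for i
  define u where "u e = (\<Sum>i<m. a' i * w i e)" for e
  have S1_a': "S1 (a' i) = fps_to_fls (fps_dil r1 (a i))" for i
    by (simp add: a'_def S1_def fls_shift_mult_fps[OF r1(1)])
  have a'0: "- S1 (a' (m - 1)) * \<beta>' 0 = fls_const c * a' 0"
  proof -
    have "fps_to_fls (- fps_dil r1 (a (m - 1)) * \<beta> 0) = fps_to_fls (fps_const c * a 0)" using ca(3) by simp
    thus ?thesis using \<beta>[of 0] eq(1) by (simp add: S1_a' fls_times_fps_to_fls fps_to_fls_uminus) (simp add: a'_def)
  qed
  have a'i: "S1 (a' (i - 1)) - S1 (a' (m - 1)) * \<beta>' i = fls_const c * a' i" if "i \<ge> 1" "i < m" for i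
  proof -
    have "fps_to_fls (fps_dil r1 (a (i - 1)) - fps_dil r1 (a (m - 1)) * \<beta> i) = fps_to_fls (fps_const c * a i)"
      using ca(4)[OF that] by simp
    thus ?thesis using \<beta>[of i] that by (simp add: S1_a' fls_times_fps_to_fls) (simp add: a'_def)
  qed
  have m: "m = Suc (m - 1)" using eq by auto
  have T_u: "T u e = fls_const c * u e" for e
  proof -
    have "T u e = (\<Sum>i<m. S1 (a' i) * w (Suc i) e)"
    proof -
      have "u = (\<lambda>e. \<Sum>i<m. a' i * w i e)" by (simp add: u_def fun_eq_iff)
      thus ?thesis by (simp add: w_Suc T_def P1_comb sum_distrib_left mult_ac)
    qed
    also have "\<dots> = (\<Sum>i<m - 1. S1 (a' i) * w (Suc i) e) + S1 (a' (m - 1)) * w m e"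
      by (subst m, subst sum.lessThan_Suc) (use m in auto)
    also have "\<dots> = (\<Sum>i<m - 1. S1 (a' i) * w (Suc i) e) - (\<Sum>i<m. S1 (a' (m - 1)) * \<beta>' i * w i e)"
      by (simp add: w_m sum_distrib_left mult.assoc)
    also have "(\<Sum>i<m. S1 (a' (m - 1)) * \<beta>' i * w i e) = S1 (a' (m - 1)) * \<beta>' 0 * w 0 e +
        (\<Sum>i<m - 1. S1 (a' (m - 1)) * \<beta>' (Suc i) * w (Suc i) e)"
      by (subst m, subst sum.lessThan_Suc_shift) auto
    also have "(\<Sum>i<m - 1. S1 (a' i) * w (Suc i) e) - (S1 (a' (m - 1)) * \<beta>' 0 * w 0 e +
        (\<Sum>i<m - 1. S1 (a' (m - 1)) * \<beta>' (Suc i) * w (Suc i) e)) =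
        (- S1 (a' (m - 1)) * \<beta>' 0) * w 0 e +
        (\<Sum>i<m - 1. (S1 (a' i) - S1 (a' (m - 1)) * \<beta>' (Suc i)) * w (Suc i) e)"
      by (simp add: left_diff_distrib sum_subtractf)
    also have "\<dots> = fls_const c * a' 0 * w 0 e + (\<Sum>i<m - 1. fls_const c * a' (Suc i) * w (Suc i) e)"
      unfolding a'0 using a'i[of "Suc _"] by (intro arg_cong2[where f = "(+)"] sum.cong) auto
    also have "\<dots> = (\<Sum>i<m. fls_const c * a' i * w i e)"
      by (subst (2) m, subst sum.lessThan_Suc_shift) auto
    also have "\<dots> = fls_const c * u e" unfolding u_def by (simp add: sum_distrib_left mult.assoc)
    finally show ?thesis .
  qed
  \<comment> \<open>Since \<open>S2\<close> multiplies \<open>X (- p)\<close> by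
    \<open>r2 powi (- p)\<close> and \<open>P2\<close> commutes with \<open>P1\<close>, the vector
    \<open>U k\<close> is an eigenvector of \<open>T\<close> with eigenvalue
    \<open>c * r2 powi (- p * int k)\<close>.\<close>
  define U where "U k = (P2 ^^ k) u" for k
  have U_Suc: "U (Suc k) = P2 (U k)" for k by (simp add: U_def)
  have "\<exists>g. g (m - 1) \<noteq> 0 \<and> U k = (\<lambda>e. \<Sum>i<m. g i * \<epsilon> ((T2 ^^ k) ((T1 ^^ i) f)) e)" for k
  proof (induction k)
    case 0
    show ?case
      by (rule exI[of _ "\<lambda>i. a' i * (fls_const (\<kappa> i) * X (p * int i))"])
         (use ca(2) \<kappa> in \<open>auto simp: U_def u_def[abs_def] w a'_def X_nz mult_ac\<close>)
  next
    case (Suc k)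
    then obtain g where g: "g (m - 1) \<noteq> 0" "U k = (\<lambda>e. \<Sum>i<m. g i * \<epsilon> ((T2 ^^ k) ((T1 ^^ i) f)) e)" by blast
    show ?case
      by (rule exI[of _ "\<lambda>i. S2 (g i)"]) (use g in \<open>auto simp: U_Suc P2_comb S2_simps P2_\<epsilon> inB\<close>)
  qed
  then obtain g where g: "\<And>k. g k (m - 1) \<noteq> 0"
      and U: "\<And>k. U k = (\<lambda>e. \<Sum>i<m. g k i * \<epsilon> ((T2 ^^ k) ((T1 ^^ i) f)) e)" by metis
  \<comment> \<open>\<open>T2 ^^ k\<close> preserves the independence of the vectors
    \<open>(T1 ^^ i) f\<close>, and the coefficient with index \<open>m - 1\<close> never
    vanishes.\<close>
  have U_nz: "\<exists>e. U k e \<noteq> 0" for k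
  proof (rule ccontr)
    assume "\<not> ?thesis"
    hence "(\<Sum>i<m. g k i * \<epsilon> ((T2 ^^ k) ((T1 ^^ i) f)) e) = 0" for e
      using fun_cong[OF U[of k], of e] by simp
    hence "g k (m - 1) = 0"
    proof (rule indep_ext[rotated 2])
      fix c i assume *: "(\<Sum>i<m. scl (c i) ((T2 ^^ k) ((T1 ^^ i) f))) = 0" "i < m"
      have "(T2 ^^ k) (\<Sum>i<m. scl (dil (1 / q2 ^ k) (c i)) ((T1 ^^ i) f)) = 0"
        using * q2 by (simp add: qdiff.T1_pow_sum[OF swap] qdiff.T1_pow_scl[OF swap] dil_inv)
      hence "(\<Sum>i<m. scl (dil (1 / q2 ^ k) (c i)) ((T1 ^^ i) f)) = 0"
        by (rule qdiff.T1_pow_inj[OF swap])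
      hence "dil (1 / q2 ^ k) (c i) = 0" using ind[of "\<lambda>i. dil (1 / q2 ^ k) (c i)" i] *(2) by simp
      thus "c i = 0" using q2 by (simp add: dil_eq_0_iff)
    qed (use inB m in auto)
    thus False using g by blast
  qed
  have U_outside: "U k e = 0" if "e \<notin> B" for k e
    using that by (simp add: U \<epsilon>_outside)
  have P1_U: "P1 (U k) = (\<lambda>e. fls_const (c * r2 powi (- p * int k)) * X (- p) * U k e)" for k
  proof (induction k)
    case 0
    show ?case
    proof
      fix e
      have "X (- p) * (X p * P1 u e) = X (- p) * (fls_const c * u e)"
        using T_u[of e] by (simp add: T_def)
      moreover have "X (- p) * X p = 1" by (simp add: X_0 flip: X_add)
      ultimately have "P1 u e = X (- p) * (fls_const c * u e)" by (metis mult.assoc mult_1)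
      thus "P1 (U 0) e = fls_const (c * r2 powi (- p * int 0)) * X (- p) * U 0 e"
        by (simp add: U_def mult_ac)
    qed
  next
    case (Suc k)
    have "P1 (U (Suc k)) = P2 (P1 (U k))" using U_outside by (simp add: U_Suc P12)
    also have "\<dots> = (\<lambda>e. fls_const (c * r2 powi (- p * int k)) * (fls_const (r2 powi (- p)) * X (- p)) * U (Suc k) e)"
      unfolding Suc U_Suc P2_scale S2_simps S2_X ..
    also have "fls_const (c * r2 powi (- p * int k)) * (fls_const (r2 powi (- p)) * X (- p)) =
        fls_const (c * r2 powi (- p * int (Suc k))) * X (- p)"
    proof -
      have "r2 powi (- p * int k) * r2 powi (- p) = r2 powi (- p * int (Suc k))"
        using r2 by (simp add: algebra_simps flip: power_int_add)
      thus ?thesis by (simp add: fls_const_mult_const mult.assoc[symmetric]) (simp add: mult.assoc)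
    qed
    finally show ?case .
  qed
  \<comment> \<open>The independence proof for eigenvectors, adapted to a semilinear operator. A
    shortest dependency, made monic, is subtracted from its rescaled image under \<open>P1\<close>.
    The leading terms cancel, so by minimality all the differences \<open>y k\<close>
    vanish.\<close>
  define dep where "dep K x \<longleftrightarrow> x K \<noteq> 0 \<and> (\<forall>e. (\<Sum>k\<le>K. x k * U k e) = 0)" for K x
  have "\<exists>K x. dep K x"
  proof -
    obtain x where x: "\<exists>k\<in>{..card B}. x k \<noteq> 0" "\<And>e. e \<in> B \<Longrightarrow> (\<Sum>k\<in>{..card B}. x k * U k e) = 0"
      using underdetermined_system[OF finB, of "{..card B}" U] by auto
    define K where "K = Max {k. k \<le> card B \<and> x k \<noteq> 0}"
    have "K \<in> {k. k \<le> card B \<and> x k \<noteq> 0}"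
      unfolding K_def by (rule Max_in) (use x in auto)
    moreover have "k \<le> K" if "k \<le> card B" "x k \<noteq> 0" for k
      unfolding K_def by (rule Max_ge) (use that in auto)
    ultimately have K: "K \<le> card B" "x K \<noteq> 0" "\<And>k. k \<le> card B \<Longrightarrow> K < k \<Longrightarrow> x k = 0"
      by (auto simp: not_le[symmetric])
    have "(\<Sum>k\<le>K. x k * U k e) = 0" for e
    proof (cases "e \<in> B")
      case True
      have "(\<Sum>k\<le>K. x k * U k e) = (\<Sum>k\<le>card B. x k * U k e)"
        by (rule sum.mono_neutral_left) (use K in auto)
      thus ?thesis using x(2)[OF True] by simp
    qed (simp add: U_outside)
    thus ?thesis using K by (auto simp: dep_def)
  qed
  define K where "K = (LEAST K. \<exists>x. dep K x)"
  have "\<exists>x. dep K x" unfolding K_def by (rule LeastI_ex) fact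
  then obtain x' where x': "dep K x'" by blast
  define x where "x k = x' k / x' K" for k
  have xK: "x K = 1" using x' by (simp add: x_def dep_def)
  have x: "(\<Sum>k\<le>K. x k * U k e) = 0" for e
    using x' by (simp add: x_def dep_def flip: sum_divide_distrib)
  have least: "\<not> dep K' y" if "K' < K" for K' y
    using not_less_Least[of K' "\<lambda>K. \<exists>x. dep K x"] that unfolding K_def by blast
  define y where "y k = S1 (x k) * fls_const (r2 powi (p * (int K - int k))) - x k" for k
  have yK: "y K = 0" by (simp add: y_def xK S1_simps)
  have y: "(\<Sum>k<K. y k * U k e) = 0" for e
  proof -
    have "P1 (\<lambda>e. \<Sum>k\<le>K. x k * U k e) e = 0" unfolding x by (simp add: P1_def P_def S1_simps)
    hence "0 = (\<Sum>k\<le>K. S1 (x k) * (fls_const (c * r2 powi (- p * int k)) * X (- p) * U k e))"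
      unfolding P1_comb P1_U by simp
    hence "0 = (fls_const (r2 powi (p * int K) / c) * X p) *
        (\<Sum>k\<le>K. S1 (x k) * (fls_const (c * r2 powi (- p * int k)) * X (- p) * U k e))" by simp
    also have "\<dots> = (\<Sum>k\<le>K. S1 (x k) * fls_const (r2 powi (p * (int K - int k))) * U k e)"
      unfolding sum_distrib_left
    proof (rule sum.cong)
      fix k
      have "r2 powi (p * int K) / c * (c * r2 powi (- p * int k)) = r2 powi (p * (int K - int k))"
        using ca(1) r2 by (simp add: right_diff_distrib power_int_diff power_int_minus field_simps)
      hence 1: "fls_const (r2 powi (p * int K) / c) * fls_const (c * r2 powi (- p * int k))
          = fls_const (r2 powi (p * (int K - int k)))" by (simp only: fls_const_mult_const)
      have 2: "X p * X (- p) = 1" by (simp add: X_0 flip: X_add)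
      have "fls_const (r2 powi (p * int K) / c) * X p *
          (S1 (x k) * (fls_const (c * r2 powi (- p * int k)) * X (- p) * U k e)) =
         (X p * X (- p)) * S1 (x k) * (fls_const (r2 powi (p * int K) / c) * fls_const (c * r2 powi (- p * int k))) * U k e"
        by (simp only: mult_ac)
      thus "fls_const (r2 powi (p * int K) / c) * X p *
          (S1 (x k) * (fls_const (c * r2 powi (- p * int k)) * X (- p) * U k e)) =
          S1 (x k) * fls_const (r2 powi (p * (int K - int k))) * U k e"
        unfolding 1 2 by simp
    qed auto
    finally have "(\<Sum>k\<le>K. y k * U k e) = 0"
      using x[of e] by (simp add: y_def left_diff_distrib sum_subtractf)
    thus ?thesis using yK by (simp flip: lessThan_Suc_atMost)
  qed
  have y0: "y k = 0" if "k < K" for k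
  proof (rule ccontr)
    assume "y k \<noteq> 0"
    define K' where "K' = Max {k. k < K \<and> y k \<noteq> 0}"
    have "K' \<in> {k. k < K \<and> y k \<noteq> 0}"
      unfolding K'_def by (rule Max_in) (use \<open>y k \<noteq> 0\<close> that in auto)
    moreover have "k \<le> K'" if "k < K" "y k \<noteq> 0" for k
      unfolding K'_def by (rule Max_ge) (use that in auto)
    ultimately have K': "K' < K" "y K' \<noteq> 0" "\<And>k. k < K \<Longrightarrow> K' < k \<Longrightarrow> y k = 0"
      by (auto simp: not_le[symmetric])
    have "(\<Sum>k\<le>K'. y k * U k e) = (\<Sum>k<K. y k * U k e)" for e
      by (rule sum.mono_neutral_left) (use K' in auto)
    hence "dep K' y" using K' y by (simp add: dep_def)
    thus False using least K' by blast
  qed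
  \<comment> \<open>Coefficientwise, \<open>y k = 0\<close> says that \<open>x k\<close> is
    annihilated by \<open>r1 powi n * r2 powi (p * (int K - int k)) - 1\<close>, which
    \<open>nonres\<close> keeps away from 0. The dependency collapses to \<open>U K = 0\<close>,
    which is impossible.\<close>
  have "x k = 0" if "k < K" for k
  proof (rule fls_eqI)
    fix n
    have "fls_nth (y k) n = (r1 powi n * r2 powi (p * (int K - int k)) - 1) * fls_nth (x k) n"
      by (simp add: y_def S1_def fls_shift_mult_nth[OF r1(1)] algebra_simps)
    moreover have "r1 powi n * r2 powi (p * (int K - int k)) \<noteq> 1"
      by (rule nonres) (use p that in auto)
    ultimately show "fls_nth (x k) n = fls_nth 0 n" using y0[OF that] by simp
  qed
  hence "(\<Sum>k\<le>K. x k * U k e) = U K e" for e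
    by (simp add: xK flip: lessThan_Suc_atMost)
  thus False using x U_nz[of K] by auto
qed

end

section \<open>Absence of slopes\<close>

context qdiff
begin

text \<open>A coefficient of negative order would give the Newton polygon a positive slope. The
  steepest one becomes an integer \<open>p\<close> after the ramified substitution
  \<open>x = z^d\<close>, which \<open>no_integral_slope\<close> excludes. The multipliers
  \<open>p1\<close> and \<open>p2\<close> belong to the local coordinate: they are
  \<open>q1\<close>, \<open>q2\<close> at 0 and their inverses at infinity.\<close>

lemma slope_nonneg:
  fixes \<phi> :: "complex poly fract \<Rightarrow> complex fls"
  assumes hom: "\<And>r s. \<phi> (r + s) = \<phi> r + \<phi> s" "\<And>r s. \<phi> (r * s) = \<phi> r * \<phi> s" "\<phi> 1 = 1"
    and dil1: "\<And>r. \<phi> (dil q1 r) = fls_shift_mult p1 (\<phi> r)"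
    and dil2: "\<And>r. \<phi> (dil q2 r) = fls_shift_mult p2 (\<phi> r)"
    and p1: "p1 \<noteq> 0" "\<not> root_of_unity p1" and p2: "p2 \<noteq> 0" "\<not> root_of_unity p2"
    and mi: "mult_independent p1 p2"
    and rel: "(T1 ^^ m) f + (\<Sum>i<m. scl (b i) ((T1 ^^ i) f)) = 0"
    and ind: "\<And>c i. (\<Sum>i<m. scl (c i) ((T1 ^^ i) f)) = 0 \<Longrightarrow> i < m \<Longrightarrow> c i = 0"
    and G: "finite G" "f \<in> span G" "\<And>g. g \<in> G \<Longrightarrow> T1 g \<in> span G" "\<And>g. g \<in> G \<Longrightarrow> T2 g \<in> span G"
    and i: "i < m"
  shows "fls_subdegree (\<phi> (b i)) \<ge> 0"
proof (rule ccontr)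
  define o' where "o' j = fls_subdegree (\<phi> (b j))" for j
  assume "\<not> ?thesis"
  hence neg: "o' i < 0" by (simp add: o'_def)
  \<comment> \<open>\<open>s j\<close> is the slope of the segment from the point of index
    \<open>j\<close> to the point of the leading coefficient. A maximal slope, attained at
    \<open>i0\<close>, leaves all points on or above that line, which is
    \<open>o'_ge\<close>.\<close>
  define s where "s j = real_of_int (- o' j) / real (m - j)" for j
  have "Max (s ` {..<m}) \<in> s ` {..<m}" using i by (intro Max_in) auto
  then obtain i0 where i0: "i0 < m" "s i0 = Max (s ` {..<m})" by auto
  have s_le: "s j \<le> s i0" if "j < m" for j
    using that by (simp add: i0)
  define d where "d = m - i0"
  define p where "p = - o' i0"
  have d: "d > 0" using i0 by (simp add: d_def)
  have "s i > 0" using neg i unfolding s_def by (intro divide_pos_pos) auto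
  hence "s i0 > 0" using s_le[OF i] by simp
  hence p: "p > 0" using i0(1) unfolding s_def p_def by (simp only: zero_less_divide_iff) auto
  have o'_ge: "int d * o' j + p * (int m - int j) \<ge> 0" if "j < m" for j
  proof -
    have "real_of_int (- o' j) * real d \<le> real_of_int p * real (m - j)"
    proof -
      have "real (m - j) > 0" "real d > 0" using that d by auto
      thus ?thesis using s_le[OF that] unfolding s_def d_def[symmetric] p_def by (simp add: field_simps)
    qed
    hence "real_of_int (int d * o' j + p * (int m - int j)) \<ge> 0"
      using that by (simp add: of_nat_diff algebra_simps)
    thus ?thesis by linarith
  qed
  define \<psi> where "\<psi> r = fls_compose_power (\<phi> r) d" for r
  have \<psi>_nz: "\<phi> r \<noteq> 0" "fls_subdegree (\<psi> r) = int d * fls_subdegree (\<phi> r)" if "\<psi> r \<noteq> 0" for r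
  proof -
    show nz: "\<phi> r \<noteq> 0" using that by (auto simp: \<psi>_def)
    show "fls_subdegree (\<psi> r) = int d * fls_subdegree (\<phi> r)"
    proof (rule fls_subdegree_eqI)
      show "fls_nth (\<psi> r) (int d * fls_subdegree (\<phi> r)) \<noteq> 0"
        using d nz by (simp add: \<psi>_def fls_nth_compose_power)
      fix k assume "k < int d * fls_subdegree (\<phi> r)"
      thus "fls_nth (\<psi> r) k = 0"
        using d by (auto simp: \<psi>_def fls_nth_compose_power elim!: dvdE)
    qed
  qed
  \<comment> \<open>Any \<open>d\<close>-th roots will do: a multiplicative relation between them
    turns into one between \<open>p1\<close> and \<open>p2\<close> on taking \<open>d\<close>-th
    powers.\<close>
  define r1 where "r1 = exp (Ln p1 / of_nat d)"
  define r2 where "r2 = exp (Ln p2 / of_nat d)"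
  have r: "r1 ^ d = p1" "r2 ^ d = p2" "r1 \<noteq> 0" "r2 \<noteq> 0"
    using d p1 p2 by (simp_all add: r1_def r2_def flip: exp_of_nat_mult)
  have powi_d: "(r1 powi n) ^ d = p1 powi n" "(r2 powi n) ^ d = p2 powi n" for n
  proof -
    have "(z powi n) ^ d = (z ^ d) powi n" for z :: complex
      using power_int_mult[of z n "int d"] power_int_mult[of z "int d" n] by (simp add: mult.commute)
    thus "(r1 powi n) ^ d = p1 powi n" "(r2 powi n) ^ d = p2 powi n" by (simp_all add: r)
  qed
  show False
  proof (rule no_integral_slope[of \<psi> r1 r2 p m f b G i0])
    show "\<psi> (x + y) = \<psi> x + \<psi> y" "\<psi> (x * y) = \<psi> x * \<psi> y" "\<psi> 1 = 1" for x y
      using d by (simp_all add: \<psi>_def hom)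
    show "\<psi> (dil q1 x) = fls_shift_mult r1 (\<psi> x)" "\<psi> (dil q2 x) = fls_shift_mult r2 (\<psi> x)" for x
      using d r by (simp_all add: \<psi>_def dil1 dil2 fls_shift_mult_compose_power)
    show "\<not> root_of_unity r1"
    proof
      assume "root_of_unity r1"
      then obtain n :: nat where "n \<ge> 1" "r1 ^ n = 1" by (auto simp: root_of_unity_def)
      moreover from this have "p1 ^ n = 1" by (metis mult.commute power_mult power_one r(1))
      ultimately show False using p1 by (auto simp: root_of_unity_def)
    qed
    show "r1 powi j * r2 powi e \<noteq> 1" if "e \<noteq> 0" for j e
    proof
      assume "r1 powi j * r2 powi e = 1"
      hence "(r1 powi j * r2 powi e) ^ d = 1" by simp
      hence eq: "p1 powi j * p2 powi e = 1" by (simp add: power_mult_distrib powi_d)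
      show False
      proof (cases "j = 0")
        case True
        thus False using eq not_root_of_unity_powi[OF p2(2,1), of e] that by simp
      next
        case False
        have "p2 powi e = p1 powi (- j)"
          using eq p1 by (simp add: power_int_minus field_simps)
        thus False using mi False that unfolding mult_independent_def by (metis neg_equal_0_iff_equal)
      qed
    qed
    show "fls_subdegree (\<psi> (b j)) + p * (int m - int j) \<ge> 0 \<or> \<psi> (b j) = 0" if "j < m" for j
      using \<psi>_nz[of "b j"] o'_ge[OF that] by (auto simp: o'_def)
    have "\<phi> (b i0) \<noteq> 0" using p by (auto simp: p_def o'_def)
    hence "fls_nth (\<psi> (b i0)) (int d * fls_subdegree (\<phi> (b i0))) \<noteq> 0"
      using d by (simp add: \<psi>_def fls_nth_compose_power)
    thus "\<psi> (b i0) \<noteq> 0" by auto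
    thus "fls_subdegree (\<psi> (b i0)) + p * (int m - int i0) = 0"
      using \<psi>_nz[of "b i0"] i0 by (simp add: p_def o'_def d_def of_nat_diff)
  qed (use p r rel ind G i0 in auto)
qed

end

subsection \<open>Expansions at zero and infinity\<close>

lemma poly_embedding_ratfun_fls: "poly_embedding (\<lambda>p. fps_to_fls (fps_of_poly p))"
  by standard (auto simp: fps_of_poly_add fps_of_poly_mult fls_times_fps_to_fls fps_of_poly_eq_iff
      simp flip: fps_of_poly_0)

interpretation ratfun_fls: poly_embedding "\<lambda>p. fps_to_fls (fps_of_poly p)"
  rewrites "poly_embedding.lift (\<lambda>p. fps_to_fls (fps_of_poly p)) = ratfun_fls"
proof -
  show "poly_embedding (\<lambda>p. fps_to_fls (fps_of_poly p))" by (rule poly_embedding_ratfun_fls)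
  then interpret poly_embedding "\<lambda>p. fps_to_fls (fps_of_poly p)" .
  show "lift = ratfun_fls"
    by (simp add: fun_eq_iff lift_def ratfun_fls_def case_prod_unfold)
qed

lemma coeff_pcompose_dil: "coeff (pcompose p [:0, q :: complex:]) n = q ^ n * coeff p n"
  by (rule coeff_pcompose_linear)

lemma ratfun_fls_dil:
  assumes "q \<noteq> 0"
  shows "ratfun_fls (dil q r) = fls_shift_mult q (ratfun_fls r)"
proof (cases r)
  case (Fract a b)
  have "fps_of_poly (pcompose p [:0, q:]) = fps_dil q (fps_of_poly p)" for p
    by (rule fps_ext) (simp add: coeff_pcompose_dil)
  thus ?thesis using Fract assms
    by (simp add: dil_Fract pcompose_linear_nonzero fls_shift_mult_simps fls_shift_mult_fps)
qed

lemma ratfun_fls_reg_at: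
  assumes "fls_subdegree (ratfun_fls r) \<ge> 0"
  shows "r \<in> reg_at 0"
proof -
  define a b where "a = fst (quot_of_fract r)" and "b = snd (quot_of_fract r)"
  have b0: "b \<noteq> 0" and r: "r = Fract a b" and co: "coprime a b"
    by (auto simp: a_def b_def coprime_quot_of_fract)
  have "poly b 0 \<noteq> 0"
  proof
    assume b_0: "poly b 0 = 0"
    have a_0: "poly a 0 \<noteq> 0"
    proof
      assume "poly a 0 = 0"
      hence "[:0, 1:] dvd a" "[:0, 1:] dvd b" using b_0 by (simp_all add: poly_eq_0_iff_dvd)
      hence "is_unit [:0, 1 :: complex:]" using co by (meson coprime_common_divisor)
      thus False by (simp add: is_unit_iff_degree)
    qed
    hence "subdegree (fps_of_poly a) = 0" by (simp add: poly_0_coeff_0 subdegree_eq_0)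
    moreover have "subdegree (fps_of_poly b) > 0"
      using b_0 b0 by (metis fps_of_poly_eq_iff fps_of_poly_0 fps_of_poly_nth neq0_conv nth_subdegree_nonzero poly_0_coeff_0)
    moreover have "fps_to_fls (fps_of_poly a) \<noteq> 0" "fps_to_fls (fps_of_poly b) \<noteq> 0"
      using a_0 b0 by (auto simp: ratfun_fls.nonzero)
    ultimately have "fls_subdegree (ratfun_fls r) < 0"
      using r b0 by (simp add: fls_divide_subdegree fls_subdegree_fls_to_fps)
    thus False using assms by simp
  qed
  thus ?thesis unfolding r by (rule reg_atI)
qed

text \<open>The series variable is the coordinate \<open>1 / x\<close> at infinity. Hence
  \<open>x\<close> becomes \<open>fls_X_inv\<close>, and a dilation by \<open>q\<close> becomes a
  dilation by \<open>1 / q\<close>.\<close>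

definition poly_inf_fls :: "complex poly \<Rightarrow> complex fls" where
  "poly_inf_fls p = poly (map_poly fls_const p) fls_X_inv"

lemma poly_inf_fls_pCons: "poly_inf_fls (pCons a p) = fls_const a + fls_X_inv * poly_inf_fls p"
  by (simp add: poly_inf_fls_def map_poly_pCons)

lemma poly_inf_fls_nth: "fls_nth (poly_inf_fls p) n = (if n \<le> 0 then coeff p (nat (- n)) else 0)"
proof (induction p arbitrary: n)
  case 0
  thus ?case by (simp add: poly_inf_fls_def)
next
  case (pCons a p)
  have "nat (- n) = Suc (nat (- (n + 1)))" if "n < 0" using that by auto
  thus ?case using pCons.IH[of "n + 1"]
    by (auto simp: poly_inf_fls_pCons fls_X_inv_times_conv_shift coeff_pCons split: nat.splits)
qed

lemma poly_inf_fls_subdegree: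
  assumes "p \<noteq> 0"
  shows "fls_subdegree (poly_inf_fls p) = - int (degree p)"
  by (rule fls_subdegree_eqI) (use assms in \<open>auto simp: poly_inf_fls_nth coeff_eq_0\<close>)

interpretation ratfun_inf: poly_embedding poly_inf_fls
proof (rule poly_embeddingI)
  show "poly_inf_fls (pCons a p) = fls_const a + fls_X_inv * poly_inf_fls p" for a p
    by (rule poly_inf_fls_pCons)
  show "poly_inf_fls p \<noteq> 0" if "p \<noteq> 0" for p
    using poly_inf_fls_nth[of p "- int (degree p)"] that by auto
qed (auto simp: poly_inf_fls_def fls_const_mult_const fls_plus_const)

lemma ratfun_inf_dil:
  assumes "q \<noteq> 0"
  shows "ratfun_inf.lift (dil q r) = fls_shift_mult (1 / q) (ratfun_inf.lift r)"
proof (cases r)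
  case (Fract a b)
  have "poly_inf_fls (pcompose p [:0, q:]) = fls_shift_mult (1 / q) (poly_inf_fls p)" for p
    by (rule fls_eqI)
       (use assms in \<open>auto simp: poly_inf_fls_nth fls_shift_mult_nth coeff_pcompose_dil power_int_def power_one_over divide_inverse power_inverse\<close>)
  thus ?thesis using Fract assms
    by (simp add: dil_Fract pcompose_linear_nonzero fls_shift_mult_simps)
qed

lemma ratfun_inf_bounded:
  assumes "fls_subdegree (ratfun_inf.lift r) \<ge> 0"
  shows "r \<in> infty_bounded 0"
proof (cases r)
  case (Fract a b)
  show ?thesis
  proof (cases "a = 0")
    case False
    hence "fls_subdegree (ratfun_inf.lift r) = int (degree b) - int (degree a)"
      using Fract by (simp add: fls_divide_subdegree poly_inf_fls_subdegree ratfun_inf.nonzero)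
    thus ?thesis using assms Fract by (auto intro!: infty_boundedI)
  qed (use Fract in \<open>auto intro!: infty_boundedI\<close>)
qed

lemma not_root_of_unity_inverse: "\<not> root_of_unity q \<Longrightarrow> \<not> root_of_unity (1 / q)"
  by (auto simp: root_of_unity_def power_one_over)

lemma mult_independent_inverse: "mult_independent p q \<Longrightarrow> mult_independent (1 / p) (1 / q)"
  unfolding mult_independent_def by (metis divide_inverse inverse_eq_iff_eq mult_1 power_int_inverse)

subsection \<open>Lattices\<close>

definition is_subring :: "'a :: comm_ring_1 set \<Rightarrow> bool" where
  "is_subring R \<longleftrightarrow> 0 \<in> R \<and> 1 \<in> R \<and> (\<forall>r\<in>R. \<forall>s\<in>R. r + s \<in> R \<and> r * s \<in> R)"

lemma is_subring_sum: "is_subring R \<Longrightarrow> (\<And>i. i \<in> A \<Longrightarrow> f i \<in> R) \<Longrightarrow> (\<Sum>i\<in>A. f i) \<in> R"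
  by (induction A rule: infinite_finite_induct) (auto simp: is_subring_def)

lemma is_subring_reg_at: "is_subring (reg_at y)"
  by (auto simp: is_subring_def reg_at_add reg_at_mult)

lemma is_subring_infty: "is_subring (infty_bounded 0)"
  using infty_bounded_mult[of _ 0 _ 0] by (auto simp: is_subring_def infty_bounded_add)

lemma is_subring_UNIV: "is_subring UNIV"
  by (auto simp: is_subring_def)

context qdiff
begin

text \<open>The generators may be dependent. This permits the same finite set \<open>G\<close> over
  every local ring, and \<open>R = UNIV\<close> recovers the linear span.\<close>

definition lattice_span :: "complex poly fract set \<Rightarrow> 'v set \<Rightarrow> 'v set" where
  "lattice_span R G = {v. \<exists>r. (\<forall>g\<in>G. r g \<in> R) \<and> v = (\<Sum>g\<in>G. scl (r g) g)}"

lemma lattice_spanI: "(\<And>g. g \<in> G \<Longrightarrow> r g \<in> R) \<Longrightarrow> (\<Sum>g\<in>G. scl (r g) g) \<in> lattice_span R G"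
  by (auto simp: lattice_span_def)

lemma lattice_spanE:
  assumes "v \<in> lattice_span R G"
  obtains r where "\<And>g. g \<in> G \<Longrightarrow> r g \<in> R" "v = (\<Sum>g\<in>G. scl (r g) g)"
  using assms by (auto simp: lattice_span_def)

lemma lattice_span_0: "is_subring R \<Longrightarrow> 0 \<in> lattice_span R G"
  using lattice_spanI[of G "\<lambda>_. 0" R] by (auto simp: is_subring_def)

lemma lattice_span_add:
  assumes "is_subring R" "u \<in> lattice_span R G" "v \<in> lattice_span R G"
  shows "u + v \<in> lattice_span R G"
proof -
  from assms(2,3) obtain r s where "\<forall>g\<in>G. r g \<in> R" "u = (\<Sum>g\<in>G. scl (r g) g)"
      "\<forall>g\<in>G. s g \<in> R" "v = (\<Sum>g\<in>G. scl (s g) g)" unfolding lattice_span_def by blast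
  thus ?thesis using lattice_spanI[of G "\<lambda>g. r g + s g" R] assms(1)
    by (auto simp: is_subring_def scale_left_distrib sum.distrib)
qed

lemma lattice_span_scale:
  assumes "is_subring R" "c \<in> R" "v \<in> lattice_span R G"
  shows "scl c v \<in> lattice_span R G"
proof -
  from assms(3) obtain r where "\<forall>g\<in>G. r g \<in> R" "v = (\<Sum>g\<in>G. scl (r g) g)"
    unfolding lattice_span_def by blast
  thus ?thesis using lattice_spanI[of G "\<lambda>g. c * r g" R] assms(1,2)
    by (auto simp: is_subring_def scale_sum_right)
qed

lemma lattice_span_sum:
  "is_subring R \<Longrightarrow> (\<And>i. i \<in> A \<Longrightarrow> f i \<in> lattice_span R G) \<Longrightarrow> (\<Sum>i\<in>A. f i) \<in> lattice_span R G"
  by (induction A rule: infinite_finite_induct) (auto simp: lattice_span_0 lattice_span_add)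

lemma lattice_span_base:
  assumes "is_subring R" "finite G" "g \<in> G"
  shows "g \<in> lattice_span R G"
proof -
  have "(\<Sum>h\<in>G. scl (if h = g then 1 else 0) h) = g"
    using assms by (simp add: if_distrib[where f = "\<lambda>c. scl c _"] cong: if_cong)
  thus ?thesis using lattice_spanI[of G "\<lambda>h. if h = g then 1 else 0" R] assms(1)
    by (auto simp: is_subring_def)
qed

lemma lattice_span_trans:
  assumes "is_subring R" "\<And>h. h \<in> H \<Longrightarrow> h \<in> lattice_span R G" "v \<in> lattice_span R H"
  shows "v \<in> lattice_span R G"
proof -
  from assms(3) obtain r where r: "\<And>g. g \<in> H \<Longrightarrow> r g \<in> R" "v = (\<Sum>g\<in>H. scl (r g) g)"
    by (rule lattice_spanE) blast
  show ?thesis unfolding r(2)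
    by (intro lattice_span_sum lattice_span_scale assms r)
qed

lemma lattice_span_subset_span: "finite G \<Longrightarrow> lattice_span R G \<subseteq> span G"
  by (auto simp: lattice_span_def intro!: span_sum intro: span_scale span_base)

lemma span_eq_lattice_span: "finite G \<Longrightarrow> span G = lattice_span UNIV G"
  by (auto simp: lattice_span_def span_finite)

end

section \<open>Pole orders and common denominators of finitely many rational functions\<close>

lemma pole_order_bound:
  fixes A :: "complex poly fract set"
  assumes "finite A"
  obtains N where "\<And>r. r \<in> A \<Longrightarrow> pfrac ([:-y, 1:] ^ N) * r \<in> reg_at y"
proof -
  have "\<exists>N. \<forall>r\<in>A. pfrac ([:-y, 1:] ^ N) * r \<in> reg_at y"
    using assms
  proof (induction A)
    case (insert r A)
    then obtain N where N: "\<forall>r\<in>A. pfrac ([:-y, 1:] ^ N) * r \<in> reg_at y" by auto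
    obtain a b where r: "r = Fract a b" "b \<noteq> 0" by (cases r)
    then obtain c where c: "b = [:-y, 1:] ^ order y b * c" "\<not> [:-y, 1:] dvd c"
      using order_decomp by blast
    define M where "M = order y b"
    have cy: "poly c y \<noteq> 0" using c(2) by (simp add: poly_eq_0_iff_dvd)
    hence c0: "c \<noteq> 0" by auto
    have M: "pfrac ([:-y, 1:] ^ M) * r = Fract a c"
      using c(1) r c0 by (simp add: M_def eq_fract mult_ac)
    have *: "pfrac ([:-y, 1:] ^ (N + M)) * s = pfrac ([:-y, 1:] ^ M) * (pfrac ([:-y, 1:] ^ N) * s)"
            "pfrac ([:-y, 1:] ^ (N + M)) * s = pfrac ([:-y, 1:] ^ N) * (pfrac ([:-y, 1:] ^ M) * s)" for s
      by (simp_all only: power_add pfrac_const_simps mult_ac)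
    show ?case
    proof (rule exI[of _ "N + M"], intro ballI)
      fix s assume "s \<in> insert r A"
      thus "pfrac ([:-y, 1:] ^ (N + M)) * s \<in> reg_at y"
      proof
        assume "s = r"
        thus ?thesis unfolding *(2) using cy by (simp add: M reg_at_mult reg_atI del: mult_fract)
      next
        assume "s \<in> A"
        thus ?thesis unfolding *(1) using N by (simp add: reg_at_mult del: mult_fract)
      qed
    qed
  qed auto
  thus thesis using that by blast
qed

lemma common_denominator:
  assumes "finite A"
  obtains D where "D \<noteq> 0" "\<And>r. r \<in> A \<Longrightarrow> \<exists>p. pfrac D * r = pfrac p"
proof -
  have "\<exists>D. D \<noteq> 0 \<and> (\<forall>r\<in>A. \<exists>p. pfrac D * r = pfrac p)"
    using assms
  proof (induction A)
    case empty
    show ?case by (rule exI[of _ 1]) auto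
  next
    case (insert r A)
    then obtain D where D: "D \<noteq> 0" "\<forall>r\<in>A. \<exists>p. pfrac D * r = pfrac p" by auto
    obtain a b where r: "r = Fract a b" "b \<noteq> 0" by (cases r)
    show ?case
    proof (rule exI[of _ "D * b"], intro conjI ballI)
      show "D * b \<noteq> 0" using D r by simp
      fix s assume "s \<in> insert r A"
      thus "\<exists>p. pfrac (D * b) * s = pfrac p"
      proof
        assume "s = r"
        thus ?thesis using r by (intro exI[of _ "D * a"]) (simp add: eq_fract)
      next
        assume "s \<in> A"
        then obtain p where "pfrac D * s = pfrac p" using D by blast
        hence "pfrac b * (pfrac D * s) = pfrac (b * p)" by simp
        thus ?thesis by (intro exI[of _ "b * p"]) (simp only: pfrac_const_simps mult_ac)
      qed
    qed
  qed
  thus thesis using that by blast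
qed

text \<open>\<open>mult_independent\<close> only speaks about pairs of nonzero exponents; the cases
  with one zero exponent are excluded because neither multiplier is a root of unity.\<close>

lemma mult_independent_powers:
  assumes "q1 \<noteq> 0" "q2 \<noteq> 0" "\<not> root_of_unity q1" "\<not> root_of_unity q2" "mult_independent q1 q2"
    and eq: "q1 powi a * q2 powi b = 1"
  shows "a = 0" "b = 0"
proof -
  have *: "q2 powi b = q1 powi (- a)"
    using eq assms(1) by (simp add: power_int_minus field_simps)
  have "a = 0 \<or> b = 0"
    using assms(5) * unfolding mult_independent_def by (metis neg_equal_0_iff_equal)
  thus "a = 0" "b = 0"
    using eq not_root_of_unity_powi[of q1 a] not_root_of_unity_powi[of q2 b] assms by auto
qed

section \<open>Generators of the space spanned by a solution and its shifts\<close>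

context qdiff
begin

text \<open>If the last coefficient of a relation of least order were 0, one \<open>T1\<close> could
  be cancelled by injectivity, after undoing the dilation of the coefficients. That
  \<open>b 0\<close> is nonzero is what later allows \<open>T1\<close> to be inverted on the
  span.\<close>

lemma minimal_relation:
  assumes "f \<noteq> 0" "(T1 ^^ m') f + (\<Sum>i<m'. scl (b' i) ((T1 ^^ i) f)) = 0"
  obtains m b where "m > 0" "(T1 ^^ m) f + (\<Sum>i<m. scl (b i) ((T1 ^^ i) f)) = 0" "b 0 \<noteq> 0"
    "\<And>c i. (\<Sum>i<m. scl (c i) ((T1 ^^ i) f)) = 0 \<Longrightarrow> i < m \<Longrightarrow> c i = 0"
proof -
  define rel where "rel m b \<longleftrightarrow> (T1 ^^ m) f + (\<Sum>i<m. scl (b i) ((T1 ^^ i) f)) = 0" for m b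
  define m where "m = (LEAST m. \<exists>b. rel m b)"
  have "\<exists>b. rel m b" unfolding m_def by (rule LeastI_ex) (use assms in \<open>auto simp: rel_def\<close>)
  then obtain b where b: "rel m b" by blast
  have least: "\<not> rel k c" if "k < m" for k c
    using not_less_Least[of k "\<lambda>m. \<exists>b. rel m b"] that unfolding m_def by blast
  have m: "m > 0" using b assms(1) by (cases m) (auto simp: rel_def)
  have ind: "c i = 0" if c: "(\<Sum>i<m. scl (c i) ((T1 ^^ i) f)) = 0" and "i < m" for c i
  proof (rule ccontr)
    assume "c i \<noteq> 0"
    define k where "k = Max {i. i < m \<and> c i \<noteq> 0}"
    have "k \<in> {i. i < m \<and> c i \<noteq> 0}" unfolding k_def by (rule Max_in) (use \<open>c i \<noteq> 0\<close> that in auto)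
    moreover have "j \<le> k" if "j < m" "c j \<noteq> 0" for j
      unfolding k_def by (rule Max_ge) (use that in auto)
    ultimately have k: "k < m" "c k \<noteq> 0" "\<And>j. j < m \<Longrightarrow> k < j \<Longrightarrow> c j = 0"
      by (auto simp: not_le[symmetric])
    have "(\<Sum>i<m. scl (c i) ((T1 ^^ i) f)) = (\<Sum>i\<le>k. scl (c i) ((T1 ^^ i) f))"
      by (rule sum.mono_neutral_right) (use k in auto)
    hence "0 = scl (1 / c k) (scl (c k) ((T1 ^^ k) f) + (\<Sum>i<k. scl (c i) ((T1 ^^ i) f)))"
      using c by (simp add: add.commute flip: lessThan_Suc_atMost)
    also have "\<dots> = (T1 ^^ k) f + (\<Sum>i<k. scl (c i / c k) ((T1 ^^ i) f))"
      using k by (simp add: scale_right_distrib scale_sum_right)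
    finally have "rel k (\<lambda>i. c i / c k)" by (simp add: rel_def)
    thus False using least k by blast
  qed
  have "b 0 \<noteq> 0"
  proof
    assume b0: "b 0 = 0"
    obtain n where n: "m = Suc n" using m by (cases m) auto
    have "T1 ((T1 ^^ n) f + (\<Sum>i<n. scl (dil (1 / q1) (b (Suc i))) ((T1 ^^ i) f))) =
       (T1 ^^ m) f + (\<Sum>i<n. scl (b (Suc i)) ((T1 ^^ Suc i) f))"
      using q1 by (simp add: T1_add T1_sum T1_scl dil_inv n)
    also have "(\<Sum>i<n. scl (b (Suc i)) ((T1 ^^ Suc i) f)) = (\<Sum>i<m. scl (b i) ((T1 ^^ i) f))"
      unfolding n by (subst sum.lessThan_Suc_shift) (simp add: b0)
    also have "(T1 ^^ m) f + \<dots> = 0" using b by (simp add: rel_def)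
    finally have "rel n (\<lambda>i. dil (1 / q1) (b (Suc i)))"
      unfolding rel_def by (rule T1_inj)
    thus False using least n by blast
  qed
  thus thesis using that m b ind unfolding rel_def by blast
qed

lemma lattice_T1:
  assumes R: "is_subring R" and G: "\<And>g. g \<in> G \<Longrightarrow> T1 g \<in> lattice_span R G"
    and RR: "\<And>r. r \<in> R' \<Longrightarrow> dil q1 r \<in> R" and v: "v \<in> lattice_span R' G"
  shows "T1 v \<in> lattice_span R G"
proof -
  from v obtain r where r: "\<And>g. g \<in> G \<Longrightarrow> r g \<in> R'" "v = (\<Sum>g\<in>G. scl (r g) g)" by (rule lattice_spanE) blast
  have "T1 v = (\<Sum>g\<in>G. scl (dil q1 (r g)) (T1 g))" by (simp add: r T1_sum T1_scl)
  also have "\<dots> \<in> lattice_span R G" by (intro lattice_span_sum lattice_span_scale R G RR r)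
  finally show ?thesis .
qed

text \<open>Once the generators are recovered over \<open>R\<close> from their images,
  \<open>T1 v\<close> can be expanded in those images, and injectivity pulls the coefficients back
  through the inverse dilation.\<close>

lemma lattice_T1_conv:
  assumes R: "is_subring R" and G: "finite G" "\<And>g. g \<in> G \<Longrightarrow> g \<in> lattice_span R (T1 ` G)"
    and RR: "\<And>r. r \<in> R \<Longrightarrow> dil (1 / q1) r \<in> R'" and v: "T1 v \<in> lattice_span R G"
  shows "v \<in> lattice_span R' G"
proof -
  have "T1 v \<in> lattice_span R (T1 ` G)" using lattice_span_trans[OF R G(2) v] .
  then obtain r where r: "\<And>g. g \<in> T1 ` G \<Longrightarrow> r g \<in> R" "T1 v = (\<Sum>g\<in>T1 ` G. scl (r g) g)"
    by (rule lattice_spanE) blast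
  have inj: "inj_on T1 G" by (auto simp: inj_on_def T1_cancel)
  have "T1 v = T1 (\<Sum>g\<in>G. scl (dil (1 / q1) (r (T1 g))) g)"
    using r(2) q1 by (simp add: sum.reindex[OF inj] T1_sum T1_scl dil_inv)
  hence "v = (\<Sum>g\<in>G. scl (dil (1 / q1) (r (T1 g))) g)" by (simp add: T1_cancel)
  thus ?thesis using lattice_spanI[of G "\<lambda>g. dil (1 / q1) (r (T1 g))" R'] r(1) RR by auto
qed

text \<open>With the orders of the two relations as bounds, these vectors span the smallest space
  over the rational functions that contains \<open>f\<close> and is stable under both
  operators.\<close>

definition orbit_box :: "'v \<Rightarrow> nat \<Rightarrow> nat \<Rightarrow> 'v set" where
  "orbit_box f m1 m2 = (\<lambda>(i, j). (T1 ^^ i) ((T2 ^^ j) f)) ` ({..<m1} \<times> {..<m2})"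

lemma finite_orbit_box [simp]: "finite (orbit_box f m1 m2)"
  by (simp add: orbit_box_def)

lemma T2_pow_relation:
  assumes "(T1 ^^ m) f + (\<Sum>i<m. scl (b i) ((T1 ^^ i) f)) = 0"
  shows "(T1 ^^ m) ((T2 ^^ j) f) + (\<Sum>i<m. scl (dil (q2 ^ j) (b i)) ((T1 ^^ i) ((T2 ^^ j) f))) = 0"
proof -
  have "(T2 ^^ j) ((T1 ^^ m) f + (\<Sum>i<m. scl (b i) ((T1 ^^ i) f))) = 0"
    by (simp add: assms qdiff.T1_pow_0[OF swap])
  thus ?thesis
    by (simp add: qdiff.T1_pow_add[OF swap] qdiff.T1_pow_sum[OF swap] qdiff.T1_pow_scl[OF swap] T1_pow_T2_pow)
qed

text \<open>Only the vectors with \<open>i = m1 - 1\<close> leave the box. The relation, transported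
  by \<open>T2 ^^ j\<close>, brings them back, and transport dilates its coefficients by
  \<open>q2 ^ j\<close>.\<close>

lemma orbit_box_T1:
  assumes rel: "(T1 ^^ m1) f + (\<Sum>i<m1. scl (b i) ((T1 ^^ i) f)) = 0"
    and R: "is_subring R" and bR: "\<And>i j. i < m1 \<Longrightarrow> j < m2 \<Longrightarrow> - dil (q2 ^ j) (b i) \<in> R"
    and g: "g \<in> orbit_box f m1 m2"
  shows "T1 g \<in> lattice_span R (orbit_box f m1 m2)"
proof -
  from g obtain i j where ij: "i < m1" "j < m2" "g = (T1 ^^ i) ((T2 ^^ j) f)" by (auto simp: orbit_box_def)
  show ?thesis
  proof (cases "Suc i < m1")
    case True
    hence "T1 g \<in> orbit_box f m1 m2"
      using ij by (auto simp: orbit_box_def intro!: image_eqI[of _ _ "(Suc i, j)"])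
    thus ?thesis using R by (simp add: lattice_span_base)
  next
    case False
    hence "Suc i = m1" using ij by simp
    hence "T1 g = (T1 ^^ m1) ((T2 ^^ j) f)" using ij(3) by (metis funpow.simps(2) o_apply)
    also have "\<dots> = (\<Sum>i<m1. scl (- dil (q2 ^ j) (b i)) ((T1 ^^ i) ((T2 ^^ j) f)))"
      using T2_pow_relation[OF rel, of j] by (simp add: eq_neg_iff_add_eq_0 sum_negf)
    also have "\<dots> \<in> lattice_span R (orbit_box f m1 m2)"
      by (intro lattice_span_sum lattice_span_scale R bR lattice_span_base)
         (use ij in \<open>auto simp: orbit_box_def\<close>)
    finally show ?thesis .
  qed
qed

text \<open>Only the vectors with \<open>i = 0\<close> are not images of box vectors. The relation
  is solved for its lowest term by dividing by \<open>b 0\<close>; the update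
  \<open>b(m1 := 1)\<close> includes the leading coefficient among the quotients.\<close>

lemma orbit_box_T1_conv:
  assumes rel: "(T1 ^^ m1) f + (\<Sum>i<m1. scl (b i) ((T1 ^^ i) f)) = 0" and b0: "b 0 \<noteq> 0"
    and R: "is_subring R" and bR: "\<And>i j. i \<le> m1 \<Longrightarrow> j < m2 \<Longrightarrow> - dil (q2 ^ j) ((b(m1 := 1)) i / b 0) \<in> R"
    and g: "g \<in> orbit_box f m1 m2"
  shows "g \<in> lattice_span R (T1 ` orbit_box f m1 m2)"
proof -
  from g obtain i j where ij: "i < m1" "j < m2" "g = (T1 ^^ i) ((T2 ^^ j) f)" by (auto simp: orbit_box_def)
  show ?thesis
  proof (cases i)
    case (Suc i')
    hence "g \<in> T1 ` orbit_box f m1 m2"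
      using ij by (auto simp: orbit_box_def image_iff intro!: exI[of _ i'] exI[of _ j])
    thus ?thesis using R by (simp add: lattice_span_base)
  next
    case 0
    define c where "c = b(m1 := 1)"
    define h where "h k = (T1 ^^ k) ((T2 ^^ j) f)" for k
    have c0: "c 0 = b 0" using ij by (auto simp: c_def)
    have qj: "q2 ^ j \<noteq> 0" using q2 by simp
    have "h m1 + (\<Sum>i<m1. scl (dil (q2 ^ j) (c i)) (h i)) = 0"
      using T2_pow_relation[OF rel, of j] by (simp add: h_def c_def)
    hence "(\<Sum>i\<le>m1. scl (dil (q2 ^ j) (c i)) (h i)) = 0"
      using qj by (simp add: c_def dil_1 add.commute flip: lessThan_Suc_atMost)
    hence "scl (1 / dil (q2 ^ j) (b 0)) (\<Sum>i\<le>m1. scl (dil (q2 ^ j) (c i)) (h i)) = 0" by simp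
    hence "(\<Sum>i\<le>m1. scl (dil (q2 ^ j) (c i / b 0)) (h i)) = 0"
      using qj by (simp add: scale_sum_right dil_divide)
    hence "h 0 + (\<Sum>i<m1. scl (dil (q2 ^ j) (c (Suc i) / b 0)) (h (Suc i))) = 0"
      using qj b0 by (simp add: sum.atMost_shift c0 dil_1)
    hence "g = (\<Sum>i<m1. scl (- dil (q2 ^ j) (c (Suc i) / b 0)) (h (Suc i)))"
      using ij 0 by (simp add: h_def eq_neg_iff_add_eq_0 sum_negf)
    also have "\<dots> \<in> lattice_span R (T1 ` orbit_box f m1 m2)"
      by (intro lattice_span_sum lattice_span_scale R lattice_span_base finite_imageI finite_orbit_box)
         (use ij bR[folded c_def] in \<open>auto simp: orbit_box_def h_def\<close>)
    finally show ?thesis .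
  qed
qed

lemma orbit_box_swap: "qdiff.orbit_box T2 T1 f m2 m1 = orbit_box f m1 m2"
  unfolding orbit_box_def qdiff.orbit_box_def[OF swap]
  by (auto simp: T1_pow_T2_pow image_iff)

text \<open>The exceptional points are the poles of the finitely many coefficients that occur when
  the generators are moved forward by \<open>T1\<close> or recovered from their images.\<close>

lemma good_points:
  assumes rel: "(T1 ^^ m1) f + (\<Sum>i<m1. scl (b i) ((T1 ^^ i) f)) = 0" and b0: "b 0 \<noteq> 0"
  obtains S where "finite S"
    "\<And>y v. y \<notin> S \<Longrightarrow> T1 v \<in> lattice_span (reg_at y) (orbit_box f m1 m2) \<longleftrightarrow>
       v \<in> lattice_span (reg_at (q1 * y)) (orbit_box f m1 m2)"
proof -
  define E where "E = (\<lambda>(i, j). - dil (q2 ^ j) (b i)) ` ({..<m1} \<times> {..<m2}) \<union>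
     (\<lambda>(i, j). - dil (q2 ^ j) ((b(m1 := 1)) i / b 0)) ` ({..m1} \<times> {..<m2})"
  define S where "S = (\<Union>r\<in>E. {y. r \<notin> reg_at y})"
  show thesis
  proof (rule that[of S])
    show "finite S" by (auto simp: S_def E_def intro!: finite_UN_I finite_not_reg_at)
    fix y v assume "y \<notin> S"
    hence E: "r \<in> reg_at y" if "r \<in> E" for r using that by (auto simp: S_def)
    have E1: "- dil (q2 ^ j) (b i) \<in> reg_at y" if "i < m1" "j < m2" for i j
      by (rule E) (use that in \<open>auto simp: E_def\<close>)
    have E2: "- dil (q2 ^ j) ((b(m1 := 1)) i / b 0) \<in> reg_at y" if "i \<le> m1" "j < m2" for i j
      by (rule E, unfold E_def, rule UnI2, rule image_eqI[of _ _ "(i, j)"]) (use that in auto)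
    show "T1 v \<in> lattice_span (reg_at y) (orbit_box f m1 m2) \<longleftrightarrow>
       v \<in> lattice_span (reg_at (q1 * y)) (orbit_box f m1 m2)"
    proof
      assume "T1 v \<in> lattice_span (reg_at y) (orbit_box f m1 m2)"
      thus "v \<in> lattice_span (reg_at (q1 * y)) (orbit_box f m1 m2)"
        by (rule lattice_T1_conv[rotated -1])
           (use q1 in \<open>auto intro!: is_subring_reg_at orbit_box_T1_conv[OF rel b0] E2 simp: dil_reg_at_iff\<close>)
    next
      assume "v \<in> lattice_span (reg_at (q1 * y)) (orbit_box f m1 m2)"
      thus "T1 v \<in> lattice_span (reg_at y) (orbit_box f m1 m2)"
        by (rule lattice_T1[rotated -1])
           (use q1 in \<open>auto intro!: is_subring_reg_at orbit_box_T1[OF rel] E1 simp: dil_reg_at_iff\<close>)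
    qed
  qed
qed

end

lemma pfrac_sum: "pfrac (\<Sum>i\<in>A. f i) = (\<Sum>i\<in>A. pfrac (f i))"
  by (induction A rule: infinite_finite_induct) (simp_all only: sum.infinite sum.empty sum.insert pfrac_const_simps simp_thms)

lemma pfrac_const_sum: "pfrac [:\<Sum>i\<in>A. f i:] = (\<Sum>i\<in>A. pfrac [:f i:])"
proof -
  have "[:\<Sum>i\<in>A. f i:] = (\<Sum>i\<in>A. [:f i:])"
    by (rule poly_eqI) (simp add: coeff_sum coeff_pCons split: nat.splits)
  thus ?thesis by (simp only: pfrac_sum)
qed

lemma reg_at_uminus: "r \<in> reg_at y \<Longrightarrow> - r \<in> reg_at y"
proof -
  assume "r \<in> reg_at y"
  hence "pfrac (-1) * r \<in> reg_at y" by (intro reg_at_mult reg_at_pfrac)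
  moreover have "pfrac (-1) = -1" by (simp add: One_fract_def)
  ultimately show ?thesis by (metis mult_minus1)
qed

lemma infty_bounded_uminus: "r \<in> infty_bounded d \<Longrightarrow> - r \<in> infty_bounded d"
proof -
  assume "r \<in> infty_bounded d"
  then obtain a b where "b \<noteq> 0" "degree a \<le> degree b + d" "r = Fract a b" by (auto simp: infty_bounded_def)
  thus ?thesis by (auto intro!: infty_boundedI)
qed

lemma finite_at_most_one: "(\<And>x y. x \<in> A \<Longrightarrow> y \<in> A \<Longrightarrow> x = y) \<Longrightarrow> finite A"
  by (metis finite.emptyI finite.insertI finite_subset insertCI subsetI)

lemma finite_orbit_meets:
  assumes "q \<noteq> 0" "\<not> root_of_unity q" "y \<noteq> 0" "finite S"
  shows "\<exists>K. \<forall>k\<ge>K. y / q ^ k \<notin> S"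
proof -
  have "inj (\<lambda>k::nat. y / q ^ k)"
  proof (rule injI)
    fix i j assume "y / q ^ i = y / q ^ j"
    hence "q powi int i = q powi int j" using assms by (simp add: field_simps)
    thus "i = j" using not_root_of_unity_powi_inj[OF assms(2,1), of "int i" "int j"] by simp
  qed
  hence "finite {k. y / q ^ k \<in> S}"
    using finite_vimageI[OF assms(4)] by (simp add: vimage_def)
  then obtain K where "\<forall>k\<in>{k. y / q ^ k \<in> S}. k < K" using finite_nat_set_iff_bounded by blast
  thus ?thesis by (intro exI[of _ K]) force
qed

section \<open>Passage to constant coefficients\<close>

context qdiff
begin

lemma T1_pow_cancel: "(T1 ^^ k) u = (T1 ^^ k) v \<longleftrightarrow> u = v"
  by (induction k) (auto simp: T1_cancel)

theorem constant_coefficient_multiple: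
  assumes rel1: "(T1 ^^ n1) f + (\<Sum>i<n1. scl (b1 i) ((T1 ^^ i) f)) = 0"
    and rel2: "(T2 ^^ n2) f + (\<Sum>i<n2. scl (b2 i) ((T2 ^^ i) f)) = 0"
  obtains D P1 P2 where "D \<noteq> 0" "P1 \<noteq> 0" "P2 \<noteq> 0"
    "(\<Sum>i\<le>degree P1. scl (pfrac [:coeff P1 i:]) ((T1 ^^ i) (scl (pfrac D) f))) = 0"
    "(\<Sum>i\<le>degree P2. scl (pfrac [:coeff P2 i:]) ((T2 ^^ i) (scl (pfrac D) f))) = 0"
proof (cases "f = 0")
  case True
  show thesis by (rule that[of 1 1 1]) (auto simp: True T1_pow_0 qdiff.T1_pow_0[OF swap])
next
  case False
  obtain m1 b where b: "m1 > 0" "(T1 ^^ m1) f + (\<Sum>i<m1. scl (b i) ((T1 ^^ i) f)) = 0" "b 0 \<noteq> 0"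
      "\<And>c i. (\<Sum>i<m1. scl (c i) ((T1 ^^ i) f)) = 0 \<Longrightarrow> i < m1 \<Longrightarrow> c i = 0"
    by (rule minimal_relation[OF False rel1]) (rule that)
  obtain m2 c where c: "m2 > 0" "(T2 ^^ m2) f + (\<Sum>i<m2. scl (c i) ((T2 ^^ i) f)) = 0" "c 0 \<noteq> 0"
      "\<And>d i. (\<Sum>i<m2. scl (d i) ((T2 ^^ i) f)) = 0 \<Longrightarrow> i < m2 \<Longrightarrow> d i = 0"
    by (rule qdiff.minimal_relation[OF swap False rel2]) (rule that)
  define G where "G = orbit_box f m1 m2"
  have finG [simp]: "finite G" by (simp add: G_def)
  have G_swap: "qdiff.orbit_box T2 T1 f m2 m1 = G" by (simp add: G_def orbit_box_swap)
  have fG: "f \<in> G" using b(1) c(1) by (force simp: G_def orbit_box_def)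
  define L where "L y = lattice_span (reg_at y) G" for y
  have spanG: "span G = lattice_span UNIV G" by (rule span_eq_lattice_span) simp
  have T1G_span: "T1 g \<in> span G" if "g \<in> G" for g
    using orbit_box_T1[OF b(2) is_subring_UNIV, of m2 g] that by (simp add: spanG flip: G_def)
  have T2G_span: "T2 g \<in> span G" if "g \<in> G" for g
    using qdiff.orbit_box_T1[OF swap c(2) is_subring_UNIV, of m1 g] that
    by (simp add: G_swap spanG)
  have T1_span: "T1 v \<in> span G" if "v \<in> span G" for v
    using lattice_T1[OF is_subring_UNIV, of G UNIV v] T1G_span that by (simp add: spanG)
  have T1_pow_span: "(T1 ^^ k) v \<in> span G" if "v \<in> span G" for k v
    using that by (induction k) (auto simp: T1_span)
  have T1_surj: "\<exists>u\<in>span G. T1 u = v" if "v \<in> span G" for v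
  proof -
    have "v \<in> lattice_span UNIV (T1 ` G)"
      using lattice_span_trans[OF is_subring_UNIV _ that[unfolded spanG], of "T1 ` G"]
        orbit_box_T1_conv[OF b(2,3) is_subring_UNIV, of m2] by (simp flip: G_def)
    then obtain r where r: "v = (\<Sum>g\<in>T1 ` G. scl (r g) g)" by (rule lattice_spanE)
    have inj: "inj_on T1 G" by (auto simp: inj_on_def T1_cancel)
    have "v = T1 (\<Sum>g\<in>G. scl (dil (1 / q1) (r (T1 g))) g)"
      using r q1 by (simp add: sum.reindex[OF inj] T1_sum T1_scl dil_inv)
    thus ?thesis by (blast intro: span_sum span_scale span_base)
  qed
  have T1_pow_surj: "\<exists>u\<in>span G. (T1 ^^ k) u = v" if "v \<in> span G" for k v
    using that
  proof (induction k arbitrary: v)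
    case (Suc k)
    then obtain w where "w \<in> span G" "T1 w = v" using T1_surj by blast
    thus ?case using Suc.IH[of w] by auto
  qed auto

  \<comment> \<open>No slopes: the equations are regular singular at 0 and infinity.\<close>
  have fG': "f \<in> span G" using fG span_base by blast
  have slope0: "b i \<in> reg_at 0" "b i \<in> infty_bounded 0" if "i < m1" for i
  proof -
    show "b i \<in> reg_at 0"
      by (rule ratfun_fls_reg_at, rule slope_nonneg[where \<phi> = ratfun_fls and m = m1 and b = b and f = f and G = G and i = i and ?p1.0 = "q1" and ?p2.0 = "q2",
           OF _ _ _ _ _ _ _ _ _ _ b(2) _ finG fG' T1G_span T2G_span that])
         (erule (1) b(4) | simp add: ratfun_fls_dil q1 q2 indep)+
    show "b i \<in> infty_bounded 0"
      by (rule ratfun_inf_bounded, rule slope_nonneg[where \<phi> = ratfun_inf.lift and m = m1 and b = b and f = f and G = G and i = i and ?p1.0 = "1 / q1" and ?p2.0 = "1 / q2",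
           OF _ _ _ _ _ _ _ _ _ _ b(2) _ finG fG' T1G_span T2G_span that])
         (erule (1) b(4) | simp add: ratfun_inf_dil q1 q2 indep not_root_of_unity_inverse mult_independent_inverse)+
  qed
  have slope0': "c i \<in> reg_at 0" "c i \<in> infty_bounded 0" if "i < m2" for i
  proof -
    note indep' = mult_independent_commute[OF indep]
    note slope = qdiff.slope_nonneg[OF swap]
    show "c i \<in> reg_at 0"
      by (rule ratfun_fls_reg_at, rule slope[where \<phi> = ratfun_fls and m = m2 and b = c and f = f and G = G and i = i and ?p1.0 = "q2" and ?p2.0 = "q1",
           OF _ _ _ _ _ _ _ _ _ _ c(2) _ finG fG' T2G_span T1G_span that])
         (erule (1) c(4) | simp add: ratfun_fls_dil q1 q2 indep')+
    show "c i \<in> infty_bounded 0"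
      by (rule ratfun_inf_bounded, rule slope[where \<phi> = ratfun_inf.lift and m = m2 and b = c and f = f and G = G and i = i and ?p1.0 = "1 / q2" and ?p2.0 = "1 / q1",
           OF _ _ _ _ _ _ _ _ _ _ c(2) _ finG fG' T2G_span T1G_span that])
         (erule (1) c(4) | simp add: ratfun_inf_dil q1 q2 indep' not_root_of_unity_inverse mult_independent_inverse)+
  qed
  have T1_L0: "T1 v \<in> L 0" if "v \<in> L 0" for v
    using that unfolding L_def G_def
    by (rule lattice_T1[OF is_subring_reg_at, rotated -1])
       (use q1 q2 slope0 in \<open>auto simp: dil_reg_at_iff intro!: orbit_box_T1[OF b(2) is_subring_reg_at] reg_at_uminus\<close>)
  have T2_L0: "T2 v \<in> L 0" if "v \<in> L 0" for v
    using that unfolding L_def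
    by (rule qdiff.lattice_T1[OF swap is_subring_reg_at, rotated -1])
       (use q1 q2 slope0' in \<open>auto simp: dil_reg_at_iff G_swap
           intro!: qdiff.orbit_box_T1[OF swap c(2) is_subring_reg_at, of m1, unfolded G_swap] reg_at_uminus\<close>)
  define Linf where "Linf = lattice_span (infty_bounded 0) G"
  have T1_Linf: "T1 v \<in> Linf" if "v \<in> Linf" for v
    using that unfolding Linf_def G_def
    by (rule lattice_T1[OF is_subring_infty, rotated -1])
       (use q1 q2 slope0 in \<open>auto simp: dil_infty_bounded intro!: orbit_box_T1[OF b(2) is_subring_infty] infty_bounded_uminus\<close>)
  have T2_Linf: "T2 v \<in> Linf" if "v \<in> Linf" for v
    using that unfolding Linf_def
    by (rule qdiff.lattice_T1[OF swap is_subring_infty, rotated -1])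
       (use q1 q2 slope0' in \<open>auto simp: dil_infty_bounded G_swap
           intro!: qdiff.orbit_box_T1[OF swap c(2) is_subring_infty, of m1, unfolded G_swap] infty_bounded_uminus\<close>)

  \<comment> \<open>Transport of the local lattices to far away points of the orbit.\<close>
  obtain S1 where S1: "finite S1" "\<And>y v. y \<notin> S1 \<Longrightarrow> T1 v \<in> L y \<longleftrightarrow> v \<in> L (q1 * y)"
    using good_points[OF b(2,3), of m2] unfolding L_def G_def by metis
  obtain S2 where S2: "finite S2" "\<And>y v. y \<notin> S2 \<Longrightarrow> T2 v \<in> L y \<longleftrightarrow> v \<in> L (q2 * y)"
    using qdiff.good_points[OF swap c(2,3), of m1] unfolding L_def G_swap by metis
  define M where "M y = {v. \<exists>k0. \<forall>k\<ge>k0. (T1 ^^ k) v \<in> L (y / q1 ^ k)}" for y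
  \<comment> \<open>Beyond the last point of \<open>S1\<close> on the orbit each step is an
    equivalence, so a single index \<open>K\<close> decides membership in
    \<open>M y\<close>.\<close>
  have M_stab: "v \<in> M y \<longleftrightarrow> (T1 ^^ K) v \<in> L (y / q1 ^ K)"
    if K: "\<And>k. k \<ge> K \<Longrightarrow> y / q1 ^ Suc k \<notin> S1" for K y v
  proof -
    have *: "(T1 ^^ k) v \<in> L (y / q1 ^ k) \<longleftrightarrow> (T1 ^^ K) v \<in> L (y / q1 ^ K)" if "k \<ge> K" for k
      using that
    proof (induction k rule: dec_induct)
      case (step k)
      have "q1 * (y / q1 ^ Suc k) = y / q1 ^ k" using q1 by simp
      thus ?case using S1(2)[OF K[OF step(1)], of "(T1 ^^ k) v"] step by simp
    qed simp
    show ?thesis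
    proof
      assume "v \<in> M y"
      then obtain k0 where "\<forall>k\<ge>k0. (T1 ^^ k) v \<in> L (y / q1 ^ k)" by (auto simp: M_def)
      thus "(T1 ^^ K) v \<in> L (y / q1 ^ K)" using *[of "max k0 K"] by simp
    next
      assume "(T1 ^^ K) v \<in> L (y / q1 ^ K)"
      thus "v \<in> M y" unfolding M_def using * by blast
    qed
  qed
  have far1: "\<exists>K. \<forall>k\<ge>K. y / q1 ^ Suc k \<notin> S1" if "y \<noteq> 0" for y
  proof -
    obtain K where K: "\<forall>k\<ge>K. y / q1 ^ k \<notin> S1" using finite_orbit_meets[OF q1 \<open>y \<noteq> 0\<close> S1(1)] by blast
    thus ?thesis by (intro exI[of _ K]) (metis le_Suc_eq)
  qed
  have M_T1: "T1 v \<in> M y" if "v \<in> M (q1 * y)" for v y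
  proof -
    obtain k0 where k0: "\<forall>k\<ge>k0. (T1 ^^ k) v \<in> L (q1 * y / q1 ^ k)" using \<open>v \<in> M (q1 * y)\<close> by (auto simp: M_def)
    have "(T1 ^^ k) (T1 v) \<in> L (y / q1 ^ k)" if "k \<ge> k0" for k
      using k0[rule_format, of "Suc k"] that q1 by (simp add: funpow_swap1)
    thus ?thesis unfolding M_def by blast
  qed
  \<comment> \<open>Far out on the \<open>q1\<close>-orbit the operator \<open>T2\<close> respects
    the obvious lattices. Since it commutes with \<open>T1\<close>, it respects the transported ones
    at every nonzero point.\<close>
  have M_T2: "T2 v \<in> M y \<longleftrightarrow> v \<in> M (q2 * y)" if "y \<noteq> 0" for v y
  proof -
    obtain K where K: "\<forall>k\<ge>K. y / q1 ^ k \<notin> S2" using finite_orbit_meets[OF q1 \<open>y \<noteq> 0\<close> S2(1)] by blast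
    have *: "(T1 ^^ k) (T2 v) \<in> L (y / q1 ^ k) \<longleftrightarrow> (T1 ^^ k) v \<in> L (q2 * y / q1 ^ k)" if "k \<ge> K" for k
      using S2(2)[of "y / q1 ^ k" "(T1 ^^ k) v"] K that T1_pow_T2_pow[of k 1 v] by simp
    show ?thesis
    proof
      assume "T2 v \<in> M y"
      then obtain k0 where "\<forall>k\<ge>k0. (T1 ^^ k) (T2 v) \<in> L (y / q1 ^ k)" by (auto simp: M_def)
      thus "v \<in> M (q2 * y)" unfolding M_def using * by (intro CollectI exI[of _ "max k0 K"]) auto
    next
      assume "v \<in> M (q2 * y)"
      then obtain k0 where "\<forall>k\<ge>k0. (T1 ^^ k) v \<in> L (q2 * y / q1 ^ k)" by (auto simp: M_def)
      thus "T2 v \<in> M y" unfolding M_def using * by (intro CollectI exI[of _ "max k0 K"]) auto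
    qed
  qed
  have M_eq1: "M y = L y" if "\<And>k. y / q1 ^ Suc k \<notin> S1" for y
    using M_stab[of 0 y] that by auto
  \<comment> \<open>If the \<open>q2\<close>-orbit of \<open>y\<close> avoids \<open>S2\<close>,
    both families of lattices are transported along it by \<open>T2\<close> in the same way. By
    multiplicative independence each point of \<open>S1\<close> lies on the \<open>q1\<close>-orbit
    of \<open>y / q2 ^ j\<close> for at most one \<open>j\<close>. Hence for some \<open>j\<close>
    that orbit avoids \<open>S1\<close>, and the two lattices agree there.\<close>
  have M_eq2: "M y = L y" if y: "y \<noteq> 0" "\<And>j. y / q2 ^ Suc j \<notin> S2" for y
  proof -
    have M_j: "(T2 ^^ j) v \<in> M (y / q2 ^ j) \<longleftrightarrow> v \<in> M y" for j v
    proof (induction j)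
      case (Suc j)
      have "q2 * (y / q2 ^ Suc j) = y / q2 ^ j" "y / q2 ^ Suc j \<noteq> 0" using q2 y by auto
      thus ?case using M_T2[of "y / q2 ^ Suc j" "(T2 ^^ j) v"] Suc by simp
    qed simp
    have L_j: "(T2 ^^ j) v \<in> L (y / q2 ^ j) \<longleftrightarrow> v \<in> L y" for j v
    proof (induction j)
      case (Suc j)
      have "q2 * (y / q2 ^ Suc j) = y / q2 ^ j" using q2 by auto
      thus ?case using S2(2)[OF y(2)[of j], of "(T2 ^^ j) v"] Suc by simp
    qed simp
    have "finite (\<Union>s\<in>S1. {j. \<exists>k. y / q2 ^ j / q1 ^ k = s})"
    proof (intro finite_UN_I S1(1) finite_at_most_one)
      fix s j j' assume "j \<in> {j. \<exists>k. y / q2 ^ j / q1 ^ k = s}" "j' \<in> {j. \<exists>k. y / q2 ^ j / q1 ^ k = s}"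
      then obtain k k' where "y / q2 ^ j / q1 ^ k = s" "y / q2 ^ j' / q1 ^ k' = s" by blast
      hence "y / q2 ^ j / q1 ^ k = y / q2 ^ j' / q1 ^ k'" by (simp only:)
      hence "q1 powi (int k - int k') * q2 powi (int j - int j') = 1"
        using y q1 q2 by (simp add: power_int_diff field_simps)
      hence "int j - int j' = 0" by (rule mult_independent_powers(2)[OF q1(1) q2(1) q1(2) q2(2) indep])
      thus "j = j'" by simp
    qed
    then obtain J where "\<forall>j\<in>(\<Union>s\<in>S1. {j. \<exists>k. y / q2 ^ j / q1 ^ k = s}). j < J"
      using finite_nat_set_iff_bounded by blast
    hence "J \<notin> (\<Union>s\<in>S1. {j. \<exists>k. y / q2 ^ j / q1 ^ k = s})" by blast
    hence "M (y / q2 ^ J) = L (y / q2 ^ J)" by (intro M_eq1) blast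
    thus ?thesis using M_j[of J] L_j[of J] by blast
  qed
  \<comment> \<open>The two families can differ only where both orbits meet singular points. Given
    \<open>y / q1 ^ k = s\<close> and \<open>y / q2 ^ j = t\<close>, the point \<open>y\<close> is
    determined by \<open>s\<close> and \<open>t\<close>: the ratio of two candidates would be a
    power of \<open>q1\<close> and a power of \<open>q2\<close> at once.\<close>
  define X where "X = {y. y \<noteq> 0 \<and> (\<exists>k. y / q1 ^ Suc k \<in> S1) \<and> (\<exists>j. y / q2 ^ Suc j \<in> S2)}"
  have M_eq: "M y = L y" if "y \<noteq> 0" "y \<notin> X" for y
    using that M_eq1[of y] M_eq2[of y] unfolding X_def by blast
  have X0: "y \<noteq> 0" if "y \<in> X" for y using that by (auto simp: X_def)
  have "finite X"
  proof (rule finite_subset)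
    show "X \<subseteq> (\<Union>s\<in>S1. \<Union>t\<in>S2. {y. y \<noteq> 0 \<and> (\<exists>k j. y / q1 ^ k = s \<and> y / q2 ^ j = t)})"
      unfolding X_def by blast
    show "finite \<dots>"
    proof (intro finite_UN_I S1(1) S2(1) finite_at_most_one)
      fix s t y y'
      assume "y \<in> {y. y \<noteq> 0 \<and> (\<exists>k j. y / q1 ^ k = s \<and> y / q2 ^ j = t)}"
             "y' \<in> {y. y \<noteq> 0 \<and> (\<exists>k j. y / q1 ^ k = s \<and> y / q2 ^ j = t)}"
      then obtain k j k' j' where *: "y / q1 ^ k = s" "y' / q1 ^ k' = s" "y / q2 ^ j = t" "y' / q2 ^ j' = t"
          and nz: "y \<noteq> 0" "y' \<noteq> 0" by auto
      have "y / q1 ^ k = y' / q1 ^ k'" "y / q2 ^ j = y' / q2 ^ j'" using * by simp_all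
      hence eq: "y * q1 ^ k' = y' * q1 ^ k" "y' * q2 ^ j = y * q2 ^ j'" using q1 q2 by (simp_all add: field_simps)
      hence "(y * y') * (q1 ^ k' * q2 ^ j) = (y * y') * (q1 ^ k * q2 ^ j')"
        by (metis mult.assoc mult.left_commute)
      hence "q1 ^ k' * q2 ^ j = q1 ^ k * q2 ^ j'" using nz by simp
      hence "q1 powi (int k - int k') * q2 powi (int j' - int j) = 1"
        using q1 q2 by (simp add: power_int_diff field_simps)
      hence "int k - int k' = 0" by (rule mult_independent_powers(1)[OF q1(1) q2(1) q1(2) q2(2) indep])
      thus "y = y'" using eq(1) q1 by simp
    qed
  qed
  have M_pfrac: "scl (pfrac p) v \<in> M y" if "v \<in> M y" for p v y
  proof -
    obtain k0 where "\<forall>k\<ge>k0. (T1 ^^ k) v \<in> L (y / q1 ^ k)" using \<open>v \<in> M y\<close> by (auto simp: M_def)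
    hence "(T1 ^^ k) (scl (pfrac p) v) \<in> L (y / q1 ^ k)" if "k \<ge> k0" for k
      using that q1 unfolding T1_pow_scl L_def
      by (intro lattice_span_scale is_subring_reg_at) (auto simp: dil_pfrac)
    thus ?thesis unfolding M_def by blast
  qed
  have L_pfrac: "scl (pfrac p) v \<in> L y" if "v \<in> L y" for p v y
    using that unfolding L_def by (intro lattice_span_scale is_subring_reg_at reg_at_pfrac)
  have lin_pow: "dil (q1 ^ K) (pfrac ([:- y, 1:] ^ N)) = pfrac [:(q1 ^ K) ^ N:] * pfrac ([:- (y / q1 ^ K), 1:] ^ N)" for K N y
  proof -
    have "pcompose ([:- y, 1:] ^ N) [:0, q1 ^ K:] = [:- y, q1 ^ K:] ^ N"
    proof -
      have "pcompose (u ^ N) w = pcompose u w ^ N" for u w :: "complex poly"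
        by (induction N) (simp_all only: power_0 power_Suc pcompose_mult pcompose_1)
      thus ?thesis by (simp add: pcompose_pCons)
    qed
    also have "[:- y, q1 ^ K:] = [:q1 ^ K:] * [:- (y / q1 ^ K), 1:]" using q1 by simp
    also have "\<dots> ^ N = [:(q1 ^ K) ^ N:] * [:- (y / q1 ^ K), 1:] ^ N"
      by (simp only: power_mult_distrib poly_const_pow)
    finally show ?thesis using q1 by (simp add: dil_pfrac)
  qed
  \<comment> \<open>At the points of \<open>X\<close> the lattices are still commensurable. Moving
    \<open>K\<close> steps along the orbit reduces this bound, and the reverse one below, to the
    pole orders of finitely many coefficients. By \<open>lin_pow\<close>, \<open>T1 ^^ K\<close>
    turns powers of \<open>x - y\<close> into powers of \<open>x - y / q1 ^ K\<close> up to
    constants.\<close>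
  have "\<exists>N. scl (pfrac ([:- y, 1:] ^ N)) f \<in> M y" if "y \<noteq> 0" for y
  proof -
    obtain K where K: "\<And>k. k \<ge> K \<Longrightarrow> y / q1 ^ Suc k \<notin> S1" using far1[OF \<open>y \<noteq> 0\<close>] by blast
    have "(T1 ^^ K) f \<in> lattice_span UNIV G" using T1_pow_span[OF fG'] spanG by simp
    then obtain r where r: "(T1 ^^ K) f = (\<Sum>g\<in>G. scl (r g) g)" by (rule lattice_spanE)
    define z where "z = y / q1 ^ K"
    obtain N where N: "\<And>s. s \<in> r ` G \<Longrightarrow> pfrac ([:- z, 1:] ^ N) * s \<in> reg_at z"
      using pole_order_bound[of "r ` G" z] by auto
    have "scl (pfrac ([:- z, 1:] ^ N)) ((T1 ^^ K) f) \<in> L z"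
      unfolding r scale_sum_right scale_scale L_def by (rule lattice_spanI) (use N in auto)
    hence "scl (pfrac [:(q1 ^ K) ^ N:]) (scl (pfrac ([:- z, 1:] ^ N)) ((T1 ^^ K) f)) \<in> L z"
      by (rule L_pfrac)
    hence "(T1 ^^ K) (scl (pfrac ([:- y, 1:] ^ N)) f) \<in> L (y / q1 ^ K)"
      unfolding T1_pow_scl lin_pow z_def scale_scale .
    hence "scl (pfrac ([:- y, 1:] ^ N)) f \<in> M y" using M_stab[OF K] by blast
    thus ?thesis by blast
  qed
  then obtain N1 where N1: "\<And>y. y \<noteq> 0 \<Longrightarrow> scl (pfrac ([:- y, 1:] ^ N1 y)) f \<in> M y" by metis
  have "\<exists>N. \<forall>v\<in>M y. scl (pfrac ([:- y, 1:] ^ N)) v \<in> L y" if "y \<noteq> 0" for y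
  proof -
    obtain K where K: "\<And>k. k \<ge> K \<Longrightarrow> y / q1 ^ Suc k \<notin> S1" using far1[OF \<open>y \<noteq> 0\<close>] by blast
    have "\<exists>u\<in>lattice_span UNIV G. (T1 ^^ K) u = g" if "g \<in> G" for g
      using T1_pow_surj[of g K] that span_base spanG by blast
    hence "\<exists>r. (T1 ^^ K) (\<Sum>h\<in>G. scl (r h) h) = g" if "g \<in> G" for g
      using that unfolding lattice_span_def by blast
    then obtain r where r: "\<And>g. g \<in> G \<Longrightarrow> (T1 ^^ K) (\<Sum>h\<in>G. scl (r g h) h) = g" by metis
    obtain N where N: "\<And>s. s \<in> case_prod r ` (G \<times> G) \<Longrightarrow> pfrac ([:- y, 1:] ^ N) * s \<in> reg_at y"
      using pole_order_bound[of "case_prod r ` (G \<times> G)" y] by auto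
    have "scl (pfrac ([:- y, 1:] ^ N)) v \<in> L y" if "v \<in> M y" for v
    proof -
      have "(T1 ^^ K) v \<in> L (y / q1 ^ K)" using M_stab[OF K] that by blast
      then obtain s where s: "\<And>g. g \<in> G \<Longrightarrow> s g \<in> reg_at (y / q1 ^ K)" "(T1 ^^ K) v = (\<Sum>g\<in>G. scl (s g) g)"
        unfolding L_def by (rule lattice_spanE) blast
      have qK: "q1 ^ K \<noteq> 0" using q1 by simp
      have "(T1 ^^ K) v = (T1 ^^ K) (\<Sum>g\<in>G. scl (dil (1 / q1 ^ K) (s g)) (\<Sum>h\<in>G. scl (r g h) h))"
        using s(2) r by (simp add: T1_pow_sum[where f = "\<lambda>g. scl (dil (1 / q1 ^ K) (s g)) (\<Sum>h\<in>G. scl (r g h) h)"]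
            T1_pow_scl dil_inv[OF qK])
      hence "v = (\<Sum>g\<in>G. scl (dil (1 / q1 ^ K) (s g)) (\<Sum>h\<in>G. scl (r g h) h))"
        by (simp only: T1_pow_cancel)
      hence "scl (pfrac ([:- y, 1:] ^ N)) v = (\<Sum>g\<in>G. scl (dil (1 / q1 ^ K) (s g))
          (\<Sum>h\<in>G. scl (pfrac ([:- y, 1:] ^ N) * r g h) h))"
        by (simp add: scale_sum_right mult_ac del: mult_fract)
      also have "\<dots> \<in> L y"
        unfolding L_def
      proof (intro lattice_span_sum lattice_span_scale is_subring_reg_at lattice_spanI)
        fix g assume "g \<in> G"
        thus "dil (1 / q1 ^ K) (s g) \<in> reg_at y" using s(1)[of g] q1 by (simp add: dil_reg_at_iff)
        fix h assume "h \<in> G"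
        thus "pfrac ([:- y, 1:] ^ N) * r g h \<in> reg_at y" using \<open>g \<in> G\<close> by (intro N) force
      qed (simp add: lattice_span_base is_subring_reg_at)
      finally show ?thesis .
    qed
    thus ?thesis by blast
  qed
  then obtain N2 where N2: "\<And>y v. y \<noteq> 0 \<Longrightarrow> v \<in> M y \<Longrightarrow> scl (pfrac ([:- y, 1:] ^ N2 y)) v \<in> L y" by metis
  \<comment> \<open>\<open>D\<close> brings \<open>f\<close> into every \<open>M y\<close>, and
    \<open>D2\<close> brings every \<open>M y\<close> back into \<open>L y\<close>, for all nonzero
    \<open>y\<close>.\<close>
  define D where "D = (\<Prod>y\<in>X. [:- y, 1:] ^ N1 y)"
  define D2 where "D2 = (\<Prod>y\<in>X. [:- y, 1:] ^ N2 y)"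
  have D0: "D \<noteq> 0" and D20: "D2 \<noteq> 0" using \<open>finite X\<close> by (auto simp: D_def D2_def)
  have fL: "f \<in> L y" for y unfolding L_def by (rule lattice_span_base[OF is_subring_reg_at finG fG])
  have DM: "scl (pfrac D) f \<in> M y" if "y \<noteq> 0" for y
  proof (cases "y \<in> X")
    case True
    hence D: "D = (\<Prod>y\<in>X - {y}. [:- y, 1:] ^ N1 y) * [:- y, 1:] ^ N1 y"
      using \<open>finite X\<close> by (simp add: D_def prod.remove mult.commute)
    have "scl (pfrac D) f = scl (pfrac (\<Prod>y\<in>X - {y}. [:- y, 1:] ^ N1 y)) (scl (pfrac ([:- y, 1:] ^ N1 y)) f)"
      unfolding D by (simp only: scale_scale pfrac_const_simps)
    thus ?thesis using M_pfrac[OF N1[OF that]] by (simp only:)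
  next
    case False
    thus ?thesis using L_pfrac[OF fL] M_eq[OF that] by simp
  qed
  have D2L: "scl (pfrac D2) v \<in> L y" if "y \<noteq> 0" "v \<in> M y" for y v
  proof (cases "y \<in> X")
    case True
    hence D: "D2 = (\<Prod>y\<in>X - {y}. [:- y, 1:] ^ N2 y) * [:- y, 1:] ^ N2 y"
      using \<open>finite X\<close> by (simp add: D2_def prod.remove mult.commute)
    have "scl (pfrac D2) v = scl (pfrac (\<Prod>y\<in>X - {y}. [:- y, 1:] ^ N2 y)) (scl (pfrac ([:- y, 1:] ^ N2 y)) v)"
      unfolding D by (simp only: scale_scale pfrac_const_simps)
    thus ?thesis using L_pfrac[OF N2[OF that]] by (simp only:)
  next
    case False
    thus ?thesis using that L_pfrac M_eq[OF that(1)] by simp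
  qed

  \<comment> \<open>Global sections of the resulting bundle on the projective line.\<close>
  define N where "N = degree D"
  define xN where "xN = monom (1 :: complex) N"
  have xN0: "xN \<noteq> 0" by (simp add: xN_def monom_eq_0_iff)
  define H where "H = {v. (\<forall>y. y \<noteq> 0 \<longrightarrow> v \<in> M y) \<and> scl (pfrac xN) v \<in> L 0 \<and> scl (1 / pfrac xN) v \<in> Linf}"
  have dil_xN: "dil q (pfrac xN) = pfrac [:q ^ N:] * pfrac xN" if "q \<noteq> 0" for q
  proof -
    have "pcompose xN [:0, q:] = [:q ^ N:] * xN"
      by (rule poly_eqI) (simp add: xN_def coeff_pcompose_dil)
    thus ?thesis using that by (simp add: dil_pfrac)
  qed
  have H_D: "scl (pfrac D) f \<in> H"
  proof -
    have "scl (pfrac xN) (scl (pfrac D) f) \<in> L 0" by (intro L_pfrac fL)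
    moreover have "scl (1 / pfrac xN) (scl (pfrac D) f) \<in> Linf"
    proof -
      have "1 / pfrac xN * pfrac D = Fract D xN" using xN0 by simp
      moreover have "Fract D xN \<in> infty_bounded 0"
        by (rule infty_boundedI) (use xN0 in \<open>auto simp: xN_def degree_monom_eq N_def\<close>)
      ultimately show ?thesis unfolding Linf_def scale_scale
        by (metis lattice_span_base[OF is_subring_infty finG fG] lattice_span_scale[OF is_subring_infty])
    qed
    ultimately show ?thesis using DM by (auto simp: H_def)
  qed
  have H_T: "T v \<in> H" if v: "v \<in> H" and q: "q \<noteq> 0"
      and T: "\<And>u. u \<in> L 0 \<Longrightarrow> T u \<in> L 0" "\<And>u. u \<in> Linf \<Longrightarrow> T u \<in> Linf"
        "\<And>r u. T (scl r u) = scl (dil q r) (T u)" "\<And>y. y \<noteq> 0 \<Longrightarrow> v \<in> M (q * y) \<Longrightarrow> T v \<in> M y"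
      for T v q
  proof -
    have "scl (pfrac [:1 / q ^ N:]) (T (scl (pfrac xN) v)) \<in> L 0"
      by (rule L_pfrac[OF T(1)]) (use v in \<open>simp add: H_def\<close>)
    also have "scl (pfrac [:1 / q ^ N:]) (T (scl (pfrac xN) v)) = scl (pfrac ([:1 / q ^ N:] * [:q ^ N:]) * pfrac xN) (T v)"
      by (simp only: T dil_xN[OF q] scale_scale pfrac_const_simps mult.assoc)
    also have "[:1 / q ^ N:] * [:q ^ N:] = 1" using q by (simp add: one_pCons)
    finally have 1: "scl (pfrac xN) (T v) \<in> L 0" by (simp only: pfrac_const_simps mult_1)
    have "scl (pfrac [:q ^ N:]) (T (scl (1 / pfrac xN) v)) \<in> Linf"
      unfolding Linf_def
      by (rule lattice_span_scale[OF is_subring_infty])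
         (use v T(2) in \<open>auto simp: H_def Linf_def infty_bounded_pfrac\<close>)
    also have "T (scl (1 / pfrac xN) v) = scl (1 / (pfrac [:q ^ N:] * pfrac xN)) (T v)"
      using q by (simp only: T(3) dil_divide[OF q] dil_1[OF q] dil_xN[OF q])
    also have "scl (pfrac [:q ^ N:]) \<dots> = scl (1 / pfrac xN) (T v)"
    proof -
      have "pfrac [:q ^ N:] \<noteq> 0" using q by simp
      hence "pfrac [:q ^ N:] * (1 / (pfrac [:q ^ N:] * pfrac xN)) = 1 / pfrac xN"
        by (simp del: mult_fract divide_fract inverse_fract)
      thus ?thesis by (simp only: scale_scale)
    qed
    finally have 2: "scl (1 / pfrac xN) (T v) \<in> Linf" .
    show ?thesis using 1 2 v q T(4) by (auto simp: H_def)
  qed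
  have T1_H: "T1 v \<in> H" if "v \<in> H" for v
    by (rule H_T[OF that q1(1) T1_L0 T1_Linf T1_scl M_T1])
  have T2_H: "T2 v \<in> H" if "v \<in> H" for v
    by (rule H_T[OF that q2(1) T2_L0 T2_Linf T2_scl]) (simp_all add: M_T2)
  obtain B where B: "B \<subseteq> G" "independent B" "G \<subseteq> span B"
    using maximal_independent_subset[of G] by auto
  have finB: "finite B" by (rule finite_subset[OF B(1) finG])
  have spanB: "span B = span G"
    using B span_mono[of G "span B"] span_mono[of B G] by (auto simp: span_span)
  define \<rho> where "\<rho> = representation B"
  have \<rho>_scale: "\<rho> (scl r v) e = r * \<rho> v e" if "v \<in> span G" for r v e
    using representation_scale[OF B(2)] that spanB by (simp add: \<rho>_def)
  have \<rho>_sum: "\<rho> (\<Sum>g\<in>G. scl (r g) g) e = (\<Sum>g\<in>G. r g * \<rho> g e)" for r e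
    using B(3) by (simp add: \<rho>_def representation_sum[OF B(2)] representation_scale[OF B(2)] span_scale subset_iff)
  define A where "A = case_prod \<rho> ` (G \<times> B)"
  have "finite A" using finB by (simp add: A_def)
  then obtain DB where DB: "DB \<noteq> 0" "\<And>r. r \<in> A \<Longrightarrow> \<exists>p. pfrac DB * r = pfrac p"
    by (rule common_denominator) blast
  have "\<exists>p. pfrac DB * \<rho> g e = pfrac p" if "g \<in> G" "e \<in> B" for g e
    by (rule DB(2)) (use that in \<open>force simp: A_def\<close>)
  then obtain p where p: "\<And>g e. g \<in> G \<Longrightarrow> e \<in> B \<Longrightarrow> pfrac DB * \<rho> g e = pfrac (p g e)" by metis
  have \<rho>_DB: "pfrac DB * \<rho> (\<Sum>g\<in>G. scl (r g) g) e = (\<Sum>g\<in>G. r g * pfrac (p g e))" if "e \<in> B" for r e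
    unfolding \<rho>_sum sum_distrib_left
    by (rule sum.cong) (auto simp: mult.left_commute[of "pfrac DB"] p that simp del: mult_fract)
  define d0 where "d0 = (\<Sum>g\<in>G. \<Sum>e\<in>B. degree (p g e))"
  have deg_p: "degree (p g e) \<le> d0" if "g \<in> G" "e \<in> B" for g e
  proof -
    have "degree (p g e) \<le> (\<Sum>e\<in>B. degree (p g e))" by (rule member_le_sum) (use that finB in auto)
    also have "\<dots> \<le> d0" unfolding d0_def
      by (rule member_le_sum[where f = "\<lambda>g. \<Sum>e\<in>B. degree (p g e)"]) (use that in auto)
    finally show ?thesis .
  qed
  \<comment> \<open>In \<open>W\<close>, the factor \<open>DB\<close> makes the coordinates of the
    generators polynomial, \<open>D2\<close> leads from \<open>M y\<close> to \<open>L y\<close> at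
    nonzero points, and \<open>xN\<close> makes up for the twist at 0. In \<open>d\<close>, one
    factor \<open>xN\<close> comes from \<open>W\<close>, the other from the twist at infinity, and
    \<open>d0\<close> bounds the degrees of the cleared coordinates.\<close>
  define d where "d = degree (D2 * xN * xN) + d0"
  define W where "W = DB * (D2 * xN)"
  have W0: "W \<noteq> 0" using DB D20 xN0 by (simp add: W_def)
  have bounded: "\<exists>P. pfrac W * \<rho> v e = pfrac P \<and> degree P \<le> d" if v: "v \<in> H" and e: "e \<in> B" for v e
  proof -
    have vM: "v \<in> M y" if "y \<noteq> 0" for y using v that by (auto simp: H_def)
    have L_span: "u \<in> span G" if "u \<in> L y" for u y
      using that lattice_span_subset_span[OF finG] by (auto simp: L_def)
    have v_span: "v \<in> span G"
    proof -
      have "scl (1 / pfrac xN) (scl (pfrac xN) v) \<in> span G"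
        using v by (intro span_scale L_span) (auto simp: H_def)
      thus ?thesis using xN0 by (simp del: divide_fract)
    qed
    have reg: "pfrac DB * \<rho> u e \<in> reg_at y" if u: "u \<in> L y" for u y
    proof -
      obtain r where r: "\<And>g. g \<in> G \<Longrightarrow> r g \<in> reg_at y" "u = (\<Sum>g\<in>G. scl (r g) g)"
        using u unfolding L_def lattice_span_def by blast
      show ?thesis unfolding r(2) \<rho>_DB[OF e]
        by (intro is_subring_sum[OF is_subring_reg_at] reg_at_mult r(1) reg_at_pfrac)
    qed
    have "pfrac W * \<rho> v e \<in> reg_at y" for y
    proof (cases "y = 0")
      case True
      have "pfrac D2 * (pfrac DB * \<rho> (scl (pfrac xN) v) e) \<in> reg_at 0"
        using v by (intro reg_at_mult reg_at_pfrac reg) (auto simp: H_def)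
      also have "pfrac D2 * (pfrac DB * \<rho> (scl (pfrac xN) v) e) = pfrac W * \<rho> v e"
        by (simp only: \<rho>_scale[OF v_span] W_def pfrac_const_simps mult_ac)
      finally show ?thesis using True by simp
    next
      case False
      have "pfrac xN * (pfrac DB * \<rho> (scl (pfrac D2) v) e) \<in> reg_at y"
        by (intro reg_at_mult reg_at_pfrac reg D2L vM False)
      also have "pfrac xN * (pfrac DB * \<rho> (scl (pfrac D2) v) e) = pfrac W * \<rho> v e"
        by (simp only: \<rho>_scale[OF v_span] W_def pfrac_const_simps mult_ac)
      finally show ?thesis .
    qed
    then obtain P where P: "pfrac W * \<rho> v e = pfrac P" using reg_at_everywhere by blast
    have "scl (1 / pfrac xN) v \<in> Linf" using v by (auto simp: H_def)
    then obtain r where r: "\<And>g. g \<in> G \<Longrightarrow> r g \<in> infty_bounded 0" "scl (1 / pfrac xN) v = (\<Sum>g\<in>G. scl (r g) g)"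
      unfolding Linf_def lattice_span_def by blast
    have "pfrac DB * \<rho> (scl (1 / pfrac xN) v) e \<in> infty_bounded d0"
    proof -
      have "(\<Sum>g\<in>I. r g * pfrac (p g e)) \<in> infty_bounded d0" if "I \<subseteq> G" for I
        using finite_subset[OF that finG] that
      proof (induction I rule: finite_induct)
        case (insert g I)
        have "r g * pfrac (p g e) \<in> infty_bounded (0 + d0)"
          by (rule infty_bounded_mult) (use insert r(1) deg_p[of g e] e in \<open>auto simp: infty_bounded_pfrac\<close>)
        thus ?case using insert by (simp add: infty_bounded_add del: mult_fract)
      qed auto
      thus ?thesis unfolding r(2) \<rho>_DB[OF e] by simp
    qed
    hence "pfrac (D2 * xN * xN) * (pfrac DB * \<rho> (scl (1 / pfrac xN) v) e) \<in> infty_bounded d"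
      unfolding d_def by (intro infty_bounded_mult) (simp_all add: infty_bounded_pfrac)
    also have "pfrac (D2 * xN * xN) * (pfrac DB * \<rho> (scl (1 / pfrac xN) v) e) = pfrac W * \<rho> v e"
    proof -
      have "pfrac xN \<noteq> 0" using xN0 by simp
      hence "pfrac xN * (1 / pfrac xN * x) = x" for x by (simp del: divide_fract)
      thus ?thesis
        by (simp only: \<rho>_scale[OF v_span] W_def pfrac_const_simps mult.assoc mult.left_commute[of "pfrac DB"])
    qed
    finally have "degree P \<le> d" unfolding P infty_bounded_pfrac .
    thus ?thesis using P by blast
  qed
  define t where "t = (\<lambda>(e, k). scl (pfrac (monom 1 k) / pfrac W) e)"
  have expand: "\<exists>c. v = (\<Sum>i\<in>B \<times> {..d}. scl (pfrac [:c i:]) (t i))" if v: "v \<in> H" for v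
  proof -
    obtain P where P: "\<And>e. e \<in> B \<Longrightarrow> pfrac W * \<rho> v e = pfrac (P e)" "\<And>e. e \<in> B \<Longrightarrow> degree (P e) \<le> d"
      using bounded[OF v] by metis
    have v_span: "v \<in> span B"
    proof -
      have "scl (pfrac xN) v \<in> span G" using v lattice_span_subset_span[OF finG] by (auto simp: H_def L_def)
      hence "scl (1 / pfrac xN) (scl (pfrac xN) v) \<in> span G" by (rule span_scale)
      thus ?thesis using xN0 spanB by (simp del: divide_fract)
    qed
    have "\<rho> v e = (\<Sum>k\<le>d. pfrac [:coeff (P e) k:] * (pfrac (monom 1 k) / pfrac W))" if e: "e \<in> B" for e
    proof -
      have "P e = (\<Sum>k\<le>d. [:coeff (P e) k:] * monom 1 k)"
        using P(2)[OF e] by (subst poly_as_sum_of_monoms'[symmetric]) (auto simp: smult_monom)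
      hence "pfrac (P e) = (\<Sum>k\<le>d. pfrac [:coeff (P e) k:] * pfrac (monom 1 k))"
        using arg_cong[of _ _ pfrac] by (metis (no_types, lifting) pfrac_sum pfrac_const_simps(4) sum.cong)
      moreover have "pfrac W \<noteq> 0" using W0 by simp
      ultimately show ?thesis using P(1)[OF e]
        by (simp add: field_simps flip: sum_divide_distrib del: mult_fract divide_fract)
    qed
    hence "v = (\<Sum>e\<in>B. scl (\<Sum>k\<le>d. pfrac [:coeff (P e) k:] * (pfrac (monom 1 k) / pfrac W)) e)"
      using sum_representation_eq[OF B(2) v_span finB] by (simp add: \<rho>_def)
    also have "\<dots> = (\<Sum>e\<in>B. \<Sum>k\<le>d. scl (pfrac [:coeff (P e) k:]) (t (e, k)))"
      by (simp only: scale_sum_left t_def scale_scale prod.case)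
    also have "\<dots> = (\<Sum>i\<in>B \<times> {..d}. scl (pfrac [:coeff (P (fst i)) (snd i):]) (t i))"
      by (subst sum.cartesian_product) (simp add: case_prod_unfold)
    finally show ?thesis by (rule exI[of _ "\<lambda>i. coeff (P (fst i)) (snd i)"])
  qed
  \<comment> \<open>More members of \<open>H\<close> than there are vectors in the family
    \<open>t\<close> are dependent over the constants. The coefficients of the dependency become
    those of a polynomial in the operator.\<close>
  have annihilator: "\<exists>P. P \<noteq> 0 \<and> (\<Sum>i\<le>degree P. scl (pfrac [:coeff P i:]) (w i)) = 0"
    if w: "\<And>i. w i \<in> H" for w :: "nat \<Rightarrow> 'v"
  proof -
    obtain c where c: "\<And>i. w i = (\<Sum>j\<in>B \<times> {..d}. scl (pfrac [:c i j:]) (t j))"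
      using expand[OF w] by metis
    define n where "n = card (B \<times> {..d})"
    obtain x where x: "\<exists>i\<in>{..n}. x i \<noteq> 0" "\<And>j. j \<in> B \<times> {..d} \<Longrightarrow> (\<Sum>i\<in>{..n}. x i * c i j) = 0"
      using underdetermined_system[of "B \<times> {..d}" "{..n}" c] finB by (auto simp: n_def)
    define P where "P = (\<Sum>i\<le>n. monom (x i) i)"
    have coeff_P: "coeff P i = (if i \<le> n then x i else 0)" for i
      by (simp add: P_def coeff_sum if_distrib cong: if_cong)
    have P0: "P \<noteq> 0" using x(1) coeff_P by (metis atMost_iff coeff_0)
    have deg: "degree P \<le> n" by (rule degree_le) (simp add: coeff_P)
    have "(\<Sum>i\<le>degree P. scl (pfrac [:coeff P i:]) (w i)) = (\<Sum>i\<le>n. scl (pfrac [:coeff P i:]) (w i))"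
      by (rule sum.mono_neutral_left) (use deg in \<open>auto simp: coeff_eq_0 not_le\<close>)
    also have "\<dots> = (\<Sum>i\<le>n. \<Sum>j\<in>B \<times> {..d}. scl (pfrac [:x i * c i j:]) (t j))"
      by (rule sum.cong) (auto simp: coeff_P c scale_sum_right mult.commute)
    also have "\<dots> = (\<Sum>j\<in>B \<times> {..d}. scl (pfrac [:\<Sum>i\<le>n. x i * c i j:]) (t j))"
      by (subst sum.swap) (simp add: pfrac_const_sum scale_sum_left del: mult_fract)
    also have "\<dots> = 0"
      using x(2) by (intro sum.neutral) auto
    finally show ?thesis using P0 by blast
  qed
  have T1_pow_H: "(T1 ^^ i) (scl (pfrac D) f) \<in> H" for i
    using H_D T1_H by (induction i) auto
  have T2_pow_H: "(T2 ^^ i) (scl (pfrac D) f) \<in> H" for i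
    using H_D T2_H by (induction i) auto
  obtain P1 where P1: "P1 \<noteq> 0" "(\<Sum>i\<le>degree P1. scl (pfrac [:coeff P1 i:]) ((T1 ^^ i) (scl (pfrac D) f))) = 0"
    using annihilator[of "\<lambda>i. (T1 ^^ i) (scl (pfrac D) f)"] T1_pow_H by blast
  obtain P2 where P2: "P2 \<noteq> 0" "(\<Sum>i\<le>degree P2. scl (pfrac [:coeff P2 i:]) ((T2 ^^ i) (scl (pfrac D) f))) = 0"
    using annihilator[of "\<lambda>i. (T2 ^^ i) (scl (pfrac D) f)"] T2_pow_H by blast
  show thesis by (rule that[OF D0 P1(1) P2(1) P1(2) P2(2)])
qed

end

subsection \<open>Formal Laurent series solutions\<close>

lemma ratfun_fls_const: "ratfun_fls (pfrac [:c:]) = fls_const c"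
  by (simp add: fps_of_poly_const)

lemma ratfun_fls_X: "ratfun_fls (pfrac [:0, 1:]) = fls_X"
  by simp

lemma fls_X_intpow_in_range: "fls_X_intpow n \<in> range ratfun_fls"
proof (cases "n \<ge> 0")
  case True
  have "ratfun_fls (pfrac [:0, 1:] ^ nat n) = fls_X_intpow n"
    unfolding ratfun_fls.lift_power ratfun_fls_X fls_X_power_conv_shift_1 using True by simp
  thus ?thesis by (rule range_eqI[OF sym])
next
  case False
  have "ratfun_fls (inverse (pfrac [:0, 1:]) ^ nat (- n)) = fls_X_intpow n"
    unfolding ratfun_fls.lift_power ratfun_fls.lift_inverse ratfun_fls_X
    using False by (simp add: fls_X_inv_power_conv_shift_1 fls_inverse_X)
  thus ?thesis by (rule range_eqI[OF sym])
qed

lemma finite_support_in_range: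
  fixes F :: "complex fls"
  assumes "finite {n. fls_nth F n \<noteq> 0}"
  shows "F \<in> range ratfun_fls"
proof -
  define N where "N = {n. fls_nth F n \<noteq> 0}"
  define r where "r n = (SOME r. ratfun_fls r = fls_X_intpow n)" for n
  have r: "ratfun_fls (r n) = fls_X_intpow n" for n
    unfolding r_def by (rule someI_ex) (use fls_X_intpow_in_range[of n] in auto)
  have "F = (\<Sum>n\<in>N. fls_const (fls_nth F n) * fls_X_intpow n)"
  proof (rule fls_eqI)
    fix k
    have "fls_nth (\<Sum>n\<in>N. fls_const (fls_nth F n) * fls_X_intpow n) k = (\<Sum>n\<in>N. if n = k then fls_nth F k else 0)"
      unfolding fls_nth_sum by (rule sum.cong) (auto simp: fls_shift_nth)
    also have "\<dots> = fls_nth F k" using assms by (auto simp: N_def)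
    finally show "fls_nth F k = fls_nth (\<Sum>n\<in>N. fls_const (fls_nth F n) * fls_X_intpow n) k" ..
  qed
  also have "\<dots> = ratfun_fls (\<Sum>n\<in>N. pfrac [:fls_nth F n:] * r n)"
    by (simp only: ratfun_fls.lift_sum ratfun_fls.lift_mult ratfun_fls_const r)
  finally show ?thesis by (rule range_eqI)
qed

lemma qdiff_fls:
  assumes "q1 \<noteq> 0" "q2 \<noteq> 0" "\<not> root_of_unity q1" "\<not> root_of_unity q2" "mult_independent q1 q2"
  shows "qdiff (\<lambda>r F. ratfun_fls r * F) (fls_shift_mult q1) (fls_shift_mult q2) q1 q2"
proof
  show "fls_shift_mult q1 (fls_shift_mult q2 v) = fls_shift_mult q2 (fls_shift_mult q1 v)" for v
    by (rule fls_eqI) (use assms in \<open>simp add: fls_shift_mult_nth\<close>)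
qed (use assms in \<open>auto simp: algebra_simps fls_shift_mult_simps ratfun_fls_dil\<close>)

lemma formal_solution_rational:
  assumes q: "q1 \<noteq> 0" "q2 \<noteq> 0" "\<not> root_of_unity q1" "\<not> root_of_unity q2" "mult_independent q1 q2"
    and F: "fls_solves_qdiff q1 F" "fls_solves_qdiff q2 F"
  shows "F \<in> range ratfun_fls"
proof -
  interpret qdiff "\<lambda>r F. ratfun_fls r * F" "fls_shift_mult q1" "fls_shift_mult q2" q1 q2
    by (rule qdiff_fls) fact+
  from F obtain m1 b1 m2 b2 where
      "(fls_shift_mult q1 ^^ m1) F + (\<Sum>i<m1. ratfun_fls (b1 i) * (fls_shift_mult q1 ^^ i) F) = 0"
      "(fls_shift_mult q2 ^^ m2) F + (\<Sum>i<m2. ratfun_fls (b2 i) * (fls_shift_mult q2 ^^ i) F) = 0"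
    unfolding fls_solves_qdiff_def by blast
  then obtain D P where D: "D \<noteq> 0" "P \<noteq> 0"
      "(\<Sum>i\<le>degree P. ratfun_fls (pfrac [:coeff P i:]) * (fls_shift_mult q1 ^^ i) (ratfun_fls (pfrac D) * F)) = 0"
    by (rule constant_coefficient_multiple) blast
  define h where "h = ratfun_fls (pfrac D) * F"
  have pow_nth: "fls_nth ((fls_shift_mult q1 ^^ i) h) n = (q1 powi n) ^ i * fls_nth h n" for i n
    by (induction i) (auto simp: fls_shift_mult_nth q)
  \<comment> \<open>Dilation multiplies the coefficient of index \<open>n\<close> by
    \<open>q1 powi n\<close>, so a nonzero coefficient makes this number a root of \<open>P\<close>.
    The numbers are pairwise different because \<open>q1\<close> is not a root of unity.\<close>
  have "poly P (q1 powi n) * fls_nth h n = 0" for n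
  proof -
    have "0 = fls_nth (\<Sum>i\<le>degree P. ratfun_fls (pfrac [:coeff P i:]) * (fls_shift_mult q1 ^^ i) h) n"
      using D(3) by (simp add: h_def)
    also have "\<dots> = poly P (q1 powi n) * fls_nth h n"
      unfolding fls_nth_sum ratfun_fls_const by (simp add: pow_nth poly_altdef sum_distrib_right mult.assoc)
    finally show ?thesis by simp
  qed
  hence "{n. fls_nth h n \<noteq> 0} \<subseteq> (\<lambda>n. q1 powi n) -` {x. poly P x = 0}" by auto
  moreover have "inj (\<lambda>n. q1 powi n)"
    using not_root_of_unity_powi_inj[OF q(3,1)] by (auto intro!: injI)
  ultimately have "finite {n. fls_nth h n \<noteq> 0}"
    using finite_vimageI[OF poly_roots_finite[OF D(2)]] finite_subset by blast
  then obtain r where "h = ratfun_fls r" using finite_support_in_range by blast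
  hence "F = ratfun_fls (r / pfrac D)"
    using D(1) by (simp add: h_def ratfun_fls.nonzero field_simps del: divide_fract)
  thus ?thesis by blast
qed

subsection \<open>The field of meromorphic functions\<close>

lemma generic_iff: "(\<forall>\<^sub>\<approx>w\<in>UNIV. P w) \<longleftrightarrow> (\<forall>z :: complex. eventually P (at z))"
  by (simp add: eventually_cosparse_open_eq)

lemma generic_shift:
  assumes "\<forall>\<^sub>\<approx>w\<in>UNIV. P w"
  shows "\<forall>\<^sub>\<approx>w\<in>UNIV. P (w + c :: complex)"
  unfolding generic_iff
proof
  fix z
  have "eventually P (at (z + c))" using assms by (simp add: generic_iff)
  thus "\<forall>\<^sub>F w in at z. P (w + c)"
    unfolding at_to_0[of "z + c"] at_to_0[of z] eventually_filtermap by (simp add: add_ac)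
qed

lemma remove_sings_nicely:
  assumes "f nicely_meromorphic_on UNIV"
  shows "remove_sings f = f"
proof
  fix z
  have "is_pole f z \<and> f z = 0 \<or> f \<midarrow>z\<rightarrow> f z" using assms by (auto simp: nicely_meromorphic_on_def)
  thus "remove_sings f z = f z" by (auto intro: remove_sings_eqI)
qed

lemma nicely_meromorphic_eqI:
  assumes "f nicely_meromorphic_on UNIV" "g nicely_meromorphic_on UNIV" "\<forall>\<^sub>\<approx>w\<in>UNIV. f w = g w"
  shows "f = g"
proof
  fix z
  have "remove_sings f z = remove_sings g z"
    using assms(3) by (intro remove_sings_cong) (auto simp: generic_iff)
  thus "f z = g z" using assms by (simp add: remove_sings_nicely)
qed

text \<open>Functions that differ on a closed discrete set must be identified to obtain a field.
  Each class has exactly one nicely meromorphic representative, so equality in this type is generic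
  equality, and every operation removes singularities afterwards.\<close>

typedef mero = "{f :: complex \<Rightarrow> complex. f nicely_meromorphic_on UNIV}"
  morphisms ev Abs_mero
  by (rule exI[of _ "\<lambda>_. 0"]) (auto intro: nicely_meromorphic_on_const)

definition mk_mero :: "(complex \<Rightarrow> complex) \<Rightarrow> mero" where
  "mk_mero f = Abs_mero (remove_sings f)"

lemma ev_nicely [simp]: "ev F nicely_meromorphic_on UNIV"
  using ev[of F] by simp

lemma ev_meromorphic [simp, meromorphic_intros]: "ev F meromorphic_on A"
  using ev_nicely[of F] meromorphic_on_subset unfolding nicely_meromorphic_on_def by blast

lemma ev_mk_mero: "f meromorphic_on UNIV \<Longrightarrow> ev (mk_mero f) = remove_sings f"
  by (simp add: mk_mero_def Abs_mero_inverse remove_sings_nicely_meromorphic)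

lemma ev_mk_mero_generic: "f meromorphic_on UNIV \<Longrightarrow> \<forall>\<^sub>\<approx>w\<in>UNIV. ev (mk_mero f) w = f w"
  by (simp add: ev_mk_mero eventually_remove_sings_eq)

lemma mero_eqI: "\<forall>\<^sub>\<approx>w\<in>UNIV. ev F w = ev G w \<Longrightarrow> F = G"
  using nicely_meromorphic_eqI[of "ev F" "ev G"] by (simp add: ev_inject)

instantiation mero :: "{zero, one, plus, minus, uminus, times, inverse}"
begin

definition "zero_mero = mk_mero (\<lambda>_. 0)"
definition "one_mero = mk_mero (\<lambda>_. 1)"
definition "plus_mero F G = mk_mero (\<lambda>w. ev F w + ev G w)"
definition "minus_mero F G = mk_mero (\<lambda>w. ev F w - ev G w)"
definition "uminus_mero F = mk_mero (\<lambda>w. - ev F w)"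
definition "times_mero F G = mk_mero (\<lambda>w. ev F w * ev G w)"
definition "inverse_mero F = mk_mero (\<lambda>w. inverse (ev F w))"
definition "divide_mero F G = mk_mero (\<lambda>w. ev F w / ev G w)"

instance ..

end

lemma ev_0 [simp]: "ev 0 w = 0"
proof -
  have "ev 0 = (\<lambda>_. 0)"
    unfolding zero_mero_def by (simp add: ev_mk_mero remove_sings_nicely nicely_meromorphic_on_const meromorphic_on_const)
  thus ?thesis by simp
qed

lemma ev_1 [simp]: "ev 1 w = 1"
proof -
  have "ev 1 = (\<lambda>_. 1)"
    unfolding one_mero_def by (simp add: ev_mk_mero remove_sings_nicely nicely_meromorphic_on_const meromorphic_on_const)
  thus ?thesis by simp
qed

lemma ev_add: "\<forall>\<^sub>\<approx>w\<in>UNIV. ev (F + G) w = ev F w + ev G w"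
  and ev_diff: "\<forall>\<^sub>\<approx>w\<in>UNIV. ev (F - G) w = ev F w - ev G w"
  and ev_uminus: "\<forall>\<^sub>\<approx>w\<in>UNIV. ev (- F) w = - ev F w"
  and ev_mult: "\<forall>\<^sub>\<approx>w\<in>UNIV. ev (F * G) w = ev F w * ev G w"
  and ev_inverse': "\<forall>\<^sub>\<approx>w\<in>UNIV. ev (inverse F) w = inverse (ev F w)"
  and ev_divide: "\<forall>\<^sub>\<approx>w\<in>UNIV. ev (F / G) w = ev F w / ev G w"
  unfolding plus_mero_def minus_mero_def uminus_mero_def times_mero_def inverse_mero_def divide_mero_def
  by (intro ev_mk_mero_generic meromorphic_intros ev_meromorphic)+

text \<open>The identity theorem: on the connected plane a meromorphic function is generically zero
  or generically nonzero. This provides the inverses of the field.\<close>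

lemma ev_nonzero_generic:
  assumes "F \<noteq> 0"
  shows "\<forall>\<^sub>\<approx>w\<in>UNIV. ev F w \<noteq> 0"
proof -
  have "\<not> (\<forall>\<^sub>\<approx>w\<in>UNIV. ev F w = 0)" using assms mero_eqI[of F 0] by auto
  thus ?thesis using meromorphic_imp_constant_or_avoid[of "ev F" UNIV 0] by auto
qed

instance mero :: field
proof
  fix F G H :: mero
  show "F + G + H = F + (G + H)"
    by (rule mero_eqI, use ev_add[of "F + G" H] ev_add[of F G] ev_add[of F "G + H"] ev_add[of G H] in eventually_elim) simp
  show "F + G = G + F"
    by (rule mero_eqI, use ev_add[of F G] ev_add[of G F] in eventually_elim) simp
  show "0 + F = F"
    by (rule mero_eqI, use ev_add[of 0 F] in eventually_elim) simp
  show "- F + F = 0"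
    by (rule mero_eqI, use ev_add[of "- F" F] ev_uminus[of F] in eventually_elim) simp
  show "F - G = F + - G"
    by (rule mero_eqI, use ev_add[of F "- G"] ev_uminus[of G] ev_diff[of F G] in eventually_elim) simp
  show "F * G * H = F * (G * H)"
    by (rule mero_eqI, use ev_mult[of "F * G" H] ev_mult[of F G] ev_mult[of F "G * H"] ev_mult[of G H] in eventually_elim) simp
  show "F * G = G * F"
    by (rule mero_eqI, use ev_mult[of F G] ev_mult[of G F] in eventually_elim) simp
  show "1 * F = F"
    by (rule mero_eqI, use ev_mult[of 1 F] in eventually_elim) simp
  show "(F + G) * H = F * H + G * H"
    by (rule mero_eqI, use ev_mult[of "F + G" H] ev_add[of F G] ev_add[of "F * H" "G * H"] ev_mult[of F H] ev_mult[of G H]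
        in eventually_elim) (simp add: algebra_simps)
  have "ev (0 :: mero) 0 \<noteq> ev 1 0" by simp
  thus "(0 :: mero) \<noteq> 1" by metis
  show "inverse F * F = 1" if "F \<noteq> 0"
    by (rule mero_eqI, use ev_mult[of "inverse F" F] ev_inverse'[of F] ev_nonzero_generic[OF that] in eventually_elim) simp
  show "F / G = F * inverse G"
    by (rule mero_eqI, use ev_divide[of F G] ev_mult[of F "inverse G"] ev_inverse'[of G] in eventually_elim) (simp add: divide_inverse)
  show "inverse (0 :: mero) = 0"
    by (rule mero_eqI, use ev_inverse'[of 0] in eventually_elim) simp
qed

lemma ev_sum: "\<forall>\<^sub>\<approx>w\<in>UNIV. ev (\<Sum>i\<in>A. F i) w = (\<Sum>i\<in>A. ev (F i) w)"
proof (induction A rule: infinite_finite_induct)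
  case (insert i A)
  show ?case
    using ev_add[of "F i" "\<Sum>i\<in>A. F i"] insert(3) by eventually_elim (use insert(1,2) in simp)
qed auto

lemma ev_power: "\<forall>\<^sub>\<approx>w\<in>UNIV. ev (F ^ n) w = ev F w ^ n"
proof (induction n)
  case (Suc n)
  show ?case using ev_mult[of F "F ^ n"] Suc by eventually_elim simp
qed auto

definition shift_mero :: "complex \<Rightarrow> mero \<Rightarrow> mero" where
  "shift_mero c F = mk_mero (\<lambda>w. ev F (w + c))"

lemma nicely_meromorphic_shift:
  assumes "f nicely_meromorphic_on UNIV"
  shows "(\<lambda>w. f (w + c)) nicely_meromorphic_on UNIV"
  unfolding nicely_meromorphic_on_def
proof (intro conjI ballI)
  show "(\<lambda>w. f (w + c)) meromorphic_on UNIV"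
    using assms unfolding nicely_meromorphic_on_def
    by (intro meromorphic_on_compose[of f UNIV "\<lambda>w. w + c"] analytic_intros) auto
  fix z
  have "is_pole f (z + c) \<and> f (z + c) = 0 \<or> f \<midarrow>z + c\<rightarrow> f (z + c)"
    using assms by (auto simp: nicely_meromorphic_on_def)
  thus "is_pole (\<lambda>w. f (w + c)) z \<and> f (z + c) = 0 \<or> (\<lambda>w. f (w + c)) \<midarrow>z\<rightarrow> f (z + c)"
    unfolding is_pole_def at_to_0[of "z + c"] at_to_0[of z] filterlim_filtermap by (simp add: add_ac)
qed

lemma ev_shift [simp]: "ev (shift_mero c F) w = ev F (w + c)"
proof -
  have "(\<lambda>w. ev F (w + c)) nicely_meromorphic_on UNIV" by (rule nicely_meromorphic_shift) simp
  thus ?thesis unfolding shift_mero_def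
    by (subst ev_mk_mero) (auto simp: remove_sings_nicely nicely_meromorphic_on_def)
qed

lemma shift_mero_shift [simp]: "shift_mero c (shift_mero d F) = shift_mero (c + d) F"
  by (rule mero_eqI) (simp add: add_ac)

lemma shift_mero_add: "shift_mero c (F + G) = shift_mero c F + shift_mero c G"
  by (rule mero_eqI, use generic_shift[OF ev_add[of F G], of c] ev_add[of "shift_mero c F" "shift_mero c G"] in eventually_elim) simp

lemma shift_mero_mult: "shift_mero c (F * G) = shift_mero c F * shift_mero c G"
  by (rule mero_eqI, use generic_shift[OF ev_mult[of F G], of c] ev_mult[of "shift_mero c F" "shift_mero c G"] in eventually_elim) simp

lemma shift_mero_0 [simp]: "shift_mero c 0 = 0" and shift_mero_1 [simp]: "shift_mero c 1 = 1"
  by (rule mero_eqI, simp)+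

lemma shift_mero_id [simp]: "shift_mero 0 F = F"
  by (rule mero_eqI) simp

lemma shift_mero_eq_0_iff [simp]: "shift_mero c F = 0 \<longleftrightarrow> F = 0"
proof
  assume "shift_mero c F = 0"
  hence "shift_mero (- c) (shift_mero c F) = 0" by simp
  thus "F = 0" by simp
qed simp

lemma shift_mero_sum: "shift_mero c (\<Sum>i\<in>A. F i) = (\<Sum>i\<in>A. shift_mero c (F i))"
  by (induction A rule: infinite_finite_induct) (auto simp: shift_mero_add)

lemma shift_mero_inverse: "shift_mero c (inverse F) = inverse (shift_mero c F)"
proof (cases "F = 0")
  case False
  have "shift_mero c F * shift_mero c (inverse F) = 1"
    using False by (simp flip: shift_mero_mult)
  thus ?thesis by (rule inverse_unique[symmetric])
qed simp

lemma shift_mero_divide: "shift_mero c (F / G) = shift_mero c F / shift_mero c G"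
  by (simp add: divide_inverse shift_mero_mult shift_mero_inverse)

lemma shift_mero_power: "shift_mero c (F ^ n) = shift_mero c F ^ n"
  by (induction n) (auto simp: shift_mero_mult)

lemma shift_mero_pow: "(shift_mero c ^^ i) F = shift_mero (of_nat i * c) F"
  by (induction i) (auto simp: algebra_simps)

definition const_mero :: "complex \<Rightarrow> mero" where
  "const_mero c = mk_mero (\<lambda>_. c)"

lemma ev_const [simp]: "ev (const_mero c) w = c"
proof -
  have "ev (const_mero c) = (\<lambda>_. c)"
    unfolding const_mero_def by (simp add: ev_mk_mero remove_sings_nicely nicely_meromorphic_on_const meromorphic_on_const)
  thus ?thesis by simp
qed

lemma const_mero_simps: "const_mero 0 = 0" "const_mero 1 = 1" "const_mero (a + b) = const_mero a + const_mero b"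
  "const_mero (a * b) = const_mero a * const_mero b" "shift_mero d (const_mero a) = const_mero a"
  "const_mero (- a) = - const_mero a"
proof -
  show "const_mero 0 = 0" "const_mero 1 = 1" "shift_mero d (const_mero a) = const_mero a" by (rule mero_eqI, simp)+
  show "const_mero (a + b) = const_mero a + const_mero b"
    by (rule mero_eqI, use ev_add[of "const_mero a" "const_mero b"] in eventually_elim) simp
  show "const_mero (a * b) = const_mero a * const_mero b"
    by (rule mero_eqI, use ev_mult[of "const_mero a" "const_mero b"] in eventually_elim) simp
  show "const_mero (- a) = - const_mero a"
    by (rule mero_eqI, use ev_uminus[of "const_mero a"] in eventually_elim) simp
qed

lemma const_mero_eq_0_iff [simp]: "const_mero c = 0 \<longleftrightarrow> c = 0"
proof
  assume "const_mero c = 0"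
  hence "ev (const_mero c) 0 = ev 0 0" by simp
  thus "c = 0" by simp
qed (simp add: const_mero_simps)

subsection \<open>Rational functions of the exponential\<close>

lemma exp_poly_meromorphic: "(\<lambda>w. poly p (exp w)) meromorphic_on A"
  by (induction p) (auto intro!: meromorphic_on_add meromorphic_on_mult analytic_on_imp_meromorphic_on[of exp] analytic_intros)

text \<open>The exponential takes all nonzero values, so a vanishing \<open>poly p (exp w)\<close>
  would give \<open>p\<close> infinitely many roots.\<close>

lemma poly_exp_nonzero:
  assumes "p \<noteq> 0"
  shows "\<forall>\<^sub>\<approx>w\<in>UNIV. poly p (exp w) \<noteq> (0 :: complex)"
proof (rule ccontr)
  assume "\<not> ?thesis"
  hence ev0: "\<forall>\<^sub>\<approx>w\<in>UNIV. poly p (exp w) = 0"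
    using meromorphic_imp_constant_or_avoid[OF exp_poly_meromorphic[of p UNIV], of 0] by auto
  have all: "poly p (exp w) = 0" for w
  proof -
    have "(\<lambda>w. poly p (exp w)) \<midarrow>w\<rightarrow> poly p (exp w)"
      by (intro tendsto_intros)
    moreover have "(\<lambda>w. poly p (exp w)) \<midarrow>w\<rightarrow> 0"
      using ev0 by (intro tendsto_eventually) (auto simp: generic_iff)
    ultimately show ?thesis by (metis LIM_unique)
  qed
  have "poly p x = 0" if "x \<noteq> 0" for x using all[of "Ln x"] that by simp
  hence "- {0} \<subseteq> {x. poly p x = 0}" by auto
  moreover have "infinite (- {0 :: complex})" by (simp add: infinite_UNIV_char_0)
  ultimately show False using poly_roots_finite[OF assms] finite_subset by blast
qed

lemma poly_embedding_exp: "poly_embedding (\<lambda>p. mk_mero (\<lambda>w. poly p (exp w)))"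
proof
  note gen = ev_mk_mero_generic[OF exp_poly_meromorphic]
  fix p q :: "complex poly"
  show "mk_mero (\<lambda>w. poly (p + q) (exp w)) = mk_mero (\<lambda>w. poly p (exp w)) + mk_mero (\<lambda>w. poly q (exp w))"
    by (rule mero_eqI, use gen[of "p + q"] gen[of p] gen[of q] ev_add[of "mk_mero (\<lambda>w. poly p (exp w))" "mk_mero (\<lambda>w. poly q (exp w))"]
        in eventually_elim) simp
  show "mk_mero (\<lambda>w. poly (p * q) (exp w)) = mk_mero (\<lambda>w. poly p (exp w)) * mk_mero (\<lambda>w. poly q (exp w))"
    by (rule mero_eqI, use gen[of "p * q"] gen[of p] gen[of q] ev_mult[of "mk_mero (\<lambda>w. poly p (exp w))" "mk_mero (\<lambda>w. poly q (exp w))"]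
        in eventually_elim) simp
  show "mk_mero (\<lambda>w. poly 1 (exp w)) = 1"
    by (rule mero_eqI, use gen[of 1] in eventually_elim) simp
  assume "p \<noteq> 0"
  show "mk_mero (\<lambda>w. poly p (exp w)) \<noteq> 0"
  proof
    assume eq: "mk_mero (\<lambda>w. poly p (exp w)) = 0"
    have "\<forall>\<^sub>\<approx>w\<in>(UNIV :: complex set). False"
      using gen[of p] poly_exp_nonzero[OF \<open>p \<noteq> 0\<close>] by eventually_elim (simp add: eq)
    thus False by (simp add: generic_iff)
  qed
qed

interpretation exp_ratfun: poly_embedding "\<lambda>p. mk_mero (\<lambda>w. poly p (exp w))"
  by (rule poly_embedding_exp)

lemma ev_exp_ratfun: "\<forall>\<^sub>\<approx>w\<in>UNIV. ev (exp_ratfun.lift r) w = ratfun_eval r (exp w)"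
proof -
  define a b where "a = fst (quot_of_fract r)" and "b = snd (quot_of_fract r)"
  show ?thesis
    using ev_mk_mero_generic[OF exp_poly_meromorphic, of a] ev_mk_mero_generic[OF exp_poly_meromorphic, of b]
      ev_divide[of "mk_mero (\<lambda>w. poly a (exp w))" "mk_mero (\<lambda>w. poly b (exp w))"]
    by eventually_elim (simp add: exp_ratfun.lift_def ratfun_eval_def case_prod_unfold flip: a_def b_def)
qed

lemma exp_ratfun_const: "exp_ratfun.lift (pfrac [:c:]) = const_mero c"
proof -
  have "mk_mero (\<lambda>w. poly [:c:] (exp w)) = const_mero c" by (simp add: const_mero_def)
  moreover have "mk_mero (\<lambda>w. poly 1 (exp w)) = 1" by (rule exp_ratfun.one)
  ultimately show ?thesis by simp
qed

lemma shift_exp_ratfun: "shift_mero l (exp_ratfun.lift r) = exp_ratfun.lift (dil (exp l) r)"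
proof (cases r)
  case (Fract a b)
  have *: "shift_mero l (mk_mero (\<lambda>w. poly p (exp w))) = mk_mero (\<lambda>w. poly (pcompose p [:0, exp l:]) (exp w))" for p
    by (rule mero_eqI, use generic_shift[OF ev_mk_mero_generic[OF exp_poly_meromorphic, of p], of l]
        ev_mk_mero_generic[OF exp_poly_meromorphic, of "pcompose p [:0, exp l:]"] in eventually_elim)
       (simp add: poly_pcompose exp_add mult.commute)
  show ?thesis using Fract by (simp add: dil_Fract pcompose_linear_nonzero shift_mero_divide *)
qed

text \<open>In the chart \<open>w = log x\<close> the rational functions act through
  \<open>exp w\<close> and the multiplication of \<open>x\<close> by \<open>exp l\<close> becomes
  the translation by \<open>l\<close>.\<close>

lemma qdiff_mero:
  assumes "\<not> root_of_unity (exp l1)" "\<not> root_of_unity (exp l2)" "mult_independent (exp l1) (exp l2)"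
  shows "qdiff (\<lambda>r F. exp_ratfun.lift r * F) (shift_mero l1) (shift_mero l2) (exp l1) (exp l2)"
  by standard (use assms in \<open>auto simp: algebra_simps shift_mero_add shift_mero_mult shift_exp_ratfun\<close>)

subsection \<open>A theta function\<close>

text \<open>The infinite q-Pochhammer symbol, entire in \<open>z\<close> for
  \<open>norm q < 1\<close>.\<close>

definition qpoch :: "complex \<Rightarrow> complex \<Rightarrow> complex" where
  "qpoch q z = (\<Prod>n. 1 - q ^ n * z)"

context
  fixes q :: complex
  assumes q: "norm q < 1"
begin

lemma qpoch_summable: "summable (\<lambda>n. norm q ^ n * R)"
  using q by (intro summable_mult2 summable_geometric) simp

lemma qpoch_has_prod: "(\<lambda>n. 1 - q ^ n * z) has_prod qpoch q z"
proof -
  have "summable (\<lambda>n. norm (1 - q ^ n * z - 1))"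
    using qpoch_summable[of "norm z"] by (simp add: norm_mult norm_power)
  hence "convergent_prod (\<lambda>n. 1 - q ^ n * z)"
    by (intro abs_convergent_prod_imp_convergent_prod summable_imp_abs_convergent_prod)
  thus ?thesis unfolding qpoch_def by (rule convergent_prod_has_prod)
qed

lemma qpoch_LIMSEQ: "(\<lambda>N. \<Prod>n<N. 1 - q ^ n * z) \<longlonglongrightarrow> qpoch q z"
  using has_prod_imp_tendsto'[OF qpoch_has_prod] .

lemma qpoch_eq_0_iff: "qpoch q z = 0 \<longleftrightarrow> (\<exists>n. q ^ n * z = 1)"
  using has_prod_eq_0_iff[OF qpoch_has_prod, of z] by (auto simp: image_iff)

lemma qpoch_step: "qpoch q z = (1 - z) * qpoch q (q * z)"
proof (rule LIMSEQ_unique)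
  show "(\<lambda>N. \<Prod>n<Suc N. 1 - q ^ n * z) \<longlonglongrightarrow> qpoch q z"
    by (rule LIMSEQ_Suc[OF qpoch_LIMSEQ])
  have "(\<Prod>n<Suc N. 1 - q ^ n * z) = (1 - z) * (\<Prod>n<N. 1 - q ^ n * (q * z))" for N
    by (subst prod.lessThan_Suc_shift) (simp add: mult_ac)
  thus "(\<lambda>N. \<Prod>n<Suc N. 1 - q ^ n * z) \<longlonglongrightarrow> (1 - z) * qpoch q (q * z)"
    using tendsto_mult[OF tendsto_const[of "1 - z"] qpoch_LIMSEQ[of "q * z"]] by (simp only:)
qed

lemma qpoch_holomorphic: "qpoch q holomorphic_on UNIV"
proof (rule holomorphic_uniform_sequence[where f = "\<lambda>N z. \<Prod>n<N. 1 - q ^ n * z"])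
  fix x :: complex
  have "uniformly_convergent_on (cball x 1) (\<lambda>N z. \<Prod>n<N. 1 - q ^ n * z)"
  proof (rule uniformly_convergent_on_prod')
    show "uniformly_convergent_on (cball x 1) (\<lambda>N z. \<Sum>n<N. norm (1 - q ^ n * z - 1))"
    proof (rule Weierstrass_m_test')
      fix n z assume "z \<in> cball x 1"
      hence "norm z \<le> norm x + 1"
        by (metis add.commute dist_norm dist_commute mem_cball norm_triangle_sub order_trans add_le_cancel_right add_right_mono)
      thus "norm (norm (1 - q ^ n * z - 1)) \<le> norm q ^ n * (norm x + 1)"
        by (simp add: norm_mult norm_power mult_left_mono)
    qed (rule qpoch_summable)
  qed (auto intro!: continuous_intros)
  then obtain l where l: "uniform_limit (cball x 1) (\<lambda>N z. \<Prod>n<N. 1 - q ^ n * z) l sequentially"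
    by (auto simp: uniformly_convergent_on_def)
  have "l z = qpoch q z" if "z \<in> cball x 1" for z
    using tendsto_uniform_limitI[OF l that] qpoch_LIMSEQ LIMSEQ_unique by blast
  hence "uniform_limit (cball x 1) (\<lambda>N z. \<Prod>n<N. 1 - q ^ n * z) (qpoch q) sequentially"
    using l by (metis (no_types, lifting) uniform_limit_cong')
  thus "\<exists>d>0. cball x d \<subseteq> UNIV \<and> uniform_limit (cball x d) (\<lambda>N z. \<Prod>n<N. 1 - q ^ n * z) (qpoch q) sequentially"
    by (intro exI[of _ 1]) auto
qed (auto intro!: holomorphic_intros)

end

definition lattice_pts :: "complex \<Rightarrow> complex set" where
  "lattice_pts \<alpha> = {of_int m + of_int n * \<alpha> | m n. True}"

lemma lattice_pts_uminus: "lattice_pts (- \<alpha>) = lattice_pts \<alpha>"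
proof -
  have "lattice_pts (- \<alpha>) \<subseteq> lattice_pts \<alpha>" for \<alpha>
  proof
    fix z assume "z \<in> lattice_pts (- \<alpha>)"
    then obtain m n where "z = of_int m + of_int n * (- \<alpha>)" by (auto simp: lattice_pts_def)
    hence "z = of_int m + of_int (- n) * \<alpha>" by simp
    thus "z \<in> lattice_pts \<alpha>" unfolding lattice_pts_def by blast
  qed
  from this[of \<alpha>] this[of "- \<alpha>"] show ?thesis by auto
qed

text \<open>This is the product side of the Jacobi triple product without its constant factor, with
  \<open>e t\<close> and \<open>q\<close> the exponentials of \<open>2 \<pi> i t\<close> and
  \<open>2 \<pi> i \<tau>\<close>. Quasi-periodicity and reflection both come from the functional
  equation \<open>qpoch_step\<close>.\<close>

lemma theta_exists_upper:
  assumes \<tau>: "Im \<tau> > 0"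
  obtains \<theta> where "\<theta> holomorphic_on UNIV" "\<And>t. \<theta> (t + 1) = \<theta> t"
    "\<And>t. \<theta> (t + \<tau>) = - exp (- 2 * pi * \<i> * t) * \<theta> t" "\<And>t. \<theta> (- t) = - exp (- 2 * pi * \<i> * t) * \<theta> t"
    "\<And>t. \<theta> t = 0 \<longleftrightarrow> t \<in> lattice_pts \<tau>" "deriv \<theta> 0 \<noteq> 0"
proof -
  define q where "q = exp (2 * pi * \<i> * \<tau>)"
  define e where "e t = exp (2 * pi * \<i> * t)" for t
  have q: "norm q < 1" using \<tau> by (simp add: q_def)
  have q0: "q \<noteq> 0" by (simp add: q_def)
  have e0: "e t \<noteq> 0" for t by (simp add: e_def)
  have e1: "e (t + 1) = e t" for t
    using exp_two_pi_i by (simp add: e_def ring_distribs exp_add mult.commute)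
  have e\<tau>: "e (t + \<tau>) = q * e t" for t by (simp add: e_def q_def ring_distribs exp_add)
  have em: "e (- t) = 1 / e t" for t by (simp add: e_def exp_minus field_simps)
  define \<theta> where "\<theta> t = qpoch q (e t) * qpoch q (q / e t)" for t
  have step: "qpoch q (1 / e t) = (1 - 1 / e t) * qpoch q (q / e t)" for t
    using qpoch_step[OF q, of "1 / e t"] by simp
  have minus: "qpoch q (1 / e t) * qpoch q (q * e t) = - (1 / e t) * \<theta> t" for t
    unfolding \<theta>_def step qpoch_step[OF q, of "e t"] using e0[of t] by (simp add: field_simps)
  have hol: "(\<lambda>t. qpoch q (f t)) holomorphic_on UNIV" if "f holomorphic_on UNIV" for f
    using holomorphic_on_compose_gen[OF that qpoch_holomorphic[OF q]] by (simp add: o_def)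
  have e_hol: "e holomorphic_on UNIV" unfolding e_def by (intro holomorphic_intros)
  have \<theta>_hol: "\<theta> holomorphic_on UNIV"
    unfolding \<theta>_def by (intro holomorphic_intros hol e_hol) (auto simp: e0)
  \<comment> \<open>Splitting off the factor \<open>1 - e t\<close>, which vanishes at 0, reduces
    the derivative there to \<open>g 0\<close>, the square of \<open>qpoch q q\<close>.\<close>
  define g where "g t = qpoch q (q * e t) * qpoch q (q / e t)" for t
  have g_hol: "g holomorphic_on UNIV"
    unfolding g_def by (intro holomorphic_intros hol e_hol) (auto simp: e0)
  have \<theta>_g: "\<theta> = (\<lambda>t. (1 - e t) * g t)"
    by (simp add: fun_eq_iff \<theta>_def g_def qpoch_step[OF q, of "e _"] mult.assoc)
  have "(\<theta> has_field_derivative - (2 * pi * \<i>) * g 0) (at 0)"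
    unfolding \<theta>_g e_def
    by (rule derivative_eq_intros refl holomorphic_derivI[OF g_hol])+ auto
  hence d: "deriv \<theta> 0 = - (2 * pi * \<i>) * g 0" by (rule DERIV_imp_deriv)
  have "qpoch q q \<noteq> 0"
  proof
    assume "qpoch q q = 0"
    then obtain n where "q ^ n * q = 1" using qpoch_eq_0_iff[OF q] by blast
    hence "norm q ^ Suc n = 1" by (metis norm_one norm_power power_Suc2)
    moreover have "norm q ^ Suc n < 1" using q by (intro power_Suc_less_one) (auto simp: q0)
    ultimately show False by simp
  qed
  hence g0: "g 0 \<noteq> 0" by (simp add: g_def e_def)
  \<comment> \<open>Nonnegative exponents describe the zeros of the first factor and negative ones
    those of the second; together they form the lattice.\<close>
  have int: "e t * q powi n = 1 \<longleftrightarrow> (\<exists>m. t = of_int m + of_int (- n) * \<tau>)" for t n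
  proof -
    have "e t * q powi n = exp (2 * pi * \<i> * (t + of_int n * \<tau>))"
      by (simp add: e_def q_def exp_add ring_distribs exp_power_int mult_ac)
    also have "\<dots> = 1 \<longleftrightarrow> (\<exists>m. t + of_int n * \<tau> = of_int m)"
    proof
      assume "exp (2 * pi * \<i> * (t + of_int n * \<tau>)) = 1"
      then obtain m :: int where m: "Re (2 * pi * \<i> * (t + of_int n * \<tau>)) = 0"
          "Im (2 * pi * \<i> * (t + of_int n * \<tau>)) = of_int (2 * m) * pi"
        unfolding exp_eq_1 by blast
      have "2 * pi * \<i> * (t + of_int n * \<tau>) = 2 * pi * \<i> * of_int m"
        by (rule complex_eqI) (unfold m, simp_all)
      thus "\<exists>m. t + of_int n * \<tau> = of_int m" by auto
    next
      assume "\<exists>m. t + of_int n * \<tau> = of_int m"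
      then obtain m where "t + of_int n * \<tau> = of_int m" by blast
      thus "exp (2 * pi * \<i> * (t + of_int n * \<tau>)) = 1"
        using exp_integer_2pi[of "of_int m"] by (simp add: mult_ac)
    qed
    finally show ?thesis by (simp add: algebra_simps)
  qed
  have zeros: "\<theta> t = 0 \<longleftrightarrow> t \<in> lattice_pts \<tau>" for t
  proof -
    have "\<theta> t = 0 \<longleftrightarrow> (\<exists>n. q ^ n * e t = 1) \<or> (\<exists>n. q ^ n * (q / e t) = 1)"
      by (simp add: \<theta>_def qpoch_eq_0_iff[OF q])
    also have "(\<exists>n. q ^ n * (q / e t) = 1) \<longleftrightarrow> (\<exists>n. e t * q powi (- int (Suc n)) = 1)"
    proof -
      have "q ^ n * (q / e t) = 1 \<longleftrightarrow> e t * q powi (- int (Suc n)) = 1" for n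
      proof -
        have "q powi (- int (Suc n)) = inverse (q ^ n * q)"
          unfolding power_int_minus power_int_of_nat power_Suc2 ..
        moreover have "e t * inverse (q ^ n * q) = 1 \<longleftrightarrow> e t = q ^ n * q"
          using q0 by (simp add: field_simps)
        moreover have "q ^ n * (q / e t) = 1 \<longleftrightarrow> q ^ n * q = e t"
          using e0[of t] by (simp add: field_simps)
        ultimately show ?thesis by auto
      qed
      thus ?thesis by simp
    qed
    also have "(\<exists>n. q ^ n * e t = 1) \<longleftrightarrow> (\<exists>n. e t * q powi (int n) = 1)"
      by (simp add: mult.commute)
    also have "(\<exists>n. e t * q powi (int n) = 1) \<or> (\<exists>n. e t * q powi (- int (Suc n)) = 1) \<longleftrightarrow> (\<exists>n::int. e t * q powi n = 1)"
      by (metis int_cases)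
    also have "\<dots> \<longleftrightarrow> t \<in> lattice_pts \<tau>"
    proof
      assume "\<exists>n. e t * q powi n = 1"
      thus "t \<in> lattice_pts \<tau>" unfolding int lattice_pts_def by blast
    next
      assume "t \<in> lattice_pts \<tau>"
      then obtain m n where "t = of_int m + of_int n * \<tau>" unfolding lattice_pts_def by blast
      hence "t = of_int m + of_int (- (- n)) * \<tau>" by simp
      thus "\<exists>n. e t * q powi n = 1" unfolding int by blast
    qed
    finally show ?thesis .
  qed
  show thesis
  proof (rule that[OF \<theta>_hol _ _ _ zeros])
    show "\<theta> (t + 1) = \<theta> t" for t by (simp add: \<theta>_def e1)
    have ee: "exp (- 2 * pi * \<i> * t) = 1 / e t" for t by (simp add: e_def exp_minus field_simps)
    show "\<theta> (t + \<tau>) = - exp (- 2 * pi * \<i> * t) * \<theta> t" for t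
      unfolding ee using minus[of t] q0 by (simp add: \<theta>_def e\<tau> mult.commute)
    show "\<theta> (- t) = - exp (- 2 * pi * \<i> * t) * \<theta> t" for t
      unfolding ee using minus[of t] by (simp add: \<theta>_def em)
  qed (use d g0 in auto)
qed

text \<open>For \<open>\<alpha>\<close> in the lower half plane the theta function of
  \<open>- \<alpha>\<close> has the same zeros. Both signs are covered by a multiplier
  \<open>exp (m * t + k)\<close>, and \<open>m \<noteq> 0\<close> is what becomes Legendre's
  relation.\<close>

lemma theta_exists:
  assumes \<alpha>: "\<alpha> \<notin> \<real>"
  obtains \<theta> m k where "\<theta> holomorphic_on UNIV" "\<And>t. \<theta> (t + 1) = \<theta> t"
    "\<And>t. \<theta> (t + \<alpha>) = exp (m * t + k) * \<theta> t" "m \<noteq> 0" "\<And>t. \<theta> (- t) = - exp (- 2 * pi * \<i> * t) * \<theta> t"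
    "\<And>t. \<theta> t = 0 \<longleftrightarrow> t \<in> lattice_pts \<alpha>" "deriv \<theta> 0 \<noteq> 0"
proof -
  have minus_exp: "- exp z = exp (z + pi * \<i>)" for z :: complex by (simp add: exp_add)
  have "Im \<alpha> > 0 \<or> Im (- \<alpha>) > 0" using \<alpha> by (auto simp: complex_is_Real_iff)
  then consider "Im \<alpha> > 0" | "Im (- \<alpha>) > 0" by blast
  thus thesis
  proof cases
    case 1
    obtain \<theta> where \<theta>: "\<theta> holomorphic_on UNIV" "\<And>t. \<theta> (t + 1) = \<theta> t"
      "\<And>t. \<theta> (t + \<alpha>) = - exp (- 2 * pi * \<i> * t) * \<theta> t" "\<And>t. \<theta> (- t) = - exp (- 2 * pi * \<i> * t) * \<theta> t"
      "\<And>t. \<theta> t = 0 \<longleftrightarrow> t \<in> lattice_pts \<alpha>" "deriv \<theta> 0 \<noteq> 0"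
      using theta_exists_upper[OF 1] by metis
    have "\<theta> (t + \<alpha>) = exp (- 2 * pi * \<i> * t + pi * \<i>) * \<theta> t" for t
      unfolding \<theta>(3) minus_exp ..
    thus thesis by (rule that[OF \<theta>(1,2) _ _ \<theta>(4-6)]) auto
  next
    case 2
    obtain \<theta> where \<theta>: "\<theta> holomorphic_on UNIV" "\<And>t. \<theta> (t + 1) = \<theta> t"
      "\<And>t. \<theta> (t + - \<alpha>) = - exp (- 2 * pi * \<i> * t) * \<theta> t" "\<And>t. \<theta> (- t) = - exp (- 2 * pi * \<i> * t) * \<theta> t"
      "\<And>t. \<theta> t = 0 \<longleftrightarrow> t \<in> lattice_pts (- \<alpha>)" "deriv \<theta> 0 \<noteq> 0"
      using theta_exists_upper[OF 2] by metis
    have "\<theta> (t + \<alpha>) = exp (2 * pi * \<i> * t + (2 * pi * \<i> * \<alpha> + pi * \<i>)) * \<theta> t" for t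
    proof -
      have "\<theta> t = - exp (- 2 * pi * \<i> * (t + \<alpha>)) * \<theta> (t + \<alpha>)" using \<theta>(3)[of "t + \<alpha>"] by simp
      moreover have "exp (2 * pi * \<i> * t + (2 * pi * \<i> * \<alpha> + pi * \<i>)) = - exp (2 * pi * \<i> * (t + \<alpha>))"
        unfolding minus_exp by (simp add: algebra_simps)
      moreover have "exp (2 * pi * \<i> * (t + \<alpha>)) * exp (- 2 * pi * \<i> * (t + \<alpha>)) = 1"
        by (simp flip: exp_add)
      ultimately show ?thesis by (simp add: mult.assoc[symmetric])
    qed
    thus thesis by (rule that[OF \<theta>(1,2) _ _ \<theta>(4) _ \<theta>(6)]) (use \<theta>(5) in \<open>auto simp: lattice_pts_uminus\<close>)
  qed
qed

subsection \<open>The sigma function\<close>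

lemma lattice_pts_countable: "countable (lattice_pts \<alpha>)"
proof -
  have "lattice_pts \<alpha> \<subseteq> range (\<lambda>p :: int \<times> int. of_int (fst p) + of_int (snd p) * \<alpha>)"
  proof
    fix z assume "z \<in> lattice_pts \<alpha>"
    then obtain m n where "z = of_int m + of_int n * \<alpha>" unfolding lattice_pts_def by blast
    hence "z = of_int (fst (m, n)) + of_int (snd (m, n)) * \<alpha>" by simp
    thus "z \<in> range (\<lambda>p :: int \<times> int. of_int (fst p) + of_int (snd p) * \<alpha>)" by (rule range_eqI)
  qed
  thus ?thesis by (rule countable_subset) simp
qed

lemma entire_quotient_at_0:
  fixes f :: "complex \<Rightarrow> complex"
  assumes "f holomorphic_on UNIV" "f 0 = 0"
  obtains h where "h holomorphic_on UNIV" "\<And>t. f t = t * h t" "h 0 = deriv f 0"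
proof -
  define h where "h z = (if z = 0 then deriv f 0 else f z / z)" for z
  have "(\<lambda>z. if z = 0 then deriv f 0 else (f z - f 0) / (z - 0)) holomorphic_on UNIV"
    using pole_lemma[OF assms(1), of 0] by simp
  hence "h holomorphic_on UNIV" using assms(2) by (simp add: h_def[abs_def] cong: if_cong)
  thus thesis by (rule that) (auto simp: h_def assms)
qed

text \<open>The theta function is corrected by exponentials. The factor
  \<open>exp (- (pi * \<i> * t))\<close> makes it odd, division by the derivative at 0 normalizes
  it, and the Gaussian factor is chosen so that the second derivative of \<open>H = S / t\<close>
  vanishes at 0, which will remove the constant term of the Weierstrass function. The Gaussian
  cancels from \<open>u2 - \<alpha> * u1\<close>, which equals the \<open>m\<close> of the theta
  function.\<close>

lemma sigma_exists:
  assumes \<alpha>: "\<alpha> \<notin> \<real>"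
  obtains S H u1 v1 u2 v2 where "S holomorphic_on UNIV" "H holomorphic_on UNIV" "\<And>t. S t = t * H t"
    "H 0 = 1" "deriv H 0 = 0" "deriv (deriv H) 0 = 0" "\<And>t. S (- t) = - S t"
    "\<And>t. S t = 0 \<longleftrightarrow> t \<in> lattice_pts \<alpha>"
    "\<And>t. S (t + 1) = exp (u1 * t + v1) * S t" "\<And>t. S (t + \<alpha>) = exp (u2 * t + v2) * S t" "u2 - \<alpha> * u1 \<noteq> 0"
proof -
  obtain \<theta> m k where \<theta>: "\<theta> holomorphic_on UNIV" "\<And>t. \<theta> (t + 1) = \<theta> t"
    "\<And>t. \<theta> (t + \<alpha>) = exp (m * t + k) * \<theta> t" "m \<noteq> 0" "\<And>t. \<theta> (- t) = - exp (- 2 * pi * \<i> * t) * \<theta> t"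
    "\<And>t. \<theta> t = 0 \<longleftrightarrow> t \<in> lattice_pts \<alpha>" "deriv \<theta> 0 \<noteq> 0"
    by (rule theta_exists[OF \<alpha>]) (rule that)
  define S0 where "S0 t = exp (- (pi * \<i> * t)) * \<theta> t / deriv \<theta> 0" for t
  have S0_hol: "S0 holomorphic_on UNIV" unfolding S0_def by (intro holomorphic_intros \<theta>(1)) (use \<theta>(7) in auto)
  have "0 = of_int 0 + of_int 0 * \<alpha>" by simp
  hence "0 \<in> lattice_pts \<alpha>" unfolding lattice_pts_def by blast
  hence \<theta>0: "\<theta> 0 = 0" using \<theta>(6) by blast
  hence S00: "S0 0 = 0" by (simp add: S0_def)
  define c where "c = deriv \<theta> 0"
  have c: "(\<theta> has_field_derivative c) (at 0)" "c \<noteq> 0"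
    using holomorphic_derivI[OF \<theta>(1)] \<theta>(7) by (auto simp: c_def)
  have "(S0 has_field_derivative 1) (at 0)"
    unfolding S0_def c_def[symmetric]
    by (rule derivative_eq_intros refl c)+ (use \<theta>0 c(2) in auto)
  hence dS0: "deriv S0 0 = 1" by (rule DERIV_imp_deriv)
  have S0_odd: "S0 (- t) = - S0 t" for t
  proof -
    have "exp (pi * \<i> * t) * exp (- 2 * pi * \<i> * t) = exp (- (pi * \<i> * t))"
      by (simp add: mult_ac flip: exp_add)
    hence "exp (pi * \<i> * t) * (exp (- 2 * pi * \<i> * t) * \<theta> t) = exp (- (pi * \<i> * t)) * \<theta> t"
      by (simp only: mult.assoc[symmetric])
    thus ?thesis by (simp add: S0_def \<theta>(5))
  qed
  obtain H0 where H0': "H0 holomorphic_on UNIV" "\<And>t. S0 t = t * H0 t" "H0 0 = deriv S0 0"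
    by (rule entire_quotient_at_0[OF S0_hol S00]) (rule that)
  note H0 = H0'(1,2) H0'(3)[unfolded dS0]
  define a where "a = - deriv (deriv H0) 0"
  define E where "E t = exp (a / 2 * t ^ 2)" for t
  define S where "S t = E t * S0 t" for t
  define H where "H t = E t * H0 t" for t
  have E_deriv: "(E has_field_derivative a * t * E t) (at t)" for t
    unfolding E_def by (rule derivative_eq_intros refl)+ (simp add: power2_eq_square field_simps)
  have E_hol: "E holomorphic_on UNIV" unfolding E_def by (intro holomorphic_intros)
  have H0': "(H0 has_field_derivative deriv H0 t) (at t)" for t
    using holomorphic_derivI[OF H0(1)] by auto
  have H0'_hol: "deriv H0 holomorphic_on UNIV" by (intro holomorphic_deriv H0) auto
  have H0'': "(deriv H0 has_field_derivative deriv (deriv H0) t) (at t)" for t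
    using holomorphic_derivI[OF H0'_hol] by auto
  have H_deriv: "deriv H = (\<lambda>t. a * t * E t * H0 t + E t * deriv H0 t)"
    unfolding H_def[abs_def]
    by (intro ext DERIV_imp_deriv) (rule derivative_eq_intros refl E_deriv H0' | simp add: algebra_simps)+
  have H_hol: "H holomorphic_on UNIV" unfolding H_def by (intro holomorphic_intros E_hol H0)
  have E0: "E 0 = 1" by (simp add: E_def)
  have H_even: "H (- t) = H t" for t
  proof -
    have *: "H0 (- t) = H0 t" if "t \<noteq> 0" for t
      using S0_odd[of t] H0(2)[of t] H0(2)[of "- t"] that by simp
    have "H0 (- t) = H0 t" by (cases "t = 0") (auto simp: *)
    thus ?thesis by (simp add: H_def E_def)
  qed
  have dH: "(H has_field_derivative deriv H 0) (at 0)" using holomorphic_derivI[OF H_hol] by auto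
  have "((\<lambda>t. H (- t)) has_field_derivative - deriv H 0) (at 0)"
  proof -
    have "(uminus has_field_derivative (- 1 :: complex)) (at 0)" by (auto intro!: derivative_eq_intros)
    thus ?thesis using DERIV_chain2[of H "deriv H 0" uminus 0 "-1" UNIV] dH by simp
  qed
  hence "(H has_field_derivative - deriv H 0) (at 0)" unfolding H_even .
  hence "deriv H 0 = - deriv H 0" using DERIV_unique dH by blast
  hence dH0: "deriv H 0 = 0" by simp
  have "(deriv H has_field_derivative a + deriv (deriv H0) 0) (at 0)"
    unfolding H_deriv
    by (rule derivative_eq_intros refl E_deriv H0' H0'' | simp add: E0 H0)+
  hence ddH0: "deriv (deriv H) 0 = 0" by (simp add: DERIV_imp_deriv a_def)
  show thesis
  proof (rule that[of S H a "a / 2 - pi * \<i>" "a * \<alpha> + m" "a / 2 * \<alpha> ^ 2 + k - pi * \<i> * \<alpha>"])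
    show "S holomorphic_on UNIV" unfolding S_def by (intro holomorphic_intros E_hol S0_hol)
    show "S t = t * H t" for t by (simp add: S_def H_def H0)
    show "H 0 = 1" by (simp add: H_def E0 H0)
    show "S (- t) = - S t" for t by (simp add: S_def E_def S0_odd)
    show "S t = 0 \<longleftrightarrow> t \<in> lattice_pts \<alpha>" for t using \<theta>(7) by (simp add: S_def E_def S0_def \<theta>(6))
    show "S (t + 1) = exp (a * t + (a / 2 - pi * \<i>)) * S t" for t
    proof -
      have "exp (a / 2 * (t + 1) ^ 2) * exp (- (pi * \<i> * (t + 1))) =
          exp (a * t + (a / 2 - pi * \<i>)) * (exp (a / 2 * t ^ 2) * exp (- (pi * \<i> * t)))"
        unfolding exp_add[symmetric] by (rule arg_cong[of _ _ exp]) (simp add: power2_eq_square field_simps)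
      thus ?thesis unfolding S_def E_def S0_def \<theta>(2) by (simp add: mult.assoc[symmetric])
    qed
    show "S (t + \<alpha>) = exp ((a * \<alpha> + m) * t + (a / 2 * \<alpha> ^ 2 + k - pi * \<i> * \<alpha>)) * S t" for t
    proof -
      have "exp (a / 2 * (t + \<alpha>) ^ 2) * exp (- (pi * \<i> * (t + \<alpha>))) * exp (m * t + k) =
          exp ((a * \<alpha> + m) * t + (a / 2 * \<alpha> ^ 2 + k - pi * \<i> * \<alpha>)) * (exp (a / 2 * t ^ 2) * exp (- (pi * \<i> * t)))"
      proof -
        define b where "b = a / 2"
        have "a = 2 * b" by (simp add: b_def)
        thus ?thesis
          unfolding exp_add[symmetric] by (intro arg_cong[of _ _ exp]) (simp add: power2_eq_square algebra_simps)
      qed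
      thus ?thesis unfolding S_def E_def S0_def \<theta>(3) by (simp add: mult.assoc[symmetric])
    qed
  qed (use H_hol dH0 ddH0 \<theta>(4) in auto)
qed

subsection \<open>Periodic functions\<close>

lemma lattice_pts_0: "0 \<in> lattice_pts \<alpha>"
proof -
  have "0 = of_int 0 + of_int 0 * \<alpha>" by simp
  thus ?thesis unfolding lattice_pts_def by blast
qed

lemma periodic_of_int:
  fixes g :: "complex \<Rightarrow> 'a"
  assumes "\<And>t. g (t + p) = g t"
  shows "g (t + of_int n * p) = g t"
proof (induction n)
  case (nonneg n)
  show ?case
  proof (induction n)
    case (Suc n)
    have "t + of_int (int (Suc n)) * p = (t + of_int (int n) * p) + p" by (simp add: ring_distribs)
    also have "g \<dots> = g (t + of_int (int n) * p)" by (rule assms)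
    also have "\<dots> = g t" by (rule Suc)
    finally show ?case .
  qed simp
next
  case (neg n)
  show ?case
  proof (induction n)
    case 0
    have "g (t - p) = g (t - p + p)" by (rule assms[symmetric])
    thus ?case by simp
  next
    case (Suc n)
    define s where "s = t + of_int (- int (Suc (Suc n))) * p"
    have "g s = g (s + p)" by (rule assms[symmetric])
    also have "s + p = t + of_int (- int (Suc n)) * p" by (simp add: s_def ring_distribs)
    also have "g \<dots> = g t" by (rule Suc)
    finally show ?case unfolding s_def .
  qed
qed

lemma periodic_lattice:
  fixes g :: "complex \<Rightarrow> 'a"
  assumes "\<And>t. g (t + 1) = g t" "\<And>t. g (t + \<alpha>) = g t" "\<mu> \<in> lattice_pts \<alpha>"
  shows "g (t + \<mu>) = g t"
proof -
  obtain m n where \<mu>: "\<mu> = of_int m + of_int n * \<alpha>" using assms(3) by (auto simp: lattice_pts_def)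
  have "g (t + \<mu>) = g (t + of_int m * 1 + of_int n * \<alpha>)" by (simp add: \<mu> add.assoc)
  also have "\<dots> = g (t + of_int m * 1)" by (rule periodic_of_int) (rule assms)
  also have "\<dots> = g t" by (rule periodic_of_int) (rule assms)
  finally show ?thesis .
qed

definition half_parallelogram :: "complex \<Rightarrow> complex set" where
  "half_parallelogram \<alpha> = (\<lambda>(a, b). of_real a + of_real b * \<alpha>) ` ({- 1 / 2..1 / 2} \<times> {- 1 / 2..1 / 2})"

lemma half_parallelogramI: "\<bar>a\<bar> \<le> 1 / 2 \<Longrightarrow> \<bar>b\<bar> \<le> 1 / 2 \<Longrightarrow> of_real a + of_real b * \<alpha> \<in> half_parallelogram \<alpha>"
  unfolding half_parallelogram_def by (rule image_eqI[of _ _ "(a, b)"]) (simp, auto)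

lemma half_parallelogramE:
  assumes "z \<in> half_parallelogram \<alpha>"
  obtains a b where "\<bar>a\<bar> \<le> 1 / 2" "\<bar>b\<bar> \<le> 1 / 2" "z = of_real a + of_real b * \<alpha>"
proof -
  from assms obtain p where p: "z = (\<lambda>(a, b). of_real a + of_real b * \<alpha>) p"
      "p \<in> {- 1 / 2..1 / 2 :: real} \<times> {- 1 / 2..1 / 2 :: real}"
    unfolding half_parallelogram_def by (rule imageE)
  show thesis
  proof (rule that)
    show "z = of_real (fst p) + of_real (snd p) * \<alpha>" using p(1) by (simp add: case_prod_unfold)
    have "- 1 / 2 \<le> fst p" "fst p \<le> 1 / 2" "- 1 / 2 \<le> snd p" "snd p \<le> 1 / 2" using p(2) by auto
    thus "\<bar>fst p\<bar> \<le> 1 / 2" "\<bar>snd p\<bar> \<le> 1 / 2" by linarith+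
  qed
qed

lemma compact_half_parallelogram: "compact (half_parallelogram \<alpha>)"
  unfolding half_parallelogram_def case_prod_unfold
proof (rule compact_continuous_image)
  show "continuous_on ({- 1 / 2..1 / 2} \<times> {- 1 / 2..1 / 2}) (\<lambda>p. complex_of_real (fst p) + complex_of_real (snd p) * \<alpha>)"
    by (intro continuous_intros)
qed (intro compact_Times compact_Icc)

lemma translate_to_parallelogram:
  assumes "\<alpha> \<notin> \<real>"
  obtains \<mu> where "\<mu> \<in> lattice_pts \<alpha>" "t - \<mu> \<in> half_parallelogram \<alpha>"
proof -
  define y where "y = Im t / Im \<alpha>"
  define x where "x = Re t - y * Re \<alpha>"
  have "Im \<alpha> \<noteq> 0" using assms by (auto simp: complex_is_Real_iff)
  hence t: "t = of_real x + of_real y * \<alpha>" by (auto simp: complex_eq_iff x_def y_def)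
  define \<mu> where "\<mu> = of_int (round x) + of_int (round y) * \<alpha>"
  have "t - \<mu> = of_real (x - of_int (round x)) + of_real (y - of_int (round y)) * \<alpha>"
    by (simp add: t \<mu>_def algebra_simps)
  also have "\<dots> \<in> half_parallelogram \<alpha>"
    using of_int_round_abs_le[of x] of_int_round_abs_le[of y] by (intro half_parallelogramI) (auto simp: abs_minus_commute)
  finally have "t - \<mu> \<in> half_parallelogram \<alpha>" .
  moreover have "\<mu> \<in> lattice_pts \<alpha>" unfolding \<mu>_def lattice_pts_def by blast
  ultimately show thesis by (rule that[rotated])
qed

lemma half_parallelogram_lattice:
  assumes "\<alpha> \<notin> \<real>"
  shows "half_parallelogram \<alpha> \<inter> lattice_pts \<alpha> = {0}"
proof -
  have "z = 0" if z: "z \<in> half_parallelogram \<alpha>" "z \<in> lattice_pts \<alpha>" for z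
  proof -
    obtain a b where ab: "\<bar>a\<bar> \<le> 1 / 2" "\<bar>b\<bar> \<le> 1 / 2" "z = of_real a + of_real b * \<alpha>"
      using z(1) by (rule half_parallelogramE)
    obtain m n where mn: "z = of_int m + of_int n * \<alpha>" using z(2) by (auto simp: lattice_pts_def)
    have "Im \<alpha> \<noteq> 0" using assms by (auto simp: complex_is_Real_iff)
    moreover have "b * Im \<alpha> = of_int n * Im \<alpha>" using arg_cong[OF trans[OF ab(3)[symmetric] mn], of Im] by simp
    ultimately have b: "b = of_int n" by simp
    moreover have "a + b * Re \<alpha> = of_int m + of_int n * Re \<alpha>"
      using arg_cong[OF trans[OF ab(3)[symmetric] mn], of Re] by simp
    ultimately have a: "a = of_int m" by simp
    have "n = 0" "m = 0" using ab a b by linarith+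
    thus ?thesis using mn by simp
  qed
  moreover have "0 \<in> half_parallelogram \<alpha>" using half_parallelogramI[of 0 0 \<alpha>] by simp
  ultimately show ?thesis using lattice_pts_0 by blast
qed

text \<open>Coordinates suit rounding and compactness, while the hull is what
  \<open>weierstrass_p\<close> refers to. A point is interpolated first in the direction of
  \<open>\<alpha>\<close> and then in that of 1.\<close>

lemma half_parallelogram_hull:
  "half_parallelogram \<alpha> = convex hull {1/2 + \<alpha>/2, 1/2 - \<alpha>/2, - 1/2 + \<alpha>/2, - 1/2 - \<alpha>/2}" (is "_ = convex hull ?V")
proof (rule antisym)
  have "convex (half_parallelogram \<alpha>)"
    unfolding half_parallelogram_def
  proof (rule convex_linear_image)
    show "linear (\<lambda>(a, b). complex_of_real a + complex_of_real b * \<alpha>)"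
      by (rule linearI) (auto simp: algebra_simps scaleR_conv_of_real)
  qed (intro convex_Times convex_closed_interval convex_real_interval)
  moreover have "?V \<subseteq> half_parallelogram \<alpha>"
    using half_parallelogramI[of "1/2" "1/2" \<alpha>] half_parallelogramI[of "1/2" "-1/2" \<alpha>]
      half_parallelogramI[of "-1/2" "1/2" \<alpha>] half_parallelogramI[of "-1/2" "-1/2" \<alpha>] by simp
  ultimately show "convex hull ?V \<subseteq> half_parallelogram \<alpha>" by (intro hull_minimal)
next
  have cv: "convex (convex hull ?V)" by simp
  show "half_parallelogram \<alpha> \<subseteq> convex hull ?V"
  proof
    fix z assume "z \<in> half_parallelogram \<alpha>"
    then obtain a b where ab: "\<bar>a\<bar> \<le> 1 / 2" "\<bar>b\<bar> \<le> 1 / 2" "z = of_real a + of_real b * \<alpha>"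
      by (rule half_parallelogramE)
    define p where "p = (1 / 2 + b) *\<^sub>R (1/2 + \<alpha>/2) + (1 / 2 - b) *\<^sub>R (1/2 - \<alpha>/2)"
    define r where "r = (1 / 2 + b) *\<^sub>R (- 1/2 + \<alpha>/2) + (1 / 2 - b) *\<^sub>R (- 1/2 - \<alpha>/2)"
    have "p \<in> convex hull ?V" "r \<in> convex hull ?V"
      unfolding p_def r_def by (intro convexD[OF cv]; (rule hull_inc)?; use ab in force)+
    hence "(1 / 2 + a) *\<^sub>R p + (1 / 2 - a) *\<^sub>R r \<in> convex hull ?V"
      using ab by (intro convexD[OF cv]) auto
    also have "(1 / 2 + a) *\<^sub>R p + (1 / 2 - a) *\<^sub>R r = z"
    proof -
      have "p = 1 / 2 + of_real b * \<alpha>" "r = - 1 / 2 + of_real b * \<alpha>"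
        by (simp_all add: p_def r_def scaleR_conv_of_real algebra_simps)
      thus ?thesis by (simp only: ab(3)) (simp add: scaleR_conv_of_real algebra_simps)
    qed
    finally show "z \<in> convex hull ?V" .
  qed
qed

text \<open>The function is bounded on a compact fundamental domain, hence everywhere, and Liouville
  applies. Periodicity of the norm suffices, so multipliers of modulus 1 are covered too;
  \<open>entire_eigenfunction\<close> depends on this.\<close>

lemma entire_norm_periodic_constant:
  assumes \<alpha>: "\<alpha> \<notin> \<real>" and f: "f holomorphic_on UNIV"
    and per: "\<And>t. norm (f (t + 1)) = norm (f t)" "\<And>t. norm (f (t + \<alpha>)) = norm (f t)"
  obtains c where "\<And>t. f t = c"
proof -
  have "compact ((\<lambda>t. norm (f t)) ` half_parallelogram \<alpha>)"
    by (intro compact_continuous_image compact_half_parallelogram continuous_intros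
        continuous_on_subset[OF holomorphic_on_imp_continuous_on[OF f]]) auto
  then obtain B where B: "\<And>t. t \<in> half_parallelogram \<alpha> \<Longrightarrow> norm (f t) \<le> B"
    using compact_imp_bounded[of "(\<lambda>t. norm (f t)) ` half_parallelogram \<alpha>"] unfolding bounded_iff by auto
  have "norm (f t) \<le> B" for t
  proof -
    obtain \<mu> where \<mu>: "\<mu> \<in> lattice_pts \<alpha>" "t - \<mu> \<in> half_parallelogram \<alpha>"
      by (rule translate_to_parallelogram[OF \<alpha>])
    have "norm (f (t - \<mu> + \<mu>)) = norm (f (t - \<mu>))"
      by (rule periodic_lattice[where g = "\<lambda>t. norm (f t)"]) (use per \<mu> in auto)
    thus ?thesis using B[OF \<mu>(2)] by simp
  qed
  hence "bounded (range f)" by (auto simp: bounded_iff)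
  hence "f constant_on UNIV" by (rule Liouville_theorem[OF f])
  thus thesis using that by (auto simp: constant_on_def)
qed

lemma entire_generic_0:
  assumes f: "f holomorphic_on UNIV" and "\<forall>\<^sub>\<approx>w\<in>UNIV. f w = (0 :: complex)"
  shows "f w = 0"
proof -
  have "f \<midarrow>w\<rightarrow> f w"
    using holomorphic_on_imp_continuous_on[OF f] by (simp add: continuous_on_eq_continuous_at isCont_def)
  moreover have "f \<midarrow>w\<rightarrow> 0"
    using assms(2) by (intro tendsto_eventually) (auto simp: generic_iff)
  ultimately show ?thesis by (metis LIM_unique)
qed

lemma entire_meromorphic: "f holomorphic_on UNIV \<Longrightarrow> f meromorphic_on A"
  by (intro analytic_on_imp_meromorphic_on analytic_on_subset[of f UNIV A]) (auto simp: analytic_on_open)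

lemma entire_nonzero_generic:
  assumes f: "f holomorphic_on UNIV" and "f w0 \<noteq> 0"
  shows "\<forall>\<^sub>\<approx>w\<in>UNIV. f w \<noteq> (0 :: complex)"
  using meromorphic_imp_constant_or_avoid[OF entire_meromorphic[OF f], of UNIV 0]
    entire_generic_0[OF f, of w0] assms(2) by auto

text \<open>At a zero of the denominator the quotient has a pole, and division by zero supplies the
  value 0 expected at a pole. The plain quotient is therefore already the canonical
  representative.\<close>

lemma entire_quotient_nicely:
  assumes N: "N holomorphic_on UNIV" and D: "D holomorphic_on UNIV"
    and ND: "\<And>t. D t = 0 \<Longrightarrow> N t \<noteq> 0" and nz: "D t0 \<noteq> 0"
  shows "(\<lambda>t. N t / D t) nicely_meromorphic_on UNIV"
    and "is_pole (\<lambda>t. N t / D t) t \<longleftrightarrow> D t = 0"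
proof -
  have mero: "(\<lambda>t. N t / D t) meromorphic_on UNIV"
    by (intro meromorphic_intros entire_meromorphic N D)
  have cont: "isCont N t" "isCont D t" for t
    using holomorphic_on_imp_continuous_on[OF N] holomorphic_on_imp_continuous_on[OF D]
    by (simp_all add: continuous_on_eq_continuous_at)
  have an: "(\<lambda>t. N t / D t) analytic_on {t. D t \<noteq> 0}"
  proof -
    have "open {t. D t \<noteq> 0}"
      using holomorphic_on_imp_continuous_on[OF D] by (intro open_Collect_neq continuous_intros) auto
    thus ?thesis
      by (simp add: analytic_on_open) (intro holomorphic_intros holomorphic_on_subset[OF N] holomorphic_on_subset[OF D], auto)
  qed
  have pole: "is_pole (\<lambda>t. N t / D t) t" if "D t = 0" for t
  proof (rule is_pole_divide)
    have "eventually (\<lambda>t. D t \<noteq> 0) (at t)"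
      using entire_nonzero_generic[OF D nz] by (simp add: generic_iff)
    moreover have "(D \<longlongrightarrow> 0) (at t)" using cont(2)[of t] that by (simp add: isCont_def)
    ultimately show "filterlim D (at 0) (at t)" by (simp add: filterlim_at)
  qed (use cont ND that in auto)
  show "(\<lambda>t. N t / D t) nicely_meromorphic_on UNIV"
  proof (rule nicely_meromorphic_onI_open[where pts = "{t. D t = 0}"])
    show "(\<lambda>t. N t / D t) analytic_on UNIV - {t. D t = 0}"
      using an by (rule analytic_on_subset) auto
    show "isolated_singularity_at (\<lambda>t. N t / D t) x" for x
      by (intro meromorphic_on_isolated_singularity meromorphic_on_subset[OF mero]) simp
  qed (use pole in auto)
  show "is_pole (\<lambda>t. N t / D t) t \<longleftrightarrow> D t = 0"
  proof
    assume "is_pole (\<lambda>t. N t / D t) t"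
    moreover have "\<not> is_pole (\<lambda>t. N t / D t) t" if "D t \<noteq> 0"
      by (rule analytic_at_imp_no_pole, rule analytic_on_subset[OF an]) (use that in auto)
    ultimately show "D t = 0" by blast
  qed (rule pole)
qed

lemma is_pole_shift: "is_pole (\<lambda>w. f (w + c)) z \<longleftrightarrow> is_pole f (z + c :: complex)"
  unfolding is_pole_def at_to_0[of "z + c"] at_to_0[of z] filterlim_filtermap by (simp add: add_ac)

subsection \<open>Identification of the Weierstrass functions\<close>

locale sigma_data =
  fixes \<alpha> :: complex and S H :: "complex \<Rightarrow> complex" and u1 v1 u2 v2 :: complex
  assumes \<alpha>: "\<alpha> \<notin> \<real>"
    and S_hol: "S holomorphic_on UNIV" and H_hol: "H holomorphic_on UNIV"
    and S_H: "S t = t * H t" and H0: "H 0 = 1" and dH0: "deriv H 0 = 0" and ddH0: "deriv (deriv H) 0 = 0"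
    and S_odd: "S (- t) = - S t"
    and S_zero: "S t = 0 \<longleftrightarrow> t \<in> lattice_pts \<alpha>"
    and S_1: "S (t + 1) = exp (u1 * t + v1) * S t"
    and S_\<alpha>: "S (t + \<alpha>) = exp (u2 * t + v2) * S t"
begin

text \<open>The sign makes \<open>Z\<close> an antiderivative of \<open>P\<close>, so that
  \<open>Z\<close> is asymptotic to \<open>- 1 / t\<close> at 0. Writing \<open>P\<close> as a
  quotient of entire functions, rather than as \<open>deriv Z\<close>, fixes its values at the
  lattice points.\<close>

definition Z :: "complex \<Rightarrow> complex" where "Z t = - deriv S t / S t"
definition P :: "complex \<Rightarrow> complex" where "P t = (deriv S t ^ 2 - deriv (deriv S) t * S t) / S t ^ 2"

lemma S_deriv: "(S has_field_derivative deriv S t) (at t)"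
  using holomorphic_derivI[OF S_hol] by simp

lemma S'_hol: "deriv S holomorphic_on UNIV"
  by (intro holomorphic_deriv S_hol) simp

lemma S'_deriv: "(deriv S has_field_derivative deriv (deriv S) t) (at t)"
  using holomorphic_derivI[OF S'_hol] by simp

lemma S''_hol: "deriv (deriv S) holomorphic_on UNIV"
  by (intro holomorphic_deriv S'_hol) simp

lemma S_0: "S 0 = 0"
  by (simp add: S_H)

lemma S'_0: "deriv S 0 = 1"
proof (rule DERIV_imp_deriv)
  have "((\<lambda>t. t * H t) has_field_derivative 1 * H 0 + deriv H 0 * 0) (at 0)"
    by (rule DERIV_mult[OF DERIV_ident]) (use holomorphic_derivI[OF H_hol] in simp)
  moreover have "S = (\<lambda>t. t * H t)" using S_H by (simp add: fun_eq_iff)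
  ultimately show "(S has_field_derivative 1) (at 0)" by (simp add: H0)
qed

lemma S_nonzero: "\<exists>t. S t \<noteq> 0"
proof (rule ccontr)
  assume "\<not> ?thesis"
  hence "S = (\<lambda>_. 0)" by (simp add: fun_eq_iff)
  hence "deriv S 0 = 0" by simp
  thus False by (simp add: S'_0)
qed

lemma S_generic: "\<forall>\<^sub>\<approx>t\<in>UNIV. S t \<noteq> 0"
  using S_nonzero entire_nonzero_generic[OF S_hol] by blast

lemma deriv_shift:
  assumes "\<And>t. S (t + c) = exp (u * t + v) * S t"
  shows "deriv S (t + c) = exp (u * t + v) * (u * S t + deriv S t)"
proof -
  have "((\<lambda>t. S (t + c)) has_field_derivative deriv S (t + c)) (at t)"
    using S_deriv[of "t + c"] by (simp add: DERIV_shift)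
  moreover have "((\<lambda>t. exp (u * t + v) * S t) has_field_derivative exp (u * t + v) * (u * S t + deriv S t)) (at t)"
    by (rule derivative_eq_intros refl S_deriv)+ (simp add: algebra_simps)
  ultimately show ?thesis using DERIV_unique unfolding assms by blast
qed

text \<open>The zero at the origin is simple by normalization, and quasi-periodicity carries
  simplicity to all other lattice points.\<close>

lemma S'_nonzero: "S t = 0 \<Longrightarrow> deriv S t \<noteq> 0"
proof -
  assume "S t = 0"
  hence t: "t \<in> lattice_pts \<alpha>" by (simp add: S_zero)
  define g where "g t \<longleftrightarrow> S t = 0 \<and> deriv S t \<noteq> 0" for t
  have "g (s + 1) = g s" for s
    by (auto simp: g_def S_1 deriv_shift[OF S_1])
  moreover have "g (s + \<alpha>) = g s" for s
    by (auto simp: g_def S_\<alpha> deriv_shift[OF S_\<alpha>])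
  ultimately have "g (0 + t) = g 0" by (rule periodic_lattice[OF _ _ t])
  thus ?thesis by (simp add: g_def S_0 S'_0)
qed

lemma Z_deriv:
  assumes "S t \<noteq> 0"
  shows "(Z has_field_derivative P t) (at t)"
  unfolding Z_def P_def
  by (rule derivative_eq_intros refl S_deriv S'_deriv assms)+
     (use assms in \<open>simp add: power2_eq_square field_simps\<close>)

lemma Z_shift:
  assumes "\<And>t. S (t + c) = exp (u * t + v) * S t" "S t \<noteq> 0"
  shows "Z (t + c) = Z t - u"
  using assms(2) unfolding Z_def assms(1) deriv_shift[OF assms(1)] by (simp add: field_simps)

text \<open>Quasi-periodicity changes \<open>Z\<close> by a constant, which disappears on
  differentiation. At the lattice points both sides are 0 by division by zero.\<close>

lemma P_shift:
  assumes "\<And>t. S (t + c) = exp (u * t + v) * S t"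
  shows "P (t + c) = P t"
proof (cases "S t = 0")
  case True
  thus ?thesis by (simp add: P_def assms)
next
  case False
  hence "S (t + c) \<noteq> 0" by (simp add: assms)
  hence "((\<lambda>t. Z (t + c)) has_field_derivative P (t + c)) (at t)"
    using Z_deriv[of "t + c"] by (simp add: DERIV_shift)
  moreover have "((\<lambda>t. Z t - u) has_field_derivative P t - 0) (at t)"
    by (intro DERIV_diff Z_deriv False DERIV_const)
  moreover have "eventually (\<lambda>s. S s \<noteq> 0) (nhds t)"
  proof -
    have "isCont S t" using holomorphic_on_imp_continuous_on[OF S_hol] by (simp add: continuous_on_eq_continuous_at)
    hence "eventually (\<lambda>s. S s \<noteq> 0) (at t)"
      using False by (intro tendsto_imp_eventually_ne[of S "S t"]) (auto simp: isCont_def)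
    thus ?thesis using False by (simp add: eventually_nhds_conv_at)
  qed
  hence "eventually (\<lambda>s. Z (s + c) = Z s - u) (nhds t)"
    by eventually_elim (rule Z_shift[OF assms])
  ultimately have "((\<lambda>t. Z t - u) has_field_derivative P (t + c)) (at t)"
    by (subst (asm) DERIV_cong_ev[OF refl _ refl]) auto
  with \<open>((\<lambda>t. Z t - u) has_field_derivative P t - 0) (at t)\<close> show ?thesis
    using DERIV_unique by fastforce
qed

lemma P_1: "P (t + 1) = P t" and P_\<alpha>: "P (t + \<alpha>) = P t"
  by (rule P_shift[OF S_1] P_shift[OF S_\<alpha>])+

lemma P_nicely: "P nicely_meromorphic_on UNIV" and P_pole_iff: "is_pole P t \<longleftrightarrow> t \<in> lattice_pts \<alpha>"
proof -
  obtain t0 where t0: "S t0 \<noteq> 0" using S_nonzero by blast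
  have N: "(\<lambda>t. deriv S t ^ 2 - deriv (deriv S) t * S t) holomorphic_on UNIV"
    by (intro holomorphic_intros S_hol S'_hol S''_hol)
  have D: "(\<lambda>t. S t ^ 2) holomorphic_on UNIV"
    by (intro holomorphic_intros S_hol)
  have *: "(\<lambda>t. (deriv S t ^ 2 - deriv (deriv S) t * S t) / S t ^ 2) = P"
    by (simp add: fun_eq_iff P_def)
  show "P nicely_meromorphic_on UNIV"
    using entire_quotient_nicely(1)[OF N D, of t0] S'_nonzero t0 unfolding * by simp
  have "is_pole P t \<longleftrightarrow> S t ^ 2 = 0"
    using entire_quotient_nicely(2)[OF N D, of t0] S'_nonzero t0 unfolding * by simp
  thus "is_pole P t \<longleftrightarrow> t \<in> lattice_pts \<alpha>" by (simp add: S_zero)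
qed

lemma Z_nicely: "Z nicely_meromorphic_on UNIV"
proof -
  obtain t0 where t0: "S t0 \<noteq> 0" using S_nonzero by blast
  have N: "(\<lambda>t. - deriv S t) holomorphic_on UNIV"
    by (intro holomorphic_intros S'_hol)
  have *: "(\<lambda>t. - deriv S t / S t) = Z" by (simp add: fun_eq_iff Z_def)
  show ?thesis using entire_quotient_nicely(1)[OF N S_hol _ t0] S'_nonzero unfolding * by simp
qed

lemma H_deriv: "(H has_field_derivative deriv H t) (at t)"
  using holomorphic_derivI[OF H_hol] by simp

lemma H'_hol: "deriv H holomorphic_on UNIV"
  by (intro holomorphic_deriv H_hol) simp

lemma H'_deriv: "(deriv H has_field_derivative deriv (deriv H) t) (at t)"
  using holomorphic_derivI[OF H'_hol] by simp

lemma H''_hol: "deriv (deriv H) holomorphic_on UNIV"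
  by (intro holomorphic_deriv H'_hol) simp

lemma S'_H: "deriv S t = H t + t * deriv H t"
proof (rule DERIV_imp_deriv)
  have "S = (\<lambda>t. t * H t)" using S_H by (simp add: fun_eq_iff)
  thus "(S has_field_derivative H t + t * deriv H t) (at t)"
    using DERIV_mult[OF DERIV_ident H_deriv[of t]] by (simp add: mult.commute add.commute)
qed

lemma S''_H: "deriv (deriv S) t = 2 * deriv H t + t * deriv (deriv H) t"
proof (rule DERIV_imp_deriv)
  have "deriv S = (\<lambda>t. H t + t * deriv H t)" using S'_H by (simp add: fun_eq_iff)
  thus "(deriv S has_field_derivative 2 * deriv H t + t * deriv (deriv H) t) (at t)"
    using DERIV_add[OF H_deriv[of t] DERIV_mult[OF DERIV_ident H'_deriv[of t]]] by (simp add: algebra_simps)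
qed

text \<open>\<open>P\<close> is minus the second derivative of \<open>log S = log t + log H\<close>.
  The contribution of \<open>H\<close> vanishes at 0 because its first two derivatives do, and this
  yields the error term \<open>O(t)\<close>.\<close>

lemma P_eq_H: "t \<noteq> 0 \<Longrightarrow> H t \<noteq> 0 \<Longrightarrow>
   P t = 1 / t ^ 2 - (deriv (deriv H) t * H t - deriv H t ^ 2) / H t ^ 2"
  unfolding P_def S'_H S''_H S_H by (simp add: field_simps power2_eq_square)

lemma H_near_0: "eventually (\<lambda>t. H t \<noteq> 0) (nhds 0)"
proof -
  have "isCont H 0" using holomorphic_on_imp_continuous_on[OF H_hol] by (simp add: continuous_on_eq_continuous_at)
  hence "eventually (\<lambda>s. H s \<noteq> 0) (at 0)"
    using H0 by (intro tendsto_imp_eventually_ne[of H 1]) (auto simp: isCont_def)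
  thus ?thesis using H0 by (simp add: eventually_nhds_conv_at)
qed

lemma P_asymp: "(\<lambda>t. P t - 1 / t ^ 2) \<in> O[at 0](\<lambda>t. t)"
proof -
  define B where "B t = - (deriv (deriv H) t * H t - deriv H t ^ 2) / H t ^ 2" for t
  obtain H3 where H3: "(deriv (deriv H) has_field_derivative H3) (at 0)"
    using holomorphic_derivI[OF H''_hol] by blast
  have "\<exists>B'. (B has_field_derivative B') (at 0)"
    unfolding B_def by (rule exI) (rule derivative_eq_intros refl H3 H_deriv H'_deriv | simp add: H0)+
  then obtain B' where "(B has_field_derivative B') (at 0)" by blast
  hence "((\<lambda>t. (B t - B 0) / (t - 0)) \<longlongrightarrow> B') (at 0)" by (simp add: has_field_derivative_iff)
  hence "((\<lambda>t. B t / t) \<longlongrightarrow> B') (at 0)" by (simp add: B_def dH0 ddH0)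
  hence "B \<in> O[at 0](\<lambda>t. t)"
    by (rule bigoI_tendsto) (simp add: eventually_at_filter)
  moreover have "eventually (\<lambda>t. B t = P t - 1 / t ^ 2) (at 0)"
    using H_near_0 unfolding eventually_at_filter
    by eventually_elim (auto simp: P_eq_H B_def minus_divide_left)
  ultimately show ?thesis
    by (subst landau_o.big.in_cong[symmetric])
qed

lemma P_zorder: "zorder P 0 = -2"
proof -
  have "eventually (\<lambda>t. H t \<noteq> 0) (nhds 0)" by (rule H_near_0)
  then obtain U where U: "open U" "0 \<in> U" "\<And>t. t \<in> U \<Longrightarrow> H t \<noteq> 0"
    by (auto simp: eventually_nhds)
  define g where "g t = (deriv S t ^ 2 - deriv (deriv S) t * S t) / H t ^ 2" for t
  show ?thesis
  proof (rule zorder_eqI[where S = U and g = g])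
    show "g holomorphic_on U"
      unfolding g_def
      by (intro holomorphic_intros holomorphic_on_subset[OF S_hol] holomorphic_on_subset[OF S'_hol]
          holomorphic_on_subset[OF S''_hol] holomorphic_on_subset[OF H_hol]) (use U in auto)
    show "g 0 \<noteq> 0" by (simp add: g_def S'_0 S_0 H0)
    show "P w = g w * (w - 0) powi - 2" if "w \<in> U" "w \<noteq> 0" for w
      using that U(3)[OF that(1)] by (simp add: P_def g_def S_H power_mult_distrib power_int_minus field_simps)
  qed (use U in auto)
qed

lemma P_elliptic: "elliptic_fun \<alpha> P"
  unfolding elliptic_fun_def using P_nicely P_1 P_\<alpha> by blast

text \<open>The difference to \<open>P\<close> is elliptic. It has no poles off the lattice, it
  tends to 0 at the origin by the two expansions, and periodicity treats the other lattice points.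
  Liouville makes it constant, and the limit at 0 makes the constant 0. The difference with its
  removable singularities filled in is \<open>E\<close>.\<close>

lemma weierstrass_p_unique:
  assumes g: "elliptic_fun \<alpha> g"
    and poles: "{t \<in> convex hull {1/2 + \<alpha>/2, 1/2 - \<alpha>/2, - 1/2 + \<alpha>/2, - 1/2 - \<alpha>/2}. is_pole g t} = {0}"
    and asymp: "(\<lambda>t. g t - 1 / t ^ 2) \<in> O[at 0](\<lambda>t. t)"
  shows "g = P"
proof -
  have g_nice: "g nicely_meromorphic_on UNIV" and g_per: "\<And>t. g (t + 1) = g t" "\<And>t. g (t + \<alpha>) = g t"
    using g by (auto simp: elliptic_fun_def)
  have mero: "g meromorphic_on UNIV" "P meromorphic_on UNIV"
    using g_nice P_nicely by (auto simp: nicely_meromorphic_on_def)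
  have pole_per: "is_pole g (t + \<mu>) = is_pole g t" if "\<mu> \<in> lattice_pts \<alpha>" for t \<mu>
  proof -
    have "(\<lambda>w. g (w + \<mu>)) = g" using periodic_lattice[of g, OF g_per that] by (simp add: fun_eq_iff)
    thus ?thesis using is_pole_shift[of g \<mu> t] by simp
  qed
  have pole_g: "t \<in> lattice_pts \<alpha>" if "is_pole g t" for t
  proof -
    obtain \<mu> where \<mu>: "\<mu> \<in> lattice_pts \<alpha>" "t - \<mu> \<in> half_parallelogram \<alpha>"
      by (rule translate_to_parallelogram[OF \<alpha>])
    have "is_pole g (t - \<mu>)" using pole_per[OF \<mu>(1), of "t - \<mu>"] that by simp
    hence "t - \<mu> \<in> {0}" using \<mu>(2) unfolding poles[symmetric] half_parallelogram_hull by simp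
    thus ?thesis using \<mu>(1) by simp
  qed
  define d where "d t = g t - P t" for t
  have d_mero: "d meromorphic_on UNIV" unfolding d_def by (intro meromorphic_intros mero)
  have d_per: "d (t + 1) = d t" "d (t + \<alpha>) = d t" for t by (simp_all add: d_def g_per P_1 P_\<alpha>)
  define E where "E = ev (mk_mero d)"
  have E_nice: "E nicely_meromorphic_on UNIV" by (simp add: E_def)
  have E_d: "\<forall>\<^sub>\<approx>w\<in>UNIV. E w = d w" unfolding E_def by (rule ev_mk_mero_generic[OF d_mero])
  have E_shift: "E (t + c) = E t" if c: "\<And>t. d (t + c) = d t" for c t
  proof -
    have "shift_mero c (mk_mero d) = mk_mero d"
      by (rule mero_eqI, use E_d generic_shift[OF E_d, of c] in eventually_elim) (simp add: c flip: E_def)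
    hence "ev (shift_mero c (mk_mero d)) t = ev (mk_mero d) t" by simp
    thus ?thesis by (simp add: E_def)
  qed
  have E_per: "E (t + 1) = E t" "E (t + \<alpha>) = E t" for t by (rule E_shift, rule d_per)+
  have "(\<lambda>t. (g t - 1 / t ^ 2) - (P t - 1 / t ^ 2)) \<in> O[at 0](\<lambda>t. t)"
    by (rule sum_in_bigo asymp P_asymp)+
  hence d_O: "d \<in> O[at 0](\<lambda>t. t)" by (simp add: d_def[abs_def])
  have d_0: "(d \<longlongrightarrow> 0) (at 0)"
  proof -
    obtain C where "eventually (\<lambda>t. norm (d t) \<le> C * norm t) (at 0)"
      using d_O by (rule landau_o.bigE)
    moreover have "((\<lambda>t :: complex. C * norm t) \<longlongrightarrow> 0) (at 0)" by (auto intro!: tendsto_eq_intros)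
    ultimately show ?thesis by (rule Lim_null_comparison)
  qed
  have E_at: "eventually (\<lambda>w. E w = d w) (at t)" for t using E_d by (simp add: generic_iff)
  have no_pole: "\<not> is_pole E t" for t
  proof (cases "t \<in> lattice_pts \<alpha>")
    case True
    have E0: "(E \<longlongrightarrow> 0) (at 0)"
      using d_0 by (rule Lim_transform_eventually) (use E_at[of 0] in \<open>eventually_elim, simp\<close>)
    have "\<not> is_pole E 0"
      unfolding is_pole_def using not_tendsto_and_filterlim_at_infinity[OF _ E0] by auto
    moreover have "(\<lambda>w. E (w + t)) = E" using periodic_lattice[of E, OF E_per True] by (simp add: fun_eq_iff)
    ultimately show ?thesis using is_pole_shift[of E t 0] by simp
  next
    case False
    have "\<not> is_pole g t" "\<not> is_pole P t" using False pole_g P_pole_iff by blast+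
    hence "g analytic_on {t}" "P analytic_on {t}"
      using nicely_meromorphic_on_imp_analytic_at[OF g_nice, of t] nicely_meromorphic_on_imp_analytic_at[OF P_nicely, of t] by auto
    hence "d analytic_on {t}" unfolding d_def by (intro analytic_intros)
    hence "\<not> is_pole d t" by (rule analytic_at_imp_no_pole)
    thus ?thesis using is_pole_cong[OF E_at[of t] refl] by simp
  qed
  have "E holomorphic_on UNIV"
    using nicely_meromorphic_without_singularities[OF E_nice] no_pole analytic_imp_holomorphic by blast
  moreover from this obtain c where c: "\<And>t. E t = c"
    by (rule entire_norm_periodic_constant[OF \<alpha>]) (use E_per in auto)
  have "(E \<longlongrightarrow> 0) (at 0)"
    using d_0 by (rule Lim_transform_eventually) (use E_at[of 0] in \<open>eventually_elim, simp\<close>)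
  moreover have "E = (\<lambda>_. c)" using c by (simp add: fun_eq_iff)
  hence "(E \<longlongrightarrow> c) (at 0)" by simp
  ultimately have "c = 0" using LIM_unique by blast
  show "g = P"
  proof (rule nicely_meromorphic_eqI[OF g_nice P_nicely])
    show "\<forall>\<^sub>\<approx>w\<in>UNIV. g w = P w"
      using E_d by eventually_elim (simp add: c \<open>c = 0\<close> d_def)
  qed
qed

lemma weierstrass_p_eq: "weierstrass_p \<alpha> = P"
  unfolding weierstrass_p_def
proof (rule the_equality)
  show "elliptic_fun \<alpha> P \<and>
     {t \<in> convex hull {1/2 + \<alpha>/2, 1/2 - \<alpha>/2, - 1/2 + \<alpha>/2, - 1/2 - \<alpha>/2}. is_pole P t} = {0} \<and>
     zorder P 0 = -2 \<and> (\<lambda>t. P t - 1 / t ^ 2) \<in> O[at 0](\<lambda>t. t)"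
    unfolding half_parallelogram_hull[symmetric] P_pole_iff
    using half_parallelogram_lattice[OF \<alpha>] P_elliptic P_zorder P_asymp by (simp add: Int_def)
qed (use weierstrass_p_unique in blast)

lemma open_nonlattice: "open {t. S t \<noteq> 0}"
  using holomorphic_on_imp_continuous_on[OF S_hol] by (intro open_Collect_neq continuous_intros) auto

text \<open>Removing a countable set leaves the plane path connected, so antiderivatives off the
  lattice are unique up to one global constant.\<close>

lemma connected_nonlattice: "connected {t. S t \<noteq> 0}"
proof -
  have "{t. S t \<noteq> 0} = - lattice_pts \<alpha>" using S_zero by auto
  thus ?thesis
    using path_connected_complement_countable[OF _ lattice_pts_countable[of \<alpha>]] by (simp add: path_connected_imp_connected)
qed

lemma constant_off_lattice:
  assumes "\<And>t. S t \<noteq> 0 \<Longrightarrow> (f has_field_derivative 0) (at t)"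
  obtains c where "\<And>t. S t \<noteq> 0 \<Longrightarrow> f t = c"
proof -
  have "continuous_on {t. S t \<noteq> 0} f"
    using assms by (intro continuous_at_imp_continuous_on ballI) (auto intro: DERIV_isCont)
  then obtain c where "\<And>t. t \<in> {t. S t \<noteq> 0} \<Longrightarrow> f t = c"
    using DERIV_zero_connected_constant[OF connected_nonlattice open_nonlattice finite.emptyI] assms by blast
  thus thesis using that by blast
qed

lemma Z_odd: "Z (- t) = - Z t"
proof -
  have "((\<lambda>t. S (- t)) has_field_derivative deriv S (- t) * - 1) (at t)"
    by (rule DERIV_chain2[OF S_deriv]) (auto intro!: derivative_eq_intros)
  moreover have "((\<lambda>t. - S t) has_field_derivative - deriv S t) (at t)"
    by (intro DERIV_minus S_deriv)
  ultimately have "deriv S (- t) * - 1 = - deriv S t"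
    unfolding S_odd using DERIV_unique by blast
  thus ?thesis by (simp add: Z_def S_odd)
qed

text \<open>Two antiderivatives differ by a constant, and an odd constant function is 0.\<close>

lemma weierstrass_zeta_eq: "weierstrass_zeta \<alpha> = Z"
  unfolding weierstrass_zeta_def weierstrass_p_eq
proof (rule the_equality)
  show "Z nicely_meromorphic_on UNIV \<and> (\<forall>t. \<not> is_pole P t \<longrightarrow> (Z has_field_derivative P t) (at t)) \<and> (\<forall>t. Z (- t) = - Z t)"
    using Z_nicely Z_deriv Z_odd by (simp add: P_pole_iff S_zero)
next
  fix z assume z: "z nicely_meromorphic_on UNIV \<and> (\<forall>t. \<not> is_pole P t \<longrightarrow> (z has_field_derivative P t) (at t)) \<and> (\<forall>t. z (- t) = - z t)"
  have "((\<lambda>t. z t - Z t) has_field_derivative 0) (at t)" if "S t \<noteq> 0" for t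
    using DERIV_diff[of z "P t" t UNIV Z "P t"] z Z_deriv[OF that] that by (simp add: P_pole_iff S_zero)
  then obtain c where c: "\<And>t. S t \<noteq> 0 \<Longrightarrow> z t - Z t = c"
    by (rule constant_off_lattice[of "\<lambda>t. z t - Z t"]) (assumption, rule that)
  obtain t0 where t0: "S t0 \<noteq> 0" using S_nonzero by blast
  have "S (- t0) \<noteq> 0" using t0 by (simp add: S_odd)
  hence "z (- t0) - Z (- t0) = z t0 - Z t0" using c t0 by simp
  moreover have "z (- t0) - Z (- t0) = - (z t0 - Z t0)" using z by (simp add: Z_odd)
  ultimately have "c = 0" using c[OF t0] by simp
  show "z = Z"
  proof (rule nicely_meromorphic_eqI)
    show "\<forall>\<^sub>\<approx>w\<in>UNIV. z w = Z w" using S_generic by eventually_elim (use c \<open>c = 0\<close> in simp)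
  qed (use z Z_nicely in auto)
qed

lemma weierstrass_sigma_eq: "weierstrass_sigma \<alpha> = S"
  unfolding weierstrass_sigma_def weierstrass_zeta_eq
proof (rule the_equality)
  show "S holomorphic_on UNIV \<and> S 0 = 0 \<and> deriv S 0 = 1 \<and> (\<forall>t. S t \<noteq> 0 \<longrightarrow> deriv S t / S t = - Z t)"
    by (simp add: S_hol S_0 S'_0 Z_def)
next
  fix s assume s: "s holomorphic_on UNIV \<and> s 0 = 0 \<and> deriv s 0 = 1 \<and> (\<forall>t. s t \<noteq> 0 \<longrightarrow> deriv s t / s t = - Z t)"
  have s_deriv: "(s has_field_derivative deriv s t) (at t)" for t
    using holomorphic_derivI[of s UNIV t] s by simp
  have s'_hol: "deriv s holomorphic_on UNIV" by (intro holomorphic_deriv) (use s in auto)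
  have "\<exists>t. s t \<noteq> 0"
  proof (rule ccontr)
    assume "\<not> ?thesis"
    hence "s = (\<lambda>_. 0)" by (simp add: fun_eq_iff)
    hence "deriv s 0 = 0" by simp
    thus False using s by simp
  qed
  hence s_generic: "\<forall>\<^sub>\<approx>t\<in>UNIV. s t \<noteq> 0" using s entire_nonzero_generic by blast
  \<comment> \<open>The Wronskian is entire and vanishes wherever both functions are nonzero, hence
    identically. So \<open>s / S\<close> has derivative 0 also at points where only \<open>s\<close>
    might vanish.\<close>
  define W where "W t = deriv s t * S t - s t * deriv S t" for t
  have W_hol: "W holomorphic_on UNIV" unfolding W_def
    by (intro holomorphic_intros s'_hol S_hol S'_hol) (use s in auto)
  have "\<forall>\<^sub>\<approx>t\<in>UNIV. W t = 0"
    using s_generic S_generic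
  proof eventually_elim
    case (elim t)
    hence "deriv s t / s t = deriv S t / S t" using s by (simp add: Z_def)
    thus "W t = 0" using elim by (simp add: W_def field_simps)
  qed
  hence W0: "W t = 0" for t using entire_generic_0[OF W_hol] by blast
  have "((\<lambda>t. s t / S t) has_field_derivative 0) (at t)" if "S t \<noteq> 0" for t
    using DERIV_divide[OF s_deriv[of t] S_deriv[of t] that] W0[of t] by (simp add: W_def)
  then obtain c where c: "\<And>t. S t \<noteq> 0 \<Longrightarrow> s t / S t = c"
    by (rule constant_off_lattice[of "\<lambda>t. s t / S t"]) (assumption, rule that)
  have "s t - c * S t = 0" for t
  proof (rule entire_generic_0[of "\<lambda>t. s t - c * S t"])
    show "(\<lambda>t. s t - c * S t) holomorphic_on UNIV" by (intro holomorphic_intros S_hol) (use s in auto)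
    show "\<forall>\<^sub>\<approx>t\<in>UNIV. s t - c * S t = 0" using S_generic by eventually_elim (use c in \<open>auto simp: field_simps\<close>)
  qed
  hence s_eq: "s = (\<lambda>t. c * S t)" by (simp add: fun_eq_iff)
  have "deriv s 0 = c * deriv S 0" unfolding s_eq by (intro DERIV_imp_deriv DERIV_cmult S_deriv)
  hence "c = 1" using s S'_0 by simp
  thus "s = S" by (simp add: s_eq)
qed

end

text \<open>The inequality is Legendre's relation.\<close>

theorem weierstrass_quasi_periods:
  assumes \<alpha>: "\<alpha> \<notin> \<real>"
  obtains u1 u2 where "u2 - \<alpha> * u1 \<noteq> 0"
    "weierstrass_zeta \<alpha> nicely_meromorphic_on UNIV"
    "\<forall>\<^sub>\<approx>t\<in>UNIV. weierstrass_zeta \<alpha> (t + 1) = weierstrass_zeta \<alpha> t - u1"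
    "\<forall>\<^sub>\<approx>t\<in>UNIV. weierstrass_zeta \<alpha> (t + \<alpha>) = weierstrass_zeta \<alpha> t - u2"
    "\<And>\<delta>. weierstrass_rho \<alpha> \<delta> meromorphic_on UNIV"
    "\<And>\<delta>. \<forall>\<^sub>\<approx>t\<in>UNIV. weierstrass_rho \<alpha> \<delta> t \<noteq> 0"
    "\<And>\<delta> t. weierstrass_rho \<alpha> \<delta> (t + 1) = exp (u1 * \<delta>) * weierstrass_rho \<alpha> \<delta> t"
    "\<And>\<delta> t. weierstrass_rho \<alpha> \<delta> (t + \<alpha>) = exp (u2 * \<delta>) * weierstrass_rho \<alpha> \<delta> t"
proof -
  obtain S H u1 v1 u2 v2 where *: "S holomorphic_on UNIV" "H holomorphic_on UNIV" "\<And>t. S t = t * H t"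
    "H 0 = 1" "deriv H 0 = 0" "deriv (deriv H) 0 = 0" "\<And>t. S (- t) = - S t"
    "\<And>t. S t = 0 \<longleftrightarrow> t \<in> lattice_pts \<alpha>"
    "\<And>t. S (t + 1) = exp (u1 * t + v1) * S t" "\<And>t. S (t + \<alpha>) = exp (u2 * t + v2) * S t" "u2 - \<alpha> * u1 \<noteq> 0"
    by (rule sigma_exists[OF \<alpha>]) (rule that)
  interpret sigma_data \<alpha> S H u1 v1 u2 v2
    by (rule sigma_data.intro[OF \<alpha> *(1,2,3,4,5,6,7,8,9,10)])
  have rho: "weierstrass_rho \<alpha> \<delta> t = S (t + \<delta>) / S t" for \<delta> t
    by (simp add: weierstrass_rho_def weierstrass_sigma_eq)
  have rho_shift: "weierstrass_rho \<alpha> \<delta> (t + c) = exp (u * \<delta>) * weierstrass_rho \<alpha> \<delta> t"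
    if "\<And>t. S (t + c) = exp (u * t + v) * S t" for c u v \<delta> t
  proof -
    have "S (t + c + \<delta>) = exp (u * (t + \<delta>) + v) * S (t + \<delta>)" using that[of "t + \<delta>"] by (simp add: add_ac)
    also have "exp (u * (t + \<delta>) + v) = exp (u * \<delta>) * exp (u * t + v)" unfolding exp_add[symmetric] by (rule arg_cong[of _ _ exp]) (simp add: algebra_simps)
    finally show ?thesis by (simp add: rho that)
  qed
  show thesis
  proof (rule that[of u2 u1])
    show "weierstrass_zeta \<alpha> nicely_meromorphic_on UNIV" by (simp add: weierstrass_zeta_eq Z_nicely)
    show "\<forall>\<^sub>\<approx>t\<in>UNIV. weierstrass_zeta \<alpha> (t + 1) = weierstrass_zeta \<alpha> t - u1"
      using S_generic by eventually_elim (simp add: weierstrass_zeta_eq Z_shift[OF S_1])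
    show "\<forall>\<^sub>\<approx>t\<in>UNIV. weierstrass_zeta \<alpha> (t + \<alpha>) = weierstrass_zeta \<alpha> t - u2"
      using S_generic by eventually_elim (simp add: weierstrass_zeta_eq Z_shift[OF S_\<alpha>])
    show "weierstrass_rho \<alpha> \<delta> meromorphic_on UNIV" for \<delta>
    proof -
      have "(\<lambda>t. S (t + \<delta>)) holomorphic_on UNIV"
        unfolding holomorphic_on_def
      proof (intro ballI)
        fix t
        show "(\<lambda>t. S (t + \<delta>)) field_differentiable at t within UNIV"
          using S_deriv[of "t + \<delta>"] DERIV_shift[of S _ t \<delta>] unfolding field_differentiable_def by auto
      qed
      hence "(\<lambda>t. S (t + \<delta>) / S t) meromorphic_on UNIV"
        by (intro meromorphic_intros entire_meromorphic S_hol)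
      moreover have "weierstrass_rho \<alpha> \<delta> = (\<lambda>t. S (t + \<delta>) / S t)" by (simp add: fun_eq_iff rho)
      ultimately show ?thesis by simp
    qed
    show "\<forall>\<^sub>\<approx>t\<in>UNIV. weierstrass_rho \<alpha> \<delta> t \<noteq> 0" for \<delta>
      using S_generic generic_shift[OF S_generic, of \<delta>] by eventually_elim (simp add: rho)
    show "weierstrass_rho \<alpha> \<delta> (t + 1) = exp (u1 * \<delta>) * weierstrass_rho \<alpha> \<delta> t" for \<delta> t
      by (rule rho_shift[OF S_1])
    show "weierstrass_rho \<alpha> \<delta> (t + \<alpha>) = exp (u2 * \<delta>) * weierstrass_rho \<alpha> \<delta> t" for \<delta> t
      by (rule rho_shift[OF S_\<alpha>])
  qed fact
qed

subsection \<open>Operators with constant coefficients\<close>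

definition shift_poly :: "complex \<Rightarrow> complex poly \<Rightarrow> mero \<Rightarrow> mero" where
  "shift_poly c p F = (\<Sum>i\<le>degree p. const_mero (coeff p i) * (shift_mero c ^^ i) F)"

lemma shift_poly_0 [simp]: "shift_poly c 0 F = 0"
  by (simp add: shift_poly_def const_mero_simps)

lemma shift_poly_pCons: "shift_poly c (pCons a p) F = const_mero a * F + shift_mero c (shift_poly c p F)"
proof (cases "p = 0")
  case False
  thus ?thesis
    unfolding shift_poly_def
    by (simp add: sum.atMost_Suc_shift shift_mero_sum shift_mero_mult const_mero_simps del: sum.atMost_Suc)
qed (simp add: shift_poly_def)

lemma shift_poly_add: "shift_poly c (p + q) F = shift_poly c p F + shift_poly c q F"
  by (induction p q rule: poly_induct2) (simp_all add: shift_poly_pCons const_mero_simps shift_mero_add algebra_simps)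

lemma shift_poly_smult: "shift_poly c (smult a p) F = const_mero a * shift_poly c p F"
  by (induction p) (simp_all add: shift_poly_pCons const_mero_simps shift_mero_mult algebra_simps)

lemma shift_poly_mult: "shift_poly c (p * q) F = shift_poly c p (shift_poly c q F)"
  by (induction p) (simp_all add: shift_poly_pCons shift_poly_add shift_poly_smult const_mero_simps)

lemma shift_poly_1: "shift_poly c 1 F = F"
  by (simp add: one_pCons shift_poly_pCons const_mero_simps)

lemma shift_poly_shift: "shift_poly c p (shift_mero d F) = shift_mero d (shift_poly c p F)"
  by (induction p) (simp_all add: shift_poly_pCons shift_mero_add shift_mero_mult const_mero_simps add.commute)

lemma shift_poly_const: "shift_poly c p (const_mero a * F) = const_mero a * shift_poly c p F"
  by (induction p) (simp_all add: shift_poly_pCons shift_mero_mult const_mero_simps algebra_simps)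

lemma shift_poly_arg_add: "shift_poly c p (F + G) = shift_poly c p F + shift_poly c p G"
  by (induction p) (simp_all add: shift_poly_pCons shift_mero_add algebra_simps)

lemma shift_poly_zero [simp]: "shift_poly c p 0 = 0"
  by (induction p) (simp_all add: shift_poly_pCons)

lemma shift_poly_commute: "shift_poly c p (shift_poly d q F) = shift_poly d q (shift_poly c p F)"
  by (induction p)
     (simp_all add: shift_poly_pCons shift_poly_arg_add shift_poly_const shift_poly_shift)

definition twisted_diff :: "complex \<Rightarrow> complex \<Rightarrow> mero \<Rightarrow> mero" where
  "twisted_diff c a F = shift_mero c F - const_mero a * F"

lemma shift_poly_linear: "shift_poly c [:- a, 1:] F = twisted_diff c a F"
  by (simp add: shift_poly_pCons twisted_diff_def const_mero_simps)

lemma shift_poly_linear_power: "shift_poly c ([:- a, 1:] ^ n) F = (twisted_diff c a ^^ n) F"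
  by (induction n arbitrary: F) (simp_all only: power_0 power_Suc shift_poly_1 shift_poly_mult shift_poly_linear funpow.simps id_apply o_apply)

lemma twisted_diff_zero [simp]: "twisted_diff c a 0 = 0"
  by (simp add: twisted_diff_def)

lemma twisted_diff_commute: "twisted_diff c a (twisted_diff d b F) = twisted_diff d b (twisted_diff c a F)"
  using shift_poly_commute[of c "[:- a, 1:]" d "[:- b, 1:]" F] by (simp only: shift_poly_linear)

lemma twisted_diff_pow_commute: "(twisted_diff c a ^^ n) (twisted_diff d b F) = twisted_diff d b ((twisted_diff c a ^^ n) F)"
  by (induction n) (simp_all add: twisted_diff_commute)

lemma twisted_diff_pow_zero: "(twisted_diff c a ^^ n) 0 = 0"
  by (induction n) auto

lemma twisted_diff_pow_diff: "(twisted_diff c a ^^ n) (F - G) = (twisted_diff c a ^^ n) F - (twisted_diff c a ^^ n) G"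
proof -
  have "twisted_diff c a (F - G) = twisted_diff c a F - twisted_diff c a G" for F G
    using shift_mero_add[of c "F - G" G] by (simp add: twisted_diff_def algebra_simps)
  thus ?thesis by (induction n) auto
qed

text \<open>Dividing by an eigenfunction for \<open>a\<close> turns shift minus \<open>a\<close>
  into shift minus 1, up to a factor. Generalized eigenvectors become unipotent functions in this
  way.\<close>

lemma twisted_diff_mult_eigen:
  assumes "shift_mero c E = const_mero a * E"
  shows "(twisted_diff c a ^^ n) (E * F) = const_mero (a ^ n) * E * (twisted_diff c 1 ^^ n) F"
proof (induction n)
  case (Suc n)
  have "twisted_diff c a (const_mero (a ^ n) * E * G) = const_mero (a ^ Suc n) * E * twisted_diff c 1 G" for G
    by (simp add: twisted_diff_def shift_mero_mult assms const_mero_simps algebra_simps)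
  thus ?case by (simp add: Suc)
qed (simp add: const_mero_simps)

text \<open>Primary decomposition: a Bezout identity splits off the full power of one root of
  \<open>P\<close>, and the cofactor has smaller degree. The root 0 contributes nothing because
  shifts are injective. The predicate \<open>C\<close> is inherited by the components, and
  \<open>R\<close> is any property that is closed under sums.\<close>

lemma generalized_eigenvector_decomposition:
  assumes C: "\<And>p F. C F \<Longrightarrow> C (shift_poly c p F)"
    and R0: "R 0" and R_add: "\<And>F G. R F \<Longrightarrow> R G \<Longrightarrow> R (F + G)"
    and eigen: "\<And>a n F. a \<noteq> 0 \<Longrightarrow> C F \<Longrightarrow> (twisted_diff c a ^^ n) F = 0 \<Longrightarrow> R F"
    and "P \<noteq> 0" "C F" "shift_poly c P F = 0"
  shows "R F"
  using assms(5-7)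
proof (induction "degree P" arbitrary: P F rule: less_induct)
  case less
  show ?case
  proof (cases "degree P = 0")
    case True
    then obtain k where k: "P = [:k:]" by (rule degree_eq_zeroE)
    with less have "F = 0" by (auto simp: shift_poly_pCons)
    thus ?thesis using R0 by simp
  next
    case False
    then obtain a where a: "poly P a = 0"
      using fundamental_theorem_of_algebra[of P] unfolding constant_degree by blast
    define n where "n = order a P"
    obtain Q where Q: "P = [:- a, 1:] ^ n * Q" "\<not> [:- a, 1:] dvd Q"
      using order_decomp[OF less(2), of a] by (auto simp: n_def)
    have n: "n > 0" using a less(2) by (simp add: n_def order_root)
    have Q0: "Q \<noteq> 0" using Q(2) by auto
    have "degree P = n + degree Q" using Q0 by (simp add: Q(1) degree_mult_eq degree_power_eq)
    hence deg: "degree Q < degree P" using n by simp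
    have "prime_elem [:- a, 1:]" by (rule prime_elem_linear_field_poly) simp
    hence "coprime [:- a, 1:] Q" using Q(2) prime_elem_imp_coprime by blast
    hence "coprime ([:- a, 1:] ^ n) Q" by simp
    then obtain u v where uv: "u * [:- a, 1:] ^ n + v * Q = 1"
      using bezout_coefficients_fst_snd[of "[:- a, 1:] ^ n" Q] by (metis coprime_imp_gcd_eq_1)
    have kill: "shift_poly c ([:- a, 1:] ^ n) (shift_poly c (v * Q) F) = 0" "shift_poly c Q (shift_poly c (u * [:- a, 1:] ^ n) F) = 0"
    proof -
      have *: "shift_poly c (r * P) F = 0" for r by (simp add: shift_poly_mult less(4))
      show "shift_poly c ([:- a, 1:] ^ n) (shift_poly c (v * Q) F) = 0"
        using *[of v] unfolding Q(1) shift_poly_mult[symmetric] by (simp only: mult_ac)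
      show "shift_poly c Q (shift_poly c (u * [:- a, 1:] ^ n) F) = 0"
        using *[of u] unfolding Q(1) shift_poly_mult[symmetric] by (simp only: mult_ac)
    qed
    have "R (shift_poly c (v * Q) F)"
    proof (cases "a = 0")
      case True
      have "shift_poly c ([:- a, 1:] ^ n) G = (shift_mero c ^^ n) G" for G
        by (simp only: shift_poly_linear_power True) (simp add: twisted_diff_def[abs_def] const_mero_simps)
      hence "shift_poly c (v * Q) F = 0" using kill(1) by (simp add: shift_mero_pow)
      thus ?thesis using R0 by simp
    next
      case False
      thus ?thesis using kill(1) C[OF less(3)] eigen unfolding shift_poly_linear_power by blast
    qed
    moreover have "R (shift_poly c (u * [:- a, 1:] ^ n) F)"
      by (rule less(1)[OF deg Q0 C[OF less(3)] kill(2)])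
    moreover have "F = shift_poly c (u * [:- a, 1:] ^ n) F + shift_poly c (v * Q) F"
      using arg_cong[OF uv, of "\<lambda>p. shift_poly c p F"] by (simp only: shift_poly_add shift_poly_1)
    ultimately show ?thesis using R_add by metis
  qed
qed

text \<open>The decomposition is applied for one shift and then to each component for the other.
  Commutativity lets the predicate \<open>C\<close> of each round carry the relation of the other
  operator along.\<close>

lemma joint_eigenvector_decomposition:
  assumes C_const: "\<And>a F. C F \<Longrightarrow> C (const_mero a * F)" and C_add: "\<And>F G. C F \<Longrightarrow> C G \<Longrightarrow> C (F + G)"
    and C_shift: "\<And>c F. C F \<Longrightarrow> C (shift_mero c F)"
    and R0: "R 0" and R_add: "\<And>F G. R F \<Longrightarrow> R G \<Longrightarrow> R (F + G)"
    and eigen: "\<And>a b n m F. a \<noteq> 0 \<Longrightarrow> b \<noteq> 0 \<Longrightarrow> C F \<Longrightarrow> (twisted_diff c a ^^ n) F = 0 \<Longrightarrow>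
        (twisted_diff d b ^^ m) F = 0 \<Longrightarrow> R F"
    and P: "P \<noteq> 0" "shift_poly c P F = 0" and Q: "Q \<noteq> 0" "shift_poly d Q F = 0" and F: "C F"
  shows "R F"
proof -
  have C_poly: "C (shift_poly e p F)" if "C F" for e p F
  proof (induction p)
    case 0
    show ?case using C_const[OF that, of 0] by (simp add: const_mero_simps)
  next
    case (pCons a p)
    thus ?case unfolding shift_poly_pCons by (intro C_add C_const C_shift that)
  qed
  show ?thesis
  proof (rule generalized_eigenvector_decomposition[where C = "\<lambda>F. C F \<and> shift_poly d Q F = 0" and R = R and c = c and P = P])
    show "C (shift_poly c p F) \<and> shift_poly d Q (shift_poly c p F) = 0" if "C F \<and> shift_poly d Q F = 0" for p F
      using that C_poly by (simp add: shift_poly_commute[of d Q c p])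
    show "R F" if "a \<noteq> 0" "C F \<and> shift_poly d Q F = 0" "(twisted_diff c a ^^ n) F = 0" for a n F
    proof (rule generalized_eigenvector_decomposition[where C = "\<lambda>F. C F \<and> shift_poly c ([:- a, 1:] ^ n) F = 0" and R = R and c = d and P = Q])
      show "C (shift_poly d p F) \<and> shift_poly c ([:- a, 1:] ^ n) (shift_poly d p F) = 0"
        if "C F \<and> shift_poly c ([:- a, 1:] ^ n) F = 0" for p F
        using that C_poly by (simp only: shift_poly_commute[of c _ d p] shift_poly_zero)
      show "R G" if "b \<noteq> 0" "C G \<and> shift_poly c ([:- a, 1:] ^ n) G = 0" "(twisted_diff d b ^^ m) G = 0" for b m G
        using eigen[OF \<open>a \<noteq> 0\<close> that(1), of G n m] that by (simp only: shift_poly_linear_power)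
      show "C F \<and> shift_poly c ([:- a, 1:] ^ n) F = 0"
        using that by (simp only: shift_poly_linear_power)
    qed (use that R0 R_add Q in auto)
  qed (use R0 R_add P Q F in auto)
qed

text \<open>Characteristic 0 makes the binomial coefficients \<open>z gchoose n\<close> of
  meromorphic functions available.\<close>

instance mero :: field_char_0
proof
  have "of_nat n = const_mero (of_nat n)" for n by (induction n) (auto simp: const_mero_simps)
  moreover have "const_mero a = const_mero b \<longleftrightarrow> a = b" for a b by (metis ev_const)
  ultimately show "inj (of_nat :: nat \<Rightarrow> mero)"
    by (intro injI) simp
qed

subsection \<open>Functions on the surface of the logarithm\<close>

lemma ls_shift_pow: "(ls_shift l ^^ i) f (ls_point w) = f (ls_point (w + of_nat i * l))"
proof (induction i arbitrary: w)
  case (Suc i)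
  have "(ls_shift l ^^ Suc i) f (ls_point w) = (ls_shift l ^^ i) f (ls_point (l + w))"
    by (simp add: ls_shift_def ls_mult_def)
  thus ?case by (simp add: Suc algebra_simps)
qed simp

lemma generic_ball_lessThan:
  fixes m :: nat
  assumes "\<And>i. i < m \<Longrightarrow> \<forall>\<^sub>\<approx>w\<in>UNIV. P i (w :: complex)"
  shows "\<forall>\<^sub>\<approx>w\<in>UNIV. \<forall>i<m. P i w"
proof -
  have "\<forall>\<^sub>\<approx>w\<in>UNIV. \<forall>i\<in>{..<m}. P i w" by (rule eventually_ball_finite) (auto intro: assms)
  thus ?thesis by (rule eventually_mono) auto
qed

lemma ls_solves_qdiff_iff:
  assumes f: "\<forall>\<^sub>\<approx>w\<in>UNIV. f (ls_point w) = ev F w"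
  shows "ls_solves_qdiff l f \<longleftrightarrow>
    (\<exists>m b. m \<ge> 1 \<and> (shift_mero l ^^ m) F + (\<Sum>i<m. exp_ratfun.lift (b i) * (shift_mero l ^^ i) F) = 0)"
proof -
  have "ls_generic (\<lambda>p. (ls_shift l ^^ m) f p + (\<Sum>i<m. ratfun_eval (b i) (ls_proj p) * (ls_shift l ^^ i) f p) = 0) \<longleftrightarrow>
        (shift_mero l ^^ m) F + (\<Sum>i<m. exp_ratfun.lift (b i) * (shift_mero l ^^ i) F) = 0" (is "?A \<longleftrightarrow> ?S = 0") for m b
  proof -
    have gen: "\<forall>\<^sub>\<approx>w\<in>UNIV. ev ?S w = (ls_shift l ^^ m) f (ls_point w)
        + (\<Sum>i<m. ratfun_eval (b i) (ls_proj (ls_point w)) * (ls_shift l ^^ i) f (ls_point w))"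
    proof -
      have 1: "\<forall>\<^sub>\<approx>w\<in>UNIV. \<forall>i<Suc m. f (ls_point (w + of_nat i * l)) = ev ((shift_mero l ^^ i) F) w"
        by (rule generic_ball_lessThan) (use generic_shift[OF f] in \<open>simp add: shift_mero_pow\<close>)
      have 2: "\<forall>\<^sub>\<approx>w\<in>UNIV. \<forall>i<m. ev (exp_ratfun.lift (b i) * (shift_mero l ^^ i) F) w =
          ratfun_eval (b i) (exp w) * ev ((shift_mero l ^^ i) F) w"
      proof (rule generic_ball_lessThan)
        fix i
        show "\<forall>\<^sub>\<approx>w\<in>UNIV. ev (exp_ratfun.lift (b i) * (shift_mero l ^^ i) F) w = ratfun_eval (b i) (exp w) * ev ((shift_mero l ^^ i) F) w"
          using ev_mult[of "exp_ratfun.lift (b i)" "(shift_mero l ^^ i) F"] ev_exp_ratfun[of "b i"] by eventually_elim simp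
      qed
      show ?thesis
        using 1 2 ev_add[of "(shift_mero l ^^ m) F" "\<Sum>i<m. exp_ratfun.lift (b i) * (shift_mero l ^^ i) F"]
          ev_sum[of "\<lambda>i. exp_ratfun.lift (b i) * (shift_mero l ^^ i) F" "{..<m}"]
        by eventually_elim (simp add: ls_shift_pow)
    qed
    show ?thesis
    proof
      assume ?A
      hence A: "\<forall>\<^sub>\<approx>w\<in>UNIV. (ls_shift l ^^ m) f (ls_point w)
        + (\<Sum>i<m. ratfun_eval (b i) (ls_proj (ls_point w)) * (ls_shift l ^^ i) f (ls_point w)) = 0" by (simp only: ls_generic_def)
      thus "?S = 0" by (intro mero_eqI, use gen A in eventually_elim) (simp only: ev_0)
    next
      assume S: "?S = 0"
      show ?A using gen unfolding ls_generic_def S by eventually_elim (drule sym, simp only: ev_0)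
    qed
  qed
  thus ?thesis unfolding ls_solves_qdiff_def by simp
qed

lemma generic_scale:
  assumes "\<forall>\<^sub>\<approx>t\<in>UNIV. P t" "l \<noteq> (0 :: complex)"
  shows "\<forall>\<^sub>\<approx>w\<in>UNIV. P (w / l)"
  unfolding generic_iff
proof
  fix z
  have "filterlim (\<lambda>w. w / l) (at (z / l)) (at z)"
    unfolding filterlim_at using assms(2) by (auto intro!: tendsto_eq_intros simp: eventually_at_filter)
  thus "\<forall>\<^sub>F w in at z. P (w / l)"
    using assms(1) unfolding generic_iff filterlim_iff by blast
qed

lemma meromorphic_scale: "f meromorphic_on UNIV \<Longrightarrow> l \<noteq> 0 \<Longrightarrow> (\<lambda>w. f (w / l)) meromorphic_on UNIV"
  by (intro meromorphic_on_compose[of f UNIV "\<lambda>w. w / l"] analytic_intros) auto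

text \<open>The two descriptions of \<open>h\<close> have different uses: as a polynomial multiple
  of \<open>f\<close> it has no poles beyond those of \<open>f\<close>, and \<open>f\<close> is
  recovered from it by multiplication with a rational function.\<close>

lemma constant_coefficient_solution:
  assumes q: "\<not> root_of_unity (exp l1)" "\<not> root_of_unity (exp l2)" "mult_independent (exp l1) (exp l2)"
    and f: "ls_meromorphic f" "ls_solves_qdiff l1 f" "ls_solves_qdiff l2 f"
  obtains D h P Q where "D \<noteq> 0" "P \<noteq> 0" "Q \<noteq> 0" "shift_poly l1 P h = 0" "shift_poly l2 Q h = 0"
    "\<forall>\<^sub>\<approx>w\<in>UNIV. ev h w = poly D (exp w) * f (ls_point w)"
    "\<forall>\<^sub>\<approx>w\<in>UNIV. f (ls_point w) = ev (exp_ratfun.lift (inverse (pfrac D)) * h) w"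
proof -
  interpret qdiff "\<lambda>r F. exp_ratfun.lift r * F" "shift_mero l1" "shift_mero l2" "exp l1" "exp l2"
    by (rule qdiff_mero) fact+
  define F where "F = mk_mero (\<lambda>w. f (ls_point w))"
  have F: "\<forall>\<^sub>\<approx>w\<in>UNIV. f (ls_point w) = ev F w"
    using ev_mk_mero_generic[OF f(1)[unfolded ls_meromorphic_def]] unfolding F_def by eventually_elim simp
  obtain m1 b1 m2 b2 where
      "(shift_mero l1 ^^ m1) F + (\<Sum>i<m1. exp_ratfun.lift (b1 i) * (shift_mero l1 ^^ i) F) = 0"
      "(shift_mero l2 ^^ m2) F + (\<Sum>i<m2. exp_ratfun.lift (b2 i) * (shift_mero l2 ^^ i) F) = 0"
    using f(2,3) unfolding ls_solves_qdiff_iff[OF F] by blast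
  then obtain D P Q where D: "D \<noteq> 0" "P \<noteq> 0" "Q \<noteq> 0"
    "(\<Sum>i\<le>degree P. exp_ratfun.lift (pfrac [:coeff P i:]) * (shift_mero l1 ^^ i) (exp_ratfun.lift (pfrac D) * F)) = 0"
    "(\<Sum>i\<le>degree Q. exp_ratfun.lift (pfrac [:coeff Q i:]) * (shift_mero l2 ^^ i) (exp_ratfun.lift (pfrac D) * F)) = 0"
    by (rule constant_coefficient_multiple)
  define h where "h = exp_ratfun.lift (pfrac D) * F"
  have "exp_ratfun.lift (pfrac D) = mk_mero (\<lambda>w. poly D (exp w))"
    using exp_ratfun.one by simp
  hence nz: "exp_ratfun.lift (pfrac D) \<noteq> 0" and lift_D: "\<forall>\<^sub>\<approx>w\<in>UNIV. ev (exp_ratfun.lift (pfrac D)) w = poly D (exp w)"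
    using ev_mk_mero_generic[OF exp_poly_meromorphic[of D UNIV]] exp_ratfun.nonzero[OF D(1)] by simp_all
  show thesis
  proof (rule that[OF D(1-3)])
    show "shift_poly l1 P h = 0" "shift_poly l2 Q h = 0"
      using D(4,5) by (simp_all only: shift_poly_def exp_ratfun_const h_def)
    show "\<forall>\<^sub>\<approx>w\<in>UNIV. ev h w = poly D (exp w) * f (ls_point w)"
      using ev_mult[of "exp_ratfun.lift (pfrac D)" F] lift_D F by eventually_elim (simp add: h_def)
    have "exp_ratfun.lift (inverse (pfrac D)) * h = F"
      using nz by (simp only: h_def exp_ratfun.lift_inverse mult.assoc[symmetric] left_inverse mult_1_left simp_thms)
    thus "\<forall>\<^sub>\<approx>w\<in>UNIV. f (ls_point w) = ev (exp_ratfun.lift (inverse (pfrac D)) * h) w" using F by simp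
  qed
qed

subsection \<open>Poles\<close>

lemma not_pole_tendsto:
  assumes "\<not> is_pole (ev F) z"
  shows "ev F \<midarrow>z\<rightarrow> ev F z"
  using assms ev_nicely[of F] by (auto simp: nicely_meromorphic_on_def)

text \<open>A finite limit of any generically equal expression excludes a pole; the pole rules for
  sums and multiples reduce to this.\<close>

lemma generic_tendsto_not_pole:
  assumes "\<forall>\<^sub>\<approx>w\<in>UNIV. ev F w = f w" "f \<midarrow>z\<rightarrow> c"
  shows "\<not> is_pole (ev F) z"
proof
  assume pole: "is_pole (ev F) z"
  have "ev F \<midarrow>z\<rightarrow> c"
    using assms(2) by (rule Lim_transform_eventually) (use assms(1) in \<open>auto simp: generic_iff eq_commute\<close>)
  thus False
    using pole not_tendsto_and_filterlim_at_infinity[of "at z" "ev F" c] by (auto simp: is_pole_def)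
qed

lemma is_pole_ev_add: "is_pole (ev (F + G)) z \<Longrightarrow> is_pole (ev F) z \<or> is_pole (ev G) z"
  using generic_tendsto_not_pole[OF ev_add tendsto_add[OF not_pole_tendsto not_pole_tendsto]] by blast

lemma not_pole_const: "\<not> is_pole (ev (const_mero a)) z"
  by (rule generic_tendsto_not_pole[of _ "\<lambda>_. a"]) auto

lemma not_pole_0: "\<not> is_pole (ev 0) z"
  using not_pole_const[of 0] by (simp add: const_mero_simps)

lemma is_pole_ev_const_mult: "is_pole (ev (const_mero a * F)) z \<Longrightarrow> is_pole (ev F) z"
  using generic_tendsto_not_pole[OF ev_mult tendsto_mult[OF not_pole_tendsto[of "const_mero a" z] not_pole_tendsto[of F z]]]
    not_pole_const by blast

lemma is_pole_ev_shift: "is_pole (ev (shift_mero c F)) z \<longleftrightarrow> is_pole (ev F) (z + c)"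
proof -
  have "ev (shift_mero c F) = (\<lambda>w. ev F (w + c))" by (simp add: fun_eq_iff)
  thus ?thesis by (simp only: is_pole_shift)
qed

lemma is_pole_twisted_diff:
  assumes "is_pole (ev (twisted_diff c a F)) z"
  shows "is_pole (ev F) z \<or> is_pole (ev F) (z + c)"
proof -
  have "twisted_diff c a F = shift_mero c F + const_mero (- a) * F"
    by (simp add: twisted_diff_def const_mero_simps)
  thus ?thesis
    using assms is_pole_ev_add[of "shift_mero c F" "const_mero (- a) * F" z] is_pole_ev_const_mult is_pole_ev_shift by metis
qed

lemma no_poles_holomorphic: "(\<And>z. \<not> is_pole (ev F) z) \<Longrightarrow> ev F holomorphic_on UNIV"
  using nicely_meromorphic_without_singularities[OF ev_nicely[of F]] analytic_imp_holomorphic by blast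

lemma generic_not_pole: "\<forall>\<^sub>\<approx>w\<in>UNIV. \<not> is_pole (ev F) w"
  by (rule meromorphic_on_imp_not_pole_cosparse) simp

text \<open>
  By induction on \<open>n + m\<close>, neither \<open>F(z + c) - a F(z)\<close> nor \<open>F(z + d) - b F(z)\<close> has poles; hence the
  poles of \<open>F\<close> are invariant under both shifts.
\<close>

lemma generalized_eigenvector_no_poles:
  assumes per: "\<And>F. C F \<Longrightarrow> (\<And>z. is_pole (ev F) (z + c) = is_pole (ev F) z) \<Longrightarrow>
      (\<And>z. is_pole (ev F) (z + d) = is_pole (ev F) z) \<Longrightarrow> (\<forall>z. \<not> is_pole (ev F) z)"
    and C: "\<And>e a F. C F \<Longrightarrow> C (twisted_diff e a F)"
    and "a \<noteq> 0" "b \<noteq> 0" "C F" "(twisted_diff c a ^^ n) F = 0" "(twisted_diff d b ^^ m) F = 0"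
  shows "\<forall>z. \<not> is_pole (ev F) z"
  using assms(5-7)
proof (induction "n + m" arbitrary: n m F)
  case (Suc k)
  have pole_iff: "is_pole (ev F) (z + e) = is_pole (ev F) z"
    if td: "\<forall>z. \<not> is_pole (ev (twisted_diff e g F)) z" and "g \<noteq> 0" for e g z
  proof
    have "shift_mero e F = twisted_diff e g F + const_mero g * F" by (simp add: twisted_diff_def)
    thus "is_pole (ev F) z" if "is_pole (ev F) (z + e)"
      using that is_pole_ev_add[of "twisted_diff e g F" "const_mero g * F" z] is_pole_ev_const_mult td is_pole_ev_shift by metis
    have "const_mero g * F = shift_mero e F + const_mero (- 1) * twisted_diff e g F"
      by (simp add: twisted_diff_def const_mero_simps)
    moreover have "F = const_mero (inverse g) * (const_mero g * F)"
      using \<open>g \<noteq> 0\<close> by (simp add: const_mero_simps(2) mult.assoc[symmetric] flip: const_mero_simps(4))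
    ultimately show "is_pole (ev F) (z + e)" if "is_pole (ev F) z"
      using that is_pole_ev_add[of "shift_mero e F" "const_mero (- 1) * twisted_diff e g F" z] is_pole_ev_const_mult td is_pole_ev_shift
      by metis
  qed
  show ?case
  proof (cases n)
    case (Suc n')
    show ?thesis
    proof (cases m)
      case (Suc m')
      have "\<forall>z. \<not> is_pole (ev (twisted_diff c a F)) z"
      proof (rule Suc.hyps(1))
        show "k = n' + m" using \<open>Suc k = n + m\<close> \<open>n = Suc n'\<close> by simp
        show "(twisted_diff c a ^^ n') (twisted_diff c a F) = 0"
          using Suc.prems(2) unfolding \<open>n = Suc n'\<close> funpow_Suc_right by simp
        show "(twisted_diff d b ^^ m) (twisted_diff c a F) = 0"
          using Suc.prems(3) by (simp add: twisted_diff_pow_commute)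
      qed (rule C[OF Suc.prems(1)])
      moreover have "\<forall>z. \<not> is_pole (ev (twisted_diff d b F)) z"
      proof (rule Suc.hyps(1))
        show "k = n + m'" using \<open>Suc k = n + m\<close> \<open>m = Suc m'\<close> by simp
        show "(twisted_diff d b ^^ m') (twisted_diff d b F) = 0"
          using Suc.prems(3) unfolding \<open>m = Suc m'\<close> funpow_Suc_right by simp
        show "(twisted_diff c a ^^ n) (twisted_diff d b F) = 0"
          using Suc.prems(2) by (simp add: twisted_diff_pow_commute)
      qed (rule C[OF Suc.prems(1)])
      ultimately show ?thesis
        using per[OF Suc.prems(1)] pole_iff \<open>a \<noteq> 0\<close> \<open>b \<noteq> 0\<close> by blast
    qed (use Suc.prems in \<open>simp add: not_pole_0\<close>)
  qed (use Suc.prems in \<open>simp add: not_pole_0\<close>)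
qed (simp add: not_pole_0)

subsection \<open>Entire solutions\<close>

text \<open>The two logarithms generate a free group of rank two. It is dense in a line through 0 if
  their ratio is real and a lattice in the plane otherwise, and the arguments split
  accordingly.\<close>

locale two_periods =
  fixes l1 l2 :: complex
  assumes l1: "l1 \<noteq> 0" and indep: "\<And>i j :: int. of_int i * l1 + of_int j * l2 = 0 \<Longrightarrow> i = 0 \<and> j = 0"
begin

text \<open>Dirichlet approximation of the real ratio gives small periods, and independence keeps
  them from being 0.\<close>

lemma small_period:
  assumes "l2 / l1 \<in> \<real>" "\<epsilon> > 0"
  obtains i j :: int where "of_int i * l1 + of_int j * l2 \<noteq> 0" "norm (of_int i * l1 + of_int j * l2) < \<epsilon>"
proof -
  obtain \<theta> where "l2 / l1 = of_real \<theta>" using assms(1) by (auto elim: Reals_cases)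
  hence \<theta>: "l2 = of_real \<theta> * l1" using l1 by (simp add: field_simps)
  obtain N :: nat where N: "N > 0" "norm l1 / \<epsilon> < N"
    using reals_Archimedean2[of "norm l1 / \<epsilon>"] by (metis assms(2) divide_nonneg_pos gr0I less_le_not_le norm_ge_zero of_nat_0)
  obtain h k where hk: "0 < k" "\<bar>of_int k * \<theta> - of_int h\<bar> < 1 / N"
    using Dirichlet_approx[OF N(1)] by metis
  have eq: "of_int (- h) * l1 + of_int k * l2 = of_real (of_int k * \<theta> - of_int h) * l1"
    by (simp add: \<theta> algebra_simps)
  have "norm (of_int (- h) * l1 + of_int k * l2) = \<bar>of_int k * \<theta> - of_int h\<bar> * norm l1"
    unfolding eq norm_mult norm_of_real ..
  also have "\<dots> < 1 / N * norm l1" using hk(2) l1 by (intro mult_strict_right_mono) auto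
  also have "\<dots> < \<epsilon>" using N assms(2) by (simp add: field_simps)
  finally show thesis using that[of "- h" k] indep[of "- h" k] hk(1) by auto
qed

text \<open>An invariant property that holds somewhere also holds arbitrarily close by, whereas one
  that fails generically fails on a punctured neighbourhood. This is applied to zeros of entire
  functions and to poles.\<close>

lemma invariant_generic:
  assumes real: "l2 / l1 \<in> \<real>"
    and inv: "\<And>w. P (w + l1) = P w" "\<And>w. P (w + l2) = P w" and gen: "\<forall>\<^sub>\<approx>w\<in>UNIV. \<not> P w"
  shows "\<not> P w"
proof
  assume P: "P w"
  have "\<forall>\<^sub>F z in at w. \<not> P z" using gen by (simp add: generic_iff)
  then obtain \<epsilon> where \<epsilon>: "\<epsilon> > 0" "\<And>z. z \<noteq> w \<Longrightarrow> dist z w < \<epsilon> \<Longrightarrow> \<not> P z"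
    unfolding eventually_at by auto
  obtain i j :: int where ij: "of_int i * l1 + of_int j * l2 \<noteq> 0" "norm (of_int i * l1 + of_int j * l2) < \<epsilon>"
    by (rule small_period[OF real \<epsilon>(1)])
  have "P (w + of_int i * l1 + of_int j * l2)"
    using P periodic_of_int[of P l1 w i, OF inv(1)] periodic_of_int[of P l2 "w + of_int i * l1" j, OF inv(2)] by simp
  moreover have "\<not> P (w + (of_int i * l1 + of_int j * l2))" by (rule \<epsilon>(2)) (use ij in \<open>auto simp: dist_norm\<close>)
  ultimately show False by (simp add: add.assoc)
qed

lemma entire_scale: "f holomorphic_on UNIV \<Longrightarrow> (\<lambda>t. f (c * t)) holomorphic_on UNIV"
  using holomorphic_on_compose[of "\<lambda>t. c * t" UNIV f] holomorphic_on_subset[of f UNIV "range ((*) c)"]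
  by (auto simp: o_def intro!: holomorphic_intros)

lemma entire_periodic_constant:
  assumes f: "f holomorphic_on UNIV" and per: "\<And>w. f (w + l1) = f w" "\<And>w. f (w + l2) = f w"
  shows "f w = f 0"
proof (cases "l2 / l1 \<in> \<real>")
  case True
  show ?thesis
  proof (rule ccontr)
    assume ne: "f w \<noteq> f 0"
    have "(\<lambda>w. f w - f 0) holomorphic_on UNIV" by (intro holomorphic_intros f)
    hence "\<forall>\<^sub>\<approx>z\<in>UNIV. f z - f 0 \<noteq> 0" by (rule entire_nonzero_generic[of _ w]) (use ne in simp)
    hence gen: "\<forall>\<^sub>\<approx>z\<in>UNIV. \<not> f z = f 0" by simp
    have "\<not> f 0 = f 0" by (rule invariant_generic[OF True _ _ gen]) (simp_all add: per)
    thus False by simp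
  qed
next
  case False
  obtain c where c: "\<And>t. f (l1 * t) = c"
  proof (rule entire_norm_periodic_constant[OF False entire_scale[OF f, of l1]])
    show "norm (f (l1 * (t + 1))) = norm (f (l1 * t))" for t
      using per(1)[of "l1 * t"] by (simp add: algebra_simps)
    show "norm (f (l1 * (t + l2 / l1))) = norm (f (l1 * t))" for t
      using per(2)[of "l1 * t"] l1 by (simp add: algebra_simps)
  qed (rule that)
  show ?thesis using c[of "w / l1"] c[of 0] l1 by simp
qed

text \<open>For a real ratio the zeros of \<open>u\<close> form an invariant set, so there are none,
  and the logarithmic derivative is invariant and hence constant. For a nonreal ratio a suitable
  exponential makes both multipliers of modulus 1, and Liouville applies.\<close>

lemma entire_eigenfunction:
  assumes u: "u holomorphic_on UNIV" "u w0 \<noteq> 0" and ab: "a \<noteq> 0" "b \<noteq> 0"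
    and per: "\<And>w. u (w + l1) = a * u w" "\<And>w. u (w + l2) = b * u w"
  obtains s where "a = exp (s * l1)" "b = exp (s * l2)"
proof -
  have "\<exists>s. \<forall>w. u w * exp (- s * w) = u 0"
  proof (cases "l2 / l1 \<in> \<real>")
    case True
    have gen: "\<forall>\<^sub>\<approx>w\<in>UNIV. \<not> u w = 0" by (rule entire_nonzero_generic[OF u])
    have nz: "u w \<noteq> 0" for w
      by (rule invariant_generic[OF True _ _ gen]) (simp_all add: per ab)
    have u': "(u has_field_derivative deriv u w) (at w)" for w
      using holomorphic_derivI[OF u(1)] by simp
    have u'_shift: "deriv u (w + e) = g * deriv u w" if "\<And>w. u (w + e) = g * u w" for e g w
    proof -
      have "((\<lambda>w. u (w + e)) has_field_derivative deriv u (w + e)) (at w)"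
        using u'[of "w + e"] by (simp add: DERIV_shift)
      moreover have "((\<lambda>w. g * u w) has_field_derivative g * deriv u w) (at w)"
        by (intro DERIV_cmult u')
      ultimately show ?thesis unfolding that using DERIV_unique by blast
    qed
    define s where "s = deriv u 0 / u 0"
    have s_eq: "deriv u w / u w = deriv u 0 / u 0" for w
    proof (rule entire_periodic_constant[where f = "\<lambda>w. deriv u w / u w"])
      show "(\<lambda>w. deriv u w / u w) holomorphic_on UNIV"
        by (intro holomorphic_intros holomorphic_deriv u(1)) (use nz in auto)
    qed (use ab in \<open>simp_all add: per u'_shift[OF per(1)] u'_shift[OF per(2)]\<close>)
    have s: "deriv u w = s * u w" for w
      unfolding s_def s_eq[of w, symmetric] using nz[of w] by simp
    have "((\<lambda>w. u w * exp (- s * w)) has_field_derivative 0) (at w)" for w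
      by (rule derivative_eq_intros u' refl)+ (simp add: s)
    hence "\<exists>c. \<forall>w\<in>UNIV. u w * exp (- s * w) = c"
      by (intro has_field_derivative_zero_constant) simp_all
    then obtain c where "\<And>w. u w * exp (- s * w) = c" by blast
    hence "u w * exp (- s * w) = u 0 * exp (- s * 0)" for w by metis
    hence "u w * exp (- s * w) = u 0" for w by simp
    thus ?thesis by blast
  next
    case False
    define \<alpha> where "\<alpha> = l2 / l1"
    have im: "Im \<alpha> \<noteq> 0" using False complex_is_Real_iff by (auto simp: \<alpha>_def)
    \<comment> \<open>The real and imaginary parts solve \<open>Re x = ln (norm a)\<close> and
      \<open>Re (x * \<alpha>) = ln (norm b)\<close>, which is possible because
      \<open>Im \<alpha> \<noteq> 0\<close>.\<close>
    define x where "x = Complex (ln (norm a)) ((ln (norm a) * Re \<alpha> - ln (norm b)) / Im \<alpha>)"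
    have x: "Re x = ln (norm a)" "Re (x * \<alpha>) = ln (norm b)" using im by (simp_all add: x_def)
    define v where "v t = u (l1 * t) * exp (- x * t)" for t
    have "v holomorphic_on UNIV" unfolding v_def by (intro holomorphic_intros entire_scale u)
    then obtain c where c: "\<And>t. v t = c"
    proof (rule entire_norm_periodic_constant[OF False[folded \<alpha>_def]])
      have "norm (v (t + 1)) = norm a * exp (- Re x) * norm (v t)" for t
      proof -
        have "v (t + 1) = a * exp (- x) * v t"
        proof -
          have "l1 * (t + 1) = l1 * t + l1" "- x * (t + 1) = - x + - x * t" by (simp_all add: algebra_simps)
          thus ?thesis unfolding v_def by (simp only: per exp_add) simp
        qed
        thus ?thesis by (simp only: norm_mult norm_exp_eq_Re uminus_complex.simps)
      qed
      thus "norm (v (t + 1)) = norm (v t)" for t using ab by (simp add: x exp_minus)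
      have "norm (v (t + \<alpha>)) = norm b * exp (- Re (x * \<alpha>)) * norm (v t)" for t
      proof -
        have "v (t + \<alpha>) = b * exp (- (x * \<alpha>)) * v t"
        proof -
          have "l1 * (t + \<alpha>) = l1 * t + l2" "- x * (t + \<alpha>) = - (x * \<alpha>) + - x * t"
            using l1 by (simp_all add: \<alpha>_def algebra_simps)
          thus ?thesis unfolding v_def by (simp only: per exp_add) simp
        qed
        thus ?thesis by (simp only: norm_mult norm_exp_eq_Re uminus_complex.simps)
      qed
      thus "norm (v (t + \<alpha>)) = norm (v t)" for t using ab by (simp only: x exp_minus) simp
    qed (rule that)
    have "u w * exp (- (x / l1) * w) = u 0" for w
      using c[of "w / l1"] c[of 0] l1 by (simp add: v_def)
    thus ?thesis by blast
  qed
  then obtain s where s: "\<And>w. u w * exp (- s * w) = u 0" by blast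
  have u_eq: "u w = u 0 * exp (s * w)" for w
    unfolding s[of w, symmetric] by (simp add: exp_minus)
  have u0: "u 0 \<noteq> 0" using u(2) u_eq[of w0] by auto
  show thesis
  proof (rule that)
    show "a = exp (s * l1)" using per(1)[of 0] u_eq[of l1] u0 by simp
    show "b = exp (s * l2)" using per(2)[of 0] u_eq[of l2] u0 by simp
  qed
qed

text \<open>The difference operator on functions instead of \<open>mero\<close>, where it can be
  combined with derivatives.\<close>

definition fdiff :: "complex \<Rightarrow> (complex \<Rightarrow> complex) \<Rightarrow> complex \<Rightarrow> complex" where
  "fdiff c f w = f (w + c) - f w"

lemma entire_shift: "f holomorphic_on UNIV \<Longrightarrow> (\<lambda>t. f (t + c)) holomorphic_on UNIV"
proof -
  assume f: "f holomorphic_on UNIV"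
  have "(f \<circ> (\<lambda>t. t + c)) holomorphic_on UNIV"
    by (intro holomorphic_on_compose holomorphic_intros holomorphic_on_subset[OF f]) auto
  thus ?thesis by (simp add: o_def)
qed

lemma fdiff_entire: "f holomorphic_on UNIV \<Longrightarrow> fdiff c f holomorphic_on UNIV"
  unfolding fdiff_def[abs_def] by (intro holomorphic_intros entire_shift)

lemma fdiff_pow_entire: "f holomorphic_on UNIV \<Longrightarrow> (fdiff c ^^ n) f holomorphic_on UNIV"
  by (induction n) (auto intro: fdiff_entire)

lemma deriv_pow_entire: "f holomorphic_on UNIV \<Longrightarrow> (deriv ^^ n) f holomorphic_on UNIV"
  by (intro holomorphic_higher_deriv) auto

lemma fdiff_commute: "fdiff c (fdiff d f) = fdiff d (fdiff c f)"
  by (simp add: fun_eq_iff fdiff_def add_ac)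

lemma fdiff_pow_commute: "(fdiff c ^^ n) (fdiff d f) = fdiff d ((fdiff c ^^ n) f)"
  by (induction n) (simp_all add: fdiff_commute)

lemma deriv_fdiff:
  assumes "f holomorphic_on UNIV"
  shows "deriv (fdiff c f) = fdiff c (deriv f)"
proof
  fix w
  have f': "(f has_field_derivative deriv f w) (at w)" for w
    using holomorphic_derivI[OF assms] by simp
  have "((\<lambda>w. f (w + c)) has_field_derivative deriv f (w + c)) (at w)"
    using f'[of "w + c"] by (simp add: DERIV_shift)
  hence "(fdiff c f has_field_derivative fdiff c (deriv f) w) (at w)"
    unfolding fdiff_def[abs_def] by (intro DERIV_diff f')
  thus "deriv (fdiff c f) w = fdiff c (deriv f) w" by (rule DERIV_imp_deriv)
qed

lemma deriv_pow_fdiff: "f holomorphic_on UNIV \<Longrightarrow> (deriv ^^ n) (fdiff c f) = fdiff c ((deriv ^^ n) f)"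
  by (induction n) (simp_all add: deriv_fdiff deriv_pow_entire)

text \<open>Differences commute with derivatives. By induction the derivative of order
  \<open>n + m - 1\<close> is annihilated by both differences, hence is constant, and one more
  derivative removes it.\<close>

lemma unipotent_deriv:
  assumes "f holomorphic_on UNIV" "(fdiff l1 ^^ n) f = (\<lambda>_. 0)" "(fdiff l2 ^^ m) f = (\<lambda>_. 0)"
  shows "(deriv ^^ (n + m)) f = (\<lambda>_. 0)"
  using assms
proof (induction "n + m" arbitrary: n m f)
  case 0
  hence "n = 0" "m = 0" by simp_all
  thus ?case using "0.prems"(2) by (simp only: funpow_0 add_0)
next
  case (Suc k)
  have zero: "(deriv ^^ j) (\<lambda>_. 0 :: complex) = (\<lambda>_. 0)" for j by (induction j) auto
  show ?case
  proof (cases "n = 0 \<or> m = 0")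
    case True
    hence "f = (\<lambda>_. 0)" using Suc.prems by auto
    thus ?thesis using zero by simp
  next
    case False
    then obtain n' m' where nm: "n = Suc n'" "m = Suc m'" by (metis not0_implies_Suc)
    have k: "k = n' + m" "k = n + m'" using Suc.hyps(2) nm by auto
    have "(deriv ^^ k) (fdiff l1 f) = (\<lambda>_. 0)"
      unfolding k(1)
    proof (rule Suc.hyps(1)[OF k(1)])
      show "(fdiff l1 ^^ n') (fdiff l1 f) = (\<lambda>_. 0)" using Suc.prems(2) unfolding nm funpow_Suc_right by simp
      show "(fdiff l2 ^^ m) (fdiff l1 f) = (\<lambda>_. 0)" using Suc.prems(3) unfolding fdiff_pow_commute by (simp add: fdiff_def fun_eq_iff)
    qed (intro fdiff_entire Suc.prems)
    moreover have "(deriv ^^ k) (fdiff l2 f) = (\<lambda>_. 0)"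
      unfolding k(2)
    proof (rule Suc.hyps(1)[OF k(2)])
      show "(fdiff l2 ^^ m') (fdiff l2 f) = (\<lambda>_. 0)" using Suc.prems(3) unfolding nm funpow_Suc_right by simp
      show "(fdiff l1 ^^ n) (fdiff l2 f) = (\<lambda>_. 0)" using Suc.prems(2) unfolding fdiff_pow_commute by (simp add: fdiff_def fun_eq_iff)
    qed (intro fdiff_entire Suc.prems)
    ultimately have "fdiff l1 ((deriv ^^ k) f) = (\<lambda>_. 0)" "fdiff l2 ((deriv ^^ k) f) = (\<lambda>_. 0)"
      by (simp_all add: deriv_pow_fdiff Suc.prems)
    hence "(deriv ^^ k) f w = (deriv ^^ k) f 0" for w
      by (intro entire_periodic_constant deriv_pow_entire Suc.prems) (auto simp: fdiff_def fun_eq_iff)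
    hence "(deriv ^^ k) f = (\<lambda>_. (deriv ^^ k) f 0)" by blast
    hence "deriv ((deriv ^^ k) f) = (\<lambda>_. 0)" by (metis deriv_const ext)
    thus ?thesis unfolding Suc.hyps(2)[symmetric] funpow.simps o_apply .
  qed
qed

lemma entire_deriv_pow_0_polynomial:
  assumes f: "f holomorphic_on UNIV" and "(deriv ^^ k) f = (\<lambda>_. 0)"
  shows "f w = (\<Sum>n<k. (deriv ^^ n) f 0 / fact n * w ^ n)"
proof -
  have "(\<lambda>n. (deriv ^^ n) f 0 / fact n * (w - 0) ^ n) sums f w"
    by (rule holomorphic_power_series[of f 0 "norm w + 1"]) (auto intro: holomorphic_on_subset[OF f])
  moreover have "(deriv ^^ n) f 0 = 0" if "n \<notin> {..<k}" for n
  proof -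
    have zero: "(deriv ^^ j) (\<lambda>_. 0 :: complex) = (\<lambda>_. 0)" for j by (induction j) auto
    have "(deriv ^^ (n - k + k)) f = (\<lambda>_. 0)" unfolding funpow_add o_apply assms(2) zero ..
    thus ?thesis using that by simp
  qed
  hence "(\<lambda>n. (deriv ^^ n) f 0 / fact n * (w - 0) ^ n) sums (\<Sum>n<k. (deriv ^^ n) f 0 / fact n * (w - 0) ^ n)"
    by (intro sums_finite) auto
  ultimately show ?thesis using sums_unique2 by fastforce
qed

end

text \<open>The triples stand for terms \<open>c x^s (log x)^j\<close> read in the chart. With
  lists, a sum of two such functions is a concatenation.\<close>

definition exp_poly_sum :: "(complex \<times> complex \<times> nat) list \<Rightarrow> complex \<Rightarrow> complex" where
  "exp_poly_sum xs w = (\<Sum>(c, s, j)\<leftarrow>xs. c * exp (s * w) * w ^ j)"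

section \<open>Solutions that are entire after clearing a denominator\<close>

context two_periods
begin

lemma twisted_diff_1_fdiff:
  assumes f: "f holomorphic_on UNIV" "\<forall>\<^sub>\<approx>w\<in>UNIV. ev y w = f w" and "(twisted_diff c 1 ^^ n) y = 0"
  shows "(fdiff c ^^ n) f = (\<lambda>_. 0)"
proof -
  have gen: "\<forall>\<^sub>\<approx>w\<in>UNIV. ev ((twisted_diff c 1 ^^ n) y) w = (fdiff c ^^ n) f w"
  proof (induction n)
    case (Suc n)
    define G g where "G = (twisted_diff c 1 ^^ n) y" and "g = (fdiff c ^^ n) f"
    have Gg: "\<forall>\<^sub>\<approx>w\<in>UNIV. ev G w = g w" using Suc by (simp add: G_def g_def)
    have "\<forall>\<^sub>\<approx>w\<in>UNIV. ev (twisted_diff c 1 G) w = fdiff c g w"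
      using Gg generic_shift[OF Gg, of c] ev_diff[of "shift_mero c G" G]
      by eventually_elim (simp add: fdiff_def twisted_diff_def const_mero_simps)
    thus ?case by (simp add: G_def g_def)
  qed (use f in simp)
  have "(fdiff c ^^ n) f w = 0" for w
    by (rule entire_generic_0[OF fdiff_pow_entire[OF f(1)]]) (use gen in \<open>eventually_elim, simp add: assms(3)\<close>)
  thus ?thesis by blast
qed

lemma nilpotent_last:
  assumes "h \<noteq> 0" "(T ^^ n) h = 0"
  obtains k where "(T ^^ k) h \<noteq> 0" "T ((T ^^ k) h) = (0 :: mero)"
proof -
  define m where "m = (LEAST m. (T ^^ m) h = 0)"
  have m: "(T ^^ m) h = 0" unfolding m_def by (rule LeastI) fact
  with assms(1) obtain k where k: "m = Suc k" by (cases m) auto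
  have "(T ^^ k) h \<noteq> 0" using not_less_Least[of k "\<lambda>m. (T ^^ m) h = 0"] k by (auto simp: m_def)
  with m k show thesis using that by auto
qed

text \<open>The last nonzero vectors of the two nilpotent chains yield a true joint eigenfunction
  \<open>u\<close>, entire like \<open>h\<close>. It shows that \<open>a\<close> and
  \<open>b\<close> come from one exponent \<open>s\<close>, and division by
  \<open>exp (s * w)\<close> leaves a unipotent entire function.\<close>

lemma entire_generalized_eigenvector:
  assumes no_pole: "\<forall>z. \<not> is_pole (ev h) z" and ab: "a \<noteq> 0" "b \<noteq> 0"
    and h: "(twisted_diff l1 a ^^ n) h = 0" "(twisted_diff l2 b ^^ m) h = 0"
  shows "\<exists>xs. \<forall>w. ev h w = exp_poly_sum xs w"
proof (cases "h = 0")
  case True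
  thus ?thesis by (intro exI[of _ "[]"]) (simp add: exp_poly_sum_def)
next
  case False
  have td_entire: "\<forall>z. \<not> is_pole (ev ((twisted_diff e g ^^ k) F)) z" if "\<forall>z. \<not> is_pole (ev F) z" for e g k F
    using that by (induction k) (auto dest: is_pole_twisted_diff)
  obtain k where k: "(twisted_diff l1 a ^^ k) h \<noteq> 0" "twisted_diff l1 a ((twisted_diff l1 a ^^ k) h) = 0"
    by (rule nilpotent_last[OF False h(1)])
  define h' where "h' = (twisted_diff l1 a ^^ k) h"
  have pow_commute: "(twisted_diff c p ^^ i) ((twisted_diff d q ^^ j) F) = (twisted_diff d q ^^ j) ((twisted_diff c p ^^ i) F)"
    for c d p q i j F by (induction j) (simp_all add: twisted_diff_pow_commute)
  have "(twisted_diff l2 b ^^ m) h' = 0"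
    unfolding h'_def pow_commute h(2) by (rule twisted_diff_pow_zero)
  then obtain j where j: "(twisted_diff l2 b ^^ j) h' \<noteq> 0" "twisted_diff l2 b ((twisted_diff l2 b ^^ j) h') = 0"
    using nilpotent_last[of h' m "twisted_diff l2 b"] k(1) unfolding h'_def by blast
  define u where "u = (twisted_diff l2 b ^^ j) h'"
  have u_entire: "ev u holomorphic_on UNIV"
    unfolding u_def h'_def using td_entire[OF td_entire[OF no_pole]] by (intro no_poles_holomorphic) blast
  have eig: "ev u (w + e) = g * ev u w" if "twisted_diff e g u = 0" for e g w
  proof -
    have "shift_mero e u = const_mero g * u" using that by (simp add: twisted_diff_def)
    hence "\<forall>\<^sub>\<approx>w\<in>UNIV. ev u (w + e) - g * ev u w = 0"
      using ev_mult[of "const_mero g" u] by (simp flip: ev_shift)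
    moreover have "(\<lambda>w. ev u (w + e) - g * ev u w) holomorphic_on UNIV"
      by (intro holomorphic_intros entire_shift u_entire)
    ultimately show ?thesis using entire_generic_0 by fastforce
  qed
  have "twisted_diff l1 a u = 0"
    unfolding u_def twisted_diff_pow_commute[symmetric] using k(2) by (simp add: h'_def twisted_diff_pow_zero)
  moreover have "\<exists>w0. ev u w0 \<noteq> 0"
  proof (rule ccontr)
    assume "\<not> ?thesis"
    hence "u = 0" by (intro mero_eqI) simp
    thus False using j(1) by (simp add: u_def)
  qed
  ultimately obtain s where s: "a = exp (s * l1)" "b = exp (s * l2)"
    using entire_eigenfunction[OF u_entire _ ab eig eig] j(2) unfolding u_def by blast
  define E where "E = mk_mero (\<lambda>w. exp (s * w))"
  define y where "y = mk_mero (\<lambda>w. exp (- s * w)) * h"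
  have exp_mero: "(\<lambda>w. exp (c * w)) meromorphic_on UNIV" for c
    by (intro entire_meromorphic holomorphic_intros)
  have gen_E: "\<forall>\<^sub>\<approx>w\<in>UNIV. ev E w = exp (s * w)" unfolding E_def by (rule ev_mk_mero_generic[OF exp_mero])
  have E_shift: "shift_mero e E = const_mero (exp (s * e)) * E" for e
    by (rule mero_eqI, use gen_E generic_shift[OF gen_E, of e] ev_mult[of "const_mero (exp (s * e))" E] in eventually_elim)
       (simp add: ring_distribs exp_add)
  define f where "f w = ev h w * exp (- s * w)" for w
  have f: "f holomorphic_on UNIV" unfolding f_def
    by (intro holomorphic_intros no_poles_holomorphic) (use no_pole in blast)
  have gen_f: "\<forall>\<^sub>\<approx>w\<in>UNIV. ev y w = f w"
    using ev_mult[of "mk_mero (\<lambda>w. exp (- s * w))" h] ev_mk_mero_generic[OF exp_mero[of "- s"]]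
    by eventually_elim (simp add: y_def f_def)
  have E0: "E \<noteq> 0"
  proof
    assume "E = 0"
    with gen_E have "\<forall>\<^sub>\<approx>w\<in>(UNIV :: complex set). False" by simp
    thus False by (simp add: generic_iff)
  qed
  have h_eq: "h = E * y"
    by (rule mero_eqI, use gen_E gen_f ev_mult[of E y] in eventually_elim) (simp add: f_def exp_minus)
  have "(fdiff l1 ^^ n) f = (\<lambda>_. 0)"
  proof (rule twisted_diff_1_fdiff[OF f gen_f])
    show "(twisted_diff l1 1 ^^ n) y = 0"
      using h(1) ab E0 unfolding h_eq by (subst (asm) twisted_diff_mult_eigen) (use E_shift[of l1] s in auto)
  qed
  moreover have "(fdiff l2 ^^ m) f = (\<lambda>_. 0)"
  proof (rule twisted_diff_1_fdiff[OF f gen_f])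
    show "(twisted_diff l2 1 ^^ m) y = 0"
      using h(2) ab E0 unfolding h_eq by (subst (asm) twisted_diff_mult_eigen) (use E_shift[of l2] s in auto)
  qed
  ultimately have "(deriv ^^ (n + m)) f = (\<lambda>_. 0)" by (rule unipotent_deriv[OF f])
  hence f_eq: "f w = (\<Sum>i<n + m. (deriv ^^ i) f 0 / fact i * w ^ i)" for w
    by (rule entire_deriv_pow_0_polynomial[OF f])
  show ?thesis
  proof (intro exI allI)
    fix w
    have "ev h w = exp (s * w) * f w" by (simp add: f_def exp_minus)
    also have "\<dots> = (\<Sum>i<n + m. (deriv ^^ i) f 0 / fact i * exp (s * w) * w ^ i)"
      unfolding f_eq[of w] sum_distrib_left by (intro sum.cong) auto
    also have "\<dots> = exp_poly_sum (map (\<lambda>i. ((deriv ^^ i) f 0 / fact i, s, i)) [0..<n + m]) w"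
      by (simp add: exp_poly_sum_def o_def interv_sum_list_conv_sum_set_nat atLeast0LessThan)
    finally show "ev h w = exp_poly_sum (map (\<lambda>i. ((deriv ^^ i) f 0 / fact i, s, i)) [0..<n + m]) w" .
  qed
qed

lemma constant_coefficient_exp_poly:
  assumes P: "P \<noteq> 0" "shift_poly l1 P h = 0" and Q: "Q \<noteq> 0" "shift_poly l2 Q h = 0"
    and poles: "l2 / l1 \<in> \<real> \<or> finite {z. is_pole (ev h) z}"
  shows "\<exists>xs. \<forall>\<^sub>\<approx>w\<in>UNIV. ev h w = exp_poly_sum xs w"
proof -
  \<comment> \<open>The hypothesis on the poles, phrased so that it is inherited by shifts, constant
    multiples and sums.\<close>
  define C where "C F \<longleftrightarrow> l2 / l1 \<in> \<real> \<or> finite {z. is_pole (ev F) z}" for F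
  have C_shift: "C (shift_mero c F)" if "C F" for c F
  proof -
    have "{z. is_pole (ev (shift_mero c F)) z} = (\<lambda>z. z + c) -` {z. is_pole (ev F) z}"
      by (auto simp: is_pole_ev_shift)
    thus ?thesis using that finite_vimageI[of "{z. is_pole (ev F) z}" "\<lambda>z. z + c"] by (auto simp: C_def inj_def)
  qed
  have C_const: "C (const_mero a * F)" if "C F" for a F
    using that finite_subset[of "{z. is_pole (ev (const_mero a * F)) z}" "{z. is_pole (ev F) z}"] is_pole_ev_const_mult
    unfolding C_def by blast
  have C_add: "C (F + G)" if "C F" "C G" for F G
    using that finite_subset[of "{z. is_pole (ev (F + G)) z}" "{z. is_pole (ev F) z} \<union> {z. is_pole (ev G) z}"] is_pole_ev_add
    unfolding C_def by blast
  have C_td: "C (twisted_diff e a F)" if "C F" for e a F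
  proof -
    have "twisted_diff e a F = shift_mero e F + const_mero (- a) * F" by (simp add: twisted_diff_def const_mero_simps)
    thus ?thesis using C_add[OF C_shift C_const] that by metis
  qed
  \<comment> \<open>An invariant set of poles is empty: for a real ratio poles would accumulate, and
    otherwise a single pole would have infinitely many translates.\<close>
  have C_periodic: "\<forall>z. \<not> is_pole (ev F) z"
    if "C F" and p1: "\<And>z. is_pole (ev F) (z + l1) = is_pole (ev F) z" and p2: "\<And>z. is_pole (ev F) (z + l2) = is_pole (ev F) z" for F
  proof (cases "l2 / l1 \<in> \<real>")
    case True
    thus ?thesis using invariant_generic[OF True, of "is_pole (ev F)", OF p1 p2 generic_not_pole] by blast
  next
    case False
    hence fin: "finite {z. is_pole (ev F) z}" using \<open>C F\<close> by (simp add: C_def)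
    show ?thesis
    proof (intro allI notI)
      fix z assume z: "is_pole (ev F) z"
      have "is_pole (ev F) (z + of_int i * l1)" for i
        using z periodic_of_int[of "is_pole (ev F)" l1 z i, OF p1] by simp
      hence "range (\<lambda>i :: int. z + of_int i * l1) \<subseteq> {z. is_pole (ev F) z}" by blast
      moreover have "inj (\<lambda>i :: int. z + of_int i * l1)" using l1 by (auto simp: inj_def)
      ultimately show False using fin finite_imageD[of "\<lambda>i :: int. z + of_int i * l1" UNIV] finite_subset infinite_UNIV_int by blast
    qed
  qed
  show ?thesis
  proof (rule joint_eigenvector_decomposition[where C = C and R = "\<lambda>h. \<exists>xs. \<forall>\<^sub>\<approx>w\<in>UNIV. ev h w = exp_poly_sum xs w"
        and P = P and Q = Q and c = l1 and d = l2, OF C_const C_add C_shift])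
    show "\<exists>xs. \<forall>\<^sub>\<approx>w\<in>UNIV. ev 0 w = exp_poly_sum xs w"
      by (intro exI[of _ "[]"]) (simp add: exp_poly_sum_def)
    show "\<exists>xs. \<forall>\<^sub>\<approx>w\<in>UNIV. ev (F + G) w = exp_poly_sum xs w"
      if FG: "\<exists>xs. \<forall>\<^sub>\<approx>w\<in>UNIV. ev F w = exp_poly_sum xs w" "\<exists>xs. \<forall>\<^sub>\<approx>w\<in>UNIV. ev G w = exp_poly_sum xs w" for F G
    proof -
      from FG obtain xs ys where xs: "\<forall>\<^sub>\<approx>w\<in>UNIV. ev F w = exp_poly_sum xs w" and ys: "\<forall>\<^sub>\<approx>w\<in>UNIV. ev G w = exp_poly_sum ys w" by blast
      have "\<forall>\<^sub>\<approx>w\<in>UNIV. ev (F + G) w = exp_poly_sum (xs @ ys) w"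
        using xs ys ev_add[of F G] by eventually_elim (simp add: exp_poly_sum_def)
      thus ?thesis by blast
    qed
    show "\<exists>xs. \<forall>\<^sub>\<approx>w\<in>UNIV. ev F w = exp_poly_sum xs w"
      if "a \<noteq> 0" "b \<noteq> 0" "C F" "(twisted_diff l1 a ^^ n) F = 0" "(twisted_diff l2 b ^^ m) F = 0" for a b n m F
    proof -
      note FF = that(4,5)
      have "\<forall>z. \<not> is_pole (ev F) z"
        by (rule generalized_eigenvector_no_poles[where C = C and c = l1 and d = l2, OF C_periodic C_td that])
      then obtain xs where "\<forall>w. ev F w = exp_poly_sum xs w"
        using entire_generalized_eigenvector[OF _ \<open>a \<noteq> 0\<close> \<open>b \<noteq> 0\<close> FF] by blast
      thus ?thesis by (intro exI[of _ xs]) simp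
    qed
  qed (use P Q poles in \<open>auto simp: C_def\<close>)
qed

end

theorem log_power_form_solution:
  assumes per: "two_periods l1 l2"
    and q: "\<not> root_of_unity (exp l1)" "\<not> root_of_unity (exp l2)" "mult_independent (exp l1) (exp l2)"
    and f: "ls_meromorphic f" "ls_solves_qdiff l1 f" "ls_solves_qdiff l2 f"
    and poles: "l2 / l1 \<in> \<real> \<or> finite {p. ls_is_pole f p}"
  shows "log_power_form f"
proof -
  interpret two_periods l1 l2 by (rule per)
  obtain D h P Q where D: "D \<noteq> 0" and P: "P \<noteq> 0" "shift_poly l1 P h = 0" and Q: "Q \<noteq> 0" "shift_poly l2 Q h = 0"
    and h: "\<forall>\<^sub>\<approx>w\<in>UNIV. ev h w = poly D (exp w) * f (ls_point w)"
    and f_eq: "\<forall>\<^sub>\<approx>w\<in>UNIV. f (ls_point w) = ev (exp_ratfun.lift (inverse (pfrac D)) * h) w"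
    by (rule constant_coefficient_solution[OF q f]) blast
  have "finite {z. is_pole (ev h) z}" if fin: "finite {p. ls_is_pole f p}"
  proof -
    have "is_pole (\<lambda>w. f (ls_point w)) z" if z: "is_pole (ev h) z" for z
    proof (rule ccontr)
      assume "\<not> ?thesis"
      moreover have "not_essential (\<lambda>w. f (ls_point w)) z"
        using f(1) meromorphic_on_subset[of _ UNIV "{z}"] unfolding ls_meromorphic_def by (metis meromorphic_at_iff subset_UNIV)
      ultimately obtain c where c: "(\<lambda>w. f (ls_point w)) \<midarrow>z\<rightarrow> c" by (auto simp: not_essential_def)
      have "(\<lambda>w. poly D (exp w) * f (ls_point w)) \<midarrow>z\<rightarrow> poly D (exp z) * c" by (intro tendsto_intros c)
      thus False using generic_tendsto_not_pole[OF h] z by blast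
    qed
    hence "{z. is_pole (ev h) z} \<subseteq> ls_log ` {p. ls_is_pole f p}"
      by (auto simp: ls_is_pole_def intro!: image_eqI[of _ _ "ls_point _"])
    thus ?thesis using fin finite_subset by blast
  qed
  hence "\<exists>xs. \<forall>\<^sub>\<approx>w\<in>UNIV. ev h w = exp_poly_sum xs w"
    using constant_coefficient_exp_poly[OF P Q] poles by blast
  then obtain xs where xs: "\<forall>\<^sub>\<approx>w\<in>UNIV. ev h w = exp_poly_sum xs w" ..
  define c s k where "c i = fst (xs ! i)" and "s i = fst (snd (xs ! i))" and "k i = snd (snd (xs ! i))" for i
  define n where "n = length xs"
  \<comment> \<open>A common bound for both indices: it is at least the number of terms and at least
    every exponent of the logarithm. Pairs that do not occur get the coefficient 0.\<close>
  define I where "I = n + (\<Sum>i<n. k i)"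
  define R where "R i = inverse (pfrac D) * pfrac [:c i:]" for i
  define r where "r i j = (if i < n \<and> j = k i then R i else 0)" for i j
  have k_le: "k i \<le> I" if "i < n" for i
    using member_le_sum[of i "{..<n}" k] that by (simp add: I_def)
  have eval_0: "ratfun_eval 0 x = 0" for x
    by (simp add: ratfun_eval_def)
  have eval_R: "\<forall>\<^sub>\<approx>w\<in>UNIV. \<forall>i<n. ratfun_eval (R i) (exp w) = ev (exp_ratfun.lift (inverse (pfrac D))) w * c i"
  proof (rule generic_ball_lessThan)
    fix i
    have R: "exp_ratfun.lift (R i) = exp_ratfun.lift (inverse (pfrac D)) * const_mero (c i)"
      by (simp only: R_def exp_ratfun.lift_mult exp_ratfun_const)
    show "\<forall>\<^sub>\<approx>w\<in>UNIV. ratfun_eval (R i) (exp w) = ev (exp_ratfun.lift (inverse (pfrac D))) w * c i"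
      using ev_exp_ratfun[of "R i"] ev_mult[of "exp_ratfun.lift (inverse (pfrac D))" "const_mero (c i)"]
      unfolding R by eventually_elim simp
  qed
  have "ls_generic (\<lambda>p. f p = (\<Sum>i=0..I. \<Sum>j=0..I. ratfun_eval (r i j) (ls_proj p) * ls_powr p (s i) * ls_log p ^ j))"
    unfolding ls_generic_def
    using f_eq xs eval_R ev_mult[of "exp_ratfun.lift (inverse (pfrac D))" h]
  proof eventually_elim
    case (elim w)
    define d where "d = ev (exp_ratfun.lift (inverse (pfrac D))) w"
    have "f (ls_point w) = d * (\<Sum>i<n. c i * exp (s i * w) * w ^ k i)"
      using elim(1,2,4) by (simp add: exp_poly_sum_def d_def sum_list_sum_nth case_prod_unfold n_def c_def s_def k_def atLeast0LessThan)
    also have "\<dots> = (\<Sum>i<n. ratfun_eval (R i) (exp w) * exp (s i * w) * w ^ k i)"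
      using elim(3) by (simp add: sum_distrib_left d_def mult.assoc)
    also have "\<dots> = (\<Sum>i<n. \<Sum>j=0..I. ratfun_eval (r i j) (exp w) * exp (s i * w) * w ^ j)"
    proof (rule sum.cong[OF refl])
      fix i assume i: "i \<in> {..<n}"
      have "(\<Sum>j=0..I. ratfun_eval (r i j) (exp w) * exp (s i * w) * w ^ j) =
          (\<Sum>j=0..I. if j = k i then ratfun_eval (R i) (exp w) * exp (s i * w) * w ^ k i else 0)"
        using i by (intro sum.cong) (auto simp: r_def eval_0)
      also have "\<dots> = ratfun_eval (R i) (exp w) * exp (s i * w) * w ^ k i" using k_le[of i] i by simp
      finally show "ratfun_eval (R i) (exp w) * exp (s i * w) * w ^ k i =
          (\<Sum>j=0..I. ratfun_eval (r i j) (exp w) * exp (s i * w) * w ^ j)" ..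
    qed
    also have "\<dots> = (\<Sum>i=0..I. \<Sum>j=0..I. ratfun_eval (r i j) (exp w) * exp (s i * w) * w ^ j)"
      by (rule sum.mono_neutral_left) (auto simp: I_def r_def eval_0)
    finally show ?case by (simp add: ls_powr_def)
  qed
  thus ?thesis unfolding log_power_form_def by blast
qed

subsection \<open>Solutions in terms of elliptic functions\<close>

interpretation exp_span: vector_space "\<lambda>r F. exp_ratfun.lift r * F"
  by standard (auto simp: algebra_simps)

lemma exp_span_const: "F \<in> exp_span.span B \<Longrightarrow> const_mero c * F \<in> exp_span.span B"
  using exp_span.span_scale[of F B "pfrac [:c:]"] by (simp only: exp_ratfun_const)

lemma shift_mk_mero_periodic:
  assumes "f meromorphic_on UNIV" "\<And>w. f (w + c) = f w"
  shows "shift_mero c (mk_mero f) = mk_mero f"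
  by (rule mero_eqI, use ev_mk_mero_generic[OF assms(1)] generic_shift[OF ev_mk_mero_generic[OF assms(1)], of c] in eventually_elim)
     (simp add: assms(2))

lemma of_nat_mero: "of_nat n = const_mero (of_nat n)"
  by (induction n) (auto simp: const_mero_simps)

lemma shift_mero_of_nat: "shift_mero c (of_nat n) = of_nat n"
  by (simp add: of_nat_mero const_mero_simps)

lemma const_mero_diff: "const_mero (a - b) = const_mero a - const_mero b"
  using const_mero_simps(3)[of "a - b" b] by simp

lemma shift_mero_gbinomial: "shift_mero c (z gchoose n) = shift_mero c z gchoose n"
proof -
  have "shift_mero c (\<Prod>i=0..<n. z - of_nat i) = (\<Prod>i=0..<n. shift_mero c z - of_nat i)"
  proof (induction n)
    case (Suc n)
    have "shift_mero c (z - of_nat n) = shift_mero c z - of_nat n"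
      using shift_mero_add[of c "z - of_nat n" "of_nat n"] by (simp add: shift_mero_of_nat algebra_simps)
    thus ?case using Suc by (simp add: shift_mero_mult)
  qed simp
  thus ?thesis
    unfolding gbinomial_prod_rev shift_mero_divide using shift_mero_of_nat[of c "fact n"] by simp
qed

text \<open>One step of Newton interpolation. The difference operator maps
  \<open>z gchoose Suc k\<close> to \<open>z gchoose k\<close>, and the top difference of
  \<open>y\<close> is invariant. Their product therefore has the same \<open>n\<close>-th difference
  as \<open>y\<close>, and subtracting it lowers the order of nilpotency.\<close>

lemma gbinomial_peel:
  assumes z: "shift_mero e z = z + 1" and y: "(twisted_diff e 1 ^^ Suc n) y = 0"
  shows "(twisted_diff e 1 ^^ n) (y - (twisted_diff e 1 ^^ n) y * (z gchoose n)) = 0"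
proof -
  define c where "c = (twisted_diff e 1 ^^ n) y"
  have c: "shift_mero e c = const_mero 1 * c"
    using y by (simp add: c_def twisted_diff_def const_mero_simps)
  have "twisted_diff e 1 (z gchoose Suc k) = z gchoose k" for k
    by (simp add: twisted_diff_def shift_mero_gbinomial z gbinomial_Suc_Suc const_mero_simps)
  hence "(twisted_diff e 1 ^^ k) (z gchoose k) = 1" for k
    by (induction k) (simp_all add: funpow_Suc_right del: funpow.simps(2))
  hence "(twisted_diff e 1 ^^ n) (c * (z gchoose n)) = c"
    unfolding twisted_diff_mult_eigen[OF c] by (simp add: const_mero_simps)
  thus ?thesis by (simp add: twisted_diff_pow_diff flip: c_def)
qed

text \<open>One iterate more than the spanning set has elements forces a relation, which is divided
  by its last nonzero coefficient. For \<open>F \<noteq> 0\<close> that relation cannot have order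
  0.\<close>

lemma finite_span_relation:
  assumes T: "finite T" "\<And>b. b \<in> T \<Longrightarrow> shift_mero e b \<in> exp_span.span T" and F: "F \<in> exp_span.span T"
  shows "\<exists>m b. m \<ge> 1 \<and> (shift_mero e ^^ m) F + (\<Sum>i<m. exp_ratfun.lift (b i) * (shift_mero e ^^ i) F) = 0"
proof (cases "F = 0")
  case True
  thus ?thesis by (intro exI[of _ 1] exI[of _ "\<lambda>_. 0"]) simp
next
  case False
  have shift_span: "shift_mero e G \<in> exp_span.span T" if "G \<in> exp_span.span T" for G
    using that
  proof (induction rule: exp_span.span_induct_alt)
    case (step c x y)
    show ?case
      unfolding shift_mero_add shift_mero_mult shift_exp_ratfun
      by (intro exp_span.span_add exp_span.span_scale T(2) step)
  qed (simp add: exp_span.span_zero)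
  have "(shift_mero e ^^ n) F \<in> exp_span.span T" for n
    by (induction n) (auto intro: F shift_span)
  hence "\<exists>u. (shift_mero e ^^ n) F = (\<Sum>v\<in>T. exp_ratfun.lift (u v) * v)" for n
    using exp_span.span_finite[OF T(1)] by (metis (no_types, lifting) imageE)
  then obtain M where M: "\<And>n. (shift_mero e ^^ n) F = (\<Sum>v\<in>T. exp_ratfun.lift (M n v) * v)" by metis
  have card: "card T < card {..card T}" by simp
  obtain c where c: "\<exists>n\<in>{..card T}. c n \<noteq> 0" "\<And>v. v \<in> T \<Longrightarrow> (\<Sum>n\<le>card T. c n * M n v) = 0"
    by (rule underdetermined_system[OF T(1) finite_atMost card, where M = M]) (rule that)
  have "(\<Sum>n\<le>card T. exp_ratfun.lift (c n) * (shift_mero e ^^ n) F) = (\<Sum>n\<le>card T. \<Sum>v\<in>T. exp_ratfun.lift (c n * M n v) * v)"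
    by (simp only: M sum_distrib_left exp_ratfun.lift_mult mult.assoc)
  also have "\<dots> = (\<Sum>v\<in>T. exp_ratfun.lift (\<Sum>n\<le>card T. c n * M n v) * v)"
    by (subst sum.swap) (simp only: sum_distrib_right exp_ratfun.lift_sum)
  also have "\<dots> = 0" by (intro sum.neutral ballI) (simp only: c(2) exp_ratfun.lift_0 mult_zero_left)
  finally have rel: "(\<Sum>n\<le>card T. exp_ratfun.lift (c n) * (shift_mero e ^^ n) F) = 0" .
  define m where "m = Max {n \<in> {..card T}. c n \<noteq> 0}"
  have "m \<in> {n \<in> {..card T}. c n \<noteq> 0}"
    unfolding m_def using c(1) by (intro Max_in) auto
  hence m: "m \<le> card T" "c m \<noteq> 0" by auto
  have above: "c n = 0" if "n \<le> card T" "n > m" for n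
    using Max_ge[of "{n \<in> {..card T}. c n \<noteq> 0}" n] that unfolding m_def by fastforce
  have "(\<Sum>n\<le>card T. exp_ratfun.lift (c n) * (shift_mero e ^^ n) F) = (\<Sum>n\<le>m. exp_ratfun.lift (c n) * (shift_mero e ^^ n) F)"
    by (rule sum.mono_neutral_right) (use m above in \<open>auto simp: not_le\<close>)
  hence rel_m: "exp_ratfun.lift (c m) * (shift_mero e ^^ m) F + (\<Sum>n<m. exp_ratfun.lift (c n) * (shift_mero e ^^ n) F) = 0"
    using rel by (simp add: add.commute flip: lessThan_Suc_atMost)
  have "m \<ge> 1"
  proof (rule ccontr)
    assume "\<not> m \<ge> 1"
    hence "m = 0" by simp
    thus False using rel_m m(2) False by simp
  qed
  moreover have "(shift_mero e ^^ m) F + (\<Sum>n<m. exp_ratfun.lift (c n / c m) * (shift_mero e ^^ n) F) =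
      inverse (exp_ratfun.lift (c m)) * (exp_ratfun.lift (c m) * (shift_mero e ^^ m) F + (\<Sum>n<m. exp_ratfun.lift (c n) * (shift_mero e ^^ n) F))"
  proof -
    have "inverse (exp_ratfun.lift (c m)) * exp_ratfun.lift (c m) = 1"
      by (rule left_inverse) (simp only: exp_ratfun.lift_eq_0_iff m(2) not_False_eq_True)
    moreover have "exp_ratfun.lift (c n / c m) = inverse (exp_ratfun.lift (c m)) * exp_ratfun.lift (c n)" for n
      by (simp only: divide_inverse exp_ratfun.lift_mult exp_ratfun.lift_inverse mult.commute)
    ultimately show ?thesis by (simp only: distrib_left sum_distrib_left mult.assoc[symmetric] mult_1_left)
  qed
  ultimately show ?thesis using rel_m by (intro exI[of _ m] exI[of _ "\<lambda>n. c n / c m"]) simp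
qed

section \<open>Functions with prescribed multipliers and prescribed differences\<close>

locale quasi_periods = two_periods +
  fixes u1 u2 :: complex
  assumes nonreal: "l2 / l1 \<notin> \<real>" and legendre: "u2 - l2 / l1 * u1 \<noteq> 0"
    and zeta: "weierstrass_zeta (l2 / l1) nicely_meromorphic_on UNIV"
    and zeta_1: "\<forall>\<^sub>\<approx>t\<in>UNIV. weierstrass_zeta (l2 / l1) (t + 1) = weierstrass_zeta (l2 / l1) t - u1"
    and zeta_\<alpha>: "\<forall>\<^sub>\<approx>t\<in>UNIV. weierstrass_zeta (l2 / l1) (t + l2 / l1) = weierstrass_zeta (l2 / l1) t - u2"
    and rho: "\<And>\<delta>. weierstrass_rho (l2 / l1) \<delta> meromorphic_on UNIV"
    and rho_nonzero: "\<And>\<delta>. \<forall>\<^sub>\<approx>t\<in>UNIV. weierstrass_rho (l2 / l1) \<delta> t \<noteq> 0"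
    and rho_1: "\<And>\<delta> t. weierstrass_rho (l2 / l1) \<delta> (t + 1) = exp (u1 * \<delta>) * weierstrass_rho (l2 / l1) \<delta> t"
    and rho_\<alpha>: "\<And>\<delta> t. weierstrass_rho (l2 / l1) \<delta> (t + l2 / l1) = exp (u2 * \<delta>) * weierstrass_rho (l2 / l1) \<delta> t"
begin

definition "W = mk_mero (\<lambda>w. w)"
definition "Z = mk_mero (\<lambda>w. weierstrass_zeta (l2 / l1) (w / l1))"
definition "Expo s = mk_mero (\<lambda>w. exp (s * w))"
definition "Rho \<delta> = mk_mero (\<lambda>w. weierstrass_rho (l2 / l1) \<delta> (w / l1))"

lemma ev_W: "\<forall>\<^sub>\<approx>w\<in>UNIV. ev W w = w"
  unfolding W_def by (rule ev_mk_mero_generic) (intro meromorphic_intros)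

lemma ev_Z: "\<forall>\<^sub>\<approx>w\<in>UNIV. ev Z w = weierstrass_zeta (l2 / l1) (w / l1)"
  unfolding Z_def using zeta by (intro ev_mk_mero_generic meromorphic_scale l1) (simp add: nicely_meromorphic_on_def)

lemma ev_Expo: "\<forall>\<^sub>\<approx>w\<in>UNIV. ev (Expo s) w = exp (s * w)"
  unfolding Expo_def by (intro ev_mk_mero_generic entire_meromorphic holomorphic_intros)

lemma ev_Rho: "\<forall>\<^sub>\<approx>w\<in>UNIV. ev (Rho \<delta>) w = weierstrass_rho (l2 / l1) \<delta> (w / l1)"
  unfolding Rho_def by (intro ev_mk_mero_generic meromorphic_scale l1 rho)

lemma shift_W: "shift_mero c W = W + const_mero c"
  by (rule mero_eqI, use ev_W generic_shift[OF ev_W, of c] ev_add[of W "const_mero c"] in eventually_elim) simp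

lemma shift_Expo: "shift_mero c (Expo s) = const_mero (exp (s * c)) * Expo s"
  by (rule mero_eqI, use ev_Expo[of s] generic_shift[OF ev_Expo[of s], of c] ev_mult[of "const_mero (exp (s * c))" "Expo s"] in eventually_elim)
     (simp add: ring_distribs exp_add)

lemma shift_Z: "shift_mero l1 Z = Z - const_mero u1" "shift_mero l2 Z = Z - const_mero u2"
proof -
  have 1: "\<forall>\<^sub>\<approx>w\<in>UNIV. weierstrass_zeta (l2 / l1) ((w + l1) / l1) = weierstrass_zeta (l2 / l1) (w / l1) - u1"
    using generic_scale[OF zeta_1 l1] l1 by (simp add: add_divide_distrib)
  show "shift_mero l1 Z = Z - const_mero u1"
    by (rule mero_eqI, use 1 ev_Z generic_shift[OF ev_Z, of l1] ev_diff[of Z "const_mero u1"] in eventually_elim) simp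
  have 2: "\<forall>\<^sub>\<approx>w\<in>UNIV. weierstrass_zeta (l2 / l1) ((w + l2) / l1) = weierstrass_zeta (l2 / l1) (w / l1) - u2"
    using generic_scale[OF zeta_\<alpha> l1] by (simp add: add_divide_distrib)
  show "shift_mero l2 Z = Z - const_mero u2"
    by (rule mero_eqI, use 2 ev_Z generic_shift[OF ev_Z, of l2] ev_diff[of Z "const_mero u2"] in eventually_elim) simp
qed

lemma shift_Rho:
  "shift_mero l1 (Rho \<delta>) = const_mero (exp (u1 * \<delta>)) * Rho \<delta>"
  "shift_mero l2 (Rho \<delta>) = const_mero (exp (u2 * \<delta>)) * Rho \<delta>"
proof -
  show "shift_mero l1 (Rho \<delta>) = const_mero (exp (u1 * \<delta>)) * Rho \<delta>"
    by (rule mero_eqI, use ev_Rho[of \<delta>] generic_shift[OF ev_Rho[of \<delta>], of l1] ev_mult[of "const_mero (exp (u1 * \<delta>))" "Rho \<delta>"]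
        in eventually_elim) (use l1 in \<open>simp add: add_divide_distrib rho_1\<close>)
  show "shift_mero l2 (Rho \<delta>) = const_mero (exp (u2 * \<delta>)) * Rho \<delta>"
    by (rule mero_eqI, use ev_Rho[of \<delta>] generic_shift[OF ev_Rho[of \<delta>], of l2] ev_mult[of "const_mero (exp (u2 * \<delta>))" "Rho \<delta>"]
        in eventually_elim) (simp add: add_divide_distrib rho_\<alpha>)
qed

lemma Expo_Rho_nonzero: "Expo s * Rho \<delta> \<noteq> 0"
proof
  assume "Expo s * Rho \<delta> = 0"
  hence "Expo s = 0 \<or> Rho \<delta> = 0" by simp
  moreover have "Expo s \<noteq> 0"
  proof
    assume "Expo s = 0"
    with ev_Expo[of s] have "\<forall>\<^sub>\<approx>w\<in>(UNIV :: complex set). False" by simp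
    thus False by (simp add: generic_iff)
  qed
  moreover have "Rho \<delta> \<noteq> 0"
  proof
    assume 0: "Rho \<delta> = 0"
    have "\<forall>\<^sub>\<approx>w\<in>(UNIV :: complex set). False"
      using ev_Rho[of \<delta>] generic_scale[OF rho_nonzero[of \<delta>] l1] by eventually_elim (simp add: 0)
    thus False by (simp add: generic_iff)
  qed
  ultimately show False by blast
qed

text \<open>Cramer's rule, with Legendre's relation as the nonvanishing determinant. It is used
  additively, for combinations of \<open>W\<close> and \<open>Z\<close> with given differences, and
  through logarithms for products of \<open>Expo\<close> and \<open>Rho\<close> with given
  multipliers.\<close>

lemma solve_periods: obtains p q where "p * l1 - q * u1 = x" "p * l2 - q * u2 = y"
proof -
  define d where "d = l2 * u1 - l1 * u2"
  have d: "d \<noteq> 0" using legendre l1 by (simp add: d_def field_simps)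
  show thesis
  proof (rule that[of "(u1 * y - u2 * x) / d" "(l1 * y - l2 * x) / d"])
    have "((u1 * y - u2 * x) * l1 - (l1 * y - l2 * x) * u1) / d = x"
      "((u1 * y - u2 * x) * l2 - (l1 * y - l2 * x) * u2) / d = y"
      unfolding nonzero_divide_eq_eq[OF d] by (simp_all add: d_def algebra_simps)
    thus "(u1 * y - u2 * x) / d * l1 - (l1 * y - l2 * x) / d * u1 = x"
      "(u1 * y - u2 * x) / d * l2 - (l1 * y - l2 * x) / d * u2 = y"
      by (simp_all only: times_divide_eq_left diff_divide_distrib[symmetric])
  qed
qed

definition invariant :: "mero \<Rightarrow> bool" where
  "invariant G \<longleftrightarrow> shift_mero l1 G = G \<and> shift_mero l2 G = G"

text \<open>The coordinates \<open>z1\<close> and \<open>z2\<close> have differences 1 and 0,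
  respectively 0 and 1, under the two shifts. Newton's method in \<open>z1\<close> leaves
  coefficients fixed by the first shift, and the same method in \<open>z2\<close> leaves
  coefficients fixed by both.\<close>

lemma unipotent_in_subring:
  assumes R_add: "\<And>F G. R F \<Longrightarrow> R G \<Longrightarrow> R (F + G)" and R_mult: "\<And>F G. R F \<Longrightarrow> R G \<Longrightarrow> R (F * G)"
    and R_inv: "\<And>G. invariant G \<Longrightarrow> R G" and R_W: "R W" and R_Z: "R Z"
    and y: "(twisted_diff l1 1 ^^ n) y = 0" "(twisted_diff l2 1 ^^ m) y = 0"
  shows "R y"
proof -
  have R_const: "R (const_mero c)" for c by (rule R_inv) (simp add: invariant_def const_mero_simps)
  have R_gbinomial: "R (z gchoose k)" if "R z" for z k
  proof -
    have "R (\<Prod>i=0..<k. z - of_nat i)"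
    proof (induction k)
      case 0
      show ?case using R_const[of 1] by (simp add: const_mero_simps)
    next
      case (Suc k)
      have "invariant (- of_nat k)"
        unfolding of_nat_mero const_mero_simps(6)[symmetric] by (simp add: invariant_def const_mero_simps(5))
      hence "R (z + - of_nat k)" by (intro R_add that R_inv)
      thus ?case using R_mult[OF Suc] by simp
    qed
    moreover have "invariant (inverse (fact k))"
      unfolding invariant_def shift_mero_inverse using shift_mero_of_nat[of _ "fact k"] by simp
    ultimately show ?thesis unfolding gbinomial_prod_rev divide_inverse by (rule R_mult[OF _ R_inv])
  qed
  have coordinate: "\<exists>z. R z \<and> shift_mero l1 z = z + const_mero x \<and> shift_mero l2 z = z + const_mero x'" for x x'
  proof -
    obtain p q where pq: "p * l1 - q * u1 = x" "p * l2 - q * u2 = x'" by (rule solve_periods)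
    define z where "z = const_mero p * W + const_mero q * Z"
    have "shift_mero l1 z = z + const_mero x" "shift_mero l2 z = z + const_mero x'"
      unfolding z_def pq[symmetric] shift_mero_add shift_mero_mult const_mero_simps const_mero_diff shift_W shift_Z
      by (simp_all add: algebra_simps)
    moreover have "R z" unfolding z_def by (intro R_add R_mult R_const R_W R_Z)
    ultimately show ?thesis by blast
  qed
  obtain z1 where z1: "R z1" "shift_mero l1 z1 = z1 + 1" "shift_mero l2 z1 = z1"
    using coordinate[of 1 0] by (auto simp: const_mero_simps)
  obtain z2 where z2: "R z2" "shift_mero l1 z2 = z2" "shift_mero l2 z2 = z2 + 1"
    using coordinate[of 0 1] by (auto simp: const_mero_simps)
  have fix_iff: "twisted_diff e 1 F = 0 \<longleftrightarrow> shift_mero e F = F" for e F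
    by (simp add: twisted_diff_def const_mero_simps)
  have scale: "(twisted_diff e 1 ^^ k) (g * F) = g * (twisted_diff e 1 ^^ k) F" if "shift_mero e g = g" for e k g F
    using twisted_diff_mult_eigen[of e g 1 k F] that by (simp add: const_mero_simps)
  have unip2: "R y" if "shift_mero l1 y = y" "(twisted_diff l2 1 ^^ m) y = 0" for y m
    using that
  proof (induction m arbitrary: y)
    case 0
    hence "y = const_mero 0" by (simp add: const_mero_simps)
    thus ?case using R_const by simp
  next
    case (Suc m)
    define c where "c = (twisted_diff l2 1 ^^ m) y"
    have "twisted_diff l1 1 c = 0"
      unfolding c_def twisted_diff_pow_commute[symmetric] using Suc.prems(1)
      by (simp add: fix_iff[THEN iffD2] twisted_diff_pow_zero)
    hence c: "shift_mero l1 c = c" "shift_mero l2 c = c"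
      using Suc.prems(2) by (simp_all add: c_def flip: fix_iff)
    have "R (y - c * (z2 gchoose m))"
    proof (rule Suc.IH)
      show "(twisted_diff l2 1 ^^ m) (y - c * (z2 gchoose m)) = 0"
        unfolding c_def by (rule gbinomial_peel[OF z2(3) Suc.prems(2)])
      have "twisted_diff l1 1 (y - c * (z2 gchoose m)) = 0"
        using twisted_diff_pow_diff[of 1 l1 1 y "c * (z2 gchoose m)"] Suc.prems(1) c(1)
        by (simp add: fix_iff[THEN iffD2] shift_mero_mult shift_mero_gbinomial z2(2))
      thus "shift_mero l1 (y - c * (z2 gchoose m)) = y - c * (z2 gchoose m)" by (simp only: fix_iff)
    qed
    moreover have "R (c * (z2 gchoose m))"
      by (intro R_mult R_gbinomial z2 R_inv) (simp add: invariant_def c)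
    ultimately show ?case using R_add[of "y - c * (z2 gchoose m)" "c * (z2 gchoose m)"] by simp
  qed
  show ?thesis using y
  proof (induction n arbitrary: y)
    case 0
    hence "y = const_mero 0" by (simp add: const_mero_simps)
    thus ?case using R_const by simp
  next
    case (Suc n)
    define c where "c = (twisted_diff l1 1 ^^ n) y"
    have pow_commute: "(twisted_diff d p ^^ i) ((twisted_diff e q ^^ j) F) = (twisted_diff e q ^^ j) ((twisted_diff d p ^^ i) F)"
      for d e p q i j F by (induction j) (simp_all add: twisted_diff_pow_commute)
    have "(twisted_diff l2 1 ^^ m) c = 0"
      unfolding c_def pow_commute[of m l2 1 n l1 1] Suc.prems(2) by (rule twisted_diff_pow_zero)
    moreover have "shift_mero l1 c = c"
      using Suc.prems(1) by (simp add: c_def flip: fix_iff)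
    ultimately have c: "shift_mero l1 c = c" "(twisted_diff l2 1 ^^ m) c = 0" by blast+
    have "R (y - c * (z1 gchoose n))"
    proof (rule Suc.IH)
      show "(twisted_diff l1 1 ^^ n) (y - c * (z1 gchoose n)) = 0"
        unfolding c_def by (rule gbinomial_peel[OF z1(2) Suc.prems(1)])
      show "(twisted_diff l2 1 ^^ m) (y - c * (z1 gchoose n)) = 0"
        unfolding twisted_diff_pow_diff mult.commute[of c] by (subst scale) (simp_all add: shift_mero_gbinomial z1 c Suc.prems)
    qed
    moreover have "R (c * (z1 gchoose n))"
      by (intro R_mult R_gbinomial z1 unip2[OF c])
    ultimately show ?case using R_add[of "y - c * (z1 gchoose n)" "c * (z1 gchoose n)"] by simp
  qed
qed

end

context quasi_periods
begin

definition elliptic_terms :: "mero set" where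
  "elliptic_terms = {Expo s * Rho \<delta> * (G * W ^ j * Z ^ k) | s \<delta> G j k. invariant G}"

lemma invariant_mult: "invariant F \<Longrightarrow> invariant G \<Longrightarrow> invariant (F * G)"
  by (simp add: invariant_def shift_mero_mult)

lemma constant_coefficient_elliptic:
  assumes P: "P \<noteq> 0" "shift_poly l1 P h = 0" and Q: "Q \<noteq> 0" "shift_poly l2 Q h = 0"
  shows "h \<in> exp_span.span elliptic_terms"
proof (rule joint_eigenvector_decomposition[where C = "\<lambda>_. True" and R = "\<lambda>h. h \<in> exp_span.span elliptic_terms", OF _ _ _ _ _ _ P Q])
  fix a b n m F
  assume ab: "a \<noteq> 0" "b \<noteq> 0" and F: "(twisted_diff l1 a ^^ n) F = 0" "(twisted_diff l2 b ^^ m) F = 0"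
  \<comment> \<open>Any logarithms of \<open>a\<close> and \<open>b\<close> will do.
    \<open>solve_periods\<close> is set up for \<open>Z\<close>, whose differences are
    \<open>- u1\<close> and \<open>- u2\<close>, so the exponents of \<open>Rho\<close> enter with
    the opposite sign and \<open>E\<close> uses \<open>Rho (- \<delta>)\<close>.\<close>
  obtain s \<delta> where s\<delta>: "s * l1 - \<delta> * u1 = Ln a" "s * l2 - \<delta> * u2 = Ln b" by (rule solve_periods)
  define E where "E = Expo s * Rho (- \<delta>)"
  have "exp (s * l1) * exp (u1 * - \<delta>) = a"
    using s\<delta>(1) exp_Ln[OF ab(1)] by (simp add: mult.commute flip: exp_add)
  hence E1: "shift_mero l1 E = const_mero a * E"
    by (simp add: E_def shift_mero_mult shift_Expo shift_Rho mult_ac flip: const_mero_simps(4))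
  have "exp (s * l2) * exp (u2 * - \<delta>) = b"
    using s\<delta>(2) exp_Ln[OF ab(2)] by (simp add: mult.commute flip: exp_add)
  hence E2: "shift_mero l2 E = const_mero b * E"
    by (simp add: E_def shift_mero_mult shift_Expo shift_Rho mult_ac flip: const_mero_simps(4))
  have E0: "E \<noteq> 0" unfolding E_def by (rule Expo_Rho_nonzero)
  define y where "y = F / E"
  have F_eq: "F = E * y" using E0 by (simp add: y_def)
  \<comment> \<open>\<open>B\<close> is closed under multiplication, so its span over the rational
    functions is a ring, as \<open>unipotent_in_subring\<close> requires.\<close>
  define B where "B = {G * W ^ j * Z ^ k | G j k. invariant G}"
  have "y \<in> exp_span.span B"
  proof (rule unipotent_in_subring)
    show "(twisted_diff l1 1 ^^ n) y = 0"
      using F(1) ab E0 unfolding F_eq twisted_diff_mult_eigen[OF E1] by simp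
    show "(twisted_diff l2 1 ^^ m) y = 0"
      using F(2) ab E0 unfolding F_eq twisted_diff_mult_eigen[OF E2] by simp
    have inB: "G * W ^ j * Z ^ k \<in> exp_span.span B" if "invariant G" for G j k
      by (rule exp_span.span_base) (use that in \<open>auto simp: B_def\<close>)
    have inv1: "invariant 1" by (simp add: invariant_def)
    show "G \<in> exp_span.span B" if "invariant G" for G using inB[OF that, of 0 0] by simp
    show "W \<in> exp_span.span B" using inB[OF inv1, of 1 0] by simp
    show "Z \<in> exp_span.span B" using inB[OF inv1, of 0 1] by simp
    show "F * G \<in> exp_span.span B" if F: "F \<in> exp_span.span B" and G: "G \<in> exp_span.span B" for F G
      using F
    proof (induction rule: exp_span.span_induct_alt)
      case (step c x z)
      then obtain g j k where x: "x = g * W ^ j * Z ^ k" "invariant g" by (auto simp: B_def)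
      have "x * G \<in> exp_span.span B" using G
      proof (induction rule: exp_span.span_induct_alt)
        case (step c' x' z')
        then obtain g' j' k' where x': "x' = g' * W ^ j' * Z ^ k'" "invariant g'" by (auto simp: B_def)
        have "x * x' = (g * g') * W ^ (j + j') * Z ^ (k + k')"
          by (simp add: x x' power_add mult_ac)
        also have "\<dots> \<in> exp_span.span B" by (intro inB invariant_mult x x')
        finally have "exp_ratfun.lift c' * (x * x') + x * z' \<in> exp_span.span B"
          using exp_span.span_add[OF exp_span.span_scale step(2)] by blast
        thus ?case by (simp only: distrib_left mult.left_commute)
      qed (simp add: exp_span.span_zero)
      hence "exp_ratfun.lift c * (x * G) + z * G \<in> exp_span.span B"
        using exp_span.span_add[OF exp_span.span_scale step(2)] by blast
      thus ?case by (simp only: distrib_right mult.assoc)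
    qed (simp add: exp_span.span_zero)
  qed (rule exp_span.span_add)
  hence "E * y \<in> exp_span.span elliptic_terms"
  proof (induction rule: exp_span.span_induct_alt)
    case (step c x z)
    have "E * x \<in> exp_span.span elliptic_terms"
      by (rule exp_span.span_base) (use step(1) in \<open>unfold B_def elliptic_terms_def E_def, blast\<close>)
    hence "exp_ratfun.lift c * (E * x) + E * z \<in> exp_span.span elliptic_terms"
      using exp_span.span_add[OF exp_span.span_scale step(2)] by blast
    thus ?case by (simp only: distrib_left mult.left_commute)
  qed (simp add: exp_span.span_zero)
  thus "F \<in> exp_span.span elliptic_terms" by (simp only: F_eq)
qed (auto intro: exp_span.span_zero exp_span.span_add)

lemma invariant_elliptic:
  assumes "invariant G"
  obtains g where "elliptic_fun (l2 / l1) g" "\<forall>\<^sub>\<approx>w\<in>UNIV. g (w / l1) = ev G w"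
proof -
  define f where "f t = ev G (l1 * t)" for t
  have f: "f meromorphic_on UNIV"
    unfolding f_def by (intro meromorphic_on_compose[of "ev G" UNIV "\<lambda>t. l1 * t"] analytic_intros) auto
  have G_per: "ev G (w + l1) = ev G w" "ev G (w + l2) = ev G w" for w
    using assms unfolding invariant_def by (metis ev_shift)+
  have "f (t + 1) = f t" "f (t + l2 / l1) = f t" for t
    using G_per[of "l1 * t"] l1 by (simp_all add: f_def ring_distribs)
  hence "shift_mero 1 (mk_mero f) = mk_mero f" "shift_mero (l2 / l1) (mk_mero f) = mk_mero f"
    by (simp_all only: shift_mk_mero_periodic[OF f])
  hence "elliptic_fun (l2 / l1) (ev (mk_mero f))"
    unfolding elliptic_fun_def by (metis ev_nicely ev_shift)
  moreover have "\<forall>\<^sub>\<approx>w\<in>UNIV. ev (mk_mero f) (w / l1) = ev G w"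
    using generic_scale[OF ev_mk_mero_generic[OF f] l1] l1 by (simp add: f_def)
  ultimately show thesis by (rule that)
qed

lemma elliptic_span_form:
  assumes F: "F \<in> exp_span.span elliptic_terms" and f: "\<forall>\<^sub>\<approx>w\<in>UNIV. f (ls_point w) = ev F w"
  shows "elliptic_form l1 (l2 / l1) f"
proof -
  obtain T r where T: "finite T" "T \<subseteq> elliptic_terms" "F = (\<Sum>b\<in>T. exp_ratfun.lift (r b) * b)"
    using F unfolding exp_span.span_explicit by blast
  obtain e where "bij_betw e {1..card T} T"
    using ex_bij_betw_nat_finite_1[OF T(1)] by blast
  define n where "n = card T"
  have e: "bij_betw e {1..n} T" unfolding n_def by fact
  have "\<exists>s \<delta> G j k. invariant G \<and> e i = Expo s * Rho \<delta> * (G * W ^ j * Z ^ k)" if "i \<in> {1..n}" for i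
    using bij_betwE[OF e] T(2) that unfolding elliptic_terms_def by blast
  then obtain s \<delta> G j k where trm: "\<And>i. i \<in> {1..n} \<Longrightarrow> invariant (G i)"
      "\<And>i. i \<in> {1..n} \<Longrightarrow> e i = Expo (s i) * Rho (\<delta> i) * (G i * W ^ j i * Z ^ k i)"
    by metis
  have "\<exists>g. elliptic_fun (l2 / l1) g \<and> (\<forall>\<^sub>\<approx>w\<in>UNIV. g (w / l1) = ev (G i) w)" if "i \<in> {1..n}" for i
    using invariant_elliptic[OF trm(1)[OF that]] by metis
  then obtain g where g: "\<And>i. i \<in> {1..n} \<Longrightarrow> elliptic_fun (l2 / l1) (g i)"
      "\<And>i. i \<in> {1..n} \<Longrightarrow> \<forall>\<^sub>\<approx>w\<in>UNIV. g i (w / l1) = ev (G i) w" by metis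
  define J K where "J = (\<Sum>i=1..n. j i)" and "K = (\<Sum>i=1..n. k i)"
  have le: "j i \<le> J" "k i \<le> K" if "i \<in> {1..n}" for i
    unfolding J_def K_def by (rule member_le_sum[OF that]; simp)+
  \<comment> \<open>Every term gets its own index \<open>i\<close>, so its exponent, its
    \<open>\<delta>\<close> and its elliptic function need not be matched with those of other terms;
    \<open>c\<close> selects its one pair of powers.\<close>
  define c where "c i p q = (if p = j i \<and> q = k i then r (e i) else 0)" for i p q
  have eval_0: "ratfun_eval 0 x = 0" for x by (simp add: ratfun_eval_def)
  have terms: "\<forall>\<^sub>\<approx>w\<in>UNIV. \<forall>i\<in>{1..n}. ev (exp_ratfun.lift (r (e i)) * e i) w =
      ratfun_eval (r (e i)) (exp w) * w ^ j i * exp (s i * w) * g i (w / l1) *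
      weierstrass_zeta (l2 / l1) (w / l1) ^ k i * weierstrass_rho (l2 / l1) (\<delta> i) (w / l1)"
  proof (rule eventually_ball_finite; (rule ballI)?)
    fix i assume i: "i \<in> {1..n}"
    show "\<forall>\<^sub>\<approx>w\<in>UNIV. ev (exp_ratfun.lift (r (e i)) * e i) w =
      ratfun_eval (r (e i)) (exp w) * w ^ j i * exp (s i * w) * g i (w / l1) *
      weierstrass_zeta (l2 / l1) (w / l1) ^ k i * weierstrass_rho (l2 / l1) (\<delta> i) (w / l1)"
      unfolding trm(2)[OF i]
      using ev_mult[of "exp_ratfun.lift (r (e i))" "Expo (s i) * Rho (\<delta> i) * (G i * W ^ j i * Z ^ k i)"]
        ev_exp_ratfun[of "r (e i)"] ev_mult[of "Expo (s i) * Rho (\<delta> i)" "G i * W ^ j i * Z ^ k i"] ev_mult[of "Expo (s i)" "Rho (\<delta> i)"]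
        ev_mult[of "G i * W ^ j i" "Z ^ k i"] ev_mult[of "G i" "W ^ j i"] ev_power[of W "j i"] ev_power[of Z "k i"]
        ev_W ev_Z ev_Expo[of "s i"] ev_Rho[of "\<delta> i"] g(2)[OF i]
      by eventually_elim (simp add: trm(2)[OF i] mult_ac)
  qed simp
  have "ls_generic (\<lambda>p. let t = ls_log p / l1 in
          f p = (\<Sum>i=1..n. \<Sum>p'=0..J. \<Sum>q=0..K.
            ratfun_eval (c i p' q) (ls_proj p) * ls_log p ^ p' * ls_powr p (s i) *
            g i t * weierstrass_zeta (l2 / l1) t ^ q * weierstrass_rho (l2 / l1) (\<delta> i) t))"
    unfolding ls_generic_def
    using f terms ev_sum[of "\<lambda>i. exp_ratfun.lift (r (e i)) * e i" "{1..n}"]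
  proof eventually_elim
    case (elim w)
    define t where "t = w / l1"
    have "F = (\<Sum>i=1..n. exp_ratfun.lift (r (e i)) * e i)"
      unfolding T(3) by (rule sum.reindex_bij_betw[OF e, symmetric])
    hence "f (ls_point w) = (\<Sum>i=1..n. ev (exp_ratfun.lift (r (e i)) * e i) w)"
      using elim(1,3) by simp
    also have "\<dots> = (\<Sum>i=1..n. \<Sum>p'=0..J. \<Sum>q=0..K.
            ratfun_eval (c i p' q) (exp w) * w ^ p' * exp (s i * w) *
            g i t * weierstrass_zeta (l2 / l1) t ^ q * weierstrass_rho (l2 / l1) (\<delta> i) t)"
    proof (rule sum.cong[OF refl])
      fix i assume i: "i \<in> {1..n}"
      define X where "X = ratfun_eval (r (e i)) (exp w) * w ^ j i * exp (s i * w) * g i t *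
          weierstrass_zeta (l2 / l1) t ^ k i * weierstrass_rho (l2 / l1) (\<delta> i) t"
      have "(\<Sum>p'=0..J. \<Sum>q=0..K.
            ratfun_eval (c i p' q) (exp w) * w ^ p' * exp (s i * w) *
            g i t * weierstrass_zeta (l2 / l1) t ^ q * weierstrass_rho (l2 / l1) (\<delta> i) t) =
          (\<Sum>p'=0..J. \<Sum>q=0..K. if q = k i then (if p' = j i then X else 0) else 0)"
        by (intro sum.cong refl) (auto simp: c_def X_def eval_0)
      also have "\<dots> = X" using le[OF i] by simp
      also have "X = ev (exp_ratfun.lift (r (e i)) * e i) w" using elim(2) i by (simp add: X_def t_def)
      finally show "ev (exp_ratfun.lift (r (e i)) * e i) w = (\<Sum>p'=0..J. \<Sum>q=0..K.
            ratfun_eval (c i p' q) (exp w) * w ^ p' * exp (s i * w) *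
            g i t * weierstrass_zeta (l2 / l1) t ^ q * weierstrass_rho (l2 / l1) (\<delta> i) t)" ..
    qed
    finally show ?case by (simp only: Let_def ls_proj_point ls_log_point ls_powr_def t_def)
  qed
  thus ?thesis
    unfolding elliptic_form_def using g(1)
    by (intro exI[of _ n] exI[of _ J] exI[of _ K] exI[of _ s] exI[of _ \<delta>] exI[of _ c] exI[of _ "\<lambda>i _. g i"]) auto
qed

lemma elliptic_fun_invariant:
  assumes "elliptic_fun (l2 / l1) g"
  shows "invariant (mk_mero (\<lambda>w. g (w / l1)))" "\<forall>\<^sub>\<approx>w\<in>UNIV. ev (mk_mero (\<lambda>w. g (w / l1))) w = g (w / l1)"
proof -
  have mero: "(\<lambda>w. g (w / l1)) meromorphic_on UNIV"
    using assms by (intro meromorphic_scale l1) (simp add: elliptic_fun_def nicely_meromorphic_on_def)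
  show "\<forall>\<^sub>\<approx>w\<in>UNIV. ev (mk_mero (\<lambda>w. g (w / l1))) w = g (w / l1)" by (rule ev_mk_mero_generic[OF mero])
  have "g ((w + l1) / l1) = g (w / l1)" "g ((w + l2) / l1) = g (w / l1)" for w
    using assms l1 by (simp_all add: elliptic_fun_def add_divide_distrib)
  thus "invariant (mk_mero (\<lambda>w. g (w / l1)))"
    unfolding invariant_def by (intro conjI shift_mk_mero_periodic mero)
qed

text \<open>A shift adds constants to \<open>W\<close> and \<open>Z\<close>, so the binomial
  expansion produces no power beyond those already present.\<close>

lemma shift_in_span:
  assumes C: "shift_mero e C = const_mero x * C" and Z: "shift_mero e Z = Z + const_mero y"
    and T: "\<And>p q. p \<le> j \<Longrightarrow> q \<le> k \<Longrightarrow> C * W ^ p * Z ^ q \<in> exp_span.span T"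
  shows "shift_mero e (C * W ^ j * Z ^ k) \<in> exp_span.span T"
proof -
  have pow: "(F + const_mero v) ^ m = (\<Sum>p\<le>m. const_mero (of_nat (m choose p) * v ^ (m - p)) * F ^ p)" for F v m
  proof -
    have "const_mero v ^ i = const_mero (v ^ i)" for i by (induction i) (simp_all add: const_mero_simps)
    thus ?thesis unfolding binomial_ring by (simp add: of_nat_mero const_mero_simps mult_ac)
  qed
  have "shift_mero e (C * W ^ j * Z ^ k) = const_mero x * C * (W + const_mero e) ^ j * (Z + const_mero y) ^ k"
    by (simp add: shift_mero_mult shift_mero_power C Z shift_W)
  also have "\<dots> = (\<Sum>p\<le>j. \<Sum>q\<le>k. const_mero (x * (of_nat (j choose p) * e ^ (j - p)) * (of_nat (k choose q) * y ^ (k - q))) * (C * W ^ p * Z ^ q))"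
    unfolding pow const_mero_simps(4) sum_distrib_left sum_distrib_right
    by (subst sum.swap) (intro sum.cong refl, simp only: mult_ac)
  also have "\<dots> \<in> exp_span.span T"
    by (intro exp_span.span_sum exp_span_const T) auto
  finally show ?thesis .
qed

lemma elliptic_form_solves:
  assumes "elliptic_form l1 (l2 / l1) f"
  shows "ls_solves_qdiff l1 f" "ls_solves_qdiff l2 f"
proof -
  obtain I :: nat and J K a \<delta> r g where g': "\<forall>i\<in>{1..I}. \<forall>k\<in>{0..K}. elliptic_fun (l2 / l1) (g i k)"
    and f: "ls_generic (\<lambda>p. let t = ls_log p / l1 in
          f p = (\<Sum>i=1..I. \<Sum>j=0..J. \<Sum>k=0..K.
            ratfun_eval (r i j k) (ls_proj p) * ls_log p ^ j * ls_powr p (a i) *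
            g i k t * weierstrass_zeta (l2 / l1) t ^ k * weierstrass_rho (l2 / l1) (\<delta> i) t))"
    using assms unfolding elliptic_form_def by (elim exE conjE) (rule that)
  have g: "elliptic_fun (l2 / l1) (g i k)" if "i \<in> {1..I}" "k \<in> {0..K}" for i k using g' that by blast
  define G where "G i k = mk_mero (\<lambda>w. g i k (w / l1))" for i k
  define C where "C i k = Expo (a i) * Rho (\<delta> i) * G i k" for i k
  define X where "X = {1..I} \<times> {0..J} \<times> {0..K}"
  define F where "F = (\<Sum>(i, j, k)\<in>X. exp_ratfun.lift (r i j k) * (C i k * W ^ j * Z ^ k))"
  have terms: "\<forall>\<^sub>\<approx>w\<in>UNIV. \<forall>x\<in>X. case x of (i, j, k) \<Rightarrow> ev (exp_ratfun.lift (r i j k) * (C i k * W ^ j * Z ^ k)) w =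
      ratfun_eval (r i j k) (exp w) * w ^ j * exp (a i * w) * g i k (w / l1) *
      weierstrass_zeta (l2 / l1) (w / l1) ^ k * weierstrass_rho (l2 / l1) (\<delta> i) (w / l1)"
  proof (rule eventually_ball_finite; (rule ballI)?)
    fix x assume "x \<in> X"
    then obtain i j k where x: "x = (i, j, k)" "i \<in> {1..I}" "k \<in> {0..K}" by (auto simp: X_def)
    note G = elliptic_fun_invariant(2)[OF g[OF x(2,3)], folded G_def]
    show "\<forall>\<^sub>\<approx>w\<in>UNIV. case x of (i, j, k) \<Rightarrow> ev (exp_ratfun.lift (r i j k) * (C i k * W ^ j * Z ^ k)) w =
      ratfun_eval (r i j k) (exp w) * w ^ j * exp (a i * w) * g i k (w / l1) *
      weierstrass_zeta (l2 / l1) (w / l1) ^ k * weierstrass_rho (l2 / l1) (\<delta> i) (w / l1)"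
      unfolding x(1) prod.case C_def
      using ev_mult[of "exp_ratfun.lift (r i j k)" "Expo (a i) * Rho (\<delta> i) * G i k * W ^ j * Z ^ k"]
        ev_exp_ratfun[of "r i j k"] ev_mult[of "Expo (a i) * Rho (\<delta> i) * G i k * W ^ j" "Z ^ k"]
        ev_mult[of "Expo (a i) * Rho (\<delta> i) * G i k" "W ^ j"] ev_mult[of "Expo (a i) * Rho (\<delta> i)" "G i k"]
        ev_mult[of "Expo (a i)" "Rho (\<delta> i)"] ev_power[of W j] ev_power[of Z k]
        ev_W ev_Z ev_Expo[of "a i"] ev_Rho[of "\<delta> i"] G
      by eventually_elim (simp add: mult_ac)
  qed (simp add: X_def)
  have f_F: "\<forall>\<^sub>\<approx>w\<in>UNIV. f (ls_point w) = ev F w"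
    using f[unfolded ls_generic_def] terms ev_sum[of "\<lambda>(i, j, k). exp_ratfun.lift (r i j k) * (C i k * W ^ j * Z ^ k)" X]
  proof eventually_elim
    case (elim w)
    have "ev F w = (\<Sum>(i, j, k)\<in>X. ratfun_eval (r i j k) (exp w) * w ^ j * exp (a i * w) * g i k (w / l1) *
      weierstrass_zeta (l2 / l1) (w / l1) ^ k * weierstrass_rho (l2 / l1) (\<delta> i) (w / l1))"
      unfolding F_def elim(3) by (rule sum.cong[OF refl]) (use elim(2) in auto)
    thus ?case using elim(1)
      by (simp add: X_def Let_def ls_powr_def sum.cartesian_product)
  qed
  \<comment> \<open>The index \<open>k\<close> of the elliptic factor and the exponent
    \<open>q\<close> of \<open>Z\<close> have to be independent, since a shift lowers the exponent
    but keeps the elliptic factor.\<close>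
  define T where "T = (\<lambda>(i, k, p, q). C i k * W ^ p * Z ^ q) ` ({1..I} \<times> {0..K} \<times> {..J} \<times> {..K})"
  have T: "finite T" by (simp add: T_def)
  have base: "C i k * W ^ p * Z ^ q \<in> exp_span.span T" if "i \<in> {1..I}" "k \<in> {0..K}" "p \<le> J" "q \<le> K" for i k p q
    by (rule exp_span.span_base) (use that in \<open>auto simp: T_def intro!: image_eqI[of _ _ "(i, k, p, q)"]\<close>)
  have F: "F \<in> exp_span.span T"
    unfolding F_def by (intro exp_span.span_sum) (auto simp: X_def intro!: exp_span.span_scale base)
  have solves: "ls_solves_qdiff e f"
    if e: "shift_mero e Z = Z + const_mero y" "\<And>i. shift_mero e (Rho (\<delta> i)) = const_mero (z i) * Rho (\<delta> i)"
      and inv: "\<And>G. invariant G \<Longrightarrow> shift_mero e G = G" for e y z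
    unfolding ls_solves_qdiff_iff[OF f_F]
  proof (rule finite_span_relation[OF T _ F])
    fix b assume "b \<in> T"
    then obtain i k p q where b: "b = C i k * W ^ p * Z ^ q" "i \<in> {1..I}" "k \<in> {0..K}" "p \<le> J" "q \<le> K"
      by (auto simp: T_def)
    have "shift_mero e (C i k) = const_mero (exp (a i * e) * z i) * C i k"
      unfolding C_def shift_mero_mult shift_Expo e(2) const_mero_simps(4)
        inv[OF elliptic_fun_invariant(1)[OF g[OF b(2,3)], folded G_def]] by (simp only: mult_ac)
    thus "shift_mero e b \<in> exp_span.span T"
      unfolding b(1) by (rule shift_in_span[OF _ e(1)]) (use b in \<open>auto intro!: base\<close>)
  qed
  have Z': "shift_mero l1 Z = Z + const_mero (- u1)" "shift_mero l2 Z = Z + const_mero (- u2)"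
    by (simp_all add: shift_Z const_mero_simps)
  show "ls_solves_qdiff l1 f" by (rule solves[OF Z'(1) shift_Rho(1)]) (simp add: invariant_def)
  show "ls_solves_qdiff l2 f" by (rule solves[OF Z'(2) shift_Rho(2)]) (simp add: invariant_def)
qed

end

section \<open>From multipliers to their logarithms, and the final assembly\<close>

lemma two_periodsI:
  assumes "\<not> root_of_unity (exp l1)" "\<not> root_of_unity (exp l2)" "mult_independent (exp l1) (exp l2)"
  shows "two_periods l1 l2"
proof
  have "\<not> root_of_unity (exp l) \<Longrightarrow> l \<noteq> 0" for l by (auto simp: root_of_unity_def)
  hence l: "l1 \<noteq> 0" "l2 \<noteq> 0" using assms by blast+
  thus "l1 \<noteq> 0" by simp
  fix i j :: int
  assume ij: "of_int i * l1 + of_int j * l2 = 0"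
  show "i = 0 \<and> j = 0"
  proof (cases "i = 0 \<or> j = 0")
    case True
    thus ?thesis using ij l by auto
  next
    case False
    have "of_int j * l2 = of_int (- i) * l1" using ij by (simp add: eq_neg_iff_add_eq_0 add.commute)
    hence "exp l2 powi j = exp l1 powi (- i)" by (simp only: exp_power_int)
    with False assms(3) show ?thesis unfolding mult_independent_def by (metis neg_equal_0_iff_equal)
  qed
qed

theorem corollary15:
  fixes q1 q2 l1 l2 \<alpha> :: complex
  assumes "q1 \<noteq> 0" and "q2 \<noteq> 0"
    and "\<not> root_of_unity q1" and "\<not> root_of_unity q2"
    and "mult_independent q1 q2"
    and "norm q1 \<noteq> 1"
    and "exp l1 = q1" and "exp l2 = q2"
    and "\<alpha> = l2 / l1"
  shows
    "(\<alpha> \<notin> \<real> \<longrightarrow>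
        (\<forall>f. ls_meromorphic f \<and> ls_solves_qdiff l1 f \<and> ls_solves_qdiff l2 f
               \<longrightarrow> elliptic_form l1 \<alpha> f) \<and>
        (\<forall>f. elliptic_form l1 \<alpha> f \<longrightarrow> ls_solves_qdiff l1 f \<and> ls_solves_qdiff l2 f)) \<and>
     (\<forall>f. ls_meromorphic f \<and> ls_solves_qdiff l1 f \<and> ls_solves_qdiff l2 f \<and>
            (\<alpha> \<in> \<real> \<or> finite {p. ls_is_pole f p})
            \<longrightarrow> log_power_form f) \<and>
     (\<forall>F :: complex fls. fls_solves_qdiff q1 F \<and> fls_solves_qdiff q2 F
            \<longrightarrow> F \<in> range ratfun_fls)"
proof (intro conjI impI allI)
  have q: "\<not> root_of_unity (exp l1)" "\<not> root_of_unity (exp l2)" "mult_independent (exp l1) (exp l2)"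
    using assms by simp_all
  have periods: "two_periods l1 l2" by (rule two_periodsI[OF q])
  have quasi: "\<exists>u1 u2. quasi_periods l1 l2 u1 u2" if "\<alpha> \<notin> \<real>"
  proof -
    have nonreal: "l2 / l1 \<notin> \<real>" using that assms(9) by simp
    show ?thesis
      by (rule weierstrass_quasi_periods[OF nonreal])
         (rule exI, rule exI, rule quasi_periods.intro[OF periods quasi_periods_axioms.intro[OF nonreal]])
  qed
  show "elliptic_form l1 \<alpha> f"
    if "\<alpha> \<notin> \<real>" and f: "ls_meromorphic f \<and> ls_solves_qdiff l1 f \<and> ls_solves_qdiff l2 f" for f
  proof -
    from quasi[OF that(1)] obtain u1 u2 where "quasi_periods l1 l2 u1 u2" by blast
    then interpret quasi_periods l1 l2 u1 u2 .
    have f': "ls_meromorphic f" "ls_solves_qdiff l1 f" "ls_solves_qdiff l2 f" using f by blast+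
    obtain D h P Q where "D \<noteq> 0" and P: "P \<noteq> 0" and Q: "Q \<noteq> 0"
      and rel: "shift_poly l1 P h = 0" "shift_poly l2 Q h = 0"
      and "\<forall>\<^sub>\<approx>w\<in>UNIV. ev h w = poly D (exp w) * f (ls_point w)"
      and f_eq: "\<forall>\<^sub>\<approx>w\<in>UNIV. f (ls_point w) = ev (exp_ratfun.lift (inverse (pfrac D)) * h) w"
      by (rule constant_coefficient_solution[OF q f'])
    have "h \<in> exp_span.span elliptic_terms" by (rule constant_coefficient_elliptic[OF P rel(1) Q rel(2)])
    hence "exp_ratfun.lift (inverse (pfrac D)) * h \<in> exp_span.span elliptic_terms" by (rule exp_span.span_scale)
    thus ?thesis unfolding assms(9) by (rule elliptic_span_form[OF _ f_eq])
  qed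
  show "ls_solves_qdiff l1 f" "ls_solves_qdiff l2 f" if "\<alpha> \<notin> \<real>" "elliptic_form l1 \<alpha> f" for f
  proof -
    from quasi[OF that(1)] obtain u1 u2 where "quasi_periods l1 l2 u1 u2" by blast
    then interpret quasi_periods l1 l2 u1 u2 .
    show "ls_solves_qdiff l1 f" "ls_solves_qdiff l2 f"
      using elliptic_form_solves[of f] that(2) assms(9) by simp_all
  qed
  show "log_power_form f"
    if "ls_meromorphic f \<and> ls_solves_qdiff l1 f \<and> ls_solves_qdiff l2 f \<and> (\<alpha> \<in> \<real> \<or> finite {p. ls_is_pole f p})" for f
    using log_power_form_solution[OF periods q, of f] that assms(9) by simp
  show "F \<in> range ratfun_fls" if "fls_solves_qdiff q1 F \<and> fls_solves_qdiff q2 F" for F :: "complex fls"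
    using formal_solution_rational[OF assms(1-5), of F] that by blast
qed

end
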